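(* Let $q$ be a prime power. For every integer $n \geq 1$, \[ \frac{1}{6 q^{n+1}} \leq \|P_U - \Lambda_{U,z-1,n}\|_{TV} \leq \frac{3}{q^{n+1}}. \]
   Context: For a partition $\lambda$, $m_i(\lambda)$ is the number of parts equal to $i$ and $\lambda'_i = m_i(\lambda)+m_{i+1}(\lambda)+\cdots$. Set $|Aut_U(\lambda)| = q^{\sum_i (\lambda'_i)^2} \prod_i \prod_{k=1}^{m_i(\lambda)} (1-(-1)^k q^{-k})$, and let $P_U$ be the probability measure on all partitions of all non-negative integers given by $P_U(\lambda) = \prod_{i\ge1}(1+1/(-q)^i)\cdot \frac{1}{|Aut_U(\lambda)|}$. Let $U(n,q)\le GL(n,q^2)$ be the finite unitary group (the isometry group of a nondegenerate Hermitian form on $\mathbb{F}_{q^2}^n$). For $g\in U(n,q)$, regard $\mathbb{F}_{q^2}^n$ as an $\mathbb{F}_{q^2}[z]$-module with $z$ acting as $g$; its $(z-1)$-primary component is $\bigoplus_i \mathbb{F}_{q^2}[z]/((z-1)^{\lambda_i})$ for a unique partition $\lambda_{z-1}(g)$. $\Lambda_{U,z-1,n}$ is the distribution of $\lambda_{z-1}(g)$ for $g$ uniform in $U(n,q)$. $\|P-Q\|_{TV}=\frac12\sum_x|P(x)-Q(x)|$. *)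

theory Defs
  imports
    "HOL-Probability.Probability"
    "HOL-Number_Theory.Prime_Powers"
    "Jordan_Normal_Form.Matrix"
begin

text \<open>Partitions are finite multisets of positive integers, so that \<open>m\<^sub>i(\<lambda>)\<close> is \<open>count \<lambda> i\<close>.\<close>

definition partitions :: "nat multiset set" where
  "partitions = {l. 0 \<notin># l}"

definition conj_part :: "nat multiset \<Rightarrow> nat \<Rightarrow> nat" where
  "conj_part l i = (\<Sum>j\<in>{j \<in> set_mset l. i \<le> j}. count l j)"

text \<open>In the following exponent and product, indices \<open>i > \<Sum>\<^sub># \<lambda>\<close> contribute \<open>0\<close> and \<open>1\<close>,
  respectively, since no part exceeds the size of the partition.\<close>

definition Aut_U :: "nat \<Rightarrow> nat multiset \<Rightarrow> real" where
  "Aut_U q l =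
     real q ^ (\<Sum>i = 1..\<Sum>\<^sub># l. (conj_part l i)\<^sup>2) *
     (\<Prod>i = 1..\<Sum>\<^sub># l. \<Prod>k = 1..count l i. 1 - (-1) ^ k / real q ^ k)"

definition P_U :: "nat \<Rightarrow> nat multiset \<Rightarrow> real" where
  "P_U q l = (\<Prod>i. 1 + 1 / (- real q) ^ Suc i) * (1 / Aut_U q l)"

text \<open>Total variation distance of two probability mass functions on \<open>S\<close>.\<close>

definition tv_dist :: "'b set \<Rightarrow> ('b \<Rightarrow> real) \<Rightarrow> ('b \<Rightarrow> real) \<Rightarrow> real" where
  "tv_dist S P Q = 1 / 2 * (\<Sum>\<^sub>\<infinity>x\<in>S. \<bar>P x - Q x\<bar>)"

text \<open>Over a field with \<open>q\<^sup>2\<close> elements, \<open>x \<mapsto> x ^ q\<close> is the involutory automorphism.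
  Conjugate-linearity in the second argument follows from the three conditions.\<close>

definition hermitian_form :: "nat \<Rightarrow> nat \<Rightarrow> ('a::field vec \<Rightarrow> 'a vec \<Rightarrow> 'a) \<Rightarrow> bool" where
  "hermitian_form q n B \<longleftrightarrow>
     (\<forall>x\<in>carrier_vec n. \<forall>y\<in>carrier_vec n. \<forall>z\<in>carrier_vec n. B (x + y) z = B x z + B y z) \<and>
     (\<forall>a. \<forall>x\<in>carrier_vec n. \<forall>y\<in>carrier_vec n. B (a \<cdot>\<^sub>v x) y = a * B x y) \<and>
     (\<forall>x\<in>carrier_vec n. \<forall>y\<in>carrier_vec n. B y x = B x y ^ q)"

definition nondegenerate :: "nat \<Rightarrow> ('a::field vec \<Rightarrow> 'a vec \<Rightarrow> 'a) \<Rightarrow> bool" where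
  "nondegenerate n B \<longleftrightarrow>
     (\<forall>x\<in>carrier_vec n. (\<forall>y\<in>carrier_vec n. B x y = 0) \<longrightarrow> x = 0\<^sub>v n)"

definition unitary_group :: "nat \<Rightarrow> ('a::field vec \<Rightarrow> 'a vec \<Rightarrow> 'a) \<Rightarrow> 'a mat set" where
  "unitary_group n B =
     {g \<in> carrier_mat n n. invertible_mat g \<and>
        (\<forall>x\<in>carrier_vec n. \<forall>y\<in>carrier_vec n. B (g *\<^sub>v x) (g *\<^sub>v y) = B x y)}"

text \<open>The \<open>F[z]\<close>-module structure on \<open>F\<^sup>n\<close> in which \<open>z\<close> acts as \<open>g\<close>: the value is \<open>p(g) v\<close>.\<close>

definition poly_act :: "nat \<Rightarrow> 'a::field mat \<Rightarrow> 'a poly \<Rightarrow> 'a vec \<Rightarrow> 'a vec" where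
  "poly_act n g p v =
     vec n (\<lambda>j. \<Sum>i\<le>degree p. coeff p i * ((g ^\<^sub>m i *\<^sub>v v) $ j))"

definition primary_component :: "nat \<Rightarrow> 'a::field poly \<Rightarrow> 'a mat \<Rightarrow> 'a vec set" where
  "primary_component n p g = {v \<in> carrier_vec n. \<exists>k. poly_act n g (p ^ k) v = 0\<^sub>v n}"

text \<open>The module \<open>\<Oplus>\<^sub>i F[z]/(p\<^bsup>\<lambda>\<^sub>i\<^esup>)\<close>, where \<open>\<lambda>\<^sub>0 \<ge> \<lambda>\<^sub>1 \<ge> \<dots>\<close> are the parts of \<open>\<lambda>\<close>:
  the \<open>i\<close>-th coordinate of an element is represented by its remainder modulo \<open>p\<^bsup>\<lambda>\<^sub>i\<^esup>\<close>.\<close>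

definition parts :: "nat multiset \<Rightarrow> nat list" where
  "parts l = rev (sorted_list_of_multiset l)"

definition cyclic_sum :: "'a::field poly \<Rightarrow> nat multiset \<Rightarrow> (nat \<Rightarrow> 'a poly) set" where
  "cyclic_sum p l =
     {f. (\<forall>i<length (parts l). f i mod p ^ (parts l ! i) = f i) \<and>
         (\<forall>i\<ge>length (parts l). f i = 0)}"

definition cyclic_sum_act ::
    "'a::field poly \<Rightarrow> nat multiset \<Rightarrow> 'a poly \<Rightarrow> (nat \<Rightarrow> 'a poly) \<Rightarrow> nat \<Rightarrow> 'a poly" where
  "cyclic_sum_act p l r f =
     (\<lambda>i. if i < length (parts l) then (r * f i) mod p ^ (parts l ! i) else 0)"

definition has_primary_type :: "nat \<Rightarrow> 'a::field poly \<Rightarrow> 'a mat \<Rightarrow> nat multiset \<Rightarrow> bool" where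
  "has_primary_type n p g l \<longleftrightarrow>
     (\<exists>\<phi>. bij_betw \<phi> (primary_component n p g) (cyclic_sum p l) \<and>
          (\<forall>v\<in>primary_component n p g. \<forall>w\<in>primary_component n p g.
             \<phi> (v + w) = (\<lambda>i. \<phi> v i + \<phi> w i)) \<and>
          (\<forall>r. \<forall>v\<in>primary_component n p g.
             \<phi> (poly_act n g r v) = cyclic_sum_act p l r (\<phi> v)))"

definition primary_partition :: "nat \<Rightarrow> 'a::field poly \<Rightarrow> 'a mat \<Rightarrow> nat multiset" where
  "primary_partition n p g = (THE l. l \<in> partitions \<and> has_primary_type n p g l)"

text \<open>The polynomial \<open>[:-1, 1:]\<close> is \<open>z - 1\<close>.\<close>

definition Lambda_U :: "nat \<Rightarrow> ('a::field vec \<Rightarrow> 'a vec \<Rightarrow> 'a) \<Rightarrow> nat multiset pmf" where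
  "Lambda_U n B = map_pmf (primary_partition n [:-1, 1:]) (pmf_of_set (unitary_group n B))"

end

theory Submission
  imports
    Defs
    "Jordan_Normal_Form.Determinant"
    "HOL-Number_Theory.Residues"
begin

text \<open>
  The type of \<open>g - 1\<close> on its generalized kernel determines \<open>\<lambda>\<^bsub>z-1\<^esub>(g)\<close>, and the Fitting decomposition of a unitary
  \<open>g\<close> is orthogonal. Hence the probability of \<open>\<lambda>\<close> with \<open>|\<lambda>| = m \<le> n\<close> is \<open>e\<^bsub>n-m\<^esub>\<close> times the proportion of
  unipotent elements of type \<open>\<lambda>\<close> in \<open>U(m, q)\<close>, where \<open>e\<^sub>k\<close> is the proportion of elements of \<open>U(k, q)\<close> without
  eigenvalue \<open>1\<close>. The Cayley transform identifies these unipotent elements with nilpotent Hermitian matrices, whose number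
  satisfies a recursion in which the first column of \<open>\<lambda>\<close> is removed; this gives the proportion \<open>1 / |Aut\<^sub>U(\<lambda>)|\<close>.

  Since the masses \<open>1 / |Aut\<^sub>U(\<lambda>)|\<close> with \<open>|\<lambda>| = m\<close> add up to \<open>(-x)\<^sup>m / (x; x)\<^sub>m\<close> for \<open>x = -1/q\<close> and the
  probabilities add up to \<open>1\<close> for every \<open>n\<close>, the \<open>e\<^sub>k\<close> are the partial sums of Euler's series for
  \<open>\<Prod>\<^bsub>i\<ge>1\<^esub> (1 + x\<^sup>i)\<close>, which is their limit. The total variation distance is thus a sum of tails of this rapidly
  converging series, dominated by the terms with \<open>m = n\<close> and \<open>m = n + 1\<close>.
\<close>

text \<open>The recursion for nilpotent Hermitian matrices replaces \<open>E\<close> by a product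
  \<open>G * D\<close> of an invertible and an arbitrary Hermitian matrix. Congruence acts on such
  pairs and conjugates the product, so either factor may be put in normal form: with
  \<open>G = 1\<close> the product is any Hermitian matrix, with \<open>D = diag(1, 0)\<close> its
  kernels are governed by the leading block of \<open>G\<close>, again Hermitian and of smaller
  type. The price is the number of invertible \<open>G\<close> with a prescribed leading block,
  found by bordering one row at a time. The Cayley transform uses a scalar \<open>a\<close> with
  \<open>cj a \<noteq> a\<close> instead of 1 and -1, so characteristic 2 is not special. Types are
  recorded by cardinalities of kernels, which turns dimension arguments into counting. As
  \<open>x = -1/q\<close> is negative, the factors \<open>1 - x ^ i\<close> and
  \<open>1 + x ^ i\<close> lie alternately above and below 1, and estimates treat two consecutive
  factors together. The upper constant is 3 = (4 + 2) / 2, from the layers \<open>m \<le> n\<close>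
  and \<open>m > n\<close>; the layer \<open>m = n\<close> alone gives 1/2 * 2/3 * 3/4 = 1/4 for the
  lower bound.\<close>

subsection \<open>Gaussian binomial coefficients\<close>

text \<open>\<open>qp x k\<close> is the Pochhammer symbol \<open>(x; x)\<^sub>k\<close>; the base \<open>x\<close> will be \<open>-1/q\<close>.\<close>

definition qp :: "real \<Rightarrow> nat \<Rightarrow> real" where
  "qp x k = (\<Prod>i=1..k. 1 - x ^ i)"

lemma qp_0 [simp]: "qp x 0 = 1" by (simp add: qp_def)

lemma qp_Suc: "qp x (Suc k) = qp x k * (1 - x ^ Suc k)" by (simp add: qp_def)

text \<open>The Gaussian binomial coefficient in base \<open>x\<close>, given by its Pascal
  recursion: it then vanishes for \<open>k > n\<close> without a convention, whereas the quotient of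
  Pochhammer symbols in \<open>qbin_fact\<close> requires \<open>k \<le> n\<close>.\<close>

fun qbin :: "real \<Rightarrow> nat \<Rightarrow> nat \<Rightarrow> real" where
  "qbin x n 0 = 1"
| "qbin x 0 (Suc k) = 0"
| "qbin x (Suc n) (Suc k) = qbin x n k + x ^ Suc k * qbin x n (Suc k)"

text \<open>The coefficient of \<open>z ^ j\<close> in Euler's expansion of the product of all
  \<open>1 + z * x ^ i\<close> with \<open>i \<ge> 1\<close>; the exponent is a triangular
  number.\<close>

definition ec :: "real \<Rightarrow> nat \<Rightarrow> real" where
  "ec x j = x ^ (Suc j * j div 2) / qp x j"

lemma qbin_eq_0: "n < k \<Longrightarrow> qbin x n k = 0"
proof (induction n arbitrary: k)
  case 0 then show ?case by (cases k) auto
next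
  case (Suc n) then show ?case by (cases k) auto
qed

lemma qbin_self [simp]: "qbin x n n = 1"
  by (induction n) (auto simp: qbin_eq_0)

context
  fixes x :: real
  assumes x: "\<bar>x\<bar> < 1"
begin

lemma one_minus_power_pos: "i \<ge> 1 \<Longrightarrow> 0 < 1 - x ^ i"
proof -
  assume "i \<ge> 1"
  then have "\<bar>x ^ i\<bar> < 1" using x power_less_one_iff[of "\<bar>x\<bar>" i] by (simp add: power_abs)
  then show ?thesis by linarith
qed

lemma qp_pos: "qp x k > 0"
  unfolding qp_def by (rule prod_pos) (use one_minus_power_pos in auto)

lemma qbin_fact: "k \<le> n \<Longrightarrow> qbin x n k = qp x n / (qp x k * qp x (n - k))"
proof (induction n arbitrary: k)
  case 0 then show ?case by simp
next
  case (Suc n)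
  show ?case
  proof (cases k)
    case 0 then show ?thesis using qp_pos[of "Suc n"] by simp
  next
    case (Suc l)
    show ?thesis
    proof (cases "l = n")
      case True then show ?thesis using Suc qp_pos[of "Suc n"] by simp
    next
      case False
      then have l: "Suc l \<le> n" using Suc Suc.prems by simp
      define d where "d = n - Suc l"
      have n: "n = Suc l + d" using l by (simp add: d_def)
      have e1: "qbin x n l = qp x n / (qp x l * qp x (Suc d))" using Suc.IH[of l] n by simp
      have e2: "qbin x n (Suc l) = qp x n / (qp x (Suc l) * qp x d)" using Suc.IH[OF l] n by simp
      note nz = less_imp_neq[OF qp_pos[of l], symmetric] less_imp_neq[OF qp_pos[of d], symmetric]
        less_imp_neq[OF one_minus_power_pos[of "Suc l"], symmetric] less_imp_neq[OF one_minus_power_pos[of "Suc d"], symmetric]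
      have p: "x ^ Suc n = x ^ Suc l * x ^ Suc d" using n by (simp flip: power_add)
      have "qbin x (Suc n) k = qp x n / (qp x l * (qp x d * (1 - x ^ Suc d))) + x ^ Suc l * (qp x n / (qp x l * (1 - x ^ Suc l) * qp x d))"
        unfolding Suc qbin.simps e1 e2 qp_Suc[of x l] qp_Suc[of x d] ..
      also have "\<dots> = qp x n * (1 - x ^ Suc l * x ^ Suc d) / (qp x l * (1 - x ^ Suc l) * (qp x d * (1 - x ^ Suc d)))"
        using nz by (simp add: divide_simps del: power_Suc) (simp add: algebra_simps del: power_Suc)
      also have "\<dots> = qp x (Suc n) / (qp x (Suc l) * qp x (Suc d))"
        unfolding qp_Suc p ..
      finally show ?thesis using Suc n by simp
    qed
  qed
qed

lemma qbin_sym: "k \<le> n \<Longrightarrow> qbin x n (n - k) = qbin x n k"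
  by (simp add: qbin_fact mult.commute)

text \<open>The mirror image of the defining Pascal rule under \<open>k \<mapsto> n - k\<close>. The
  Vandermonde induction uses one rule in each of its two upper arguments.\<close>

lemma qbin_Suc':
  assumes "k \<le> n"
  shows "qbin x (Suc n) (Suc k) = qbin x n (Suc k) + x ^ (n - k) * qbin x n k"
proof (cases "k = n")
  case True then show ?thesis by (simp add: qbin_eq_0)
next
  case False
  then obtain d where n: "n = Suc k + d" using assms by (metis le_neq_implies_less less_iff_Suc_add add_Suc)
  have "qbin x (Suc n) (Suc k) = qbin x (Suc n) (Suc d)" using qbin_sym[of "Suc k" "Suc n"] n by simp
  also have "\<dots> = qbin x n d + x ^ Suc d * qbin x n (Suc d)" by simp
  also have "qbin x n d = qbin x n (Suc k)" using qbin_sym[of "Suc k" n] n by simp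
  also have "qbin x n (Suc d) = qbin x n k" using qbin_sym[of k n] n by simp
  finally show ?thesis using n by simp
qed

text \<open>A unit is moved from \<open>Suc m\<close> to \<open>n\<close>, which is why
  \<open>n\<close> varies in the induction: the mirrored rule opens the coefficient with
  \<open>Suc n\<close> above, and the defining rule then closes the one with \<open>Suc m\<close>
  above.\<close>

lemma q_vandermonde:
  "qbin x (m + n) k = (\<Sum>j\<le>k. qbin x m j * qbin x n (k - j) * x ^ (j * (n - (k - j))))"
proof (induction m arbitrary: n)
  case 0
  have "(\<Sum>j\<le>k. qbin x 0 j * qbin x n (k - j) * x ^ (j * (n - (k - j)))) = (\<Sum>j\<le>k. if j = 0 then qbin x n k else 0)"
    by (rule sum.cong) (auto simp: gr0_conv_Suc)
  then show ?case by simp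
next
  case (Suc m)
  define T where "T j = qbin x n (k - j) * x ^ (j * (n - (k - j)))" for j
  \<comment> \<open>\<open>L j\<close> is the first summand of the Pascal rule for
    \<open>qbin x (Suc m) j\<close>, times \<open>T j\<close>; the guard supplies the missing term
    at \<open>j = 0\<close>.\<close>
  define L where "L j = (if j \<ge> 1 then qbin x m (j - 1) * T j else 0)" for j
  have step: "qbin x m j * qbin x (Suc n) (k - j) * x ^ (j * (Suc n - (k - j))) =
      qbin x m j * x ^ j * T j + (if j < k then L (Suc j) else 0)" if j: "j \<le> k" for j
  proof (cases "k - j")
    case 0
    then have "j = k" using j by simp
    then show ?thesis by (simp add: T_def power_add algebra_simps)
  next
    case (Suc i)
    show ?thesis
    proof (cases "i \<le> n")
      case True
      have jk: "j < k" "k - Suc j = i" using Suc by auto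
      have e: "qbin x (Suc n) (Suc i) = qbin x n (Suc i) + x ^ (n - i) * qbin x n i" by (rule qbin_Suc'[OF True])
      \<comment> \<open>At \<open>i = n\<close> both sides vanish, which takes care of the truncated
        exponent \<open>n - Suc i\<close>.\<close>
      have f1: "qbin x n (Suc i) * x ^ (j * (n - i)) = qbin x n (Suc i) * (x ^ j * x ^ (j * (n - Suc i)))"
      proof (cases "i = n")
        case False
        then have "n - i = Suc (n - Suc i)" using True by simp
        then show ?thesis by (simp add: power_add)
      qed (simp add: qbin_eq_0)
      have f2: "x ^ (n - i) * x ^ (j * (n - i)) = x ^ (Suc j * (n - i))" by (simp add: power_add)
      have "qbin x m j * (qbin x n (Suc i) + x ^ (n - i) * qbin x n i) * x ^ (j * (n - i)) =
        qbin x m j * (qbin x n (Suc i) * x ^ (j * (n - i))) + qbin x m j * (qbin x n i * (x ^ (n - i) * x ^ (j * (n - i))))"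
        by (simp only: distrib_left distrib_right mult_ac)
      then show ?thesis unfolding Suc e f1 f2 using jk
        by (simp add: L_def T_def Suc mult_ac del: mult_Suc)
    next
      case False
      then show ?thesis using Suc by (simp add: qbin_eq_0 T_def L_def)
    qed
  qed
  have "qbin x (Suc m + n) k = qbin x (m + Suc n) k" by simp
  also have "\<dots> = (\<Sum>j\<le>k. qbin x m j * x ^ j * T j + (if j < k then L (Suc j) else 0))"
    unfolding Suc.IH by (rule sum.cong) (use step in auto)
  also have "\<dots> = (\<Sum>j\<le>k. qbin x m j * x ^ j * T j) + (\<Sum>j<k. L (Suc j))"
    by (simp add: sum.distrib lessThan_Suc_atMost[symmetric])
  also have "(\<Sum>j<k. L (Suc j)) = (\<Sum>j\<le>k. L j)"
    unfolding lessThan_Suc_atMost[symmetric] by (subst sum.lessThan_Suc_shift) (simp add: L_def)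
  also have "(\<Sum>j\<le>k. qbin x m j * x ^ j * T j) + (\<Sum>j\<le>k. L j) = (\<Sum>j\<le>k. qbin x (Suc m) j * T j)"
    unfolding sum.distrib[symmetric]
  proof (rule sum.cong)
    fix j show "qbin x m j * x ^ j * T j + L j = qbin x (Suc m) j * T j"
      by (cases j) (simp_all add: L_def algebra_simps)
  qed simp
  finally show ?case by (simp add: T_def mult.assoc)
qed

text \<open>Vandermonde with lower index \<open>k - 1\<close>, reindexed by \<open>j = i + 1\<close>
  and reflected. In \<open>sum_Aut_U_size\<close> this is the sum over the length \<open>j\<close>
  of the second column of a partition whose first column has length \<open>k\<close>.\<close>

lemma q_vandermonde_square:
  "(\<Sum>j=1..k. x ^ (j * (j - 1)) * qbin x N (j - 1) * qbin x k j) = (if k = 0 then 0 else qbin x (N + k) (k - 1))"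
proof (cases k)
  case (Suc l)
  have "qbin x (N + k) l = (\<Sum>i\<le>l. qbin x N i * qbin x k (l - i) * x ^ (i * (k - (l - i))))"
    by (rule q_vandermonde)
  also have "\<dots> = (\<Sum>i\<le>l. x ^ (Suc i * i) * qbin x N i * qbin x k (Suc i))"
  proof (rule sum.cong)
    fix i assume "i \<in> {..l}"
    then have "k - (l - i) = Suc i" "l - i = k - Suc i" "Suc i \<le> k" using Suc by auto
    then show "qbin x N i * qbin x k (l - i) * x ^ (i * (k - (l - i))) = x ^ (Suc i * i) * qbin x N i * qbin x k (Suc i)"
      using qbin_sym[of "Suc i" k] by (simp add: mult.commute)
  qed simp
  also have "\<dots> = (\<Sum>j=1..k. x ^ (j * (j - 1)) * qbin x N (j - 1) * qbin x k j)"
    by (simp only: Suc One_nat_def sum.atLeast1_atMost_eq diff_Suc_Suc diff_zero lessThan_Suc_atMost)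
  finally show ?thesis using Suc by simp
qed simp

lemma qbin_tendsto: "(\<lambda>n. qbin x (n + k) k) \<longlonglongrightarrow> 1 / qp x k"
proof -
  have qs: "qp x (n + k) = qp x n * (\<Prod>i=1..k. 1 - x ^ (n + i))" for n
    by (induction k) (auto simp: qp_Suc algebra_simps)
  have "qbin x (n + k) k = (\<Prod>i=1..k. 1 - x ^ (n + i)) / qp x k" for n
  proof -
    have "qbin x (n + k) k = qp x (n + k) / (qp x k * qp x n)" using qbin_fact[of k "n + k"] by simp
    also have "\<dots> = (\<Prod>i=1..k. 1 - x ^ (n + i)) / qp x k" unfolding qs using qp_pos[of n] by simp
    finally show ?thesis .
  qed
  moreover have "(\<lambda>n. (\<Prod>i=1..k. 1 - x ^ (n + i)) / qp x k) \<longlonglongrightarrow> (\<Prod>i=1..k. 1 - 0) / qp x k"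
    by (intro tendsto_intros LIMSEQ_ignore_initial_segment LIMSEQ_power_zero) (use x qp_pos[of k] in auto)
  ultimately show ?thesis by simp
qed

text \<open>The limit \<open>k \<rightarrow> \<infinity>\<close> of the previous identity.\<close>

lemma sum_qbin_square_over_qp:
  "(\<Sum>j=1..Suc N. x ^ (j * (j - 1)) * qbin x N (j - 1) / qp x j) = 1 / qp x (Suc N)"
proof -
  let ?f = "\<lambda>k j. x ^ (j * (j - 1)) * qbin x N (j - 1) * qbin x k j"
  have lim: "(\<lambda>k. qbin x k j) \<longlonglongrightarrow> 1 / qp x j" for j
    using qbin_tendsto[of j] by (rule LIMSEQ_offset)
  have "(\<lambda>k. \<Sum>j=1..Suc N. ?f k j) \<longlonglongrightarrow> (\<Sum>j=1..Suc N. x ^ (j * (j - 1)) * qbin x N (j - 1) * (1 / qp x j))"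
    by (intro tendsto_intros lim)
  \<comment> \<open>The range can be frozen at \<open>Suc N\<close>, since
    \<open>qbin x N (j - 1)\<close> vanishes beyond; the limit is thus taken in a finite
    sum.\<close>
  moreover have "(\<Sum>j=1..Suc N. ?f k j) = qbin x (N + k) (Suc N)" if "k \<ge> Suc N" for k
  proof -
    have "(\<Sum>j=1..Suc N. ?f k j) = (\<Sum>j=1..k. ?f k j)"
      by (rule sum.mono_neutral_left) (use that in \<open>auto simp: qbin_eq_0\<close>)
    also have "\<dots> = qbin x (N + k) (k - 1)" using q_vandermonde_square[of N k] that by simp
    also have "\<dots> = qbin x (N + k) (Suc N)" using qbin_sym[of "Suc N" "N + k"] that by (simp add: diff_diff_add[symmetric] del: diff_diff_left)
    finally show ?thesis .
  qed
  then have "\<forall>\<^sub>F k in sequentially. (\<Sum>j=1..Suc N. ?f k j) = qbin x (N + k) (Suc N)"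
    unfolding eventually_sequentially by blast
  ultimately have "(\<lambda>k. qbin x (N + k) (Suc N)) \<longlonglongrightarrow> (\<Sum>j=1..Suc N. x ^ (j * (j - 1)) * qbin x N (j - 1) * (1 / qp x j))"
    by (rule Lim_transform_eventually)
  moreover have "(\<lambda>k. qbin x (N + k) (Suc N)) \<longlonglongrightarrow> 1 / qp x (Suc N)"
    by (rule LIMSEQ_offset[of _ 1], rule Lim_transform_eventually[OF qbin_tendsto]) (simp add: add.commute)
  ultimately show ?thesis using LIMSEQ_unique by fastforce
qed

text \<open>The factor with \<open>i = 0\<close> is split off and \<open>t\<close> is replaced by
  \<open>t * x\<close>, which shifts the other factors down; hence the induction for arbitrary
  \<open>t\<close>.\<close>

lemma gauss_binomial:
  "(\<Prod>i<n. 1 + t * x ^ i) = (\<Sum>j\<le>n. qbin x n j * x ^ (j * (j - 1) div 2) * t ^ j)"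
proof (induction n arbitrary: t)
  case (Suc n)
  define f where "f j = qbin x n j * x ^ (j * (j - 1) div 2) * t ^ j" for j
  have tri: "x ^ (Suc j * j div 2) = x ^ (j * (j - 1) div 2) * x ^ j" for j
  proof -
    have "Suc j * j = j * (j - 1) + 2 * j" by (cases j) auto
    then have "Suc j * j div 2 = j * (j - 1) div 2 + j" by simp
    then show ?thesis by (simp add: power_add)
  qed
  have "(\<Prod>i<Suc n. 1 + t * x ^ i) = (1 + t) * (\<Prod>i<n. 1 + (t * x) * x ^ i)"
    by (subst prod.lessThan_Suc_shift) (simp add: mult.assoc)
  also have "\<dots> = (1 + t) * (\<Sum>j\<le>n. f j * x ^ j)"
    unfolding Suc.IH by (simp add: f_def power_mult_distrib mult_ac)
  also have "\<dots> = (\<Sum>j\<le>n. f j * x ^ j) + (\<Sum>j\<le>n. t * f j * x ^ j)"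
    by (simp add: algebra_simps sum_distrib_left sum.distrib)
  also have "(\<Sum>j\<le>n. f j * x ^ j) = f 0 + (\<Sum>j\<le>n. f (Suc j) * x ^ Suc j)"
  proof -
    have "(\<Sum>j\<le>n. f j * x ^ j) = (\<Sum>j\<le>Suc n. f j * x ^ j)" by (simp add: f_def qbin_eq_0)
    also have "\<dots> = f 0 + (\<Sum>j\<le>n. f (Suc j) * x ^ Suc j)" by (subst sum.atMost_Suc_shift) simp
    finally show ?thesis .
  qed
  also have "f 0 + (\<Sum>j\<le>n. f (Suc j) * x ^ Suc j) + (\<Sum>j\<le>n. t * f j * x ^ j) =
    f 0 + (\<Sum>j\<le>n. qbin x (Suc n) (Suc j) * x ^ (Suc j * j div 2) * t ^ Suc j)"
    unfolding add.assoc sum.distrib[symmetric]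
  proof (intro arg_cong2[of _ _ _ _ "(+)"] refl sum.cong)
    fix j show "f (Suc j) * x ^ Suc j + t * f j * x ^ j = qbin x (Suc n) (Suc j) * x ^ (Suc j * j div 2) * t ^ Suc j"
      unfolding f_def diff_Suc_1 tri qbin.simps by (simp add: algebra_simps)
  qed
  also have "\<dots> = (\<Sum>j\<le>Suc n. qbin x (Suc n) j * x ^ (j * (j - 1) div 2) * t ^ j)"
    unfolding sum.atMost_Suc_shift[of "\<lambda>j. qbin x (Suc n) j * x ^ (j * (j - 1) div 2) * t ^ j" n] by (simp add: f_def)
  finally show ?case .
qed simp

text \<open>After clearing denominators this is the Gauss binomial formula at \<open>t = -1\<close>,
  whose factor with \<open>i = 0\<close> is zero. In terms of series, the
  \<open>(- x) ^ m / qp x m\<close> and the \<open>ec x j\<close> are the coefficients of mutually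
  inverse Euler products.\<close>

lemma ec_convolution:
  assumes "m \<ge> 1" shows "(\<Sum>j\<le>m. (- x) ^ (m - j) / qp x (m - j) * ec x j) = 0"
proof -
  have tri: "x ^ (Suc j * j div 2) = x ^ (j * (j - 1) div 2) * x ^ j" for j
  proof -
    have "Suc j * j = j * (j - 1) + 2 * j" by (cases j) auto
    then have "Suc j * j div 2 = j * (j - 1) div 2 + j" by simp
    then show ?thesis by (simp add: power_add)
  qed
  have "(\<Sum>j\<le>m. (- x) ^ (m - j) / qp x (m - j) * ec x j) =
    (\<Sum>j\<le>m. (- x) ^ m / qp x m * (qbin x m j * x ^ (j * (j - 1) div 2) * (-1) ^ j))"
  proof (rule sum.cong)
    fix j assume j: "j \<in> {..m}"
    have "(- x) ^ m = (- x) ^ (m - j) * (- x) ^ j" using j by (simp flip: power_add)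
    also have "(- x) ^ j = (-1) ^ j * x ^ j" by (rule power_minus)
    finally have "(- x) ^ m * (-1) ^ j = (- x) ^ (m - j) * x ^ j * ((-1) ^ j * (-1) ^ j)" by (simp only: mult_ac)
    then have key: "(- x) ^ (m - j) * x ^ j = (- x) ^ m * (-1) ^ j" by (simp flip: power_mult_distrib)
    define A where "A = x ^ (j * (j - 1) div 2)"
    have ec: "ec x j = A * x ^ j / qp x j" unfolding ec_def tri A_def ..
    have "(- x) ^ (m - j) / qp x (m - j) * ec x j = ((- x) ^ (m - j) * x ^ j) * A / (qp x j * qp x (m - j))"
      unfolding ec by (simp add: mult_ac)
    also have "\<dots> = (- x) ^ m / qp x m * (qp x m / (qp x j * qp x (m - j)) * A * (-1) ^ j)"
      unfolding key using qp_pos[of m] by simp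
    finally show "(- x) ^ (m - j) / qp x (m - j) * ec x j = (- x) ^ m / qp x m * (qbin x m j * x ^ (j * (j - 1) div 2) * (-1) ^ j)"
      using j qbin_fact[of j m] by (simp add: A_def)
  qed simp
  also have "\<dots> = (- x) ^ m / qp x m * (\<Prod>i<m. 1 + (-1) * x ^ i)"
    unfolding gauss_binomial sum_distrib_left ..
  also have "(\<Prod>i<m. 1 + (-1) * x ^ i) = 0"
    by (rule prod_zero) (use assms in \<open>auto intro!: bexI[of _ 0]\<close>)
  finally show ?thesis by simp
qed

text \<open>The equations form a triangular system with leading coefficient 1, so they have one
  solution; the partial sums of \<open>ec\<close> solve it because the step from \<open>n\<close> to
  \<open>n + 1\<close> adds exactly the sum in \<open>ec_convolution\<close>.\<close>

lemma convolution_one_imp: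
  assumes "\<And>n. (\<Sum>m\<le>n. (- x) ^ m / qp x m * e (n - m)) = 1"
  shows "e n = (\<Sum>j\<le>n. ec x j)"
proof (induction n rule: less_induct)
  case (less n)
  let ?u = "\<lambda>m. (- x) ^ m / qp x m"
  let ?e = "\<lambda>n. \<Sum>j\<le>n. ec x j"
  have conv: "(\<Sum>m\<le>n. ?u m * ?e (n - m)) = 1" for n
  proof (induction n)
    case (Suc n)
    have "(\<Sum>m\<le>Suc n. ?u m * ?e (Suc n - m)) = (\<Sum>m\<le>n. ?u m * (?e (n - m) + ec x (Suc n - m))) + ?u (Suc n) * ec x 0"
      by (simp add: Suc_diff_le)
    also have "\<dots> = 1 + ((\<Sum>m\<le>n. ?u m * ec x (Suc n - m)) + ?u (Suc n) * ec x 0)"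
      using Suc.IH by (simp add: distrib_left sum.distrib)
    also have "(\<Sum>m\<le>n. ?u m * ec x (Suc n - m)) + ?u (Suc n) * ec x 0 = (\<Sum>m\<le>Suc n. ?u m * ec x (Suc n - m))" by simp
    also have "\<dots> = (\<Sum>j\<le>Suc n. ?u (Suc n - j) * ec x j)"
      by (rule sum.reindex_bij_witness[of _ "\<lambda>j. Suc n - j" "\<lambda>j. Suc n - j"]) auto
    also have "\<dots> = 0" by (rule ec_convolution) simp
    finally show ?case by simp
  qed (simp add: ec_def)
  have A: "(\<Sum>m\<le>n. ?u m * e (n - m)) = (\<Sum>m\<le>n. ?u m * ?e (n - m))" using assms conv by simp
  have B: "(\<Sum>m\<le>n. ?u m * f (n - m)) = f n + (\<Sum>m=1..n. ?u m * f (n - m))" for f :: "nat \<Rightarrow> real"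
    by (simp add: sum.atLeast_Suc_atMost atMost_atLeast0)
  have C: "(\<Sum>m=1..n. ?u m * e (n - m)) = (\<Sum>m=1..n. ?u m * ?e (n - m))"
    by (rule sum.cong) (use less.IH in auto)
  show ?case using A unfolding B[of e] B[of ?e] C by simp
qed

end

subsection \<open>Partitions\<close>

lemma conj_part_eq_size: "conj_part l i = size {#j \<in># l. i \<le> j#}"
  by (auto simp: conj_part_def size_multiset_overloaded_eq intro!: sum.cong)

lemma partition_member_le: "(i :: nat) \<in># l \<Longrightarrow> i \<le> \<Sum>\<^sub># l"
  by (metis le_add1 multi_member_split sum_mset.add_mset)

lemma conj_part_eq_0: "\<Sum>\<^sub># l < i \<Longrightarrow> conj_part l i = 0"
  using partition_member_le[of _ l] by (fastforce simp: conj_part_eq_size filter_mset_eq_conv)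

lemma count_eq_0_partition: "\<Sum>\<^sub># l < (i :: nat) \<Longrightarrow> count l i = 0"
  using partition_member_le[of i l] by (metis not_in_iff not_le)

text \<open>A common bound \<open>M\<close> lets the products for partitions of different size be
  compared index by index; the alternating factors of \<open>Aut_U\<close> are Pochhammer factors in
  base \<open>-1/q\<close>.\<close>

lemma Aut_U_eq:
  assumes "\<Sum>\<^sub># l \<le> M"
  shows "Aut_U q l = real q ^ (\<Sum>i = 1..M. (conj_part l i)\<^sup>2) * (\<Prod>i = 1..M. qp (- 1 / real q) (count l i))"
proof -
  have "(\<Sum>i = 1..\<Sum>\<^sub># l. (conj_part l i)\<^sup>2) = (\<Sum>i = 1..M. (conj_part l i)\<^sup>2)"
    by (rule sum.mono_neutral_left) (use assms in \<open>auto simp: conj_part_eq_0\<close>)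
  moreover have "(\<Prod>i = 1..\<Sum>\<^sub># l. \<Prod>k = 1..count l i. 1 - (-1) ^ k / real q ^ k) = (\<Prod>i = 1..\<Sum>\<^sub># l. qp (- 1 / real q) (count l i))"
    by (simp only: qp_def power_divide)
  moreover have "\<dots> = (\<Prod>i = 1..M. qp (- 1 / real q) (count l i))"
    by (rule prod.mono_neutral_left) (use assms in \<open>auto simp: count_eq_0_partition\<close>)
  ultimately show ?thesis by (simp add: Aut_U_def)
qed

lemma filter_replicate_mset: "{#j \<in># replicate_mset n a. P j#} = (if P a then replicate_mset n a else {#})"
  by (induction n) auto

lemma size_partition_pos: "0 < \<Sum>\<^sub># (l :: nat multiset) \<Longrightarrow> 0 < size l"
  by (cases "l = {#}") (auto simp: nonempty_has_size)

text \<open>Adding and removing the first column of the Young diagram.\<close>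

definition add_col :: "nat \<Rightarrow> nat multiset \<Rightarrow> nat multiset" where
  "add_col k m = image_mset Suc m + replicate_mset (k - size m) 1"

definition del_col :: "nat multiset \<Rightarrow> nat multiset" where
  "del_col l = {#j \<in># image_mset (\<lambda>j. j - 1) l. 0 < j#}"

lemma del_col_decomp: "l \<in> partitions \<Longrightarrow> image_mset Suc (del_col l) + replicate_mset (count l 1) 1 = l"
proof (induction l)
  case (add x l)
  then have "l \<in> partitions" "x > 0" by (auto simp: partitions_def)
  then show ?case using add.IH by (cases "x = 1") (auto simp: del_col_def)
qed (simp add: del_col_def)

lemma size_del_col: "l \<in> partitions \<Longrightarrow> size l = size (del_col l) + count l 1"
  using arg_cong[OF del_col_decomp, of l size] by simp

lemma add_col_del_col: "l \<in> partitions \<Longrightarrow> add_col (size l) (del_col l) = l"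
  using del_col_decomp[of l] size_del_col[of l] by (simp add: add_col_def)

lemma del_col_partitions: "del_col l \<in> partitions"
  by (simp add: partitions_def del_col_def)

lemma del_col_add_col: "m \<in> partitions \<Longrightarrow> del_col (add_col k m) = m"
proof -
  assume m: "m \<in> partitions"
  have "{#j \<in># m. 0 < j#} = m" using m by (auto simp: partitions_def filter_mset_eq_conv intro!: Nat.gr0I)
  then show ?thesis by (simp add: del_col_def add_col_def multiset.map_comp o_def filter_replicate_mset)
qed

lemma add_col_partitions: "add_col k m \<in> partitions"
  by (auto simp: add_col_def partitions_def)

lemma size_add_col: "size m \<le> k \<Longrightarrow> size (add_col k m) = k"
  by (simp add: add_col_def)

lemma sum_add_col: "size m \<le> k \<Longrightarrow> \<Sum>\<^sub># (add_col k m) = \<Sum>\<^sub># m + k"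
proof -
  have "\<Sum>\<^sub># (image_mset Suc m) = \<Sum>\<^sub># m + size m" by (induction m) auto
  moreover assume "size m \<le> k"
  ultimately show ?thesis by (simp add: add_col_def)
qed

lemma conj_part_add_col:
  assumes "m \<in> partitions" "size m \<le> k"
  shows "conj_part (add_col k m) (Suc 0) = k" "i \<ge> 1 \<Longrightarrow> conj_part (add_col k m) (Suc i) = conj_part m i"
proof -
  have "{#j \<in># add_col k m. Suc 0 \<le> j#} = add_col k m"
    using add_col_partitions[of k m] by (auto simp: partitions_def filter_mset_eq_conv Suc_le_eq intro!: Nat.gr0I)
  then show "conj_part (add_col k m) (Suc 0) = k" using assms by (simp add: conj_part_eq_size size_add_col)
  assume "i \<ge> 1"
  have "{#j \<in># image_mset Suc m. Suc i \<le> j#} = image_mset Suc {#j \<in># m. i \<le> j#}"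
    by (induction m) auto
  with \<open>i \<ge> 1\<close> show "conj_part (add_col k m) (Suc i) = conj_part m i"
    by (simp add: conj_part_eq_size add_col_def filter_replicate_mset)
qed

lemma count_add_col:
  assumes "m \<in> partitions" "size m \<le> k"
  shows "count (add_col k m) (Suc 0) = k - size m" "i \<ge> 1 \<Longrightarrow> count (add_col k m) (Suc i) = count m i"
proof -
  have c: "count (image_mset Suc m) (Suc i) = count m i" for i
    by (induction m) auto
  show "count (add_col k m) (Suc 0) = k - size m" using c[of 0] assms by (simp add: add_col_def partitions_def not_in_iff)
  show "i \<ge> 1 \<Longrightarrow> count (add_col k m) (Suc i) = count m i" using c[of i] by (simp add: add_col_def)
qed

text \<open>A new first column of length \<open>k\<close> moves all conjugate parts and
  multiplicities up by one index; the new index 1 has conjugate part \<open>k\<close> and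
  multiplicity \<open>k - size m\<close>.\<close>

lemma Aut_U_add_col:
  assumes "m \<in> partitions" "size m \<le> k"
  shows "Aut_U q (add_col k m) = real q ^ (k\<^sup>2) * qp (- 1 / real q) (k - size m) * Aut_U q m"
proof -
  let ?l = "add_col k m" and ?M = "\<Sum>\<^sub># m + k"
  have s: "\<Sum>\<^sub># ?l \<le> Suc ?M" "\<Sum>\<^sub># m \<le> ?M" using assms by (simp_all add: sum_add_col)
  have "(\<Sum>i = 1..Suc ?M. (conj_part ?l i)\<^sup>2) = k\<^sup>2 + (\<Sum>i = 1..?M. (conj_part m i)\<^sup>2)"
    unfolding One_nat_def sum.atLeast1_atMost_eq sum.lessThan_Suc_shift by (simp add: conj_part_add_col[OF assms])
  moreover have "(\<Prod>i = 1..Suc ?M. qp (- 1 / real q) (count ?l i)) =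
      qp (- 1 / real q) (k - size m) * (\<Prod>i = 1..?M. qp (- 1 / real q) (count m i))"
    unfolding One_nat_def prod.atLeast1_atMost_eq prod.lessThan_Suc_shift by (simp add: count_add_col[OF assms])
  ultimately show ?thesis unfolding Aut_U_eq[OF s(1)] Aut_U_eq[OF s(2)] by (simp add: power_add)
qed

lemma Aut_U_empty: "Aut_U q {#} = 1"
  by (simp add: Aut_U_def)

definition partitions_of :: "nat \<Rightarrow> nat multiset set" where
  "partitions_of n = {l \<in> partitions. \<Sum>\<^sub># l = n}"

lemma partitions_of_0: "partitions_of 0 = {{#}}"
proof -
  have "l = {#}" if "l \<in> partitions" "\<Sum>\<^sub># l = 0" for l
    using that by (metis multiset_nonemptyE partition_member_le le_zero_eq mem_Collect_eq partitions_def)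
  then show ?thesis by (auto simp: partitions_of_def partitions_def)
qed

lemma size_le_sum_partition: "l \<in> partitions \<Longrightarrow> size l \<le> \<Sum>\<^sub># l"
  using sum_add_col[of "del_col l" "size l"] size_del_col[of l] add_col_del_col[of l] by simp

lemma partitions_of_size_bij:
  assumes "1 \<le> k" "k \<le> n"
  shows "bij_betw (add_col k) {m \<in> partitions_of (n - k). size m \<le> k} {l \<in> partitions_of n. size l = k}"
proof (rule bij_betw_byWitness[where f' = del_col])
  show "\<forall>m\<in>{m \<in> partitions_of (n - k). size m \<le> k}. del_col (add_col k m) = m"
    by (auto simp: partitions_of_def del_col_add_col)
  show "\<forall>l\<in>{l \<in> partitions_of n. size l = k}. add_col k (del_col l) = l"
    by (auto simp: partitions_of_def add_col_del_col)
  show "add_col k ` {m \<in> partitions_of (n - k). size m \<le> k} \<subseteq> {l \<in> partitions_of n. size l = k}"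
    using assms by (auto simp: partitions_of_def add_col_partitions sum_add_col size_add_col)
  show "del_col ` {l \<in> partitions_of n. size l = k} \<subseteq> {m \<in> partitions_of (n - k). size m \<le> k}"
  proof (rule image_subsetI)
    fix l assume "l \<in> {l \<in> partitions_of n. size l = k}"
    then have l: "l \<in> partitions" "\<Sum>\<^sub># l = n" "size l = k" by (auto simp: partitions_of_def)
    have s: "size (del_col l) \<le> k" using size_del_col[OF l(1)] l by simp
    then have "n = \<Sum>\<^sub># (del_col l) + k" using sum_add_col[OF s] add_col_del_col[OF l(1)] l by simp
    then show "del_col l \<in> {m \<in> partitions_of (n - k). size m \<le> k}"
      using s del_col_partitions[of l] by (simp add: partitions_of_def)
  qed
qed

lemma partitions_of_split: "n \<ge> 1 \<Longrightarrow> partitions_of n = (\<Union>k\<in>{1..n}. {l \<in> partitions_of n. size l = k})"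
  using size_le_sum_partition size_partition_pos by (fastforce simp: partitions_of_def Suc_le_eq)

lemma finite_partitions_of [simp]: "finite (partitions_of n)"
proof (induction n rule: less_induct)
  case (less n)
  show ?case
  proof (cases "n = 0")
    case False
    have "finite {l \<in> partitions_of n. size l = k}" if k: "k \<in> {1..n}" for k
    proof -
      have "finite {m \<in> partitions_of (n - k). size m \<le> k}" using less[of "n - k"] k by simp
      then show ?thesis using bij_betw_finite[OF partitions_of_size_bij[of k n]] k by simp
    qed
    then show ?thesis using False by (subst partitions_of_split) auto
  qed (simp add: partitions_of_0)
qed

context
  fixes q :: nat
  assumes q: "q \<ge> 2"
begin

lemma abs_inverse_q: "\<bar>- 1 / real q\<bar> < 1"
  using q by simp

lemma Aut_U_pos: "Aut_U q l > 0"
  unfolding Aut_U_eq[OF order.refl] by (intro mult_pos_pos prod_pos qp_pos[OF abs_inverse_q] zero_less_power) (use q in simp)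

text \<open>Removing the first column leaves a partition of \<open>n - k\<close> with some number
  \<open>j \<le> k\<close> of parts. The induction hypothesis applies for each \<open>j\<close>, and
  the sum over \<open>j\<close> is \<open>q_vandermonde_square\<close>.\<close>

lemma sum_Aut_U_size:
  assumes "1 \<le> k" "k \<le> n"
  shows "(\<Sum>l\<in>{l \<in> partitions_of n. size l = k}. 1 / Aut_U q l) =
    (1 / real q) ^ n * (- 1 / real q) ^ (k * (k - 1)) * qbin (- 1 / real q) (n - 1) (k - 1) / qp (- 1 / real q) k"
  using assms
proof (induction n arbitrary: k rule: less_induct)
  case (less n)
  define x where "x = - 1 / real q"
  have x: "\<bar>x\<bar> < 1" using abs_inverse_q by (simp add: x_def)
  note pos = qp_pos[OF x]
  \<comment> \<open>An even exponent hides the sign of \<open>x\<close>, so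
    \<open>1 / q ^ (k\<^sup>2)\<close> can be split into \<open>(1 / q) ^ k\<close> and a power of
    \<open>x\<close>, the shape that the Vandermonde sum requires.\<close>
  have ev: "even (k * (k - 1))" for k :: nat by (cases k) auto
  have xk: "(1 / real q) ^ k * x ^ (k * (k - 1)) = 1 / real q ^ (k\<^sup>2)"
  proof -
    have "x ^ (k * (k - 1)) = (1 / real q) ^ (k * (k - 1))" using ev[of k] by (simp add: x_def power_divide)
    then have "(1 / real q) ^ k * x ^ (k * (k - 1)) = (1 / real q) ^ (k + k * (k - 1))" by (simp add: power_add)
    also have "k + k * (k - 1) = k\<^sup>2" by (cases k) (auto simp: power2_eq_square)
    finally show ?thesis by (simp add: power_divide)
  qed
  let ?N = "n - k"
  have "(\<Sum>l\<in>{l \<in> partitions_of n. size l = k}. 1 / Aut_U q l) =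
    (\<Sum>m\<in>{m \<in> partitions_of ?N. size m \<le> k}. 1 / Aut_U q (add_col k m))"
    by (rule sum.reindex_bij_betw[symmetric, OF partitions_of_size_bij[OF less.prems]])
  also have "\<dots> = (\<Sum>m\<in>{m \<in> partitions_of ?N. size m \<le> k}. 1 / real q ^ (k\<^sup>2) * (1 / qp x (k - size m) * (1 / Aut_U q m)))"
    by (rule sum.cong) (auto simp: partitions_of_def Aut_U_add_col x_def)
  also have "\<dots> = (1 / real q) ^ n * x ^ (k * (k - 1)) * qbin x (n - 1) (k - 1) / qp x k"
  proof (cases "?N = 0")
    \<comment> \<open>Here only the empty partition remains, which the sum over
      \<open>j \<ge> 1\<close> in the other case would miss.\<close>
    case True
    then have "n = k" using less.prems by simp
    then show ?thesis using xk by (simp add: partitions_of_0 Aut_U_empty cong: conj_cong)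
  next
    case False
    define M where "M = ?N - 1"
    have M: "?N = Suc M" using False by (simp add: M_def)
    have "(\<Sum>m\<in>{m \<in> partitions_of ?N. size m \<le> k}. 1 / real q ^ (k\<^sup>2) * (1 / qp x (k - size m) * (1 / Aut_U q m)))
      = (\<Sum>j=1..k. \<Sum>m\<in>{m \<in> {m \<in> partitions_of ?N. size m \<le> k}. size m = j}. 1 / real q ^ (k\<^sup>2) * (1 / qp x (k - size m) * (1 / Aut_U q m)))"
    proof (rule sum.group[symmetric])
      show "size ` {m \<in> partitions_of ?N. size m \<le> k} \<subseteq> {1..k}"
        using False size_partition_pos by (fastforce simp: partitions_of_def Suc_le_eq)
    qed auto
    also have "\<dots> = (\<Sum>j=1..k. 1 / real q ^ (k\<^sup>2) / qp x (k - j) * (\<Sum>m\<in>{m \<in> partitions_of ?N. size m = j}. 1 / Aut_U q m))"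
      unfolding sum_distrib_left by (intro sum.cong) auto
    also have "\<dots> = (\<Sum>j=1..k. (1 / real q) ^ ?N / real q ^ (k\<^sup>2) / qp x k * (x ^ (j * (j - 1)) * qbin x M (j - 1) * qbin x k j))"
    proof (rule sum.cong)
      fix j assume j: "j \<in> {1..k}"
      have "(\<Sum>m\<in>{m \<in> partitions_of ?N. size m = j}. 1 / Aut_U q m) = (1 / real q) ^ ?N * x ^ (j * (j - 1)) * qbin x M (j - 1) / qp x j"
      proof (cases "j \<le> ?N")
        case True
        then show ?thesis using less.IH[of ?N j] j False less.prems by (simp add: M_def x_def)
      next
        \<comment> \<open>With more parts than boxes both sides vanish: there is no such partition,
          and the Gaussian binomial is zero.\<close>
        case F: False
        have "{m \<in> partitions_of ?N. size m = j} = {}" using F by (auto simp: partitions_of_def dest: size_le_sum_partition)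
        then have "(\<Sum>m\<in>{m \<in> partitions_of ?N. size m = j}. 1 / Aut_U q m) = 0" by (simp only: sum.empty)
        moreover have "M < j - 1" using F M by simp
        ultimately show ?thesis by (simp add: qbin_eq_0)
      qed
      then show "1 / real q ^ (k\<^sup>2) / qp x (k - j) * (\<Sum>m\<in>{m \<in> partitions_of ?N. size m = j}. 1 / Aut_U q m) =
        (1 / real q) ^ ?N / real q ^ (k\<^sup>2) / qp x k * (x ^ (j * (j - 1)) * qbin x M (j - 1) * qbin x k j)"
        using qbin_fact[OF x, of j k] j pos[of k] by (simp add: mult_ac)
    qed simp
    also have "\<dots> = (1 / real q) ^ ?N / real q ^ (k\<^sup>2) / qp x k * qbin x (M + k) (k - 1)"
      unfolding sum_distrib_left[symmetric] q_vandermonde_square[OF x] using less.prems by simp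
    also have "M + k = n - 1" using M less.prems by simp
    also have "(1 / real q) ^ ?N / real q ^ (k\<^sup>2) = (1 / real q) ^ n * x ^ (k * (k - 1))"
      using xk less.prems by (metis (no_types, lifting) le_add_diff_inverse2 mult.assoc mult.right_neutral power_add times_divide_eq_right)
    finally show ?thesis by simp
  qed
  finally show ?case by (simp add: x_def)
qed

text \<open>Summing the previous formula over the length of the first column leaves
  \<open>sum_qbin_square_over_qp\<close> with \<open>N = n - 1\<close>.\<close>

lemma sum_Aut_U: "(\<Sum>l\<in>partitions_of n. 1 / Aut_U q l) = (1 / real q) ^ n / qp (- 1 / real q) n"
proof (cases n)
  case 0 then show ?thesis by (simp add: partitions_of_0 Aut_U_empty)
next
  case (Suc N)
  define x where "x = - 1 / real q"
  have x: "\<bar>x\<bar> < 1" using abs_inverse_q by (simp add: x_def)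
  have "(\<Sum>l\<in>partitions_of n. 1 / Aut_U q l) = (\<Sum>k=1..n. \<Sum>l\<in>{l \<in> partitions_of n. size l = k}. 1 / Aut_U q l)"
  proof (rule sum.group[symmetric])
    show "size ` partitions_of n \<subseteq> {1..n}" unfolding image_subset_iff partitions_of_def
      using Suc size_partition_pos size_le_sum_partition by (fastforce simp: Suc_le_eq)
  qed auto
  also have "\<dots> = (\<Sum>k=1..n. (1 / real q) ^ n * (x ^ (k * (k - 1)) * qbin x N (k - 1) / qp x k))"
    by (rule sum.cong) (use Suc in \<open>auto simp: sum_Aut_U_size x_def\<close>)
  also have "\<dots> = (1 / real q) ^ n * (\<Sum>k=1..Suc N. x ^ (k * (k - 1)) * qbin x N (k - 1) / qp x k)"
    unfolding Suc sum_distrib_left ..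
  also have "\<dots> = (1 / real q) ^ n / qp x n"
    unfolding sum_qbin_square_over_qp[OF x] Suc by simp
  finally show ?thesis by (simp add: x_def)
qed

end

subsection \<open>The limiting distribution\<close>

locale q_series =
  fixes q :: nat
  assumes q: "q \<ge> 2"
begin

text \<open>The base of all series is negative: \<open>yq\<close> carries its size and
  \<open>xq\<close> its sign, so that estimates can be made with a positive number that is at most
  1/2.\<close>

definition yq :: real where "yq = 1 / real q"

definition xq :: real where "xq = - yq"

lemma yq: "0 < yq" "yq \<le> 1 / 2"
  using q by (auto simp: yq_def divide_simps)

lemma xq_abs: "\<bar>xq\<bar> < 1" "\<bar>xq\<bar> = yq"
  using yq by (auto simp: xq_def)

lemma xq_power_odd: "xq ^ Suc (2 * n) = - (yq ^ Suc (2 * n))" and xq_power_even: "xq ^ (2 * n) = yq ^ (2 * n)"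
  by (simp_all add: xq_def)

lemma yq_power: "0 < yq ^ n" "yq ^ Suc n \<le> 1 / 2"
proof -
  show "0 < yq ^ n" using yq by simp
  have "yq ^ Suc n \<le> yq ^ 1" using yq by (intro power_decreasing) auto
  also have "yq ^ 1 \<le> 1 / 2" using yq by simp
  finally show "yq ^ Suc n \<le> 1 / 2" .
qed

text \<open>Consecutive factors are paired: \<open>(1 + b) * (1 - b * yq) \<ge> 1\<close> for
  \<open>b = yq ^ Suc (2 * n)\<close>, because \<open>yq\<close> and \<open>b\<close> are at most
  1/2.\<close>

lemma qp_even_ge_1: "qp xq (2 * n) \<ge> 1"
proof (induction n)
  case (Suc n)
  define b where "b = yq ^ Suc (2 * n)"
  have b: "0 \<le> b" "b \<le> 1 / 2" using yq_power unfolding b_def by (auto simp: less_imp_le simp del: power_Suc)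
  have "b * yq \<le> 1 / 2 * (1 / 2)" using b yq by (intro mult_mono) auto
  then have "0 \<le> b * (1 - yq - b * yq)" using b yq by (intro mult_nonneg_nonneg) auto
  then have "1 \<le> (1 + b) * (1 - b * yq)" by (simp add: algebra_simps)
  also have "1 + b = 1 - xq ^ Suc (2 * n)" unfolding xq_power_odd b_def by simp
  also have "1 - b * yq = 1 - xq ^ Suc (Suc (2 * n))" using xq_power_even[of "Suc n"] by (simp add: b_def mult_ac)
  finally have "1 * 1 \<le> qp xq (2 * n) * ((1 - xq ^ Suc (2 * n)) * (1 - xq ^ Suc (Suc (2 * n))))"
    using Suc by (intro mult_mono) auto
  then show ?case by (simp add: qp_Suc mult.assoc)
qed simp

lemma qp_ge_1: "qp xq n \<ge> 1"
proof (cases "even n")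
  case True then show ?thesis using qp_even_ge_1 by (auto elim!: evenE)
next
  case False
  then obtain m where m: "n = Suc (2 * m)" by (auto elim!: oddE)
  have "1 \<le> 1 - xq ^ Suc (2 * m)" unfolding xq_power_odd using yq_power(1)[of "Suc (2 * m)"] by simp
  then have "1 * 1 \<le> qp xq (2 * m) * (1 - xq ^ Suc (2 * m))" using qp_even_ge_1[of m] by (intro mult_mono) auto
  then show ?thesis unfolding m qp_Suc by simp
qed

text \<open>The first factor is \<open>1 + yq \<le> 3 / 2\<close>; the others are paired as
  \<open>(1 - b) * (1 + b * yq) \<le> 1\<close>.\<close>

lemma qp_odd_le: "qp xq (Suc (2 * n)) \<le> 3 / 2"
proof (induction n)
  case 0 show ?case using yq by (simp add: qp_Suc xq_def)
next
  case (Suc n)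
  define b where "b = yq ^ Suc (Suc (2 * n))"
  have b: "0 \<le> b" using yq_power unfolding b_def by (auto simp: less_imp_le simp del: power_Suc)
  have "0 \<le> b * (1 - yq + b * yq)" using b yq by (intro mult_nonneg_nonneg add_nonneg_nonneg) auto
  then have "(1 - b) * (1 + b * yq) \<le> 1" by (simp add: algebra_simps)
  also have "1 - b = 1 - xq ^ Suc (Suc (2 * n))" using xq_power_even[of "Suc n"] by (simp add: b_def mult_ac)
  also have "1 + b * yq = 1 - xq ^ Suc (Suc (Suc (2 * n)))" using xq_power_odd[of "Suc n"] by (simp add: b_def mult_ac)
  finally have "qp xq (Suc (2 * n)) * ((1 - xq ^ Suc (Suc (2 * n))) * (1 - xq ^ Suc (Suc (Suc (2 * n))))) \<le> qp xq (Suc (2 * n)) * 1"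
    using qp_pos[OF xq_abs(1)] by (intro mult_left_mono) (auto intro: less_imp_le)
  then have "qp xq (Suc (2 * Suc n)) \<le> qp xq (Suc (2 * n))" by (simp add: qp_Suc mult.assoc)
  then show ?case using Suc by linarith
qed

lemma qp_le: "qp xq n \<le> 3 / 2"
proof (cases "odd n")
  case True then show ?thesis using qp_odd_le by (auto elim!: oddE)
next
  case False
  show ?thesis
  proof (cases n)
    case (Suc k)
    then have "odd k" using False by simp
    then have "qp xq k \<le> 3 / 2" using qp_odd_le by (auto elim!: oddE)
    moreover have "qp xq n \<le> qp xq k * 1" unfolding Suc qp_Suc
    proof (intro mult_left_mono)
      show "1 - xq ^ Suc k \<le> 1" using False Suc zero_le_even_power[of "Suc k" xq] by simp
    qed (use qp_pos[OF xq_abs(1)] in \<open>auto intro: less_imp_le\<close>)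
    ultimately show ?thesis by simp
  qed simp
qed

text \<open>\<open>ee k\<close> turns out to be the proportion of elements without eigenvalue \<open>1\<close> in \<open>U(k, q)\<close>, and \<open>uu m\<close> below the
  total mass \<open>\<Sum> 1 / |Aut\<^sub>U(\<lambda>)|\<close> of the partitions of \<open>m\<close>.\<close>

definition ee :: "nat \<Rightarrow> real" where "ee k = (\<Sum>j\<le>k. ec xq j)"

definition einf :: real where "einf = (\<Prod>i. 1 + xq ^ Suc i)"

lemma ec_0 [simp]: "ec x 0 = 1"
  by (simp add: ec_def)

lemma abs_ec_le: "\<bar>ec xq j\<bar> \<le> yq ^ (Suc j * j div 2)"
proof -
  define T where "T = Suc j * j div 2"
  have "ec xq j = xq ^ T / qp xq j" by (simp only: ec_def T_def)
  then have "\<bar>ec xq j\<bar> = yq ^ T / qp xq j"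
    using qp_ge_1[of j] by (simp add: abs_mult power_abs xq_abs(2))
  also have "\<dots> \<le> yq ^ T / 1" using qp_ge_1[of j] yq by (intro divide_left_mono) auto
  finally show ?thesis by (simp add: T_def)
qed

lemma abs_ec_le_power: "\<bar>ec xq j\<bar> \<le> yq ^ j"
proof (rule order.trans[OF abs_ec_le], rule power_decreasing)
  have "2 * j \<le> Suc j * j" by (cases j) auto
  then show "j \<le> Suc j * j div 2" by linarith
qed (use yq in auto)

lemma summable_ec: "summable (\<lambda>j. \<bar>ec xq j\<bar>)"
proof (rule summable_comparison_test)
  show "summable (\<lambda>j. yq ^ j)" using yq by (intro summable_geometric) auto
  show "\<exists>N. \<forall>n\<ge>N. norm \<bar>ec xq n\<bar> \<le> yq ^ n"
    using abs_ec_le_power by auto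
qed

text \<open>Euler's identity, via the functional equation \<open>F(z) = (1 + z x) F(z x)\<close> of \<open>F(z) = \<Sum>\<^sub>j ec\<^sub>j z\<^sup>j\<close>.\<close>

lemma
  shows convergent_einf: "(\<lambda>n. \<Prod>i<n. 1 + xq ^ Suc i) \<longlonglongrightarrow> einf" and einf_eq: "einf = (\<Sum>j. ec xq j)"
proof -
  define Fz where "Fz z = (\<Sum>j. ec xq j * z ^ j)" for z
  have summ: "summable (\<lambda>j. ec xq j * z ^ j)" if "\<bar>z\<bar> \<le> 1" for z
  proof (rule summable_comparison_test[OF _ summable_ec])
    show "\<exists>N. \<forall>n\<ge>N. norm (ec xq n * z ^ n) \<le> \<bar>ec xq n\<bar>"
      using that by (auto simp: abs_mult power_abs intro!: mult_left_le power_le_one)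
  qed
  have ec_Suc: "ec xq (Suc j) = ec xq (Suc j) * xq ^ Suc j + xq * (ec xq j * xq ^ j)" for j
  proof -
    have "(a + 2 * b) div 2 = a div 2 + b" for a b :: nat by simp
    moreover have "Suc (Suc j) * Suc j = Suc j * j + 2 * Suc j" by simp
    ultimately have t: "Suc (Suc j) * Suc j div 2 = Suc j * j div 2 + Suc j" by (simp only:)
    define A where "A = xq ^ (Suc j * j div 2)"
    have "ec xq (Suc j) = A * xq ^ Suc j / (qp xq j * (1 - xq ^ Suc j))"
      unfolding ec_def t qp_Suc power_add A_def ..
    moreover have "ec xq j = A / qp xq j" unfolding ec_def A_def ..
    moreover have "qp xq j > 0" "1 - xq ^ Suc j > 0" using qp_pos[OF xq_abs(1)] one_minus_power_pos[OF xq_abs(1), of "Suc j"] by auto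
    ultimately have "ec xq (Suc j) * (1 - xq ^ Suc j) = ec xq j * xq ^ Suc j"
      by (simp del: power_Suc)
    then show ?thesis by (simp add: algebra_simps)
  qed
  have fe: "Fz z = (1 + z * xq) * Fz (z * xq)" if z: "\<bar>z\<bar> \<le> 1" for z
  proof -
    have zx: "\<bar>z * xq\<bar> \<le> 1" using z xq_abs(1) by (simp add: abs_mult mult_le_one)
    have "Fz z = ec xq 0 + (\<Sum>j. ec xq (Suc j) * z ^ Suc j)"
      unfolding Fz_def using suminf_split_head[OF summ[OF z]] by simp
    also have "(\<Sum>j. ec xq (Suc j) * z ^ Suc j) = (\<Sum>j. ec xq (Suc j) * (z * xq) ^ Suc j + (z * xq) * (ec xq j * (z * xq) ^ j))"
      by (rule suminf_cong) (subst ec_Suc, simp add: power_mult_distrib algebra_simps)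
    also have "\<dots> = (\<Sum>j. ec xq (Suc j) * (z * xq) ^ Suc j) + (\<Sum>j. (z * xq) * (ec xq j * (z * xq) ^ j))"
      using summ[OF zx] by (intro suminf_add[symmetric] summable_mult) (auto simp: summable_Suc_iff[of "\<lambda>j. ec xq j * (z * xq) ^ j"] simp del: power_Suc)
    also have "(\<Sum>j. (z * xq) * (ec xq j * (z * xq) ^ j)) = (z * xq) * Fz (z * xq)"
      unfolding Fz_def by (rule suminf_mult[OF summ[OF zx]])
    also have "ec xq 0 + ((\<Sum>j. ec xq (Suc j) * (z * xq) ^ Suc j) + (z * xq) * Fz (z * xq)) = Fz (z * xq) + (z * xq) * Fz (z * xq)"
      unfolding Fz_def using suminf_split_head[OF summ[OF zx]] by simp
    finally show ?thesis by (simp add: algebra_simps)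
  qed
  have pw: "\<bar>xq ^ n\<bar> \<le> 1" for n using xq_abs(1) by (simp add: power_abs power_le_one)
  \<comment> \<open>Iterating the functional equation from \<open>z = 1\<close>; the last factor
    will tend to the constant term 1.\<close>
  have it: "Fz 1 = (\<Prod>i<n. 1 + xq ^ Suc i) * Fz (xq ^ n)" for n
  proof (induction n)
    case (Suc n)
    then show ?case using fe[OF pw[of n]] by (simp add: mult_ac)
  qed simp
  have sS: "summable (\<lambda>j. \<bar>ec xq (Suc j)\<bar>)"
    using summable_ec by (subst summable_Suc_iff)
  \<comment> \<open>Continuity at 0 in quantitative form: every term but the constant one carries
    the factor \<open>xq ^ n\<close>.\<close>
  have F0: "Fz (xq ^ n) - 1 = xq ^ n * (\<Sum>j. ec xq (Suc j) * (xq ^ n) ^ j)" for n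
  proof -
    have s: "summable (\<lambda>j. ec xq (Suc j) * (xq ^ n) ^ j)"
    proof (rule summable_comparison_test[OF _ sS])
      show "\<exists>N. \<forall>k\<ge>N. norm (ec xq (Suc k) * (xq ^ n) ^ k) \<le> \<bar>ec xq (Suc k)\<bar>"
        using pw[of n] by (auto simp: abs_mult power_abs intro!: mult_left_le power_le_one)
    qed
    show ?thesis unfolding Fz_def using suminf_split_head[OF summ[OF pw[of n]]] suminf_mult[OF s, of "xq ^ n"]
      by (simp add: mult_ac)
  qed
  have bd: "\<bar>Fz (xq ^ n) - 1\<bar> \<le> \<bar>xq ^ n\<bar> * (\<Sum>j. \<bar>ec xq (Suc j)\<bar>)" for n
  proof -
    have le: "norm (ec xq (Suc k) * (xq ^ n) ^ k) \<le> \<bar>ec xq (Suc k)\<bar>" for k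
      using pw[of n] by (auto simp: abs_mult power_abs intro!: mult_left_le power_le_one)
    have "\<bar>\<Sum>j. ec xq (Suc j) * (xq ^ n) ^ j\<bar> \<le> (\<Sum>j. \<bar>ec xq (Suc j)\<bar>)"
      using norm_suminf_le[OF le sS] by simp
    then show ?thesis unfolding F0 by (simp add: abs_mult mult_left_mono)
  qed
  have "(\<lambda>n. \<bar>xq ^ n\<bar> * (\<Sum>j. \<bar>ec xq (Suc j)\<bar>)) \<longlonglongrightarrow> \<bar>0\<bar> * (\<Sum>j. \<bar>ec xq (Suc j)\<bar>)"
    by (intro tendsto_intros LIMSEQ_power_zero) (use xq_abs in simp)
  then have z: "(\<lambda>n. \<bar>xq ^ n\<bar> * (\<Sum>j. \<bar>ec xq (Suc j)\<bar>)) \<longlonglongrightarrow> 0" by simp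
  have "(\<lambda>n. Fz (xq ^ n) - 1) \<longlonglongrightarrow> 0"
    by (rule Lim_null_comparison[OF _ z]) (simp add: bd always_eventually)
  then have Fl: "(\<lambda>n. Fz (xq ^ n)) \<longlonglongrightarrow> 1" by (rule LIM_zero_cancel)
  then have ne: "\<forall>\<^sub>F n in sequentially. Fz (xq ^ n) > 0" by (intro order_tendstoD) auto
  have lim0: "(\<lambda>n. Fz 1 / Fz (xq ^ n)) \<longlonglongrightarrow> Fz 1 / 1" by (intro tendsto_intros Fl) auto
  have lim: "(\<lambda>n. \<Prod>i<n. 1 + xq ^ Suc i) \<longlonglongrightarrow> Fz 1"
  proof (rule Lim_transform_eventually[OF _ eventually_mono[OF ne]])
    fix n assume "Fz (xq ^ n) > 0"
    then show "Fz 1 / Fz (xq ^ n) = (\<Prod>i<n. 1 + xq ^ Suc i)" using it[of n] by (simp add: field_simps)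
  qed (use lim0 in simp)
  \<comment> \<open>\<open>einf\<close> is defined by the infinite product operator, whose value is
    tied to the limit of partial products through \<open>convergent_prod\<close>.\<close>
  have "abs_convergent_prod (\<lambda>i. 1 + xq ^ Suc i)"
    unfolding abs_convergent_prod_conv_summable using xq_abs
    by (simp add: power_abs norm_power abs_mult summable_mult summable_geometric)
  then have "convergent_prod (\<lambda>i. 1 + xq ^ Suc i)" by (rule abs_convergent_prod_imp_convergent_prod)
  then have "(\<lambda>n. \<Prod>i\<le>n. 1 + xq ^ Suc i) \<longlonglongrightarrow> einf" unfolding einf_def by (rule convergent_prod_LIMSEQ)
  moreover have "(\<lambda>n. \<Prod>i\<le>n. 1 + xq ^ Suc i) \<longlonglongrightarrow> Fz 1"
    using LIMSEQ_Suc[OF lim] by (simp add: lessThan_Suc_atMost)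
  ultimately have "einf = Fz 1" by (rule LIMSEQ_unique)
  then show "(\<lambda>n. \<Prod>i<n. 1 + xq ^ Suc i) \<longlonglongrightarrow> einf" "einf = (\<Sum>j. ec xq j)"
    using lim by (auto simp: Fz_def)
qed

text \<open>Origin of 3/4: the first two factors multiply to
  \<open>1 - 3 / 4 * yq - yq * (1 / 2 - yq)\<^sup>2\<close>, and each later pair of factors is at
  most 1.\<close>

lemma einf_bounds: "0 \<le> einf" "einf \<le> 1 - 3 / 4 * yq" "einf \<le> 1"
proof -
  let ?p = "\<lambda>n. \<Prod>i<n. 1 + xq ^ Suc i"
  have f: "0 \<le> 1 + xq ^ Suc i" for i
  proof -
    have "\<bar>xq ^ Suc i\<bar> \<le> 1" using xq_abs(1) by (simp only: power_abs) (intro power_le_one, auto)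
    then show ?thesis by linarith
  qed
  have p0: "0 \<le> ?p n" for n by (rule prod_nonneg) (use f in auto)
  show "0 \<le> einf" by (rule tendsto_lowerbound[OF convergent_einf]) (use p0 in auto)
  have b0: "?p 2 \<le> 1 - 3 / 4 * yq"
  proof -
    have "?p 2 = (1 - yq) * (1 + yq * yq)" by (simp add: numeral_2_eq_2 xq_def)
    also have "\<dots> = 1 - 3 / 4 * yq - yq * ((1 / 2 - yq) * (1 / 2 - yq))" by (simp add: algebra_simps)
    also have "\<dots> \<le> 1 - 3 / 4 * yq" using yq by simp
    finally show ?thesis .
  qed
  have "?p (2 * Suc n) \<le> 1 - 3 / 4 * yq" for n
  proof (induction n)
    case 0 then show ?case using b0 by (simp add: numeral_2_eq_2)
  next
    case (Suc n)
    define b where "b = yq ^ Suc (2 * Suc n)"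
    have b: "0 \<le> b" using yq_power unfolding b_def by (auto simp: less_imp_le simp del: power_Suc)
    have "0 \<le> b * (1 - yq + b * yq)" using b yq by (intro mult_nonneg_nonneg add_nonneg_nonneg) auto
    then have "(1 - b) * (1 + b * yq) \<le> 1" by (simp add: algebra_simps)
    moreover have "1 - b = 1 + xq ^ Suc (2 * Suc n)" unfolding xq_power_odd b_def by simp
    moreover have "1 + b * yq = 1 + xq ^ Suc (Suc (2 * Suc n))" using xq_power_even[of "Suc (Suc n)"] by (simp add: b_def mult_ac)
    ultimately have "(1 + xq ^ Suc (2 * Suc n)) * (1 + xq ^ Suc (Suc (2 * Suc n))) \<le> 1" by (simp only:)
    from mult_left_mono[OF this p0] have "?p (2 * Suc n) * ((1 + xq ^ Suc (2 * Suc n)) * (1 + xq ^ Suc (Suc (2 * Suc n)))) \<le> ?p (2 * Suc n) * 1" .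
    moreover have "?p (2 * Suc (Suc n)) = ?p (2 * Suc n) * ((1 + xq ^ Suc (2 * Suc n)) * (1 + xq ^ Suc (Suc (2 * Suc n))))"
    proof -
      have "2 * Suc (Suc n) = Suc (Suc (2 * Suc n))" by simp
      then show ?thesis by (simp only: prod.lessThan_Suc mult.assoc)
    qed
    ultimately show ?case using Suc by linarith
  qed
  moreover have "(\<lambda>n. ?p (2 * Suc n)) \<longlonglongrightarrow> einf"
    using LIMSEQ_subseq_LIMSEQ[OF convergent_einf, of "\<lambda>n. 2 * Suc n"] by (simp add: strict_mono_def o_def)
  ultimately show "einf \<le> 1 - 3 / 4 * yq" by (intro tendsto_upperbound[of _ einf]) auto
  then show "einf \<le> 1" using yq by linarith
qed

text \<open>The first omitted exponent is the triangular number of \<open>k + 1\<close>, and the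
  exponents grow by at least one from term to term; a geometric series of ratio 1/2 yields the
  factor 2.\<close>

lemma einf_minus_ee: "\<bar>einf - ee k\<bar> \<le> 2 * yq ^ (Suc (Suc k) * Suc k div 2)"
proof -
  define T where "T = Suc (Suc k) * Suc k div 2"
  have sm: "summable (ec xq)" using summable_rabs_cancel[OF summable_ec] .
  have "einf - ee k = (\<Sum>j. ec xq (j + Suc k))"
    unfolding einf_eq ee_def using suminf_split_initial_segment[OF sm, of "Suc k"] by (simp add: lessThan_Suc_atMost)
  moreover have le: "norm (ec xq (j + Suc k)) \<le> yq ^ T * (1 / 2) ^ j" for j
  proof -
    have tri: "T + j \<le> Suc (j + Suc k) * (j + Suc k) div 2"
    proof -
      have "Suc (Suc k) * Suc k + 2 * j \<le> Suc (j + Suc k) * (j + Suc k)" by (simp add: algebra_simps)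
      then have "(Suc (Suc k) * Suc k + 2 * j) div 2 \<le> Suc (j + Suc k) * (j + Suc k) div 2" by (rule div_le_mono)
      moreover have "(a + 2 * b) div 2 = a div 2 + b" for a b :: nat by simp
      ultimately show ?thesis unfolding T_def by (simp only:)
    qed
    have "norm (ec xq (j + Suc k)) \<le> yq ^ (Suc (j + Suc k) * (j + Suc k) div 2)" using abs_ec_le[of "j + Suc k"] by (simp only: real_norm_def)
    also have "\<dots> \<le> yq ^ (T + j)" by (rule power_decreasing[OF tri]) (use yq in auto)
    also have "\<dots> \<le> yq ^ T * (1 / 2) ^ j" unfolding power_add using yq by (intro mult_left_mono power_mono) auto
    finally show ?thesis .
  qed
  have g: "(\<lambda>j. yq ^ T * (1 / 2) ^ j) sums (yq ^ T * 2)"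
    using sums_mult[OF geometric_sums[of "1 / 2 :: real"], of "yq ^ T"] by simp
  have "\<bar>\<Sum>j. ec xq (j + Suc k)\<bar> \<le> yq ^ T * 2"
    using norm_suminf_le[OF le sums_summable[OF g]] sums_unique[OF g] by simp
  ultimately show ?thesis unfolding T_def[symmetric] by simp
qed

lemma P_U_eq: "P_U q l = einf / Aut_U q l"
proof -
  have "xq = 1 / (- real q)" by (simp add: xq_def yq_def)
  then have "(\<lambda>i. 1 + 1 / (- real q) ^ Suc i) = (\<lambda>i. 1 + xq ^ Suc i)" by (simp only: power_one_over)
  then show ?thesis unfolding P_U_def einf_def by (simp only:) simp
qed

definition uu :: "nat \<Rightarrow> real" where "uu m = (- xq) ^ m / qp xq m"

lemma sum_Aut_U_uu: "(\<Sum>l\<in>partitions_of m. 1 / Aut_U q l) = uu m"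
  using sum_Aut_U[OF q, of m] by (simp add: uu_def xq_def yq_def)

lemma uu_bounds: "0 \<le> uu m" "uu m \<le> yq ^ m" "2 / 3 * yq ^ m \<le> uu m"
proof -
  have p: "0 < yq ^ m" using yq by simp
  show "0 \<le> uu m" using p qp_ge_1[of m] by (simp add: uu_def xq_def)
  have "yq ^ m / qp xq m \<le> yq ^ m / 1" using p qp_ge_1[of m] by (intro divide_left_mono) auto
  then show "uu m \<le> yq ^ m" by (simp add: uu_def xq_def)
  have "yq ^ m / (3 / 2) \<le> yq ^ m / qp xq m" using p qp_ge_1[of m] qp_le[of m] by (intro divide_left_mono) auto
  then show "2 / 3 * yq ^ m \<le> uu m" by (simp add: uu_def xq_def)
qed

lemma sum_power_half: "(\<Sum>k<n. (1 / 2) ^ k) \<le> (2 :: real)"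
proof -
  have "(\<Sum>k<n. (1 / 2) ^ k) = 2 - 2 * (1 / 2 :: real) ^ n" by (induction n) auto
  then show ?thesis by simp
qed

text \<open>On the layer of partitions of size \<open>m\<close> both distributions are constant
  multiples of \<open>1 / Aut_U\<close>, so the layer contributes \<open>uu m * d m\<close>. The
  lower bound keeps only the layer \<open>m = n\<close>, where
  \<open>d n = 1 - einf \<ge> 3 / 4 * yq\<close>.\<close>

lemma tv_dist_bounds:
  fixes L :: "nat multiset \<Rightarrow> real"
  assumes L: "\<And>l. l \<in> partitions \<Longrightarrow> L l = (if \<Sum>\<^sub># l \<le> n then e (n - \<Sum>\<^sub># l) / Aut_U q l else 0)"
    and conv: "\<And>k. (\<Sum>m\<le>k. uu m * e (k - m)) = 1"
  shows "1 / (6 * real q ^ (n + 1)) \<le> tv_dist partitions (P_U q) L \<and>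
    tv_dist partitions (P_U q) L \<le> 3 / real q ^ (n + 1)"
proof -
  have e: "e k = ee k" for k
    unfolding ee_def by (rule convolution_one_imp[OF xq_abs(1)]) (use conv in \<open>simp add: uu_def\<close>)
  define d where "d m = \<bar>einf - (if m \<le> n then ee (n - m) else 0)\<bar>" for m
  define f where "f l = \<bar>P_U q l - L l\<bar>" for l
  have f: "f l = 1 / Aut_U q l * d (\<Sum>\<^sub># l)" if "l \<in> partitions" for l
  proof -
    have "P_U q l - L l = 1 / Aut_U q l * (einf - (if \<Sum>\<^sub># l \<le> n then ee (n - \<Sum>\<^sub># l) else 0))"
      using L[OF that] by (simp add: P_U_eq e diff_divide_distrib)
    then show ?thesis using Aut_U_pos[OF q, of l] by (simp add: f_def d_def abs_mult)
  qed
  have layer: "(\<Sum>l\<in>partitions_of m. f l) = uu m * d m" for m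
  proof -
    have "(\<Sum>l\<in>partitions_of m. f l) = (\<Sum>l\<in>partitions_of m. 1 / Aut_U q l * d m)"
      by (rule sum.cong) (auto simp: f partitions_of_def)
    then show ?thesis unfolding sum_distrib_right[symmetric] sum_Aut_U_uu .
  qed
  have f0: "0 \<le> f l" for l by (simp add: f_def)
  \<comment> \<open>A dyadic majorant of the layers: the part up to \<open>n\<close> sums to at most
    4 and the rest to at most 2.\<close>
  define c where "c m = (if m \<le> n then 2 * (1 / 2) ^ (n - m) else (1 / 2) ^ (m - Suc n) :: real)" for m
  have termwise: "uu m * d m \<le> yq ^ Suc n * c m" for m
  proof (cases "m \<le> n")
    case True
    define k where "k = n - m"
    have n: "n = m + k" using True by (simp add: k_def)
    define T where "T = Suc (Suc k) * Suc k div 2"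
    \<comment> \<open>The triangular exponent is at least \<open>2 * k + 1\<close>. With
      \<open>m + k = n\<close> this produces \<open>yq ^ Suc n\<close> and a spare
      \<open>yq ^ k\<close> for the geometric decay.\<close>
    have "2 * (Suc k + k) \<le> Suc (Suc k) * Suc k" by (cases k) auto
    then have "2 * (Suc k + k) div 2 \<le> T" unfolding T_def by (rule div_le_mono)
    then have T: "Suc k + k \<le> T" by simp
    have "uu m * d m \<le> yq ^ m * (2 * yq ^ T)"
      using uu_bounds[of m] einf_minus_ee[of k] True unfolding d_def T_def k_def by (intro mult_mono) auto
    also have "\<dots> \<le> yq ^ m * (2 * yq ^ (Suc k + k))"
      using yq by (intro mult_left_mono power_decreasing[OF T]) auto
    also have "\<dots> = yq ^ Suc n * (2 * yq ^ k)" by (simp add: n power_add)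
    also have "\<dots> \<le> yq ^ Suc n * (2 * (1 / 2) ^ k)" using yq by (intro mult_left_mono power_mono) auto
    finally show ?thesis using True by (simp add: c_def k_def)
  next
    case False
    define k where "k = m - Suc n"
    have m: "m = Suc n + k" using False by (simp add: k_def)
    have "uu m * d m \<le> yq ^ m * 1"
      using uu_bounds[of m] einf_bounds False unfolding d_def by (intro mult_mono) auto
    also have "\<dots> = yq ^ Suc n * yq ^ k" unfolding m power_add by simp
    also have "\<dots> \<le> yq ^ Suc n * (1 / 2) ^ k" using yq by (intro mult_left_mono power_mono) auto
    finally show ?thesis using False by (simp add: c_def k_def)
  qed
  have csum: "(\<Sum>m<Suc n + k. c m) \<le> 6" for k
  proof -
    have "(\<Sum>m<Suc n + k. c m) = (\<Sum>m<Suc n. c m) + (\<Sum>i<k. c (Suc n + i))"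
      by (induction k) (auto simp: add.assoc)
    also have "(\<Sum>m<Suc n. c m) = (\<Sum>i<Suc n. 2 * (1 / 2) ^ i)"
      by (rule sum.reindex_bij_witness[of _ "\<lambda>i. n - i" "\<lambda>i. n - i"]) (auto simp: c_def)
    also have "\<dots> = 2 * (\<Sum>i<Suc n. (1 / 2) ^ i)" by (simp only: sum_distrib_left)
    also have "(\<Sum>i<k. c (Suc n + i)) = (\<Sum>i<k. (1 / 2) ^ i)" by (simp add: c_def)
    finally show ?thesis using sum_power_half[of "Suc n"] sum_power_half[of k] by linarith
  qed
  have fin: "sum f S \<le> 6 * yq ^ Suc n" if S: "finite S" "S \<subseteq> partitions" for S
  proof -
    define k where "k = Max (insert 0 (sum_mset ` S))"
    have k: "\<Sum>\<^sub># l \<le> k" if "l \<in> S" for l unfolding k_def using S that by (intro Max_ge) auto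
    have "sum f S \<le> sum f (\<Union>m<Suc n + Suc k. partitions_of m)"
    proof (rule sum_mono2)
      show "S \<subseteq> (\<Union>m<Suc n + Suc k. partitions_of m)"
      proof
        fix l assume l: "l \<in> S"
        then have "l \<in> partitions_of (\<Sum>\<^sub># l)" using S by (auto simp: partitions_of_def)
        moreover have "\<Sum>\<^sub># l < Suc n + Suc k" using k[OF l] by simp
        ultimately show "l \<in> (\<Union>m<Suc n + Suc k. partitions_of m)" by blast
      qed
    qed (simp_all add: f0)
    also have "\<dots> = (\<Sum>m<Suc n + Suc k. sum f (partitions_of m))"
      by (rule sum.UNION_disjoint) (simp, simp, force simp: partitions_of_def)
    also have "\<dots> \<le> (\<Sum>m<Suc n + Suc k. yq ^ Suc n * c m)" unfolding layer by (rule sum_mono) (rule termwise)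
    also have "\<dots> = yq ^ Suc n * (\<Sum>m<Suc n + Suc k. c m)" by (simp only: sum_distrib_left)
    also have "\<dots> \<le> yq ^ Suc n * 6" using csum[of "Suc k"] yq by (intro mult_left_mono) auto
    finally show ?thesis by simp
  qed
  have summ: "f summable_on partitions"
    by (rule nonneg_bdd_above_summable_on) (use f0 fin in \<open>auto intro!: bdd_aboveI[of _ "6 * yq ^ Suc n"]\<close>)
  have up: "infsum f partitions \<le> 6 * yq ^ Suc n"
    by (rule infsum_le_finite_sums[OF summ]) (use fin in auto)
  have sub: "partitions_of n \<subseteq> partitions" by (auto simp: partitions_of_def)
  have "sum f (partitions_of n) \<le> infsum f partitions"
    by (rule finite_sum_le_infsum[OF summ]) (simp_all add: f0 sub)
  moreover have "2 / 3 * yq ^ n * (3 / 4 * yq) \<le> sum f (partitions_of n)"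
  proof -
    have "3 / 4 * yq \<le> d n" using einf_bounds by (simp add: d_def ee_def)
    then show ?thesis unfolding layer using uu_bounds[of n] yq by (intro mult_mono) auto
  qed
  ultimately have low: "1 / 2 * yq ^ Suc n \<le> infsum f partitions" by (simp add: mult_ac)
  have tv: "tv_dist partitions (P_U q) L = 1 / 2 * infsum f partitions"
    unfolding tv_dist_def by (simp only: f_def[abs_def])
  have y: "1 / real q ^ (n + 1) = yq ^ Suc n" by (simp add: yq_def power_one_over)
  have "1 / (6 * real q ^ (n + 1)) = 1 / 6 * yq ^ Suc n" unfolding y[symmetric] by simp
  moreover have "3 / real q ^ (n + 1) = 3 * yq ^ Suc n" unfolding y[symmetric] by simp
  ultimately show ?thesis using up low yq_power(1)[of "Suc n"] unfolding tv by linarith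
qed

end

text \<open>The induction step of \<open>ext_count_closed_form\<close>, freed of common powers of
  \<open>Q\<close>. For a prime power \<open>q\<close>, \<open>P c k\<close> counts the injective
  linear maps from dimension \<open>c\<close> to dimension \<open>k\<close> over the field with
  \<open>Q\<close> elements, and \<open>real q ^ (m\<^sup>2) * S m\<close> is the number of
  invertible Hermitian matrices of size \<open>m\<close>.\<close>

lemma ext_count_identity:
  fixes q :: nat and k c :: nat
  assumes q: "q \<ge> 2"
  defines "x \<equiv> - 1 / real q" and "Q \<equiv> (real q)\<^sup>2"
  defines "P \<equiv> \<lambda>c k. \<Prod>i<c. Q ^ k - Q ^ i" and "S \<equiv> \<lambda>m. \<Prod>i=1..m. 1 + x ^ i"
  shows "real q ^ ((k + 1)\<^sup>2) * P c (k + 1) * S (k + 1 - c) =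
    real q ^ (k\<^sup>2) * (P (c + 1) k * S (k - (c + 1)) + (real q - 1) * Q ^ k * P c k * S (k - c)
      + (Q ^ c - 1) * real q * Q ^ (2 * k) * P (c - 1) k * S (k - (c - 1)))"
proof -
  have q0: "real q > 0" using q by simp
  have Q0: "Q > 0" using q0 by (simp add: Q_def)
  have Sq: "real q ^ ((k + 1)\<^sup>2) = real q ^ (k\<^sup>2) * (Q ^ k * real q)"
  proof -
    have "(k + 1)\<^sup>2 = k\<^sup>2 + (2 * k + 1)" by (simp add: power2_eq_square algebra_simps)
    then show ?thesis by (simp add: Q_def power_add flip: power_mult)
  qed
  have qx: "real q * x ^ Suc m = - (x ^ m)" for m using q0 by (simp add: x_def)
  have Qx: "(Q ^ m - 1) = Q ^ m * (1 - x ^ m) * (1 + x ^ m)" for m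
  proof -
    have "Q * (x * x) = 1" using q0 by (simp add: Q_def x_def power2_eq_square)
    then have "Q ^ m * (x ^ m * x ^ m) = 1" by (metis power_mult_distrib power_one)
    then show ?thesis by (simp add: algebra_simps)
  qed
  have PS: "P (Suc c) (Suc k) = (Q ^ Suc k - 1) * (Q ^ c * P c k)" for c
  proof -
    have "P (Suc c) (Suc k) = (Q ^ Suc k - 1) * (\<Prod>i<c. Q * (Q ^ k - Q ^ i))"
      unfolding P_def by (subst prod.lessThan_Suc_shift) (simp add: algebra_simps)
    then show ?thesis by (simp add: P_def prod.distrib)
  qed
  \<comment> \<open>Since \<open>Q * x\<^sup>2 = 1\<close>, the number \<open>Q ^ m - 1\<close>
    splits as \<open>Q ^ m * (1 - x ^ m) * (1 + x ^ m)\<close>, and the last factor is absorbed by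
    \<open>S\<close>.\<close>
  have top: "(Q ^ k - Q ^ c) * S (k - Suc c) = Q ^ k * (1 - x ^ (k - c)) * S (k - c)" if "c \<le> k" for c
  proof (cases "c = k")
    case False
    define m where "m = k - Suc c"
    have k: "k = c + Suc m" "k - c = Suc m" using that False by (auto simp: m_def)
    have "Q ^ k - Q ^ c = Q ^ c * (Q ^ Suc m - 1)" by (simp add: k power_add algebra_simps)
    also have "\<dots> = Q ^ k * (1 - x ^ Suc m) * (1 + x ^ Suc m)" unfolding Qx by (simp add: k power_add)
    finally show ?thesis unfolding k(2) m_def[symmetric] by (simp add: S_def)
  qed simp
  have q2: "Q ^ (2 * k) = Q ^ k * Q ^ k" by (simp add: mult_2 power_add)
  have main: "Q ^ k * real q * P c (k + 1) * S (k + 1 - c) =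
    P (c + 1) k * S (k - (c + 1)) + (real q - 1) * Q ^ k * P c k * S (k - c)
      + (Q ^ c - 1) * real q * Q ^ (2 * k) * P (c - 1) k * S (k - (c - 1))"
  proof (cases c)
    \<comment> \<open>For \<open>c = 0\<close> the third term has the factor
      \<open>Q ^ 0 - 1 = 0\<close>, so the truncated \<open>c - 1\<close> does no harm.\<close>
    case 0
    have "P 1 k * S (k - 1) = Q ^ k * (1 - x ^ k) * S k" using top[of 0] by (simp add: P_def)
    moreover have "S (Suc k) = S k * (1 + x ^ Suc k)" by (simp add: S_def)
    ultimately have "P 1 k * S (k - 1) + (real q - 1) * Q ^ k * S k = Q ^ k * real q * S (k + 1)"
    proof -
      have "Q ^ k * real q * S (k + 1) = Q ^ k * S k * (real q + real q * x ^ Suc k)"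
        using \<open>S (Suc k) = _\<close> by (simp add: algebra_simps del: power_Suc)
      then show ?thesis unfolding qx \<open>P 1 k * _ = _\<close> by (simp add: algebra_simps)
    qed
    then show ?thesis unfolding 0 by (simp add: P_def)
  next
    case (Suc b)
    have Pc: "P c k = P b k * (Q ^ k - Q ^ b)" "P (c + 1) k = P b k * (Q ^ k - Q ^ b) * (Q ^ k - Q ^ c)"
      by (simp_all add: P_def Suc)
    have Pk: "P c (k + 1) = (Q ^ Suc k - 1) * (Q ^ b * P b k)" using PS[of b] Suc by simp
    have cb: "c - 1 = b" and Qc: "Q ^ c = Q * Q ^ b" using Suc by simp_all
    \<comment> \<open>\<open>P c k\<close> vanishes for \<open>c > k\<close>: at
      \<open>c = k + 1\<close> only the third term on the right survives, and beyond that both sides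
      are zero.\<close>
    consider "c \<le> k" | "c = k + 1" | "c > k + 1" by linarith
    then show ?thesis
    proof cases
      case 1
      define m where "m = k - c"
      have s: "k + 1 - c = Suc m" "k - b = Suc m" "k - (c + 1) = k - Suc c" using 1 Suc by (auto simp: m_def)
      have Sm: "S (Suc m) = S m * (1 + x ^ Suc m)" by (simp add: S_def)
      have T: "(Q ^ k - Q ^ c) * S (k - Suc c) = Q ^ k * (1 - x ^ m) * S m" using top[OF 1] by (simp add: m_def)
      define A B D y where "A = P b k * S m * Q ^ k" and "B = Q ^ b" and "D = Q ^ k" and "y = real q * (1 + x ^ Suc m)"
      have y: "y = real q - x ^ m" unfolding y_def distrib_left qx by simp
      have AC: "Q ^ k * real q * P c (k + 1) * S (k + 1 - c) = A * (y * ((Q * D - 1) * B))"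
        unfolding Pk s(1) Sm A_def B_def D_def y_def power_Suc by (simp only: mult_ac)
      have t1: "P (c + 1) k * S (k - (c + 1)) = A * ((D - B) * (1 - x ^ m))"
        unfolding Pc(2) s(3) mult.assoc T A_def B_def D_def by (simp only: mult_ac)
      have t2: "(real q - 1) * Q ^ k * P c k * S (k - c) = A * ((real q - 1) * (D - B))"
        unfolding Pc(1) m_def[symmetric] A_def B_def D_def by (simp only: mult_ac)
      have t3: "(Q ^ c - 1) * real q * Q ^ (2 * k) * P (c - 1) k * S (k - (c - 1)) = A * ((Q * B - 1) * D * y)"
        unfolding cb s(2) Sm q2 Qc A_def B_def D_def y_def power_Suc by (simp only: mult_ac)
      have "A * (y * ((Q * D - 1) * B)) = A * ((D - B) * (1 - x ^ m)) + A * ((real q - 1) * (D - B)) + A * ((Q * B - 1) * D * y)"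
        unfolding y by (simp add: algebra_simps)
      then show ?thesis unfolding AC t1 t2 t3 .
    next
      case 2
      then have bk: "b = k" using Suc by simp
      have z: "P c k = 0" "P (c + 1) k = 0" using bk Pc by auto
      have "k + 1 - c = 0" "k - b = 0" using 2 bk by auto
      then show ?thesis unfolding Pk z cb q2 Qc using bk by (simp add: mult_ac)
    next
      case 3
      then have "k < b" using Suc by simp
      then have z: "P b k = 0" unfolding P_def by (intro prod_zero) auto
      then have z': "P c k = 0" "P (c + 1) k = 0" using Pc by auto
      show ?thesis unfolding Pk z z' cb by simp
    qed
  qed
  have "real q ^ ((k + 1)\<^sup>2) * P c (k + 1) * S (k + 1 - c) = real q ^ (k\<^sup>2) * (Q ^ k * real q * P c (k + 1) * S (k + 1 - c))"
    unfolding Sq by (simp only: mult.assoc)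
  then show ?thesis unfolding main .
qed

unbundle no vec_syntax

lemma card_fibres:
  assumes "finite A" "f ` A \<subseteq> B" "finite B" "\<And>b. b \<in> B \<Longrightarrow> card {a \<in> A. f a = b} = m"
  shows "card A = card B * m"
proof -
  have "card A = (\<Sum>b\<in>B. card {a \<in> A. f a = b})"
    using sum.group[OF assms(1,3,2), of "\<lambda>_. 1::nat"] by simp
  then show ?thesis using assms(4) by simp
qed

subsection \<open>Finite fields with an involution\<close>

locale hermitian_field =
  fixes q :: nat and F :: "'a::{field, finite} itself"
  assumes primepow_q: "primepow q" and card_UNIV: "CARD('a) = q\<^sup>2"
begin

definition cj :: "'a \<Rightarrow> 'a" where "cj x = x ^ q"

lemma q_ge_2: "q \<ge> 2"
  using primepow_gt_Suc_0[OF primepow_q] by simp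

text \<open>Multiplication by a nonzero \<open>x\<close> permutes the nonzero elements, so it does
  not change their product.\<close>

lemma power_card_eq: "x ^ (q\<^sup>2) = (x::'a)"
proof (cases "x = 0")
  case False
  have "x * (\<Prod>y\<in>UNIV-{0}. x * y) = x * x ^ (CARD('a) - 1) * \<Prod>(UNIV-{0})"
    by (simp add: prod.distrib mult_ac)
  also have "x * x ^ (CARD('a) - 1) = x ^ Suc (CARD('a) - 1)"
    by (subst power_Suc) auto
  also have "Suc (CARD('a) - 1) = CARD('a)"
    using finite_UNIV_card_ge_0[where ?'a = 'a] by simp
  also have "(\<Prod>y\<in>UNIV-{0}. x * y) = (\<Prod>y\<in>UNIV-{0}. y)"
    by (rule prod.reindex_bij_witness[of _ "\<lambda>y. y / x" "\<lambda>y. x * y"]) (use False in auto)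
  finally show ?thesis
    by (simp add: card_UNIV)
qed (use q_ge_2 in auto)

text \<open>The characteristic is a prime dividing \<open>q\<^sup>2\<close>, hence the prime below
  \<open>q\<close>. This makes \<open>x \<mapsto> x ^ q\<close> an iterate of the Frobenius map and
  therefore additive.\<close>

lemma q_eq_CHAR_power: "\<exists>k. q = CHAR('a) ^ k" and prime_CHAR: "prime CHAR('a)"
proof -
  have "CHAR('a) > 0" by (rule finite_imp_CHAR_pos) simp
  then show pr: "prime CHAR('a)" by (rule prime_CHAR_semidom)
  obtain p k where p: "prime p" "q = p ^ k" using primepow_q by (auto simp: primepow_def)
  have "CHAR('a) dvd q\<^sup>2" using CHAR_dvd_CARD[where 'a = 'a] card_UNIV by simp
  then have "CHAR('a) dvd p" using pr p by (metis prime_dvd_power)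
  then have "CHAR('a) = p" using pr p by (simp add: primes_dvd_imp_eq)
  then show "\<exists>k. q = CHAR('a) ^ k" using p by blast
qed

lemma cj_add [simp]: "cj (x + y) = cj x + cj y"
  using q_eq_CHAR_power freshmans_dream'[OF prime_CHAR] unfolding cj_def by blast

lemma cj_mult [simp]: "cj (x * y) = cj x * cj y"
  by (simp add: cj_def power_mult_distrib)

lemma cj_cj [simp]: "cj (cj x) = x"
  using power_card_eq by (simp add: cj_def power2_eq_square flip: power_mult)

lemma cj_0 [simp]: "cj 0 = 0" and cj_1 [simp]: "cj 1 = 1"
  using q_ge_2 by (auto simp: cj_def)

sublocale cj: comm_ring_hom cj
  by unfold_locales auto

lemma cj_uminus [simp]: "cj (- x) = - cj x"
  by (simp add: cj.hom_uminus)

lemma cj_diff [simp]: "cj (x - y) = cj x - cj y"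
  by (simp add: cj.hom_minus)

lemma cj_eq_0_iff [simp]: "cj x = 0 \<longleftrightarrow> x = 0"
  by (metis cj_0 cj_cj)

lemma cj_inverse: "cj (inverse x) = inverse (cj x)"
  by (simp add: cj_def power_inverse)

definition fixed_field :: "'a set" where "fixed_field = {x. cj x = x}"

lemma card_roots_le:
  fixes p :: "'a poly"
  assumes "p \<noteq> 0" "\<And>x. x \<in> S \<Longrightarrow> poly p x = 0"
  shows "card S \<le> Polynomial.degree p"
proof -
  have "card S \<le> card {x. poly p x = 0}" by (rule card_mono) (use assms in auto)
  also have "\<dots> \<le> Polynomial.degree p" by (rule card_poly_roots_bound) fact
  finally show ?thesis .
qed

lemma card_trace_zero_le: "card {x. x + cj x = 0} \<le> q"
proof -
  let ?p = "Polynomial.monom 1 q + Polynomial.monom 1 1 :: 'a poly"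
  have c: "Polynomial.coeff ?p q = 1" using q_ge_2 by simp
  have "Polynomial.degree ?p \<le> q" using q_ge_2 by (intro degree_add_le) (auto intro: degree_monom_le le_trans)
  moreover have "?p \<noteq> 0" using c by (metis coeff_0 zero_neq_one)
  moreover have "poly ?p x = 0" if "x + cj x = 0" for x
    using that by (simp add: poly_monom cj_def add.commute)
  ultimately show ?thesis using card_roots_le[of ?p "{x. x + cj x = 0}"] by auto
qed

lemma card_fixed_field_le: "card fixed_field \<le> q"
proof -
  let ?p = "Polynomial.monom 1 q - Polynomial.monom 1 1 :: 'a poly"
  have c: "Polynomial.coeff ?p q = 1" using q_ge_2 by simp
  have "Polynomial.degree ?p \<le> q" using q_ge_2 by (intro degree_diff_le) (auto intro: degree_monom_le le_trans)
  moreover have "?p \<noteq> 0" using c by (metis coeff_0 zero_neq_one)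
  moreover have "poly ?p x = 0" if "x \<in> fixed_field" for x
    using that by (simp add: poly_monom cj_def fixed_field_def)
  ultimately show ?thesis using card_roots_le[of ?p fixed_field] by auto
qed

lemma trace_in_fixed_field: "x + cj x \<in> fixed_field"
  by (simp add: fixed_field_def add.commute)

lemma norm_in_fixed_field: "x * cj x \<in> fixed_field"
  by (simp add: fixed_field_def mult.commute)

text \<open>The trace \<open>x + cj x\<close> has at most \<open>q\<close> zeros, so its image,
  which lies in the fixed field, has at least \<open>q\<^sup>2 / q\<close> elements; the fixed field
  in turn consists of roots of a polynomial of degree \<open>q\<close>.\<close>

lemma card_fixed_field: "card fixed_field = q"
proof -
  let ?t = "\<lambda>x. x + cj x"
  have "CARD('a) = card (range ?t) * card {x. ?t x = 0}"
  proof (rule card_fibres[where f = ?t])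
    fix b assume "b \<in> range ?t"
    then obtain x where x: "b = ?t x" by auto
    show "card {a \<in> UNIV. ?t a = b} = card {x. ?t x = 0}"
      by (rule bij_betw_same_card[OF bij_betw_byWitness[where f = "\<lambda>a. a - x" and f' = "\<lambda>a. a + x"]])
        (auto simp: x algebra_simps)
  qed auto
  also have "\<dots> \<le> card (range ?t) * q" using card_trace_zero_le by simp
  finally have "q \<le> card (range ?t)" using q_ge_2 by (simp add: card_UNIV power2_eq_square)
  also have "\<dots> \<le> card fixed_field" by (intro card_mono) (auto simp: trace_in_fixed_field)
  finally show ?thesis using card_fixed_field_le by simp
qed

text \<open>As \<open>a\<close> varies, \<open>a * e\<close> runs through the whole field, whose
  \<open>q\<^sup>2\<close> elements cannot all have trace zero. The argument is the same in
  characteristic 2.\<close>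

lemma ex_trace_nonzero:
  assumes "e \<noteq> 0" shows "\<exists>a. a * e + cj (a * e) \<noteq> 0"
proof (rule ccontr)
  assume "\<not> ?thesis"
  then have "(x / e) * e + cj ((x / e) * e) = 0" for x by blast
  then have "{x. x + cj x = 0} = UNIV" using assms by simp
  then have "q\<^sup>2 \<le> q" using card_trace_zero_le card_UNIV by simp
  then show False using q_ge_2 by (simp add: power2_eq_square)
qed

lemma ex_cj_neq: "\<exists>a. cj a \<noteq> a"
proof (rule ccontr)
  assume "\<not> ?thesis"
  then have "fixed_field = UNIV" by (auto simp: fixed_field_def)
  then have "q\<^sup>2 = q" using card_fixed_field card_UNIV by simp
  then show False using q_ge_2 by (simp add: power2_eq_square)
qed

text \<open>The count made for the trace, now for the norm: at most \<open>q + 1\<close> elements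
  have norm 1, so the nonzero norms number at least \<open>(q\<^sup>2 - 1) / (q + 1) = q - 1\<close>
  and fill the nonzero part of the fixed field.\<close>

lemma ex_norm_eq:
  assumes "c \<in> fixed_field" "c \<noteq> 0" shows "\<exists>x. x * cj x = c"
proof -
  let ?n = "\<lambda>x. x * cj x"
  let ?K = "{x. ?n x = 1}"
  have K: "card ?K \<le> q + 1"
  proof -
    let ?p = "Polynomial.monom 1 (q + 1) - 1 :: 'a poly"
    have c: "Polynomial.coeff ?p (q + 1) = 1" by (simp add: coeff_1)
    have "Polynomial.degree ?p \<le> q + 1" by (intro degree_diff_le) (auto intro: degree_monom_le)
    moreover have "?p \<noteq> 0" using c by (metis coeff_0 zero_neq_one)
    moreover have "poly ?p x = 0" if "?n x = 1" for x
      using that by (simp add: poly_monom cj_def)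
    ultimately show ?thesis using card_roots_le[of ?p ?K] by auto
  qed
  have "card (UNIV - {0::'a}) = card (?n ` (UNIV - {0})) * card ?K"
  proof (rule card_fibres[where f = ?n])
    fix b assume "b \<in> ?n ` (UNIV - {0})"
    then obtain x where x: "b = ?n x" "x \<noteq> 0" by auto
    define nm where "nm = ?n"
    have "nm (a / x) = nm a / nm x" and "nm (a * x) = nm a * nm x" for a
      by (simp_all add: nm_def divide_inverse cj_inverse)
    moreover have "nm x \<noteq> 0" "b = nm x" "nm 0 = 0" using x by (simp_all add: nm_def)
    ultimately have "card {a \<in> UNIV - {0}. nm a = b} = card {x. nm x = 1}"
      by (intro bij_betw_same_card[OF bij_betw_byWitness[where f = "\<lambda>a. a / x" and f' = "\<lambda>a. a * x"]])
        (use x in \<open>auto\<close>)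
    then show "card {a \<in> UNIV - {0}. ?n a = b} = card ?K" by (simp add: nm_def)
  qed auto
  then have "(q - 1) * (q + 1) = card (?n ` (UNIV - {0})) * card ?K"
    by (simp add: card_UNIV power2_eq_square algebra_simps)
  also have "\<dots> \<le> card (?n ` (UNIV - {0})) * (q + 1)" using K by (rule mult_le_mono2)
  finally have "q - 1 \<le> card (?n ` (UNIV - {0}))" by (simp only: mult_le_cancel2)
  moreover have sub: "?n ` (UNIV - {0}) \<subseteq> fixed_field - {0}" using norm_in_fixed_field by auto
  moreover have "card (fixed_field - {0}) = q - 1"
    using card_fixed_field by (simp add: fixed_field_def)
  moreover have "card (?n ` (UNIV - {0})) \<le> card (fixed_field - {0})"
    by (rule card_mono[OF _ sub]) simp
  ultimately have "?n ` (UNIV - {0}) = fixed_field - {0}"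
    by (intro card_subset_eq) simp_all
  then have "c \<in> ?n ` (UNIV - {0})" using assms by simp
  then show ?thesis by auto
qed

end

subsection \<open>Matrices\<close>

text \<open>Matrix laws with side conditions on \<open>dim_row\<close> and \<open>dim_col\<close>
  instead of carrier sets: dimensions can be evaluated by rewriting, so long products are
  reassociated without supplying sizes.\<close>

lemma assoc_mult_mat_dim:
  "dim_col A = dim_row B \<Longrightarrow> dim_col B = dim_row C \<Longrightarrow> A * B * C = A * (B * C :: 'a::semiring_0 mat)"
  by (rule assoc_mult_mat) auto

lemma assoc_mult_mat_vec_dim:
  "dim_col A = dim_row B \<Longrightarrow> dim_col B = dim_vec v \<Longrightarrow> A * B *\<^sub>v v = A *\<^sub>v (B *\<^sub>v v :: 'a::semiring_0 vec)"
  by (rule assoc_mult_mat_vec) auto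

lemma left_mult_one_mat_dim: "dim_row A = n \<Longrightarrow> 1\<^sub>m n * A = (A :: 'a::semiring_1 mat)"
  and right_mult_one_mat_dim: "dim_col A = n \<Longrightarrow> A * 1\<^sub>m n = (A :: 'a::semiring_1 mat)"
  by (auto intro: left_mult_one_mat' right_mult_one_mat')

definition GL :: "nat \<Rightarrow> 'a::field mat set" where
  "GL n = {A \<in> carrier_mat n n. det A \<noteq> 0}"

text \<open>A total function whose value carries information only on \<open>GL\<close>.\<close>

definition minv :: "'a::field mat \<Rightarrow> 'a mat" where
  "minv A = (SOME B. B \<in> carrier_mat (dim_row A) (dim_row A) \<and>
     A * B = 1\<^sub>m (dim_row A) \<and> B * A = 1\<^sub>m (dim_row A))"

lemma GL_D: "A \<in> GL n \<Longrightarrow> A \<in> carrier_mat n n" "A \<in> GL n \<Longrightarrow> dim_row A = n"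
  "A \<in> GL n \<Longrightarrow> dim_col A = n" "A \<in> GL n \<Longrightarrow> det A \<noteq> 0"
  by (auto simp: GL_def)

lemma minv:
  assumes "A \<in> GL n"
  shows minv_carrier: "minv A \<in> carrier_mat n n" and minv_right: "A * minv A = 1\<^sub>m n"
    and minv_left: "minv A * A = 1\<^sub>m n"
proof -
  have "A \<in> Units (ring_mat TYPE('a) n ())" using assms det_non_zero_imp_unit by (auto simp: GL_def)
  then have "\<exists>B. B \<in> carrier_mat (dim_row A) (dim_row A) \<and>
     A * B = 1\<^sub>m (dim_row A) \<and> B * A = 1\<^sub>m (dim_row A)"
    using assms by (auto simp: Units_def ring_mat_def GL_def)
  from someI_ex[OF this] assms show "minv A \<in> carrier_mat n n" "A * minv A = 1\<^sub>m n" "minv A * A = 1\<^sub>m n"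
    by (auto simp: minv_def GL_def)
qed

lemma GL_I:
  assumes "A \<in> carrier_mat n n" "B \<in> carrier_mat n n" "A * B = 1\<^sub>m n"
  shows "A \<in> GL n"
  using assms det_mult[OF assms(1,2)] by (auto simp: GL_def)

lemma minv_GL: "A \<in> GL n \<Longrightarrow> minv A \<in> GL n"
  using minv GL_I GL_D by blast

lemma minv_dim: "A \<in> GL n \<Longrightarrow> dim_row (minv A) = n" "A \<in> GL n \<Longrightarrow> dim_col (minv A) = n"
  using minv_carrier by auto

lemma GL_mult: "A \<in> GL n \<Longrightarrow> B \<in> GL n \<Longrightarrow> A * B \<in> GL n"
  by (auto simp: GL_def det_mult)

lemma one_GL: "1\<^sub>m n \<in> GL n"
  by (auto simp: GL_def)

lemma GL_cancel:
  assumes "A \<in> GL n"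
  shows "dim_row B = n \<Longrightarrow> A * (minv A * B) = B" "dim_row B = n \<Longrightarrow> minv A * (A * B) = B"
    "dim_vec v = n \<Longrightarrow> A *\<^sub>v (minv A *\<^sub>v v) = v" "dim_vec v = n \<Longrightarrow> minv A *\<^sub>v (A *\<^sub>v v) = v"
  using minv_left[OF assms] minv_right[OF assms] minv_carrier[OF assms] GL_D[OF assms]
  by (auto simp flip: assoc_mult_mat_dim assoc_mult_mat_vec_dim simp: left_mult_one_mat_dim one_mult_mat_vec
      intro!: one_mult_mat_vec carrier_vecI)

lemma minv_unique:
  assumes "A \<in> GL n" "B \<in> carrier_mat n n" "A * B = 1\<^sub>m n"
  shows "B = minv A"
  using GL_cancel(2)[OF assms(1), of B] assms minv_dim[OF assms(1)]
  by (simp add: right_mult_one_mat_dim)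

lemma invertible_mat_iff_GL: "A \<in> carrier_mat n n \<Longrightarrow> invertible_mat A \<longleftrightarrow> A \<in> GL n"
proof
  assume A: "A \<in> carrier_mat n n" "invertible_mat A"
  then obtain B where B: "A * B = 1\<^sub>m n" "B * A = 1\<^sub>m (dim_row B)"
    by (auto simp: invertible_mat_def inverts_mat_def)
  then have "B \<in> carrier_mat n n" using A
    by (metis carrier_matD(1,2) carrier_matI index_mult_mat(2,3) index_one_mat(2,3))
  then show "A \<in> GL n" using GL_I A B by blast
next
  assume "A \<in> carrier_mat n n" "A \<in> GL n"
  then show "invertible_mat A" using minv[of A n]
    by (auto simp: invertible_mat_def inverts_mat_def intro!: exI[of _ "minv A"])
qed

lemma GL_iff_kernel: "A \<in> carrier_mat n n \<Longrightarrow>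
  A \<in> GL n \<longleftrightarrow> (\<forall>v\<in>carrier_vec n. A *\<^sub>v v = 0\<^sub>v n \<longrightarrow> v = 0\<^sub>v n)"
  using det_0_iff_vec_prod_zero_field[of A n] by (auto simp: GL_def)

lemma carrier_vec_bij: "bij_betw (\<lambda>v. restrict (\<lambda>i. v $ i) {..<n}) (carrier_vec n) ({..<n} \<rightarrow>\<^sub>E UNIV)"
proof (rule bij_betw_byWitness[where f' = "vec n"])
  show "\<forall>v\<in>carrier_vec n. vec n (restrict (\<lambda>i. v $ i) {..<n}) = v"
    by (intro ballI eq_vecI) auto
  show "\<forall>f\<in>{..<n} \<rightarrow>\<^sub>E UNIV. restrict (\<lambda>i. vec n f $ i) {..<n} = f"
    by (intro ballI extensionalityI[where A = "{..<n}"]) (auto simp: PiE_def)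
qed (auto simp: image_subset_iff simp del: PiE_iff)

lemma card_carrier_vec: "card (carrier_vec n :: 'a::finite vec set) = CARD('a) ^ n"
  using bij_betw_same_card[OF carrier_vec_bij] by (simp add: card_PiE)

lemma finite_carrier_vec [simp]: "finite (carrier_vec n :: 'a::finite vec set)"
  using bij_betw_finite[OF carrier_vec_bij[where ?'a = 'a]] finite_PiE[of "{..<n}" "\<lambda>_. UNIV :: 'a set"] by simp

lemma carrier_mat_bij: "bij_betw (\<lambda>A. restrict (\<lambda>ij. A $$ ij) ({..<m} \<times> {..<n}))
  (carrier_mat m n) (({..<m} \<times> {..<n}) \<rightarrow>\<^sub>E UNIV)"
proof (rule bij_betw_byWitness[where f' = "mat m n"])
  show "\<forall>A\<in>carrier_mat m n. mat m n (restrict (\<lambda>ij. A $$ ij) ({..<m} \<times> {..<n})) = A"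
    by (intro ballI eq_matI) auto
  show "\<forall>f\<in>({..<m} \<times> {..<n}) \<rightarrow>\<^sub>E UNIV. restrict (\<lambda>ij. mat m n f $$ ij) ({..<m} \<times> {..<n}) = f"
    by (intro ballI extensionalityI[where A = "{..<m} \<times> {..<n}"]) (auto simp: PiE_def)
qed (auto simp: image_subset_iff simp del: PiE_iff)

lemma card_carrier_mat: "card (carrier_mat m n :: 'a::finite mat set) = CARD('a) ^ (m * n)"
  using bij_betw_same_card[OF carrier_mat_bij] by (simp add: card_PiE card_cartesian_product)

lemma finite_carrier_mat [simp]: "finite (carrier_mat m n :: 'a::finite mat set)"
  using bij_betw_finite[OF carrier_mat_bij[where ?'a = 'a]] finite_PiE[of "{..<m} \<times> {..<n}" "\<lambda>_. UNIV :: 'a set"] by simp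

lemma finite_GL [simp]: "finite (GL n :: 'a::{field,finite} mat set)"
  by (rule finite_subset[OF _ finite_carrier_mat[of n n]]) (auto simp: GL_def)

definition mker :: "'a::semiring_0 mat \<Rightarrow> 'a vec set" where
  "mker A = {v \<in> carrier_vec (dim_col A). A *\<^sub>v v = 0\<^sub>v (dim_row A)}"

lemma finite_mker [simp]: "finite (mker A :: 'a::{semiring_0,finite} vec set)"
  by (rule finite_subset[OF _ finite_carrier_vec[of "dim_col A"]]) (auto simp: mker_def)

lemma mult_zero_vec_dim [simp]: "dim_col A = n \<Longrightarrow> A *\<^sub>v 0\<^sub>v n = 0\<^sub>v (dim_row A)"
  for A :: "'a::semiring_0 mat"
  by (rule eq_vecI) (auto simp: scalar_prod_def)

lemma GL_mult_vec_zero_iff: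
  assumes "A \<in> GL n" "dim_vec v = n"
  shows "A *\<^sub>v v = 0\<^sub>v n \<longleftrightarrow> v = 0\<^sub>v n"
proof
  assume "A *\<^sub>v v = 0\<^sub>v n"
  then show "v = 0\<^sub>v n"
    using GL_iff_kernel[OF GL_D(1)[OF assms(1)]] assms(1) carrier_vecI[OF assms(2)] by blast
next
  assume "v = 0\<^sub>v n"
  then show "A *\<^sub>v v = 0\<^sub>v n" using GL_D(2,3)[OF assms(1)] by simp
qed

lemma card_mker_mult:
  assumes "P \<in> GL m" "R \<in> GL n" "A \<in> carrier_mat m n"
  shows "card (mker (P * A * R)) = card (mker A)"
proof (rule bij_betw_same_card, rule bij_betw_byWitness[where f = "\<lambda>v. R *\<^sub>v v" and f' = "\<lambda>v. minv R *\<^sub>v v"])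
  note d = GL_D(2,3)[OF assms(1)] GL_D(2,3)[OF assms(2)] minv_dim[OF assms(2)] carrier_matD[OF assms(3)]
  have *: "P * A * R *\<^sub>v v = P *\<^sub>v (A *\<^sub>v (R *\<^sub>v v))" if "dim_vec v = n" for v
    using d that by (simp add: assoc_mult_mat_dim assoc_mult_mat_vec_dim)
  have m: "v \<in> mker (P * A * R) \<longleftrightarrow> dim_vec v = n \<and> A *\<^sub>v (R *\<^sub>v v) = 0\<^sub>v m" for v
  proof (cases "dim_vec v = n")
    case True
    have "v \<in> mker (P * A * R) \<longleftrightarrow> P *\<^sub>v (A *\<^sub>v (R *\<^sub>v v)) = 0\<^sub>v m"
      unfolding mker_def mem_Collect_eq *[OF True] using carrier_vecI[OF True] d by simp
    also have "\<dots> \<longleftrightarrow> A *\<^sub>v (R *\<^sub>v v) = 0\<^sub>v m"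
      by (rule GL_mult_vec_zero_iff[OF assms(1)]) (simp add: d)
    finally show ?thesis using True by simp
  next
    case False
    then show ?thesis using carrier_vecD[of v n] d by (auto simp only: mker_def mem_Collect_eq index_mult_mat)
  qed
  have m': "v \<in> mker A \<longleftrightarrow> dim_vec v = n \<and> A *\<^sub>v v = 0\<^sub>v m" for v
    unfolding mker_def mem_Collect_eq d using carrier_vecD[of v n] carrier_vecI[of v n] by blast
  show "\<forall>a\<in>mker (P * A * R). minv R *\<^sub>v (R *\<^sub>v a) = a"
    by (rule ballI, rule GL_cancel(4)[OF assms(2)]) (simp add: m)
  show "\<forall>a\<in>mker A. R *\<^sub>v (minv R *\<^sub>v a) = a"
    by (rule ballI, rule GL_cancel(3)[OF assms(2)]) (simp add: m')
  show "(*\<^sub>v) R ` mker (P * A * R) \<subseteq> mker A"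
    by (rule image_subsetI) (simp add: m m' d)
  show "(*\<^sub>v) (minv R) ` mker A \<subseteq> mker (P * A * R)"
    by (rule image_subsetI) (simp add: m m' d GL_cancel(3)[OF assms(2)])
qed

subsection \<open>Hermitian matrices\<close>

lemma zero_mult_mat_dim: "dim_row A = n \<Longrightarrow> 0\<^sub>m m n * A = 0\<^sub>m m (dim_col A :: nat)"
  and mult_zero_mat_dim: "dim_col A = n \<Longrightarrow> A * 0\<^sub>m n m = 0\<^sub>m (dim_row A) m"
  and zero_add_mat_dim: "dim_row A = m \<Longrightarrow> dim_col A = n \<Longrightarrow> 0\<^sub>m m n + A = A"
  and add_zero_mat_dim: "dim_row A = m \<Longrightarrow> dim_col A = n \<Longrightarrow> A + 0\<^sub>m m n = A"
  for A :: "'a::semiring_0 mat"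
  by (auto intro!: eq_matI simp: scalar_prod_def)

lemmas zero_mat_dim = zero_mult_mat_dim mult_zero_mat_dim zero_add_mat_dim add_zero_mat_dim

lemma mult_four_block_dim:
  fixes A1 :: "'a::semiring_0 mat"
  assumes "dim_row B1 = dim_row A1" "dim_col C1 = dim_col A1" "dim_row C1 = dim_row D1" "dim_col D1 = dim_col B1"
    "dim_row B2 = dim_row A2" "dim_col C2 = dim_col A2" "dim_row C2 = dim_row D2" "dim_col D2 = dim_col B2"
    "dim_col A1 = dim_row A2" "dim_col B1 = dim_row D2"
  shows "four_block_mat A1 B1 C1 D1 * four_block_mat A2 B2 C2 D2 =
    four_block_mat (A1 * A2 + B1 * C2) (A1 * B2 + B1 * D2) (C1 * A2 + D1 * C2) (C1 * B2 + D1 * D2)"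
  by (rule mult_four_block_mat[of _ "dim_row A1" "dim_col A1" _ "dim_col B1" _ "dim_row D1" _ _ "dim_col A2" _ "dim_col B2"])
    (rule carrier_matI; simp add: assms)+

lemma four_block_mult_vec_dim:
  fixes A :: "'a::semiring_0 mat"
  assumes "dim_row B = dim_row A" "dim_col C = dim_col A" "dim_row C = dim_row D" "dim_col D = dim_col B"
    "dim_vec a = dim_col A" "dim_vec d = dim_col D"
  shows "four_block_mat A B C D *\<^sub>v (a @\<^sub>v d) = (A *\<^sub>v a + B *\<^sub>v d) @\<^sub>v (C *\<^sub>v a + D *\<^sub>v d)"
  by (rule four_block_mat_mult_vec[of _ "dim_row A" "dim_col A" _ "dim_col B" _ "dim_row D"])
    (rule carrier_matI carrier_vecI; simp add: assms)+

lemma four_block_split: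
  assumes "A \<in> carrier_mat (r + k) (s + l)"
  obtains A1 A2 A3 A4 where "A1 \<in> carrier_mat r s" "A2 \<in> carrier_mat r l"
    "A3 \<in> carrier_mat k s" "A4 \<in> carrier_mat k l" "A = four_block_mat A1 A2 A3 A4"
proof -
  obtain A1 A2 A3 A4 where s: "split_block A r s = (A1, A2, A3, A4)" by (metis prod_cases4)
  from split_block[OF s carrier_matD[OF assms]] show ?thesis by (rule that)
qed

lemma four_block_eq_iff:
  assumes "A \<in> carrier_mat r s" "B \<in> carrier_mat r l" "C \<in> carrier_mat k s" "D \<in> carrier_mat k l"
    "A' \<in> carrier_mat r s" "B' \<in> carrier_mat r l" "C' \<in> carrier_mat k s" "D' \<in> carrier_mat k l"
  shows "four_block_mat A B C D = four_block_mat A' B' C' D' \<longleftrightarrow> A = A' \<and> B = B' \<and> C = C' \<and> D = D'"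
    (is "?X = ?Y \<longleftrightarrow> _")
proof (intro iffI)
  assume e: "?X = ?Y"
  note d = assms[THEN carrier_matD(1)] assms[THEN carrier_matD(2)]
  have i: "?X $$ (i, j) = ?Y $$ (i, j)" for i j by (simp only: e)
  have "A = A'"
  proof (rule eq_matI)
    show "A $$ (i, j) = A' $$ (i, j)" if "i < dim_row A'" "j < dim_col A'" for i j
      using i[of i j] d that by simp
  qed (simp_all add: d)
  moreover have "B = B'"
  proof (rule eq_matI)
    show "B $$ (i, j) = B' $$ (i, j)" if "i < dim_row B'" "j < dim_col B'" for i j
      using i[of i "s + j"] d that by simp
  qed (simp_all add: d)
  moreover have "C = C'"
  proof (rule eq_matI)
    show "C $$ (i, j) = C' $$ (i, j)" if "i < dim_row C'" "j < dim_col C'" for i j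
      using i[of "r + i" j] d that by simp
  qed (simp_all add: d)
  moreover have "D = D'"
  proof (rule eq_matI)
    show "D $$ (i, j) = D' $$ (i, j)" if "i < dim_row D'" "j < dim_col D'" for i j
      using i[of "r + i" "s + j"] d that by simp
  qed (simp_all add: d)
  ultimately show "A = A' \<and> B = B' \<and> C = C' \<and> D = D'" by blast
qed simp

lemma four_block_GL_upper:
  assumes "A \<in> carrier_mat r r" "D \<in> carrier_mat k k" "B \<in> carrier_mat r k"
  shows "four_block_mat A B (0\<^sub>m k r) D \<in> GL (r + k) \<longleftrightarrow> A \<in> GL r \<and> D \<in> GL k"
  unfolding GL_def mem_Collect_eq det_four_block_mat_lower_left_zero[OF assms(1,3) refl assms(2)]
  using assms by simp

lemma four_block_GL_lower:
  assumes "A \<in> carrier_mat r r" "D \<in> carrier_mat k k" "C \<in> carrier_mat k r"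
  shows "four_block_mat A (0\<^sub>m r k) C D \<in> GL (r + k) \<longleftrightarrow> A \<in> GL r \<and> D \<in> GL k"
  unfolding GL_def mem_Collect_eq det_four_block_mat_upper_right_zero[OF assms(1) refl assms(3,2)]
  using assms by simp

text \<open>Basis extension by exchange: \<open>v\<close> takes the place of a unit vector in whose
  coordinate \<open>v\<close> does not vanish.\<close>

lemma ex_GL_first_col:
  fixes v :: "'a::field vec"
  assumes v: "v \<in> carrier_vec n" "v \<noteq> 0\<^sub>v n"
  shows "\<exists>g\<in>GL n. col g 0 = v"
proof -
  obtain k where k: "k < n" "v $ k \<noteq> 0" using v by (metis carrier_vecD eq_vecI index_zero_vec)
  \<comment> \<open>The transposition of 0 and \<open>k\<close>. Column \<open>b > 0\<close> of
    \<open>g\<close> is the unit vector with index \<open>t b\<close>, and the index left out is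
    \<open>t 0 = k\<close>.\<close>
  define t where "t a = (if a = 0 then k else if a = k then 0 else a)" for a :: nat
  define g where "g = mat n n (\<lambda>(a, b). if b = 0 then v $ a else if b = t a then 1 else 0)"
  have tt: "t (t a) = a" "t a < n \<longleftrightarrow> a < n" for a using k(1) by (cases "a = 0"; cases "a = k"; simp add: t_def)+
  have gc: "g \<in> carrier_mat n n" by (simp add: g_def)
  have "g \<in> GL n"
  proof (unfold GL_iff_kernel[OF gc], intro ballI impI)
    fix x :: "'a vec" assume x: "x \<in> carrier_vec n" "g *\<^sub>v x = 0\<^sub>v n"
    have row: "v $ a * x $ 0 + (if t a \<noteq> 0 then x $ t a else 0) = 0" if a: "a < n" for a
    proof -
      have "0 = (g *\<^sub>v x) $ a" using x a by simp
      also have "\<dots> = (\<Sum>b<n. g $$ (a, b) * x $ b)"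
        using x(1) a gc by (simp add: scalar_prod_def lessThan_atLeast0)
      also have "\<dots> = (\<Sum>b<n. (if b = 0 then v $ a * x $ 0 else 0) + (if b = t a then (if t a \<noteq> 0 then x $ t a else 0) else 0))"
        by (intro sum.cong refl) (use a in \<open>simp add: g_def\<close>)
      also have "\<dots> = v $ a * x $ 0 + (if t a \<noteq> 0 then x $ t a else 0)"
        using tt(2)[of a] a by (simp add: sum.distrib)
      finally show ?thesis by simp
    qed
    have "t k = 0" by (simp add: t_def)
    then have x0: "x $ 0 = 0" using row[OF k(1)] k(2) by simp
    show "x = 0\<^sub>v n"
    proof (rule eq_vecI)
      fix b assume b: "b < dim_vec (0\<^sub>v n :: 'a vec)"
      show "x $ b = 0\<^sub>v n $ b"
        using row[of "t b"] b x0 by (cases "b = 0") (simp_all add: tt)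
    qed (use x in simp)
  qed
  moreover have "col g 0 = v" by (rule eq_vecI) (use v(1) k in \<open>simp_all add: g_def\<close>)
  ultimately show ?thesis by blast
qed

section \<open>Adjoints, and the normal form of Hermitian matrices under congruence\<close>

context hermitian_field
begin

definition adj :: "'a mat \<Rightarrow> 'a mat" where
  "adj A = map_mat cj (transpose_mat A)"

lemma adj_dim [simp]: "dim_row (adj A) = dim_col A" "dim_col (adj A) = dim_row A"
  by (auto simp: adj_def)

lemma adj_carrier [simp]: "adj A \<in> carrier_mat m n \<longleftrightarrow> A \<in> carrier_mat n m"
  unfolding carrier_mat_def mem_Collect_eq adj_dim by blast

lemma adj_index [simp]: "i < dim_col A \<Longrightarrow> j < dim_row A \<Longrightarrow> adj A $$ (i, j) = cj (A $$ (j, i))"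
  by (auto simp: adj_def)

lemma adj_adj [simp]: "adj (adj A) = A"
  by (rule eq_matI) auto

lemma adj_mult: "dim_col A = dim_row B \<Longrightarrow> adj (A * B) = adj B * adj A"
  by (rule eq_matI) (auto simp: scalar_prod_def cj.hom_sum mult.commute intro!: sum.cong)

lemma adj_add: "dim_row A = dim_row B \<Longrightarrow> dim_col A = dim_col B \<Longrightarrow> adj (A + B) = adj A + adj B"
  by (rule eq_matI) auto

lemma adj_minus: "dim_row A = dim_row B \<Longrightarrow> dim_col A = dim_col B \<Longrightarrow> adj (A - B) = adj A - adj B"
  by (rule eq_matI) auto

lemma adj_uminus: "adj (- A) = - adj A"
  by (rule eq_matI) auto

lemma adj_smult: "adj (c \<cdot>\<^sub>m A) = cj c \<cdot>\<^sub>m adj A"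
  by (rule eq_matI) auto

lemma adj_one [simp]: "adj (1\<^sub>m n) = 1\<^sub>m n"
  by (rule eq_matI) auto

lemma adj_zero [simp]: "adj (0\<^sub>m m n) = 0\<^sub>m n m"
  by (rule eq_matI) auto

lemma adj_four_block:
  assumes "dim_row B = dim_row A" "dim_col C = dim_col A" "dim_row C = dim_row D" "dim_col D = dim_col B"
  shows "adj (four_block_mat A B C D) = four_block_mat (adj A) (adj C) (adj B) (adj D)"
  by (rule eq_matI) (use assms in auto)

lemma det_adj: "A \<in> carrier_mat n n \<Longrightarrow> det (adj A) = cj (det A)"
  by (simp add: adj_def det_transpose)

lemma adj_GL [simp]: "adj A \<in> GL n \<longleftrightarrow> A \<in> GL n"
  by (auto simp: GL_def det_adj)

lemma minv_adj:
  assumes "A \<in> GL n" shows "minv (adj A) = adj (minv A)"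
proof (rule minv_unique[symmetric, of _ n])
  have "adj A * adj (minv A) = adj (minv A * A)"
    by (rule adj_mult[symmetric]) (simp add: minv_dim[OF assms] GL_D[OF assms])
  then show "adj A * adj (minv A) = 1\<^sub>m n" by (simp add: minv_left[OF assms])
qed (use assms minv_carrier[OF assms] in simp_all)

definition Hm :: "nat \<Rightarrow> 'a mat set" where
  "Hm n = {A \<in> carrier_mat n n. adj A = A}"

lemma Hm_D: "A \<in> Hm n \<Longrightarrow> dim_row A = n" "A \<in> Hm n \<Longrightarrow> dim_col A = n" "A \<in> Hm n \<Longrightarrow> adj A = A"
  "A \<in> Hm n \<Longrightarrow> A \<in> carrier_mat n n"
  by (auto simp: Hm_def)

lemma finite_Hm [simp]: "finite (Hm n)"
  by (rule finite_subset[OF _ finite_carrier_mat[of n n]]) (auto simp: Hm_def)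

lemma Hm_congruence:
  assumes "A \<in> Hm n" "g \<in> carrier_mat n m" shows "adj g * A * g \<in> Hm m"
  using assms Hm_D[OF assms(1)] by (auto simp: Hm_def adj_mult assoc_mult_mat_dim)

lemma four_block_Hm:
  assumes "A \<in> carrier_mat r r" "B \<in> carrier_mat r k" "C \<in> carrier_mat k r" "D \<in> carrier_mat k k"
  shows "four_block_mat A B C D \<in> Hm (r + k) \<longleftrightarrow> A \<in> Hm r \<and> C = adj B \<and> D \<in> Hm k"
  using assms by (auto simp: Hm_def adj_four_block four_block_eq_iff[of _ r r _ k _ k])

lemma Hm_split:
  assumes "A \<in> Hm (r + k)"
  obtains X Y Z where "X \<in> Hm r" "Y \<in> carrier_mat r k" "Z \<in> Hm k" "A = four_block_mat X Y (adj Y) Z"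
  using four_block_split[OF Hm_D(4)[OF assms]] four_block_Hm assms by metis

text \<open>The matrix \<open>diag(1, 0)\<close> of rank \<open>s\<close> and corank
  \<open>c\<close>. Over a finite field the corank is the only invariant of a Hermitian matrix of
  given size under congruence.\<close>

definition nf :: "nat \<Rightarrow> nat \<Rightarrow> 'a mat" where
  "nf s c = four_block_mat (1\<^sub>m s) (0\<^sub>m s c) (0\<^sub>m c s) (0\<^sub>m c c)"

lemma nf_dim [simp]: "dim_row (nf s c) = s + c" "dim_col (nf s c) = s + c"
  by (auto simp: nf_def)

lemma nf_Hm: "nf s c \<in> Hm (s + c)"
  unfolding nf_def by (subst four_block_Hm) (auto simp: Hm_def)

lemma nf_Suc: "four_block_mat (1\<^sub>m 1) (0\<^sub>m 1 (s + c)) (0\<^sub>m (s + c) 1) (nf s c) = nf (Suc s) c"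
  by (rule eq_matI) (auto simp: nf_def)

lemma schur_complement:
  assumes B: "B \<in> carrier_mat s k" and D: "D \<in> carrier_mat k k"
  defines "g \<equiv> four_block_mat (1\<^sub>m s) (- B) (0\<^sub>m k s) (1\<^sub>m k)"
  shows "g \<in> GL (s + k)"
    "adj g * four_block_mat (1\<^sub>m s) B (adj B) D * g = four_block_mat (1\<^sub>m s) (0\<^sub>m s k) (0\<^sub>m k s) (D - adj B * B)"
proof -
  show "g \<in> GL (s + k)" unfolding g_def using B by (subst four_block_GL_upper) (auto simp: one_GL)
  note d = carrier_matD[OF B] carrier_matD[OF D]
  have e: "- B + B = 0\<^sub>m s k" "adj B + - adj B = 0\<^sub>m k s" "B + - B = 0\<^sub>m s k" "- adj B + adj B = 0\<^sub>m k s"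
    by (rule eq_matI; simp add: d)+
  have e3: "- (0\<^sub>m k k :: 'a mat) = 0\<^sub>m k k" by (rule eq_matI) auto
  have e4: "0\<^sub>m k k + (D - adj B * B) = D - adj B * B" by (rule eq_matI) (auto simp: d)
  have e2: "- (adj B * B) + D = D - adj B * B" by (rule eq_matI) (auto simp: d)
  show "adj g * four_block_mat (1\<^sub>m s) B (adj B) D * g = four_block_mat (1\<^sub>m s) (0\<^sub>m s k) (0\<^sub>m k s) (D - adj B * B)"
    unfolding g_def
    by (simp add: adj_four_block mult_four_block_dim d adj_uminus left_mult_one_mat_dim right_mult_one_mat_dim
        zero_mat_dim e e2 e3 e4)
qed

text \<open>If all values vanish, the unit vectors give a zero diagonal; then the value at
  \<open>e\<^sub>i + a * e\<^sub>j\<close> is the trace of \<open>a * E $$ (i, j)\<close>, which is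
  nonzero for a suitable \<open>a\<close>.\<close>

lemma ex_value_nonzero:
  assumes E: "E \<in> Hm n" "E \<noteq> 0\<^sub>m n n"
  shows "\<exists>V\<in>carrier_mat n 1. (adj V * E * V) $$ (0, 0) \<noteq> 0"
proof (rule ccontr)
  assume "\<not> ?thesis"
  then have z: "(adj V * E * V) $$ (0, 0) = 0" if "V \<in> carrier_mat n 1" for V using that by blast
  note d = Hm_D(1,2)[OF E(1)]
  have val: "(adj V * E * V) $$ (0, 0) = (\<Sum>j<n. (\<Sum>i<n. cj (V $$ (i, 0)) * E $$ (i, j)) * V $$ (j, 0))"
    if "V \<in> carrier_mat n 1" for V using carrier_matD[OF that] d
    by (simp add: scalar_prod_def lessThan_atLeast0)
  have h: "E $$ (j, i) = cj (E $$ (i, j))" if "i < n" "j < n" for i j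
    using adj_index[of j E i] Hm_D(3)[OF E(1)] d that by simp
  have diag: "E $$ (i, i) = 0" if i: "i < n" for i
  proof -
    let ?V = "mat n 1 (\<lambda>(l, m). if l = i then 1 else 0) :: 'a mat"
    have c: "?V \<in> carrier_mat n 1" by simp
    have in1: "(\<Sum>m<n. cj (?V $$ (m, 0)) * E $$ (m, l)) = (\<Sum>m<n. if m = i then E $$ (i, l) else 0)" for l
      by (intro sum.cong refl) auto
    have "0 = (\<Sum>l<n. (\<Sum>m<n. cj (?V $$ (m, 0)) * E $$ (m, l)) * ?V $$ (l, 0))"
      using z[OF c] unfolding val[OF c] by (rule sym)
    also have "\<dots> = (\<Sum>l<n. if l = i then E $$ (i, i) else 0)"
      unfolding in1 by (intro sum.cong refl) (use i in auto)
    finally show ?thesis using i by simp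
  qed
  obtain i j where ij: "i < n" "j < n" "E $$ (i, j) \<noteq> 0"
    using E d by (metis eq_matI index_zero_mat)
  then have ne: "i \<noteq> j" using diag by auto
  obtain a where a: "a * E $$ (i, j) + cj (a * E $$ (i, j)) \<noteq> 0" using ex_trace_nonzero[OF ij(3)] by blast
  let ?V = "mat n 1 (\<lambda>(l, m). if l = i then 1 else if l = j then a else 0) :: 'a mat"
  have c: "?V \<in> carrier_mat n 1" by simp
  have in1: "(\<Sum>m<n. cj (?V $$ (m, 0)) * E $$ (m, l)) =
    (\<Sum>m<n. (if m = i then E $$ (i, l) else 0) + (if m = j then cj a * E $$ (j, l) else 0))" for l
    by (intro sum.cong refl) (use ne in auto)
  have in2: "(\<Sum>m<n. cj (?V $$ (m, 0)) * E $$ (m, l)) = E $$ (i, l) + cj a * E $$ (j, l)" for l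
    unfolding in1 using ij by (simp add: sum.distrib)
  have "0 = (\<Sum>l<n. (\<Sum>m<n. cj (?V $$ (m, 0)) * E $$ (m, l)) * ?V $$ (l, 0))"
    using z[OF c] unfolding val[OF c] by (rule sym)
  also have "\<dots> = (\<Sum>l<n. (if l = i then E $$ (i, i) + cj a * E $$ (j, i) else 0) +
      (if l = j then a * (E $$ (i, j) + cj a * E $$ (j, j)) else 0))"
    unfolding in2 by (intro sum.cong refl) (use ne ij in \<open>auto simp: mult.commute\<close>)
  also have "\<dots> = a * E $$ (i, j) + cj (a * E $$ (i, j))"
    using ij diag h[of i j] by (simp add: sum.distrib)
  finally show False using a by simp
qed

text \<open>Values of a Hermitian form lie in the fixed field, and scaling the vector multiplies
  them by a norm; by \<open>ex_norm_eq\<close> a nonzero value can be brought to 1.\<close>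

lemma ex_unit_value:
  assumes E: "E \<in> Hm n" "E \<noteq> 0\<^sub>m n n"
  shows "\<exists>V\<in>carrier_mat n 1. adj V * E * V = 1\<^sub>m 1"
proof -
  obtain V where V: "V \<in> carrier_mat n 1" "(adj V * E * V) $$ (0, 0) \<noteq> 0" using ex_value_nonzero[OF E] by blast
  let ?c = "(adj V * E * V) $$ (0, 0)"
  have W: "adj V * E * V \<in> Hm 1" by (rule Hm_congruence[OF E(1) V(1)])
  have "cj ?c = ?c" using adj_index[of 0 "adj V * E * V" 0] Hm_D[OF W] by simp
  then have "inverse ?c \<in> fixed_field" "inverse ?c \<noteq> 0" using V(2) by (auto simp: fixed_field_def cj_inverse)
  then obtain x where x: "x * cj x = inverse ?c" using ex_norm_eq by blast
  have ss: "a \<cdot>\<^sub>m (b \<cdot>\<^sub>m M) = (a * b) \<cdot>\<^sub>m M" for a b and M :: "'a mat" by (rule eq_matI) auto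
  have "adj (x \<cdot>\<^sub>m V) * E * (x \<cdot>\<^sub>m V) = (cj x * x) \<cdot>\<^sub>m (adj V * E * V)"
    unfolding adj_smult using Hm_D[OF E(1)] V(1)
    by (simp add: mult_smult_assoc_mat[of "adj V" 1 n E n] mult_smult_assoc_mat[of "adj V * E" 1 n V 1]
        mult_smult_distrib[of "cj x \<cdot>\<^sub>m (adj V * E)" 1 n V 1] ss mult.commute)
  also have "\<dots> = 1\<^sub>m 1"
    by (rule eq_matI) (use V Hm_D[OF W] x in \<open>simp_all add: mult.commute\<close>)
  finally show ?thesis using V(1) by (intro bexI[of _ "x \<cdot>\<^sub>m V"]) auto
qed

text \<open>A vector of value 1 is made the first basis vector, and the rest of its row and column
  is cleared by the Schur complement.\<close>

lemma ex_first_col_congruence: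
  assumes E: "E \<in> Hm (1 + n)" "E \<noteq> 0\<^sub>m (1 + n) (1 + n)"
  shows "\<exists>g\<in>GL (1 + n). \<exists>D\<in>Hm n. adj g * E * g = four_block_mat (1\<^sub>m 1) (0\<^sub>m 1 n) (0\<^sub>m n 1) D"
proof -
  note dE = Hm_D[OF E(1)]
  obtain V where V: "V \<in> carrier_mat (1 + n) 1" "adj V * E * V = 1\<^sub>m 1" using ex_unit_value[OF E] by blast
  note dV = carrier_matD[OF V(1)]
  have v: "col V 0 \<in> carrier_vec (1 + n)" by (rule carrier_vecI) (simp add: dV)
  have "col V 0 \<noteq> 0\<^sub>v (1 + n)"
  proof
    assume *: "col V 0 = 0\<^sub>v (1 + n)"
    have "V = 0\<^sub>m (1 + n) 1"
    proof (rule eq_matI)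
      fix i j assume "i < dim_row (0\<^sub>m (1 + n) 1 :: 'a mat)" "j < dim_col (0\<^sub>m (1 + n) 1 :: 'a mat)"
      then show "V $$ (i, j) = 0\<^sub>m (1 + n) 1 $$ (i, j)"
        using arg_cong[OF *, of "\<lambda>v. v $ i"] dV by simp
    qed (simp_all add: dV)
    then have "(1\<^sub>m 1 :: 'a mat) = 0\<^sub>m 1 1" using V(2) dE by (simp add: mult_zero_mat_dim)
    from arg_cong[OF this, of "\<lambda>M. M $$ (0, 0)"] show False by simp
  qed
  from ex_GL_first_col[OF v this] obtain g where g: "g \<in> GL (1 + n)" "col g 0 = col V 0" by blast
  note dg = GL_D[OF g(1)]
  let ?E = "adj g * E * g"
  have H: "?E \<in> Hm (1 + n)" by (rule Hm_congruence[OF E(1) dg(1)])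
  obtain X Y Z where X: "X \<in> Hm 1" "Y \<in> carrier_mat 1 n" "Z \<in> Hm n" "?E = four_block_mat X Y (adj Y) Z"
    by (rule Hm_split[OF H])
  have g0: "g $$ (i, 0) = V $$ (i, 0)" if "i < 1 + n" for i
    using arg_cong[OF g(2), of "\<lambda>v. v $ i"] that dg dV by simp
  have r: "row (adj g) 0 = row (adj V) 0" by (rule eq_vecI) (use g0 dg dV in simp_all)
  have r2: "row (adj g * E) 0 = row (adj V * E) 0" by (rule eq_vecI) (use r dg dV dE in simp_all)
  have "?E $$ (0, 0) = row (adj g * E) 0 \<bullet> col g 0"
    by (rule index_mult_mat(1)) (use dg in simp_all)
  also have "\<dots> = (adj V * E * V) $$ (0, 0)"
    unfolding r2 g(2) by (rule index_mult_mat(1)[symmetric]) (use dV in simp_all)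
  finally have "?E $$ (0, 0) = (adj V * E * V) $$ (0, 0)" .
  then have "X $$ (0, 0) = 1" using X V Hm_D[OF X(1)] by simp
  then have X1: "X = 1\<^sub>m 1" by (intro eq_matI) (use Hm_D[OF X(1)] in auto)
  let ?h = "four_block_mat (1\<^sub>m 1) (- Y) (0\<^sub>m n 1) (1\<^sub>m n)"
  note sc = schur_complement[OF X(2) Hm_D(4)[OF X(3)]]
  have "adj (g * ?h) * E * (g * ?h) = adj ?h * ?E * ?h"
    using dg dE X(2) by (simp add: adj_mult assoc_mult_mat_dim)
  also have "\<dots> = four_block_mat (1\<^sub>m 1) (0\<^sub>m 1 n) (0\<^sub>m n 1) (Z - adj Y * Y)"
    unfolding X(4) X1 by (rule sc(2))
  finally have eq: "adj (g * ?h) * E * (g * ?h) = four_block_mat (1\<^sub>m 1) (0\<^sub>m 1 n) (0\<^sub>m n 1) (Z - adj Y * Y)" .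
  have "Z - adj Y * Y \<in> Hm n"
    using Hm_D[OF X(3)] carrier_matD[OF X(2)] unfolding Hm_def
    by (auto simp: adj_minus adj_mult intro!: carrier_matI)
  then show ?thesis using eq GL_mult[OF g(1) sc(1)] by blast
qed

lemma normal_form:
  "E \<in> Hm n \<Longrightarrow> \<exists>g\<in>GL n. \<exists>s c. s + c = n \<and> adj g * E * g = nf s c"
proof (induction n arbitrary: E)
  case 0
  have "adj (1\<^sub>m 0) * E * 1\<^sub>m 0 = nf 0 0"
    by (rule eq_matI) (use Hm_D[OF 0] in auto)
  then show ?case using one_GL[of 0] by (metis add_0)
next
  case (Suc n)
  show ?case
  proof (cases "E = 0\<^sub>m (Suc n) (Suc n)")
    case True
    have "adj (1\<^sub>m (Suc n)) * E * 1\<^sub>m (Suc n) = nf 0 (Suc n)"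
      unfolding True by (rule eq_matI) (auto simp: nf_def left_mult_one_mat_dim right_mult_one_mat_dim)
    then show ?thesis using one_GL[of "Suc n"] by (metis add_0)
  next
    case False
    obtain g D where g: "g \<in> GL (1 + n)" "D \<in> Hm n"
      "adj g * E * g = four_block_mat (1\<^sub>m 1) (0\<^sub>m 1 n) (0\<^sub>m n 1) D"
      using ex_first_col_congruence[of E n] Suc.prems False by auto
    obtain h s c where h: "h \<in> GL n" "s + c = n" "adj h * D * h = nf s c" using Suc.IH[OF g(2)] by blast
    note d = GL_D[OF g(1)] GL_D[OF h(1)] Hm_D[OF g(2)] Hm_D[OF Suc.prems]
    let ?h = "four_block_mat (1\<^sub>m 1) (0\<^sub>m 1 n) (0\<^sub>m n 1) h"
    have hG: "?h \<in> GL (1 + n)" by (subst four_block_GL_upper) (use d h one_GL in auto)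
    have "adj (g * ?h) * E * (g * ?h) = adj ?h * (adj g * E * g) * ?h"
      using d by (simp add: adj_mult assoc_mult_mat_dim)
    also have "\<dots> = four_block_mat (1\<^sub>m 1) (0\<^sub>m 1 n) (0\<^sub>m n 1) (adj h * D * h)"
      unfolding g(3) using d by (simp add: adj_four_block mult_four_block_dim left_mult_one_mat_dim right_mult_one_mat_dim
        zero_mat_dim)
    also have "\<dots> = nf (Suc s) c" unfolding h(3) using h(2) nf_Suc[of s c] by simp
    finally show ?thesis using GL_mult[OF g(1) hG] h(2) by (metis add_Suc plus_1_eq_Suc)
  qed
qed

lemma append_zero_vec: "0\<^sub>v s @\<^sub>v 0\<^sub>v c = 0\<^sub>v (s + c)"
  by (rule eq_vecI) auto

lemma mker_nf: "mker (nf s c) = (\<lambda>b. 0\<^sub>v s @\<^sub>v b) ` (carrier_vec c :: 'a vec set)"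
proof (intro equalityI subsetI)
  fix v assume "v \<in> mker (nf s c)"
  then have v: "v \<in> carrier_vec (s + c)" "nf s c *\<^sub>v v = 0\<^sub>v (s + c)" by (auto simp: mker_def)
  let ?a = "vec_first v s" and ?b = "vec_last v c"
  have e: "v = ?a @\<^sub>v ?b" using v(1) by simp
  have "nf s c *\<^sub>v (?a @\<^sub>v ?b) = ?a @\<^sub>v 0\<^sub>v c"
    unfolding nf_def by (subst four_block_mult_vec_dim) auto
  then have "?a @\<^sub>v 0\<^sub>v c = 0\<^sub>v s @\<^sub>v 0\<^sub>v c" using v e by (simp add: append_zero_vec)
  then have "?a = 0\<^sub>v s" by (subst (asm) append_vec_eq[of _ s]) auto
  then show "v \<in> (\<lambda>b. 0\<^sub>v s @\<^sub>v b) ` carrier_vec c" using e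
    by (intro image_eqI[of _ _ ?b]) auto
next
  fix v :: "'a vec" assume "v \<in> (\<lambda>b. 0\<^sub>v s @\<^sub>v b) ` carrier_vec c"
  then obtain b where b: "b \<in> carrier_vec c" "v = 0\<^sub>v s @\<^sub>v b" by blast
  have "nf s c *\<^sub>v (0\<^sub>v s @\<^sub>v b) = 0\<^sub>v s @\<^sub>v 0\<^sub>v c"
    unfolding nf_def using b by (subst four_block_mult_vec_dim) auto
  then show "v \<in> mker (nf s c)" using b by (auto simp: mker_def append_zero_vec)
qed

lemma card_mker_nf: "card (mker (nf s c)) = (q\<^sup>2) ^ c"
proof -
  have "inj_on (\<lambda>b. 0\<^sub>v s @\<^sub>v b) (carrier_vec c :: 'a vec set)"
    by (rule inj_onI) (subst (asm) append_vec_eq[of _ s]; auto)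
  then show ?thesis unfolding mker_nf by (simp add: card_image card_carrier_vec card_UNIV)
qed

text \<open>The corank is encoded by the cardinality of the kernel, a form in which it is invariant
  under congruence by \<open>card_mker_congruence\<close> and directly usable in counting.\<close>

definition corank_set :: "nat \<Rightarrow> nat \<Rightarrow> 'a mat set" where
  "corank_set n c = {E \<in> Hm n. card (mker E) = (q\<^sup>2) ^ c}"

lemma Q_power_inject [simp]: "(q\<^sup>2) ^ a = (q\<^sup>2) ^ b \<longleftrightarrow> a = b"
  by (rule power_inject_exp, rule one_less_power) (use q_ge_2 in auto)

lemma card_mker_congruence:
  "E \<in> Hm n \<Longrightarrow> g \<in> GL n \<Longrightarrow> card (mker (adj g * E * g)) = card (mker E)"
  by (rule card_mker_mult) (auto simp: Hm_D)

lemma corank_set_normal_form: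
  assumes "E \<in> corank_set n c"
  shows "c \<le> n" "\<exists>g\<in>GL n. adj g * E * g = nf (n - c) c"
proof -
  have E: "E \<in> Hm n" "card (mker E) = (q\<^sup>2) ^ c" using assms by (auto simp: corank_set_def)
  obtain g s c' where g: "g \<in> GL n" "s + c' = n" "adj g * E * g = nf s c'" using normal_form[OF E(1)] by blast
  have "(q\<^sup>2) ^ c' = (q\<^sup>2) ^ c" using card_mker_congruence[OF E(1) g(1)] E(2) g(3) card_mker_nf by simp
  then have "c' = c" by simp
  then show "c \<le> n" "\<exists>g\<in>GL n. adj g * E * g = nf (n - c) c" using g by auto
qed

end

text \<open>The fibre over a first column \<open>b\<close> is a left translate of the fibre over the
  unit vector, which consists of block matrices with first column \<open>(1, 0)\<close>.\<close>

lemma card_GL_Suc: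
  "card (GL (Suc n) :: 'a::{field,finite} mat set) = (CARD('a) ^ Suc n - 1) * (CARD('a) ^ n * card (GL n :: 'a mat set))"
proof -
  let ?G = "GL (Suc n) :: 'a mat set" and ?u = "unit_vec (Suc n) 0 :: 'a vec"
  let ?S = "{A \<in> ?G. col A 0 = ?u}"
  have "card ?G = card (carrier_vec (Suc n) - {0\<^sub>v (Suc n)} :: 'a vec set) * card ?S"
  proof (rule card_fibres[where f = "\<lambda>A. col A 0"])
    show "(\<lambda>A. col A 0) ` ?G \<subseteq> carrier_vec (Suc n) - {0\<^sub>v (Suc n)}"
    proof (rule image_subsetI)
      fix A assume A: "A \<in> ?G"
      note d = GL_D[OF A]
      have c: "col A 0 \<in> carrier_vec (Suc n)" by (rule carrier_vecI) (simp add: d)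
      have "A *\<^sub>v ?u = col A 0" by (rule eq_vecI) (simp_all add: d)
      moreover have "?u \<noteq> 0\<^sub>v (Suc n)" by (metis index_unit_vec(1) index_zero_vec(1) zero_less_Suc zero_neq_one)
      ultimately have "col A 0 \<noteq> 0\<^sub>v (Suc n)" using GL_mult_vec_zero_iff[OF A, of ?u] by simp
      then show "col A 0 \<in> carrier_vec (Suc n) - {0\<^sub>v (Suc n)}" using c by simp
    qed
    fix b :: "'a vec" assume b: "b \<in> carrier_vec (Suc n) - {0\<^sub>v (Suc n)}"
    then obtain g where g: "g \<in> ?G" "col g 0 = b" using ex_GL_first_col by blast
    note d = GL_D[OF g(1)]
    have gu: "g *\<^sub>v ?u = b" unfolding g(2)[symmetric] by (rule eq_vecI) (simp_all add: d)
    then have mb: "minv g *\<^sub>v b = ?u" using GL_cancel(4)[OF g(1), of ?u] by simp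
    show "card {A \<in> ?G. col A 0 = b} = card ?S"
    proof (rule bij_betw_same_card, rule bij_betw_byWitness[where f = "\<lambda>A. minv g * A" and f' = "\<lambda>A. g * A"])
      show "\<forall>A\<in>{A \<in> ?G. col A 0 = b}. g * (minv g * A) = A"
        by (rule ballI, rule GL_cancel(1)[OF g(1)]) (simp add: GL_D)
      show "\<forall>A\<in>?S. minv g * (g * A) = A"
        by (rule ballI, rule GL_cancel(2)[OF g(1)]) (simp add: GL_D)
      have cm: "col (P * A) 0 = P *\<^sub>v col A 0" if "P \<in> ?G" "A \<in> ?G" for P A
        by (rule col_mult2[of _ "Suc n" "Suc n" _ "Suc n"]) (use that in \<open>simp_all add: GL_D\<close>)
      show "(\<lambda>A. minv g * A) ` {A \<in> ?G. col A 0 = b} \<subseteq> ?S"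
        by (rule image_subsetI) (use cm[OF minv_GL[OF g(1)]] GL_mult[OF minv_GL[OF g(1)]] mb in auto)
      show "(\<lambda>A. g * A) ` ?S \<subseteq> {A \<in> ?G. col A 0 = b}"
        by (rule image_subsetI) (use cm[OF g(1)] GL_mult[OF g(1)] gu in auto)
    qed
  qed auto
  moreover have "card ?S = card (carrier_mat 1 n \<times> GL n :: ('a mat \<times> 'a mat) set)"
  proof (rule sym, rule bij_betw_same_card)
    let ?f = "\<lambda>(b, A). four_block_mat (1\<^sub>m 1) b (0\<^sub>m n 1) A :: 'a mat"
    have inj: "inj_on ?f (carrier_mat 1 n \<times> GL n)"
      by (rule inj_onI) (clarsimp, subst (asm) four_block_eq_iff[of _ 1 1 _ n _ n], auto simp: GL_D)
    have "?f ` (carrier_mat 1 n \<times> GL n) = ?S"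
    proof (intro equalityI subsetI)
      fix X assume "X \<in> ?f ` (carrier_mat 1 n \<times> GL n)"
      then obtain b A where X: "b \<in> carrier_mat 1 n" "A \<in> GL n" "X = four_block_mat (1\<^sub>m 1) b (0\<^sub>m n 1) A" by auto
      have "X \<in> GL (1 + n)" unfolding X(3) by (subst four_block_GL_upper) (use X GL_D one_GL in auto)
      moreover have "col X 0 = ?u" by (rule eq_vecI) (use X(1) GL_D[OF X(2)] in \<open>auto simp: X(3)\<close>)
      ultimately show "X \<in> ?S" by simp
    next
      fix X assume X: "X \<in> ?S"
      then have "X \<in> carrier_mat (1 + n) (1 + n)" using GL_D(1) by auto
      from four_block_split[OF this] obtain A1 A2 A3 A4 where A: "A1 \<in> carrier_mat 1 1" "A2 \<in> carrier_mat 1 n"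
        "A3 \<in> carrier_mat n 1" "A4 \<in> carrier_mat n n" "X = four_block_mat A1 A2 A3 A4" by metis
      have i: "X $$ (i, 0) = ?u $ i" if "i < Suc n" for i
      proof -
        have "X $$ (i, 0) = col X 0 $ i"
          by (rule index_col[symmetric]) (use X that GL_D(2,3)[of X "Suc n"] in auto)
        also have "col X 0 = ?u" using X by blast
        finally show ?thesis .
      qed
      have A1: "A1 = 1\<^sub>m 1" by (rule eq_matI) (use i[of 0] A(1,4) in \<open>auto simp: A(5)\<close>)
      have A3: "A3 = 0\<^sub>m n 1" by (rule eq_matI) (use i[of "Suc _"] A(1,3,4) in \<open>auto simp: A(5)\<close>)
      have "X \<in> GL (1 + n)" using X by simp
      then have "A4 \<in> GL n" unfolding A(5) A1 A3 by (subst (asm) four_block_GL_upper) (use A in auto)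
      then show "X \<in> ?f ` (carrier_mat 1 n \<times> GL n)" using A A1 A3 by auto
    qed
    then show "bij_betw ?f (carrier_mat 1 n \<times> GL n) ?S" using inj by (simp add: bij_betw_def)
  qed
  moreover have "card (carrier_vec (Suc n) - {0\<^sub>v (Suc n)} :: 'a vec set) = CARD('a) ^ Suc n - 1"
    by (subst card_Diff_singleton) (auto simp: card_carrier_vec)
  ultimately show ?thesis by (simp add: card_cartesian_product card_carrier_mat)
qed

section \<open>The unitary group and the sizes of the congruence classes of Hermitian
  matrices\<close>

context hermitian_field
begin

text \<open>The unitary group of the form with Gram matrix 1. All counting is done here;
  \<open>unitary_group_bij\<close> carries it over to an arbitrary nondegenerate form.\<close>

definition UG :: "nat \<Rightarrow> 'a mat set" where
  "UG n = {A \<in> carrier_mat n n. adj A * A = 1\<^sub>m n}"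

lemma UG_GL: "A \<in> UG n \<Longrightarrow> A \<in> GL n"
proof -
  assume A: "A \<in> UG n"
  then have c: "A \<in> carrier_mat n n" "adj A * A = 1\<^sub>m n" by (auto simp: UG_def)
  have "adj A \<in> GL n" by (rule GL_I[OF _ c(1,2)]) (use c in simp)
  then show ?thesis by simp
qed

lemma minv_UG: "A \<in> UG n \<Longrightarrow> minv A = adj A"
proof -
  assume A: "A \<in> UG n"
  then have c: "A \<in> carrier_mat n n" "adj A * A = 1\<^sub>m n" by (auto simp: UG_def)
  have "adj A \<in> GL n" using UG_GL[OF A] by simp
  from minv_unique[OF this c] have "A = minv (adj A)" .
  also have "\<dots> = adj (minv A)" by (rule minv_adj[OF UG_GL[OF A]])
  finally show ?thesis by (metis adj_adj)
qed

lemma finite_UG [simp]: "finite (UG n)"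
  by (rule finite_subset[OF _ finite_carrier_mat[of n n]]) (auto simp: UG_def)

text \<open>An isometry of the degenerate form \<open>diag(1, 0)\<close> preserves the radical, so
  its upper right block is zero; on the quotient by the radical it is unitary, and the other blocks
  are free up to invertibility.\<close>

lemma nf_stabilizer:
  "bij_betw (\<lambda>(a, c, e). four_block_mat a (0\<^sub>m r k) c e) (UG r \<times> (carrier_mat k r :: 'a mat set) \<times> GL k)
     {s \<in> GL (r + k). adj s * nf r k * s = nf r k}"
proof (rule bij_betwI')
  fix x y :: "'a mat \<times> 'a mat \<times> 'a mat" assume "x \<in> UG r \<times> carrier_mat k r \<times> GL k" "y \<in> UG r \<times> carrier_mat k r \<times> GL k"
  then show "((case x of (a, c, e) \<Rightarrow> four_block_mat a (0\<^sub>m r k) c e) = (case y of (a, c, e) \<Rightarrow> four_block_mat a (0\<^sub>m r k) c e)) = (x = y)"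
    by (clarsimp, subst four_block_eq_iff[of _ r r _ k _ k], auto simp: UG_def GL_D)
next
  fix x :: "'a mat \<times> 'a mat \<times> 'a mat" assume "x \<in> UG r \<times> carrier_mat k r \<times> GL k"
  then obtain a c e where x: "x = (a, c, e)" "a \<in> UG r" "c \<in> carrier_mat k r" "e \<in> GL k" by auto
  let ?s = "four_block_mat a (0\<^sub>m r k) c e"
  note d = GL_D[OF UG_GL[OF x(2)]] carrier_matD[OF x(3)] GL_D[OF x(4)]
  have a: "adj a * a = 1\<^sub>m r" using x(2) by (auto simp: UG_def)
  have "?s \<in> GL (r + k)" by (subst four_block_GL_lower) (use d x UG_GL in auto)
  moreover have "adj ?s * nf r k * ?s = nf r k"
    unfolding nf_def by (simp add: adj_four_block mult_four_block_dim d a left_mult_one_mat_dim right_mult_one_mat_dim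
        zero_mat_dim)
  ultimately show "(case x of (a, c, e) \<Rightarrow> four_block_mat a (0\<^sub>m r k) c e) \<in> {s \<in> GL (r + k). adj s * nf r k * s = nf r k}"
    by (simp add: x)
next
  fix s :: "'a mat" assume s: "s \<in> {s \<in> GL (r + k). adj s * nf r k * s = nf r k}"
  then have sG: "s \<in> GL (r + k)" and sn: "adj s * nf r k * s = nf r k" by auto
  from four_block_split[OF GL_D(1)[OF sG]] obtain a b c e where A: "a \<in> carrier_mat r r" "b \<in> carrier_mat r k"
        "c \<in> carrier_mat k r" "e \<in> carrier_mat k k" "s = four_block_mat a b c e" by metis
  note d = A(1-4)[THEN carrier_matD(1)] A(1-4)[THEN carrier_matD(2)]
  have "adj s * nf r k * s = four_block_mat (adj a * a) (adj a * b) (adj b * a) (adj b * b)"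
    unfolding A(5) nf_def by (simp add: adj_four_block mult_four_block_dim d left_mult_one_mat_dim right_mult_one_mat_dim
        zero_mat_dim)
  then have "four_block_mat (adj a * a) (adj a * b) (adj b * a) (adj b * b) =
    four_block_mat (1\<^sub>m r) (0\<^sub>m r k) (0\<^sub>m k r) (0\<^sub>m k k)" using sn unfolding nf_def by simp
  then have e: "adj a * a = 1\<^sub>m r" "adj a * b = 0\<^sub>m r k"
    by (subst (asm) four_block_eq_iff[of _ r r _ k _ k], use A in \<open>auto intro!: mult_carrier_mat\<close>)+
  have aU: "a \<in> UG r" using A e by (simp add: UG_def)
  have "b = 0\<^sub>m r k"
  proof -
    have "adj a \<in> GL r" using UG_GL[OF aU] by simp
    from GL_cancel(2)[OF this, of b] show ?thesis unfolding e(2) using minv_dim[OF \<open>adj a \<in> GL r\<close>] d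
      by (simp add: mult_zero_mat_dim)
  qed
  then have s2: "s = four_block_mat a (0\<^sub>m r k) c e" using A by simp
  have "e \<in> GL k" using sG unfolding s2 by (subst (asm) four_block_GL_lower) (use A in auto)
  then show "\<exists>x\<in>UG r \<times> carrier_mat k r \<times> GL k. s = (case x of (a, c, e) \<Rightarrow> four_block_mat a (0\<^sub>m r k) c e)"
    using s2 aU A by (intro bexI[of _ "(a, c, e)"]) auto
qed

text \<open>Orbit and stabilizer: by the normal form, the Hermitian matrices of corank
  \<open>k\<close> are a single orbit of \<open>GL\<close> under congruence, and
  \<open>nf_stabilizer\<close> describes the stabilizer of \<open>nf r k\<close>.\<close>

lemma card_corank_set:
  "card (GL (r + k) :: 'a mat set) = card (corank_set (r + k) k) * (card (UG r) * (q\<^sup>2) ^ (k * r) * card (GL k :: 'a mat set))"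
proof -
  let ?S = "{s \<in> GL (r + k). adj s * nf r k * s = nf r k}"
  have "card (GL (r + k) :: 'a mat set) = card (corank_set (r + k) k) * card ?S"
  proof (rule card_fibres[where f = "\<lambda>g. adj g * nf r k * g"])
    show "(\<lambda>g. adj g * nf r k * g) ` GL (r + k) \<subseteq> corank_set (r + k) k"
      by (rule image_subsetI)
        (simp add: corank_set_def card_mker_congruence[OF nf_Hm] Hm_congruence[OF nf_Hm] GL_D card_mker_nf)
    show "finite (corank_set (r + k) k)" by (rule finite_subset[OF _ finite_Hm]) (auto simp: corank_set_def)
    fix b assume b: "b \<in> corank_set (r + k) k"
    then obtain g where g: "g \<in> GL (r + k)" "adj g * b * g = nf r k" using corank_set_normal_form[OF b] by auto
    have bH: "b \<in> Hm (r + k)" using b by (simp add: corank_set_def)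
    note d = GL_D[OF g(1)] Hm_D[OF bH] minv_dim[OF g(1)]
    have ag: "adj g \<in> GL (r + k)" using g by simp
    have key: "adj s * b * s = adj (minv g * s) * nf r k * (minv g * s)" if "s \<in> GL (r + k)" for s
    proof -
      note ds = GL_D[OF that]
      have "adj (minv g * s) * nf r k * (minv g * s) = adj s * (minv (adj g) * (adj g * (b * (g * (minv g * s)))))"
        unfolding g(2)[symmetric] minv_adj[OF g(1)] by (simp add: adj_mult d ds assoc_mult_mat_dim)
      also have "\<dots> = adj s * b * s"
        by (simp add: GL_cancel[OF g(1)] GL_cancel[OF ag] d ds assoc_mult_mat_dim)
      finally show ?thesis ..
    qed
    show "card {s \<in> GL (r + k). adj s * nf r k * s = b} = card ?S"
    proof (rule bij_betw_same_card, rule bij_betw_byWitness[where f = "\<lambda>s. s * g" and f' = "\<lambda>s. s * minv g"])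
      have c: "s * g * minv g = s" "s * minv g * g = s" if "s \<in> GL (r + k)" for s
        using GL_D(2,3)[OF that] minv_right[OF g(1)] minv_left[OF g(1)] d
        by (simp_all add: assoc_mult_mat_dim right_mult_one_mat_dim)
      then show "\<forall>s\<in>{s \<in> GL (r + k). adj s * nf r k * s = b}. s * g * minv g = s" "\<forall>s\<in>?S. s * minv g * g = s"
        by blast+
      show "(\<lambda>s. s * g) ` {s \<in> GL (r + k). adj s * nf r k * s = b} \<subseteq> ?S"
      proof (rule image_subsetI)
        fix s assume s: "s \<in> {s \<in> GL (r + k). adj s * nf r k * s = b}"
        then have sG: "s \<in> GL (r + k)" by blast
        note ds = GL_D(2,3)[OF sG]
        have "adj (s * g) * nf r k * (s * g) = adj g * (adj s * nf r k * s) * g"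
          using ds by (simp add: adj_mult d assoc_mult_mat_dim)
        also have "\<dots> = adj g * b * g" using s by simp
        finally show "s * g \<in> ?S" using g(2) GL_mult[OF sG g(1)] by simp
      qed
      show "(\<lambda>s. s * minv g) ` ?S \<subseteq> {s \<in> GL (r + k). adj s * nf r k * s = b}"
      proof (rule image_subsetI)
        fix s assume s: "s \<in> ?S"
        then have sG: "s \<in> GL (r + k)" by blast
        note ds = GL_D(2,3)[OF sG]
        have "adj (s * minv g) * nf r k * (s * minv g) = adj (minv g) * (adj s * nf r k * s) * minv g"
          using ds by (simp add: adj_mult d assoc_mult_mat_dim)
        also have "\<dots> = adj (minv g) * nf r k * minv g" using s by simp
        also have "\<dots> = adj (minv g * 1\<^sub>m (r + k)) * nf r k * (minv g * 1\<^sub>m (r + k))"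
          by (simp add: right_mult_one_mat_dim d)
        also have "\<dots> = adj (1\<^sub>m (r + k)) * b * 1\<^sub>m (r + k)" by (rule key[OF one_GL, symmetric])
        also have "\<dots> = b" by (simp add: right_mult_one_mat_dim left_mult_one_mat_dim d)
        finally show "s * minv g \<in> {s \<in> GL (r + k). adj s * nf r k * s = b}"
          using GL_mult[OF sG minv_GL[OF g(1)]] by simp
      qed
    qed
  qed simp
  also have "card ?S = card (UG r) * (q\<^sup>2) ^ (k * r) * card (GL k :: 'a mat set)"
    using bij_betw_same_card[OF nf_stabilizer[of r k]] by (simp add: card_cartesian_product card_carrier_mat card_UNIV)
  finally show ?thesis .
qed

end

subsection \<open>Extensions of Hermitian matrices\<close>

definition lead :: "nat \<Rightarrow> 'a mat \<Rightarrow> 'a mat" where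
  "lead r H = mat r r (\<lambda>ij. H $$ ij)"

lemma lead_dim [simp]: "dim_row (lead r H) = r" "dim_col (lead r H) = r"
  by (simp_all add: lead_def)

lemma lead_index [simp]: "i < r \<Longrightarrow> j < r \<Longrightarrow> lead r H $$ (i, j) = H $$ (i, j)"
  by (simp add: lead_def)

lemma lead_four_block: "A \<in> carrier_mat r r \<Longrightarrow> lead r (four_block_mat A B C D) = A"
  by (rule eq_matI) auto

lemma lead_lead: "r \<le> s \<Longrightarrow> lead r (lead s H) = lead r H"
  by (rule eq_matI) auto

lemma lead_self: "H \<in> carrier_mat r r \<Longrightarrow> lead r H = H"
  by (rule eq_matI) auto

definition cmat :: "'a vec \<Rightarrow> 'a mat" where
  "cmat y = mat (dim_vec y) 1 (\<lambda>(i, j). y $ i)"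

lemma cmat_dim [simp]: "dim_row (cmat y) = dim_vec y" "dim_col (cmat y) = 1"
  by (simp_all add: cmat_def)

lemma cmat_index [simp]: "i < dim_vec y \<Longrightarrow> cmat y $$ (i, 0) = y $ i"
  by (simp add: cmat_def)

lemma cmat_mult: "dim_col A = dim_vec y \<Longrightarrow> cmat (A *\<^sub>v y) = A * cmat y" for A :: "'a::semiring_0 mat"
  by (rule eq_matI) (auto simp: cmat_def scalar_prod_def)

lemma append_vec_carrier_split:
  assumes "v \<in> carrier_vec (m + n)"
  obtains a b where "a \<in> carrier_vec m" "b \<in> carrier_vec n" "v = a @\<^sub>v b"
  using assms vec_first_last_append[OF assms] vec_first_carrier vec_last_carrier by metis

lemma append_vec_bij: "bij_betw (\<lambda>(a, b). a @\<^sub>v b) (carrier_vec m \<times> carrier_vec n) (carrier_vec (m + n))"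
proof (rule bij_betwI')
  fix x y :: "'a vec \<times> 'a vec" assume "x \<in> carrier_vec m \<times> carrier_vec n" "y \<in> carrier_vec m \<times> carrier_vec n"
  then show "((case x of (a, b) \<Rightarrow> a @\<^sub>v b) = (case y of (a, b) \<Rightarrow> a @\<^sub>v b)) = (x = y)"
    by (cases x; cases y) (simp, subst append_vec_eq[of _ m], auto)
next
  fix v :: "'a vec" assume "v \<in> carrier_vec (m + n)"
  then obtain a b where "a \<in> carrier_vec m" "b \<in> carrier_vec n" "v = a @\<^sub>v b" by (rule append_vec_carrier_split)
  then show "\<exists>x\<in>carrier_vec m \<times> carrier_vec n. v = (case x of (a, b) \<Rightarrow> a @\<^sub>v b)"
    by (intro bexI[of _ "(a, b)"]) auto
qed auto

context hermitian_field
begin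

definition hp :: "'a vec \<Rightarrow> 'a vec \<Rightarrow> 'a" where
  "hp y v = (\<Sum>i<dim_vec y. cj (y $ i) * v $ i)"

definition border :: "'a mat \<Rightarrow> 'a vec \<Rightarrow> 'a \<Rightarrow> 'a mat" where
  "border E y z = four_block_mat E (cmat y) (adj (cmat y)) (mat 1 1 (\<lambda>_. z))"

lemma one_by_one_Hm: "mat 1 1 (\<lambda>_. z) \<in> Hm 1 \<longleftrightarrow> z \<in> fixed_field"
proof -
  have "adj (mat 1 1 (\<lambda>_. z)) = mat 1 1 (\<lambda>_. cj z)" by (rule eq_matI) auto
  moreover have "mat 1 1 (\<lambda>_. cj z) = mat 1 1 (\<lambda>_. z) \<longleftrightarrow> cj z = z"
    by (auto dest: arg_cong[of _ _ "\<lambda>M. M $$ (0, 0)"])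
  ultimately show ?thesis by (simp add: Hm_def fixed_field_def)
qed

lemma border_Hm:
  assumes "y \<in> carrier_vec r" "z \<in> fixed_field" "E \<in> Hm r"
  shows "border E y z \<in> Hm (Suc r)"
proof -
  have c: "cmat y \<in> carrier_mat r 1" by (rule carrier_matI) (use assms in auto)
  have "four_block_mat E (cmat y) (adj (cmat y)) (mat 1 1 (\<lambda>_. z)) \<in> Hm (r + 1)"
    by (subst four_block_Hm) (use c assms one_by_one_Hm[of z] Hm_D[OF assms(3)] in simp_all)
  then show ?thesis by (simp add: border_def)
qed

lemma border_bij:
  assumes E: "E \<in> Hm r"
  shows "bij_betw (\<lambda>(y, z). border E y z) (carrier_vec r \<times> fixed_field) {H \<in> Hm (Suc r). lead r H = E}"
proof (rule bij_betw_byWitness[where f' = "\<lambda>H. (vec r (\<lambda>i. H $$ (i, r)), H $$ (r, r))"])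
  note dE = Hm_D[OF E]
  show "\<forall>yz\<in>carrier_vec r \<times> fixed_field. (vec r (\<lambda>i. (case yz of (y, z) \<Rightarrow> border E y z) $$ (i, r)), (case yz of (y, z) \<Rightarrow> border E y z) $$ (r, r)) = yz"
  proof (clarify, intro conjI)
    fix y :: "'a vec" and z assume "y \<in> carrier_vec r"
    then have "dim_vec y = r" by simp
    then show "vec r (\<lambda>i. border E y z $$ (i, r)) = y" "border E y z $$ (r, r) = z"
      using dE by (auto simp: border_def intro!: eq_vecI)
  qed
  show "(\<lambda>(y, z). border E y z) ` (carrier_vec r \<times> fixed_field) \<subseteq> {H \<in> Hm (Suc r). lead r H = E}"
    using border_Hm[OF _ _ E] dE by (auto simp: border_def lead_four_block)
  have *: "border E (vec r (\<lambda>i. H $$ (i, r))) (H $$ (r, r)) = H" if H: "H \<in> Hm (Suc r)" "lead r H = E" for H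
  proof -
    note dH = Hm_D[OF H(1)]
    have h: "cj (H $$ (j, i)) = H $$ (i, j)" if "i < Suc r" "j < Suc r" for i j
      using adj_index[of i H j] that dH by simp
    show ?thesis unfolding H(2)[symmetric]
    proof (rule eq_matI)
      fix i j assume ij: "i < dim_row H" "j < dim_col H"
      then show "border (lead r H) (vec r (\<lambda>i. H $$ (i, r))) (H $$ (r, r)) $$ (i, j) = H $$ (i, j)"
        using h[of r j] dH by (cases "i < r"; cases "j < r"; simp add: border_def less_Suc_eq)
    qed (simp_all add: border_def dH)
  qed
  then show "\<forall>H\<in>{H \<in> Hm (Suc r). lead r H = E}. (case (vec r (\<lambda>i. H $$ (i, r)), H $$ (r, r)) of (y, z) \<Rightarrow> border E y z) = H"
    by simp
  show "(\<lambda>H. (vec r (\<lambda>i. H $$ (i, r)), H $$ (r, r))) ` {H \<in> Hm (Suc r). lead r H = E} \<subseteq> carrier_vec r \<times> fixed_field"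
  proof (rule image_subsetI)
    fix H :: "'a mat" assume H: "H \<in> {H \<in> Hm (Suc r). lead r H = E}"
    then have H': "H \<in> Hm (Suc r)" by simp
    note dH = Hm_D[OF H']
    have "cj (H $$ (r, r)) = H $$ (r, r)" using adj_index[of r H r] dH by simp
    then show "(vec r (\<lambda>i. H $$ (i, r)), H $$ (r, r)) \<in> carrier_vec r \<times> fixed_field" by (simp add: fixed_field_def)
  qed
qed

lemma hp_add: "dim_vec v = dim_vec y \<Longrightarrow> dim_vec w = dim_vec y \<Longrightarrow> hp y (v + w) = hp y v + hp y w"
  by (simp add: hp_def sum.distrib algebra_simps)

lemma hp_smult: "dim_vec v = dim_vec y \<Longrightarrow> hp y (a \<cdot>\<^sub>v v) = a * hp y v"
  by (simp add: hp_def sum_distrib_left mult_ac)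

lemma hp_append: "dim_vec a = dim_vec y1 \<Longrightarrow> dim_vec b = dim_vec y2 \<Longrightarrow> hp (y1 @\<^sub>v y2) (a @\<^sub>v b) = hp y1 a + hp y2 b"
proof -
  assume d: "dim_vec a = dim_vec y1" "dim_vec b = dim_vec y2"
  have s: "(\<Sum>i<m + n. f i) = (\<Sum>i<m. f i) + (\<Sum>i<n. f (m + i))" for m n and f :: "nat \<Rightarrow> 'a"
    by (induction n) (auto simp: add.assoc)
  show ?thesis using d by (simp add: hp_def s)
qed

lemma adj_cmat_mult: "dim_vec v = dim_vec y \<Longrightarrow> adj (cmat y) *\<^sub>v v = vec 1 (\<lambda>_. hp y v)"
  by (rule eq_vecI) (auto simp: hp_def scalar_prod_def lessThan_atLeast0)

lemma hp_self_fixed: "hp y y \<in> fixed_field"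
  by (simp add: hp_def fixed_field_def cj.hom_sum mult.commute)

lemma card_hyperplane:
  assumes y: "y \<in> carrier_vec c" "y \<noteq> 0\<^sub>v c"
  shows "card {b \<in> carrier_vec c. hp y b = 0} = (q\<^sup>2) ^ (c - 1)"
proof -
  obtain k where k: "k < c" "y $ k \<noteq> 0" using y by (metis carrier_vecD eq_vecI index_zero_vec)
  define w where "w x = (x / cj (y $ k)) \<cdot>\<^sub>v unit_vec c k" for x
  have wc: "w x \<in> carrier_vec c" for x by (simp add: w_def)
  have dy: "dim_vec y = c" using y by simp
  have "hp y (unit_vec c k) = cj (y $ k)"
    using k dy by (simp add: hp_def unit_vec_def if_distrib[of "\<lambda>z. _ * z"] cong: if_cong)
  then have hw: "hp y (w x) = x" for x using k dy by (simp add: w_def hp_smult)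
  have "card (carrier_vec c :: 'a vec set) = card (UNIV :: 'a set) * card {b \<in> carrier_vec c. hp y b = 0}"
  proof (rule card_fibres[where f = "hp y"])
    fix x :: 'a
    show "card {b \<in> carrier_vec c. hp y b = x} = card {b \<in> carrier_vec c. hp y b = 0}"
    proof (rule bij_betw_same_card, rule bij_betw_byWitness[where f = "\<lambda>b. b + w (- x)" and f' = "\<lambda>b. b + w x"])
      have wx: "w (- x) + w x = 0\<^sub>v c" "w x + w (- x) = 0\<^sub>v c" by (auto simp: w_def intro!: eq_vecI)
      show "\<forall>a\<in>{b \<in> carrier_vec c. hp y b = x}. a + w (- x) + w x = a"
        "\<forall>a\<in>{b \<in> carrier_vec c. hp y b = 0}. a + w x + w (- x) = a"
        using wc wx by (auto simp: assoc_add_vec[of _ c])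
      show "(\<lambda>b. b + w (- x)) ` {b \<in> carrier_vec c. hp y b = x} \<subseteq> {b \<in> carrier_vec c. hp y b = 0}"
        "(\<lambda>b. b + w x) ` {b \<in> carrier_vec c. hp y b = 0} \<subseteq> {b \<in> carrier_vec c. hp y b = x}"
        using wc hw dy by (auto simp: hp_add)
    qed
  qed auto
  then have "q\<^sup>2 * (q\<^sup>2) ^ (c - 1) = q\<^sup>2 * card {b \<in> carrier_vec c. hp y b = 0}"
    using k by (cases c) (simp_all add: card_carrier_vec card_UNIV)
  then show ?thesis using q_ge_2 by simp
qed

text \<open>For a vector \<open>(a, b, t)\<close> the kernel equations amount to
  \<open>a = - t * y1\<close>, \<open>t * y2 = 0\<close> and
  \<open>hp y2 b + (z - hp y1 y1) * t = 0\<close>. If \<open>y2\<close> is nonzero, then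
  \<open>t = 0\<close> and \<open>b\<close> lies in a hyperplane; otherwise \<open>b\<close> is
  free, and \<open>t\<close> is free or zero according to \<open>z\<close>.\<close>

lemma card_mker_border_nf:
  assumes y1: "y1 \<in> carrier_vec s" and y2: "y2 \<in> carrier_vec c"
  shows "card (mker (border (nf s c) (y1 @\<^sub>v y2) z)) =
    (if y2 = 0\<^sub>v c then if z = hp y1 y1 then (q\<^sup>2) ^ (c + 1) else (q\<^sup>2) ^ c else (q\<^sup>2) ^ (c - 1))"
proof -
  let ?M = "border (nf s c) (y1 @\<^sub>v y2) z"
  let ?K = "{(b, t). b \<in> carrier_vec c \<and> t \<cdot>\<^sub>v y2 = 0\<^sub>v c \<and> hp y2 b + (z - hp y1 y1) * t = 0}"
  let ?f = "\<lambda>(b, t). ((- t) \<cdot>\<^sub>v y1 @\<^sub>v b) @\<^sub>v vec 1 (\<lambda>_. t)"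
  note d = carrier_vecD[OF y1] carrier_vecD[OF y2]
  have mul: "?M *\<^sub>v ((a @\<^sub>v b) @\<^sub>v vec 1 (\<lambda>_. t)) = ((a + t \<cdot>\<^sub>v y1) @\<^sub>v (t \<cdot>\<^sub>v y2)) @\<^sub>v vec 1 (\<lambda>_. hp y1 a + hp y2 b + z * t)"
    if ab: "dim_vec a = s" "dim_vec b = c" for a b t
  proof -
    have 1: "nf s c *\<^sub>v (a @\<^sub>v b) = a @\<^sub>v 0\<^sub>v c"
      unfolding nf_def using ab by (subst four_block_mult_vec_dim) (auto intro!: eq_vecI)
    have 2: "cmat (y1 @\<^sub>v y2) *\<^sub>v vec 1 (\<lambda>_. t) = (t \<cdot>\<^sub>v y1) @\<^sub>v (t \<cdot>\<^sub>v y2)"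
      by (rule eq_vecI) (auto simp: scalar_prod_def d mult.commute)
    have 3: "mat 1 1 (\<lambda>_. z) *\<^sub>v vec 1 (\<lambda>_. t) = vec 1 (\<lambda>_. z * t)"
      by (rule eq_vecI) (auto simp: scalar_prod_def)
    have 4: "adj (cmat (y1 @\<^sub>v y2)) *\<^sub>v (a @\<^sub>v b) = vec 1 (\<lambda>_. hp y1 a + hp y2 b)"
      using ab d by (subst adj_cmat_mult) (auto simp: hp_append)
    have "?M *\<^sub>v ((a @\<^sub>v b) @\<^sub>v vec 1 (\<lambda>_. t)) = ((a @\<^sub>v 0\<^sub>v c) + ((t \<cdot>\<^sub>v y1) @\<^sub>v (t \<cdot>\<^sub>v y2))) @\<^sub>v (vec 1 (\<lambda>_. hp y1 a + hp y2 b) + vec 1 (\<lambda>_. z * t))"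
      unfolding border_def by (subst four_block_mult_vec_dim) (use ab d 1 2 3 4 in simp_all)
    also have "(a @\<^sub>v 0\<^sub>v c) + ((t \<cdot>\<^sub>v y1) @\<^sub>v (t \<cdot>\<^sub>v y2)) = (a + t \<cdot>\<^sub>v y1) @\<^sub>v (t \<cdot>\<^sub>v y2)"
      by (rule eq_vecI) (use ab d in auto)
    also have "vec 1 (\<lambda>_. hp y1 a + hp y2 b) + vec 1 (\<lambda>_. z * t) = vec 1 (\<lambda>_. hp y1 a + hp y2 b + z * t)"
      by (rule eq_vecI) auto
    finally show ?thesis .
  qed
  have dM: "dim_row ?M = s + c + 1" "dim_col ?M = s + c + 1" by (simp_all add: border_def)
  have zz: "0\<^sub>v (s + c + 1) = (0\<^sub>v s @\<^sub>v 0\<^sub>v c) @\<^sub>v (vec 1 (\<lambda>_. 0) :: 'a vec)" by (rule eq_vecI) auto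
  have ker: "(a @\<^sub>v b) @\<^sub>v vec 1 (\<lambda>_. t) \<in> mker ?M \<longleftrightarrow> a = (- t) \<cdot>\<^sub>v y1 \<and> (b, t) \<in> ?K"
    if ab: "a \<in> carrier_vec s" "b \<in> carrier_vec c" for a b t
  proof -
    have "(a @\<^sub>v b) @\<^sub>v vec 1 (\<lambda>_. t) \<in> carrier_vec (s + c + 1)" using ab by (intro append_carrier_vec) auto
    then have "(a @\<^sub>v b) @\<^sub>v vec 1 (\<lambda>_. t) \<in> mker ?M \<longleftrightarrow>
      ((a + t \<cdot>\<^sub>v y1) @\<^sub>v (t \<cdot>\<^sub>v y2)) @\<^sub>v vec 1 (\<lambda>_. hp y1 a + hp y2 b + z * t) = (0\<^sub>v s @\<^sub>v 0\<^sub>v c) @\<^sub>v vec 1 (\<lambda>_. 0)"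
      unfolding mker_def mem_Collect_eq dM mul[OF carrier_vecD[OF ab(1)] carrier_vecD[OF ab(2)]] zz by simp
    also have "\<dots> \<longleftrightarrow> (a + t \<cdot>\<^sub>v y1) @\<^sub>v (t \<cdot>\<^sub>v y2) = 0\<^sub>v s @\<^sub>v 0\<^sub>v c \<and> vec 1 (\<lambda>_. hp y1 a + hp y2 b + z * t) = vec 1 (\<lambda>_. 0)"
      by (rule append_vec_eq[of _ "s + c"]) (use ab y1 y2 in auto)
    also have "(a + t \<cdot>\<^sub>v y1) @\<^sub>v (t \<cdot>\<^sub>v y2) = 0\<^sub>v s @\<^sub>v 0\<^sub>v c \<longleftrightarrow> a + t \<cdot>\<^sub>v y1 = 0\<^sub>v s \<and> t \<cdot>\<^sub>v y2 = 0\<^sub>v c"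
      by (rule append_vec_eq[of _ s]) (use ab y1 y2 in auto)
    also have "a + t \<cdot>\<^sub>v y1 = 0\<^sub>v s \<longleftrightarrow> a = (- t) \<cdot>\<^sub>v y1"
    proof
      assume e: "a + t \<cdot>\<^sub>v y1 = 0\<^sub>v s"
      show "a = (- t) \<cdot>\<^sub>v y1"
      proof (rule eq_vecI)
        fix i assume "i < dim_vec ((- t) \<cdot>\<^sub>v y1)"
        then show "a $ i = ((- t) \<cdot>\<^sub>v y1) $ i" using arg_cong[OF e, of "\<lambda>v. v $ i"] ab d
          by (simp add: eq_neg_iff_add_eq_0)
      qed (use ab d in simp)
    next
      assume "a = (- t) \<cdot>\<^sub>v y1"
      then show "a + t \<cdot>\<^sub>v y1 = 0\<^sub>v s" using d by (auto intro!: eq_vecI)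
    qed
    also have "vec 1 (\<lambda>_. hp y1 a + hp y2 b + z * t) = vec 1 (\<lambda>_. 0) \<longleftrightarrow> hp y1 a + hp y2 b + z * t = 0"
      by (auto dest: arg_cong[of _ _ "\<lambda>v. v $ 0"])
    finally show ?thesis using ab d by (auto simp: hp_smult algebra_simps)
  qed
  have "bij_betw ?f ?K (mker ?M)"
  proof (rule bij_betwI')
    fix x x' assume "x \<in> ?K" "x' \<in> ?K"
    then obtain b t b' t' where x: "x = (b, t)" "x' = (b', t')" "b \<in> carrier_vec c" "b' \<in> carrier_vec c" by auto
    have "(((- t) \<cdot>\<^sub>v y1 @\<^sub>v b) @\<^sub>v vec 1 (\<lambda>_. t) = ((- t') \<cdot>\<^sub>v y1 @\<^sub>v b') @\<^sub>v vec 1 (\<lambda>_. t')) \<longleftrightarrow>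
       (- t) \<cdot>\<^sub>v y1 @\<^sub>v b = (- t') \<cdot>\<^sub>v y1 @\<^sub>v b' \<and> vec 1 (\<lambda>_. t) = vec 1 (\<lambda>_. t')"
      by (rule append_vec_eq[of _ "s + c"]) (use x y1 in auto)
    also have "(- t) \<cdot>\<^sub>v y1 @\<^sub>v b = (- t') \<cdot>\<^sub>v y1 @\<^sub>v b' \<longleftrightarrow> (- t) \<cdot>\<^sub>v y1 = (- t') \<cdot>\<^sub>v y1 \<and> b = b'"
      by (rule append_vec_eq[of _ s]) (use x y1 in auto)
    also have "vec 1 (\<lambda>_. t) = vec 1 (\<lambda>_. t') \<longleftrightarrow> t = t'"
      by (auto dest: arg_cong[of _ _ "\<lambda>v. v $ 0"])
    finally show "(?f x = ?f x') = (x = x')" unfolding x by auto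
  next
    fix x assume "x \<in> ?K"
    then show "?f x \<in> mker ?M" using ker[of "(- snd x) \<cdot>\<^sub>v y1" "fst x" "snd x"] y1 by (auto simp: case_prod_unfold)
  next
    fix v assume v: "v \<in> mker ?M"
    then have "v \<in> carrier_vec ((s + c) + 1)" by (auto simp: mker_def dM)
    then obtain u w where "u \<in> carrier_vec (s + c)" and w: "w \<in> carrier_vec 1" and vu: "v = u @\<^sub>v w" by (rule append_vec_carrier_split)
    from this(1) obtain a b where ab: "a \<in> carrier_vec s" "b \<in> carrier_vec c" "u = a @\<^sub>v b" by (rule append_vec_carrier_split)
    have w': "w = vec 1 (\<lambda>_. w $ 0)" by (rule eq_vecI) (use w in auto)
    show "\<exists>x\<in>?K. v = ?f x"
      using ker[OF ab(1,2), of "w $ 0"] v vu ab w' by (intro bexI[of _ "(b, w $ 0)"]) auto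
  qed
  then have "card (mker ?M) = card ?K" by (rule bij_betw_same_card[symmetric])
  also have "\<dots> = (if y2 = 0\<^sub>v c then if z = hp y1 y1 then (q\<^sup>2) ^ (c + 1) else (q\<^sup>2) ^ c else (q\<^sup>2) ^ (c - 1))"
  proof (cases "y2 = 0\<^sub>v c")
    case True
    have z0: "t \<cdot>\<^sub>v 0\<^sub>v c = (0\<^sub>v c :: 'a vec)" for t by (rule eq_vecI) auto
    have h0: "hp (0\<^sub>v c) b = 0" for b by (simp add: hp_def)
    show ?thesis
    proof (cases "z = hp y1 y1")
      case T: True
      have "?K = carrier_vec c \<times> UNIV" unfolding True T by (auto simp: z0 h0)
      then show ?thesis using True T by (simp add: card_cartesian_product card_carrier_vec card_UNIV)
    next
      case F: False
      then have "?K = carrier_vec c \<times> {0}" unfolding True by (auto simp: z0 h0)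
      then show ?thesis using True F by (simp add: card_cartesian_product card_carrier_vec card_UNIV)
    qed
  next
    case False
    then obtain k where k: "k < c" "y2 $ k \<noteq> 0" using y2 by (metis carrier_vecD eq_vecI index_zero_vec)
    have t0: "t = 0" if "t \<cdot>\<^sub>v y2 = 0\<^sub>v c" for t
      using arg_cong[OF that, of "\<lambda>v. v $ k"] k d by simp
    have "0 \<cdot>\<^sub>v y2 = 0\<^sub>v c" using d by (auto intro!: eq_vecI)
    then have "(b, t) \<in> ?K \<longleftrightarrow> (b, t) \<in> {b \<in> carrier_vec c. hp y2 b = 0} \<times> {0}" for b t
      using t0[of t] by (cases "t = 0") auto
    then have "?K = {b \<in> carrier_vec c. hp y2 b = 0} \<times> {0}" unfolding set_eq_iff split_paired_All by blast
    then show ?thesis using False card_hyperplane[OF y2 False] by (simp add: card_cartesian_product)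
  qed
  finally show ?thesis .
qed

text \<open>The weights of the three outcomes: \<open>y1\<close> is arbitrary; for
  \<open>y2 = 0\<close> one of the \<open>q\<close> values of \<open>z\<close> raises the corank and
  the others keep it; for \<open>y2\<close> nonzero every \<open>z\<close> lowers it. At
  \<open>c = 0\<close> the last coefficient is zero.\<close>

lemma sum_border_nf:
  fixes f :: "nat \<Rightarrow> nat"
  shows "(\<Sum>(y, z)\<in>carrier_vec (s + c) \<times> fixed_field. f (card (mker (border (nf s c) y z)))) =
    (q\<^sup>2) ^ s * (f ((q\<^sup>2) ^ (c + 1)) + (q - 1) * f ((q\<^sup>2) ^ c) + ((q\<^sup>2) ^ c - 1) * q * f ((q\<^sup>2) ^ (c - 1)))"
proof -
  have fin: "finite fixed_field" by simp
  have "(\<Sum>(y, z)\<in>carrier_vec (s + c) \<times> fixed_field. f (card (mker (border (nf s c) y z)))) =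
    (\<Sum>y\<in>carrier_vec (s + c). \<Sum>z\<in>fixed_field. f (card (mker (border (nf s c) y z))))"
    by (rule sum.cartesian_product[symmetric])
  also have "\<dots> = (\<Sum>yy\<in>carrier_vec s \<times> carrier_vec c. \<Sum>z\<in>fixed_field. f (card (mker (border (nf s c) (case yy of (a, b) \<Rightarrow> a @\<^sub>v b) z))))"
    by (rule sum.reindex_bij_betw[symmetric, OF append_vec_bij])
  also have "\<dots> = (\<Sum>y1\<in>carrier_vec s. \<Sum>y2\<in>carrier_vec c. \<Sum>z\<in>fixed_field. f (card (mker (border (nf s c) (y1 @\<^sub>v y2) z))))"
    by (rule trans[OF _ sum.cartesian_product[symmetric]], rule sum.cong) auto
  also have "\<dots> = (\<Sum>y1\<in>(carrier_vec s :: 'a vec set). f ((q\<^sup>2) ^ (c + 1)) + (q - 1) * f ((q\<^sup>2) ^ c) + ((q\<^sup>2) ^ c - 1) * q * f ((q\<^sup>2) ^ (c - 1)))"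
  proof (rule sum.cong)
    fix y1 :: "'a vec" assume y1: "y1 \<in> carrier_vec s"
    let ?g = "\<lambda>y2. \<Sum>z\<in>fixed_field. f (card (mker (border (nf s c) (y1 @\<^sub>v y2) z)))"
    have "(\<Sum>y2\<in>carrier_vec c. ?g y2) = ?g (0\<^sub>v c) + (\<Sum>y2\<in>carrier_vec c - {0\<^sub>v c}. ?g y2)"
      by (rule sum.remove) auto
    also have "?g (0\<^sub>v c) = (\<Sum>z\<in>fixed_field. if z = hp y1 y1 then f ((q\<^sup>2) ^ (c + 1)) else f ((q\<^sup>2) ^ c))"
      by (rule sum.cong) (use card_mker_border_nf[OF y1] in auto)
    also have "\<dots> = f ((q\<^sup>2) ^ (c + 1)) + (\<Sum>z\<in>fixed_field - {hp y1 y1}. f ((q\<^sup>2) ^ c))"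
      by (subst sum.remove[OF fin hp_self_fixed[of y1]]) (auto intro!: sum.cong)
    also have "(\<Sum>z\<in>fixed_field - {hp y1 y1}. f ((q\<^sup>2) ^ c)) = (q - 1) * f ((q\<^sup>2) ^ c)"
      using hp_self_fixed[of y1] by (simp add: card_fixed_field)
    also have "(\<Sum>y2\<in>carrier_vec c - {0\<^sub>v c}. ?g y2) = (\<Sum>y2\<in>carrier_vec c - {0\<^sub>v c :: 'a vec}. q * f ((q\<^sup>2) ^ (c - 1)))"
    proof (rule sum.cong)
      fix y2 :: "'a vec" assume "y2 \<in> carrier_vec c - {0\<^sub>v c}"
      then have "?g y2 = (\<Sum>z\<in>fixed_field. f ((q\<^sup>2) ^ (c - 1)))"
        by (intro sum.cong) (use card_mker_border_nf[OF y1] in auto)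
      then show "?g y2 = q * f ((q\<^sup>2) ^ (c - 1))" by (simp add: card_fixed_field)
    qed simp
    also have "\<dots> = ((q\<^sup>2) ^ c - 1) * (q * f ((q\<^sup>2) ^ (c - 1)))"
      by (simp add: card_Diff_singleton card_carrier_vec card_UNIV)
    finally show "(\<Sum>y2\<in>carrier_vec c. ?g y2) = f ((q\<^sup>2) ^ (c + 1)) + (q - 1) * f ((q\<^sup>2) ^ c) + ((q\<^sup>2) ^ c - 1) * q * f ((q\<^sup>2) ^ (c - 1))"
      by (simp add: mult.assoc)
  qed simp
  also have "\<dots> = (q\<^sup>2) ^ s * (f ((q\<^sup>2) ^ (c + 1)) + (q - 1) * f ((q\<^sup>2) ^ c) + ((q\<^sup>2) ^ c - 1) * q * f ((q\<^sup>2) ^ (c - 1)))"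
    by (simp add: card_carrier_vec card_UNIV)
  finally show ?thesis .
qed

text \<open>Congruence by \<open>diag(g, 1)\<close> brings the given block to normal form and merely
  permutes the bordering columns through \<open>adj g\<close>, so the sum depends on
  \<open>E\<close> only through its corank.\<close>

lemma sum_one_step_extension:
  fixes f :: "nat \<Rightarrow> nat"
  assumes E: "E \<in> corank_set r c"
  shows "(\<Sum>H\<in>{H \<in> Hm (Suc r). lead r H = E}. f (card (mker H))) =
    (q\<^sup>2) ^ (r - c) * (f ((q\<^sup>2) ^ (c + 1)) + (q - 1) * f ((q\<^sup>2) ^ c) + ((q\<^sup>2) ^ c - 1) * q * f ((q\<^sup>2) ^ (c - 1)))"
proof -
  have EH: "E \<in> Hm r" using E by (simp add: corank_set_def)
  obtain g where g: "g \<in> GL r" "adj g * E * g = nf (r - c) c" using corank_set_normal_form[OF E] by blast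
  have cr: "r - c + c = r" using corank_set_normal_form[OF E] by simp
  have ag: "adj g \<in> GL r" using g by simp
  note d = GL_D[OF g(1)] Hm_D[OF EH]
  let ?g = "four_block_mat g (0\<^sub>m r 1) (0\<^sub>m 1 r) (1\<^sub>m 1)"
  have gG: "?g \<in> GL (r + 1)" by (subst four_block_GL_upper) (use d g one_GL in auto)
  have key: "card (mker (border (nf (r - c) c) (adj g *\<^sub>v y) z)) = card (mker (border E y z))"
    if y: "y \<in> carrier_vec r" and z: "z \<in> fixed_field" for y z
  proof -
    have "adj ?g * border E y z * ?g = border (nf (r - c) c) (adj g *\<^sub>v y) z"
      unfolding border_def g(2)[symmetric] cmat_mult[OF trans[OF adj_dim(2) trans[OF d(2) carrier_vecD[OF y, symmetric]]]]
      using d carrier_vecD[OF y]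
      by (simp add: adj_four_block mult_four_block_dim left_mult_one_mat_dim right_mult_one_mat_dim
        zero_mat_dim adj_mult)
    then show ?thesis using card_mker_congruence[of "border E y z" "r + 1" ?g] gG border_Hm[OF y z EH] by simp
  qed
  have "(\<Sum>H\<in>{H \<in> Hm (Suc r). lead r H = E}. f (card (mker H))) =
    (\<Sum>x\<in>carrier_vec r \<times> fixed_field. f (card (mker (case x of (y, z) \<Rightarrow> border E y z))))"
    by (rule sum.reindex_bij_betw[symmetric, OF border_bij[OF EH]])
  also have "\<dots> = (\<Sum>(y, z)\<in>carrier_vec r \<times> fixed_field. f (card (mker (border (nf (r - c) c) (adj g *\<^sub>v y) z))))"
    by (rule sum.cong) (auto simp: key)
  also have "\<dots> = (\<Sum>y\<in>carrier_vec r. \<Sum>z\<in>fixed_field. f (card (mker (border (nf (r - c) c) (adj g *\<^sub>v y) z))))"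
    by (rule sum.cartesian_product[symmetric])
  also have "\<dots> = (\<Sum>y\<in>carrier_vec r. \<Sum>z\<in>fixed_field. f (card (mker (border (nf (r - c) c) y z))))"
  proof (rule sum.reindex_bij_betw)
    show "bij_betw (\<lambda>y. adj g *\<^sub>v y) (carrier_vec r) (carrier_vec r)"
    proof (rule bij_betw_byWitness[where f' = "\<lambda>y. minv (adj g) *\<^sub>v y"])
      show "\<forall>y\<in>carrier_vec r. minv (adj g) *\<^sub>v (adj g *\<^sub>v y) = y" "\<forall>y\<in>carrier_vec r. adj g *\<^sub>v (minv (adj g) *\<^sub>v y) = y"
        using GL_cancel(3,4)[OF ag] carrier_vecD by blast+
    qed (use GL_D(1)[OF ag] minv_carrier[OF ag] in auto)
  qed
  also have "\<dots> = (\<Sum>(y, z)\<in>carrier_vec r \<times> fixed_field. f (card (mker (border (nf (r - c) c) y z))))"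
    by (rule sum.cartesian_product)
  finally show ?thesis using sum_border_nf[of f "r - c" c] unfolding cr by simp
qed

text \<open>The number of invertible Hermitian matrices of size \<open>r + k\<close> with a given leading \<open>r \<times> r\<close> block of corank \<open>c\<close>:
  bordering by one row and column changes the corank by at most one.\<close>

fun ext_count :: "nat \<Rightarrow> nat \<Rightarrow> nat \<Rightarrow> nat" where
  "ext_count 0 r c = (if c = 0 then 1 else 0)"
| "ext_count (Suc k) r c = (q\<^sup>2) ^ (r - c) * (ext_count k (Suc r) (Suc c) + (q - 1) * ext_count k (Suc r) c +
     ((q\<^sup>2) ^ c - 1) * q * ext_count k (Suc r) (c - 1))"

lemma corank_exists: "E \<in> Hm n \<Longrightarrow> \<exists>c. E \<in> corank_set n c"
proof -
  assume E: "E \<in> Hm n"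
  obtain g s c where g: "g \<in> GL n" "adj g * E * g = nf s c" using normal_form[OF E] by blast
  then have "card (mker E) = (q\<^sup>2) ^ c" using card_mker_congruence[OF E g(1)] card_mker_nf by simp
  then show ?thesis using E by (auto simp: corank_set_def)
qed

lemma corank_set_0: "corank_set n 0 = {E \<in> Hm n. E \<in> GL n}"
proof -
  have "card (mker E) = 1 \<longleftrightarrow> E \<in> GL n" if E: "E \<in> Hm n" for E
  proof
    assume "card (mker E) = 1"
    then obtain w where w: "mker E = {w}" by (rule card_1_singletonE)
    have "0\<^sub>v n \<in> mker E" using Hm_D[OF E] by (simp add: mker_def)
    then have m: "mker E = {0\<^sub>v n}" using w by simp
    have "v = 0\<^sub>v n" if "v \<in> carrier_vec n" "E *\<^sub>v v = 0\<^sub>v n" for v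
    proof -
      have "v \<in> mker E" using that Hm_D[OF E] by (simp add: mker_def)
      then show ?thesis using m by simp
    qed
    then show "E \<in> GL n" using GL_iff_kernel[OF Hm_D(4)[OF E]] by blast
  next
    assume G: "E \<in> GL n"
    have "v = 0\<^sub>v n" if "v \<in> mker E" for v
      using that GL_mult_vec_zero_iff[OF G, of v] Hm_D[OF E] by (auto simp: mker_def)
    moreover have "0\<^sub>v n \<in> mker E" using Hm_D[OF E] by (simp add: mker_def)
    ultimately have "mker E = {0\<^sub>v n}" by blast
    then show "card (mker E) = 1" by simp
  qed
  then show ?thesis by (auto simp: corank_set_def)
qed

text \<open>The extensions are sorted by their leading block of size \<open>r + 1\<close>, to which
  the induction hypothesis applies; the sum over these blocks is
  \<open>sum_one_step_extension\<close>.\<close>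

lemma card_extensions:
  "E \<in> corank_set r c \<Longrightarrow> card {H \<in> Hm (r + k). H \<in> GL (r + k) \<and> lead r H = E} = ext_count k r c"
proof (induction k arbitrary: r c E)
  case 0
  have EH: "E \<in> Hm r" using 0 by (simp add: corank_set_def)
  have "E \<in> GL r \<longleftrightarrow> E \<in> corank_set r 0" using EH corank_set_0[of r] by blast
  also have "\<dots> \<longleftrightarrow> (q\<^sup>2) ^ c = (q\<^sup>2) ^ 0" using 0 unfolding corank_set_def by simp
  also have "\<dots> \<longleftrightarrow> c = 0" by (rule Q_power_inject)
  finally have "E \<in> GL r \<longleftrightarrow> c = 0" .
  moreover have "{H \<in> Hm (r + 0). H \<in> GL (r + 0) \<and> lead r H = E} = (if E \<in> GL r then {E} else {})"
    using EH lead_self[OF Hm_D(4)] by auto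
  ultimately show ?case by simp
next
  case (Suc k)
  let ?A = "{H \<in> Hm (r + Suc k). H \<in> GL (r + Suc k) \<and> lead r H = E}"
  let ?B = "{E' \<in> Hm (Suc r). lead r E' = E}"
  \<comment> \<open>\<open>sum_one_step_extension\<close> sums a function of the kernel size, so the
    corank is decoded from the corresponding power of \<open>q\<^sup>2\<close>.\<close>
  define f where "f \<kappa> = ext_count k (Suc r) (THE c'. \<kappa> = (q\<^sup>2) ^ c')" for \<kappa>
  have f: "f ((q\<^sup>2) ^ c') = ext_count k (Suc r) c'" for c'
  proof -
    have "(THE c''. (q\<^sup>2) ^ c' = (q\<^sup>2) ^ c'') = c'" by (rule the_equality) simp_all
    then show ?thesis by (simp add: f_def)
  qed
  have leadH: "lead (Suc r) H \<in> Hm (Suc r)" if "H \<in> Hm (r + Suc k)" for H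
  proof -
    note dH = Hm_D[OF that]
    have "adj (lead (Suc r) H) = lead (Suc r) H"
    proof (rule eq_matI)
      fix i j assume "i < dim_row (lead (Suc r) H)" "j < dim_col (lead (Suc r) H)"
      then show "adj (lead (Suc r) H) $$ (i, j) = lead (Suc r) H $$ (i, j)"
        using adj_index[of i H j] dH by simp
    qed simp_all
    moreover have "lead (Suc r) H \<in> carrier_mat (Suc r) (Suc r)" by (rule carrier_matI) simp_all
    ultimately show ?thesis by (simp add: Hm_def)
  qed
  have "card ?A = (\<Sum>E'\<in>?B. card {H \<in> ?A. lead (Suc r) H = E'})"
  proof -
    have "(\<Sum>E'\<in>?B. \<Sum>H\<in>{H \<in> ?A. lead (Suc r) H = E'}. 1::nat) = (\<Sum>H\<in>?A. 1)"
      by (rule sum.group) (use leadH in \<open>auto simp: lead_lead\<close>)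
    then show ?thesis by (simp only: card_eq_sum)
  qed
  also have "\<dots> = (\<Sum>E'\<in>?B. f (card (mker E')))"
  proof (rule sum.cong)
    fix E' assume E': "E' \<in> ?B"
    then obtain c' where c': "E' \<in> corank_set (Suc r) c'" using corank_exists by blast
    have "{H \<in> ?A. lead (Suc r) H = E'} = {H \<in> Hm (Suc r + k). H \<in> GL (Suc r + k) \<and> lead (Suc r) H = E'}"
      using E' by (auto simp: lead_lead)
    then have "card {H \<in> ?A. lead (Suc r) H = E'} = ext_count k (Suc r) c'" using Suc.IH[OF c'] by simp
    also have "\<dots> = f (card (mker E'))" using c' f by (simp add: corank_set_def)
    finally show "card {H \<in> ?A. lead (Suc r) H = E'} = f (card (mker E'))" .
  qed simp
  also have "\<dots> = ext_count (Suc k) r c"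
    unfolding sum_one_step_extension[OF Suc.prems] f by simp
  finally show ?case .
qed

end

subsection \<open>Nilpotent Hermitian matrices\<close>

text \<open>The dimension of the kernel of \<open>T\<^sup>i\<close> is \<open>\<lambda>'\<^sub>1 + \<dots> + \<lambda>'\<^sub>i\<close> exactly if the part of \<open>T\<close> for the eigenvalue
  \<open>0\<close> has Jordan type \<open>\<lambda>\<close>.\<close>

definition mtype :: "'a::{field,finite} mat \<Rightarrow> nat multiset \<Rightarrow> bool" where
  "mtype T l \<longleftrightarrow> (\<forall>i. card (mker (T ^\<^sub>m i)) = CARD('a) ^ (\<Sum>t=1..i. conj_part l t))"

lemma pow_mat_Suc_left: "A \<in> carrier_mat n n \<Longrightarrow> A ^\<^sub>m Suc i = A * A ^\<^sub>m i" for A :: "'a::semiring_1 mat"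
proof (induction i)
  case (Suc i)
  have "A ^\<^sub>m Suc (Suc i) = (A * A ^\<^sub>m i) * A" using Suc by simp
  also have "\<dots> = A * (A ^\<^sub>m i * A)" by (rule assoc_mult_mat_dim) (use Suc.prems in auto)
  finally show ?case by simp
qed simp

lemma pow_mat_conj:
  assumes "p \<in> GL n" "T \<in> carrier_mat n n"
  shows "(minv p * T * p) ^\<^sub>m i = minv p * T ^\<^sub>m i * p"
proof (induction i)
  case 0
  then show ?case using GL_D[OF assms(1)] minv_dim[OF assms(1)] minv_left[OF assms(1)] assms(2)
    by (simp add: right_mult_one_mat_dim)
next
  case (Suc i)
  note d = GL_D[OF assms(1)] minv_dim[OF assms(1)] carrier_matD[OF assms(2)]
  have "(minv p * T * p) ^\<^sub>m Suc i = minv p * T ^\<^sub>m i * p * (minv p * T * p)" using Suc by simp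
  also have "\<dots> = minv p * (T ^\<^sub>m i * (p * (minv p * (T * p))))" using d assms(2) by (simp add: assoc_mult_mat_dim)
  also have "\<dots> = minv p * T ^\<^sub>m Suc i * p" using d assms(2) by (simp add: GL_cancel[OF assms(1)] assoc_mult_mat_dim)
  finally show ?case .
qed

lemma mtype_conj:
  assumes "p \<in> GL n" "T \<in> carrier_mat n n"
  shows "mtype (minv p * T * p) l \<longleftrightarrow> mtype T l"
  unfolding mtype_def pow_mat_conj[OF assms]
  by (subst card_mker_mult[OF minv_GL[OF assms(1)] assms(1) pow_carrier_mat[OF assms(2)]]) simp

lemma conj_part_Suc_0: "l \<in> partitions \<Longrightarrow> conj_part l (Suc 0) = size l"
  using conj_part_add_col(1)[of "del_col l" "size l"] size_del_col[of l] add_col_del_col[of l] del_col_partitions[of l] by simp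

lemma mtype_card_mker: "mtype T l \<Longrightarrow> l \<in> partitions \<Longrightarrow> T \<in> carrier_mat n n \<Longrightarrow> card (mker T) = CARD('a) ^ size l"
  for T :: "'a::{field,finite} mat"
  unfolding mtype_def by (drule spec[of _ 1]) (simp add: conj_part_Suc_0 left_mult_one_mat_dim)

lemma card_mker_one: "card (mker (1\<^sub>m n :: 'a::{field,finite} mat)) = 1"
proof -
  have "mker (1\<^sub>m n :: 'a mat) = {0\<^sub>v n}" by (auto simp: mker_def)
  then show ?thesis by simp
qed

text \<open>Power \<open>i + 1\<close> of the block matrix sends \<open>(x, y)\<close> to
  \<open>(E w, L w)\<close> with \<open>w = E ^ i x\<close>. As \<open>E\<close> and
  \<open>L\<close> have no common kernel, this vanishes exactly for \<open>w = 0\<close>, with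
  \<open>y\<close> free: the kernel is that of \<open>E ^ i\<close> with \<open>k\<close> dimensions
  added, as when a column of length \<open>k\<close> is put in front.\<close>

lemma mker_pow_first_column_zero:
  fixes E :: "'a::{field,finite} mat"
  assumes E: "E \<in> carrier_mat r r" and L: "L \<in> carrier_mat k r"
    and inj: "\<And>w. w \<in> carrier_vec r \<Longrightarrow> E *\<^sub>v w = 0\<^sub>v r \<Longrightarrow> L *\<^sub>v w = 0\<^sub>v k \<Longrightarrow> w = 0\<^sub>v r"
  shows "card (mker (four_block_mat E (0\<^sub>m r k) L (0\<^sub>m k k) ^\<^sub>m Suc i)) = CARD('a) ^ k * card (mker (E ^\<^sub>m i))"
proof -
  note d = carrier_matD[OF E] carrier_matD[OF L]
  have pow: "four_block_mat E (0\<^sub>m r k) L (0\<^sub>m k k) ^\<^sub>m Suc i = four_block_mat (E ^\<^sub>m Suc i) (0\<^sub>m r k) (L * E ^\<^sub>m i) (0\<^sub>m k k)" for i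
  proof (induction i)
    case 0
    show ?case using d by (simp add: left_mult_one_mat_dim right_mult_one_mat_dim)
  next
    case (Suc i)
    have "four_block_mat E (0\<^sub>m r k) L (0\<^sub>m k k) ^\<^sub>m Suc (Suc i) =
      four_block_mat (E ^\<^sub>m Suc i) (0\<^sub>m r k) (L * E ^\<^sub>m i) (0\<^sub>m k k) * four_block_mat E (0\<^sub>m r k) L (0\<^sub>m k k)"
      unfolding Suc[symmetric] by simp
    also have "\<dots> = four_block_mat (E ^\<^sub>m Suc i * E) (0\<^sub>m r k) (L * E ^\<^sub>m i * E) (0\<^sub>m k k)"
      using d by (subst mult_four_block_dim) (simp_all add: zero_mat_dim)
    also have "L * E ^\<^sub>m i * E = L * E ^\<^sub>m Suc i" using d by (simp add: assoc_mult_mat_dim)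
    finally show ?case by simp
  qed
  let ?M = "four_block_mat E (0\<^sub>m r k) L (0\<^sub>m k k) ^\<^sub>m Suc i"
  have dM: "dim_row ?M = r + k" "dim_col ?M = r + k" using d by (simp_all add: pow)
  have mul: "?M *\<^sub>v (x @\<^sub>v y) = (E *\<^sub>v (E ^\<^sub>m i *\<^sub>v x)) @\<^sub>v (L *\<^sub>v (E ^\<^sub>m i *\<^sub>v x))"
    if "x \<in> carrier_vec r" "y \<in> carrier_vec k" for x y
  proof -
    have z: "0\<^sub>m r k *\<^sub>v y = 0\<^sub>v r" "0\<^sub>m k k *\<^sub>v y = 0\<^sub>v k" using that by (auto intro!: eq_vecI)
    have dx: "dim_vec x = r" using that by simp
    have "?M *\<^sub>v (x @\<^sub>v y) = (E ^\<^sub>m Suc i *\<^sub>v x + 0\<^sub>v r) @\<^sub>v (L * E ^\<^sub>m i *\<^sub>v x + 0\<^sub>v k)"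
      unfolding pow z[symmetric] by (rule four_block_mult_vec_dim) (use d that in simp_all)
    also have "E ^\<^sub>m Suc i *\<^sub>v x + 0\<^sub>v r = E *\<^sub>v (E ^\<^sub>m i *\<^sub>v x)"
      unfolding pow_mat_Suc_left[OF E] using d dx by (simp add: assoc_mult_mat_vec_dim) (rule eq_vecI, auto)
    also have "L * E ^\<^sub>m i *\<^sub>v x + 0\<^sub>v k = L *\<^sub>v (E ^\<^sub>m i *\<^sub>v x)"
      using d dx by (simp add: assoc_mult_mat_vec_dim) (rule eq_vecI, auto)
    finally show ?thesis .
  qed
  have ker: "x @\<^sub>v y \<in> mker ?M \<longleftrightarrow> x \<in> mker (E ^\<^sub>m i)" if xy: "x \<in> carrier_vec r" "y \<in> carrier_vec k" for x y
  proof -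
    let ?w = "E ^\<^sub>m i *\<^sub>v x"
    have w: "?w \<in> carrier_vec r" by (rule mult_mat_vec_carrier[OF pow_carrier_mat[OF E] xy(1)])
    have "x @\<^sub>v y \<in> mker ?M \<longleftrightarrow> (E *\<^sub>v ?w) @\<^sub>v (L *\<^sub>v ?w) = 0\<^sub>v r @\<^sub>v 0\<^sub>v k"
    proof -
      have "0\<^sub>v r @\<^sub>v 0\<^sub>v k = (0\<^sub>v (r + k) :: 'a vec)" by (rule eq_vecI) auto
      then show ?thesis unfolding mker_def mem_Collect_eq dM mul[OF xy] using append_carrier_vec[OF xy] by simp
    qed
    also have "\<dots> \<longleftrightarrow> E *\<^sub>v ?w = 0\<^sub>v r \<and> L *\<^sub>v ?w = 0\<^sub>v k"
      by (rule append_vec_eq[of _ r]) (use mult_mat_vec_carrier[OF E w] in auto)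
    also have "\<dots> \<longleftrightarrow> ?w = 0\<^sub>v r" using inj[OF w] d by auto
    also have "\<dots> \<longleftrightarrow> x \<in> mker (E ^\<^sub>m i)" unfolding mker_def using xy d by simp
    finally show ?thesis .
  qed
  have "bij_betw (\<lambda>(x, y). x @\<^sub>v y) (mker (E ^\<^sub>m i) \<times> carrier_vec k) (mker ?M)"
  proof (rule bij_betw_subset[OF append_vec_bij[of r k]])
    have sub: "mker (E ^\<^sub>m i) \<subseteq> carrier_vec r" using d by (auto simp: mker_def)
    then show "mker (E ^\<^sub>m i) \<times> carrier_vec k \<subseteq> carrier_vec r \<times> carrier_vec k" by auto
    show "(\<lambda>(x, y). x @\<^sub>v y) ` (mker (E ^\<^sub>m i) \<times> carrier_vec k) = mker ?M"
    proof (intro equalityI subsetI)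
      fix v assume "v \<in> mker ?M"
      then have v: "v \<in> mker ?M" "v \<in> carrier_vec (r + k)" unfolding mker_def mem_Collect_eq dM by blast+
      obtain x y where xy: "x \<in> carrier_vec r" "y \<in> carrier_vec k" "v = x @\<^sub>v y" using v(2) by (rule append_vec_carrier_split)
      then show "v \<in> (\<lambda>(x, y). x @\<^sub>v y) ` (mker (E ^\<^sub>m i) \<times> carrier_vec k)"
        using ker[OF xy(1,2)] v(1) by (intro image_eqI[of _ _ "(x, y)"]) auto
    next
      fix v assume "v \<in> (\<lambda>(x, y). x @\<^sub>v y) ` (mker (E ^\<^sub>m i) \<times> carrier_vec k)"
      then obtain x y where "v = x @\<^sub>v y" "x \<in> mker (E ^\<^sub>m i)" "y \<in> carrier_vec k" by auto
      then show "v \<in> mker ?M" using ker[of x y] sub by blast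
    qed
  qed
  from bij_betw_same_card[OF this, symmetric] show ?thesis
    unfolding card_cartesian_product card_carrier_vec by (rule trans[OF _ mult.commute])
qed

context hermitian_field
begin

text \<open>Multiplication by \<open>nf r k\<close> keeps the first \<open>r\<close> columns of
  \<open>G\<close> and sets the others to zero. The kept columns are independent because
  \<open>G\<close> is invertible, so \<open>mker_pow_first_column_zero\<close> applies with the
  leading block as \<open>E\<close>.\<close>

lemma mtype_mult_nf:
  assumes G: "G \<in> Hm (r + k)" "G \<in> GL (r + k)" and m: "m \<in> partitions" "size m \<le> k"
  shows "mtype (G * nf r k) (add_col k m) \<longleftrightarrow> mtype (lead r G) m"
proof -
  obtain E L Z where A: "E \<in> Hm r" "L \<in> carrier_mat r k" "Z \<in> Hm k" "G = four_block_mat E L (adj L) Z"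
    by (rule Hm_split[OF G(1)])
  note d = Hm_D[OF A(1)] Hm_D[OF A(3)] carrier_matD[OF A(2)]
  have Gn: "G * nf r k = four_block_mat E (0\<^sub>m r k) (adj L) (0\<^sub>m k k)"
    unfolding A(4) nf_def by (subst mult_four_block_dim) (simp_all add: d right_mult_one_mat_dim mult_zero_mat_dim add_zero_mat_dim)
  have lead: "lead r G = E" unfolding A(4) by (rule lead_four_block[OF d(4)])
  have inj: "w = 0\<^sub>v r" if w: "w \<in> carrier_vec r" "E *\<^sub>v w = 0\<^sub>v r" "adj L *\<^sub>v w = 0\<^sub>v k" for w
  proof -
    have z: "L *\<^sub>v 0\<^sub>v k = 0\<^sub>v r" "Z *\<^sub>v 0\<^sub>v k = 0\<^sub>v k" using d by simp_all
    have "G *\<^sub>v (w @\<^sub>v 0\<^sub>v k) = (E *\<^sub>v w + L *\<^sub>v 0\<^sub>v k) @\<^sub>v (adj L *\<^sub>v w + Z *\<^sub>v 0\<^sub>v k)"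
      unfolding A(4) by (rule four_block_mult_vec_dim) (use d w in simp_all)
    also have "\<dots> = 0\<^sub>v (r + k)" unfolding w z by (rule eq_vecI) auto
    finally have "w @\<^sub>v 0\<^sub>v k = 0\<^sub>v (r + k)" using GL_mult_vec_zero_iff[OF G(2), of "w @\<^sub>v 0\<^sub>v k"] w by simp
    then have "w @\<^sub>v 0\<^sub>v k = 0\<^sub>v r @\<^sub>v 0\<^sub>v k" by (simp add: append_zero_vec)
    then show ?thesis by (subst (asm) append_vec_eq[of _ r]) (use w in auto)
  qed
  have cardS: "card (mker ((G * nf r k) ^\<^sub>m Suc i)) = CARD('a) ^ k * card (mker (E ^\<^sub>m i))" for i
    unfolding Gn by (rule mker_pow_first_column_zero[OF d(4) _ inj]) (use A in auto)
  have card0: "card (mker ((G * nf r k) ^\<^sub>m 0)) = 1" by (simp add: card_mker_one)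
  have sumS: "(\<Sum>t=1..Suc i. conj_part (add_col k m) t) = k + (\<Sum>t=1..i. conj_part m t)" for i
    unfolding One_nat_def sum.atLeast1_atMost_eq sum.lessThan_Suc_shift by (simp add: conj_part_add_col[OF m])
  have "mtype (G * nf r k) (add_col k m) \<longleftrightarrow> (\<forall>i. card (mker ((G * nf r k) ^\<^sub>m Suc i)) = CARD('a) ^ (\<Sum>t=1..Suc i. conj_part (add_col k m) t))"
    unfolding mtype_def
  proof (intro iffI allI)
    fix i assume *: "\<forall>i. card (mker ((G * nf r k) ^\<^sub>m Suc i)) = CARD('a) ^ (\<Sum>t=1..Suc i. conj_part (add_col k m) t)"
    show "card (mker ((G * nf r k) ^\<^sub>m i)) = CARD('a) ^ (\<Sum>t=1..i. conj_part (add_col k m) t)"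
      using card0 *[rule_format, of "i - 1"] by (cases i) simp_all
  qed blast
  also have "\<dots> \<longleftrightarrow> (\<forall>i. card (mker (E ^\<^sub>m i)) = CARD('a) ^ (\<Sum>t=1..i. conj_part m t))"
    unfolding cardS sumS power_add using q_ge_2 by (simp add: card_UNIV)
  finally show ?thesis unfolding lead mtype_def[of E] .
qed

definition nilp :: "nat multiset \<Rightarrow> 'a mat set" where
  "nilp l = {E \<in> Hm (\<Sum>\<^sub># l). mtype E l}"

lemma congruence_bij:
  assumes p: "p \<in> GL n"
  shows "bij_betw (\<lambda>D. adj p * D * p) (Hm n) (Hm n)"
proof (rule bij_betw_byWitness[where f' = "\<lambda>D. adj (minv p) * D * minv p"])
  note d = GL_D[OF p] minv_dim[OF p]
  have pp: "adj (minv p) * adj p = 1\<^sub>m n" "adj p * adj (minv p) = 1\<^sub>m n"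
    using d minv_left[OF p] minv_right[OF p] by (simp_all flip: adj_mult)
  have e: "adj (minv p) * (adj p * D * p) * minv p = D" "adj p * (adj (minv p) * D * minv p) * p = D" if "D \<in> Hm n" for D
  proof -
    note dD = Hm_D[OF that]
    have "adj (minv p) * (adj p * D * p) * minv p = (adj (minv p) * adj p) * D * (p * minv p)"
      by (simp add: d dD assoc_mult_mat_dim)
    then show "adj (minv p) * (adj p * D * p) * minv p = D"
      unfolding pp minv_right[OF p] by (simp add: dD left_mult_one_mat_dim right_mult_one_mat_dim)
    have "adj p * (adj (minv p) * D * minv p) * p = (adj p * adj (minv p)) * D * (minv p * p)"
      by (simp add: d dD assoc_mult_mat_dim)
    then show "adj p * (adj (minv p) * D * minv p) * p = D"
      unfolding pp minv_left[OF p] by (simp add: dD left_mult_one_mat_dim right_mult_one_mat_dim)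
  qed
  then show "\<forall>D\<in>Hm n. adj (minv p) * (adj p * D * p) * minv p = D" "\<forall>D\<in>Hm n. adj p * (adj (minv p) * D * minv p) * p = D"
    by blast+
  show "(\<lambda>D. adj p * D * p) ` Hm n \<subseteq> Hm n" "(\<lambda>D. adj (minv p) * D * minv p) ` Hm n \<subseteq> Hm n"
    using Hm_congruence p minv_carrier[OF p] d by blast+
qed

lemma congruence_bij_restrict:
  assumes p: "p \<in> GL n" and PR: "\<And>D. D \<in> Hm n \<Longrightarrow> P D \<longleftrightarrow> R (adj p * D * p)"
  shows "card {D \<in> Hm n. P D} = card {D \<in> Hm n. R D}"
proof (rule bij_betw_same_card, rule bij_betw_subset[OF congruence_bij[OF p]])
  show "(\<lambda>D. adj p * D * p) ` {D \<in> Hm n. P D} = {D \<in> Hm n. R D}"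
  proof (intro equalityI subsetI)
    fix D assume "D \<in> {D \<in> Hm n. R D}"
    then have D: "D \<in> Hm n" "R D" by auto
    from D(1) have "D \<in> (\<lambda>D. adj p * D * p) ` Hm n" using congruence_bij[OF p] by (simp add: bij_betw_def)
    then show "D \<in> (\<lambda>D. adj p * D * p) ` {D \<in> Hm n. P D}" using D PR by auto
  next
    fix D assume "D \<in> (\<lambda>D. adj p * D * p) ` {D \<in> Hm n. P D}"
    then show "D \<in> {D \<in> Hm n. R D}" using PR Hm_congruence[OF _ GL_D(1)[OF p]] by auto
  qed
qed auto

text \<open>Double counting of the pairs of an invertible Hermitian \<open>G\<close> and a Hermitian \<open>D\<close> such that \<open>G D\<close> has the given
  type: \<open>G\<close> is congruent to \<open>1\<close>, and \<open>D\<close> to \<open>diag(1, 0)\<close>, for which the type is that of the leading block of \<open>G\<close> with a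
  column added.\<close>

lemma card_nilp_recursion:
  assumes m: "m \<in> partitions" "size m \<le> k"
  defines "r \<equiv> \<Sum>\<^sub># m" and "n \<equiv> \<Sum>\<^sub># m + k"
  shows "card (corank_set n 0) * card (nilp (add_col k m)) =
    card (corank_set n k) * (card (nilp m) * ext_count k r (size m))"
proof -
  let ?l = "add_col k m"
  let ?N = "corank_set n 0"
  have N: "?N = {G \<in> Hm n. G \<in> GL n}" by (rule corank_set_0)
  have l: "?l \<in> partitions" "size ?l = k" "\<Sum>\<^sub># ?l = n" using m by (simp_all add: add_col_partitions size_add_col sum_add_col n_def)
  have nr: "n = r + k" by (simp add: n_def r_def)
  let ?P = "\<lambda>G D. mtype (G * D) ?l"
  \<comment> \<open>\<open>G\<close> is congruent to 1, hence of the form \<open>p * adj p\<close>;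
    conjugating \<open>G * D\<close> by \<open>p\<close> then gives the Hermitian matrix
    \<open>adj p * D * p\<close>.\<close>
  have byG: "card {D \<in> Hm n. ?P G D} = card (nilp ?l)" if G: "G \<in> ?N" for G
  proof -
    obtain g where g: "g \<in> GL n" "adj g * G * g = nf n 0" using corank_set_normal_form[OF G] by auto
    have nf1: "nf n 0 = 1\<^sub>m n" by (rule eq_matI) (auto simp: nf_def)
    have GH: "G \<in> Hm n" using G N by simp
    define p where "p = minv (adj g)"
    have ag: "adj g \<in> GL n" using g by simp
    have p: "p \<in> GL n" unfolding p_def by (rule minv_GL[OF ag])
    have ap: "adj p = minv g" unfolding p_def minv_adj[OF g(1)] by simp
    note d = GL_D[OF g(1)] Hm_D[OF GH] GL_D[OF p] minv_dim[OF g(1)] minv_dim[OF p]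
    have "p * adj p = p * (adj g * G * g) * minv g" unfolding g(2) nf1 ap by (simp add: d right_mult_one_mat_dim)
    also have "\<dots> = p * (adj g * (G * (g * minv g)))" by (simp add: d assoc_mult_mat_dim)
    also have "\<dots> = G" unfolding minv_right[OF g(1)] p_def using GL_cancel(2)[OF ag] d by (simp add: right_mult_one_mat_dim)
    finally have Gp: "p * adj p = G" .
    have "card {D \<in> Hm n. ?P G D} = card {D \<in> Hm n. mtype D ?l}"
    proof (rule congruence_bij_restrict[OF p])
      fix D assume D: "D \<in> Hm n"
      note dD = Hm_D[OF D]
      have "minv p * (G * D) * p = adj p * D * p"
        unfolding Gp[symmetric] by (simp add: d dD assoc_mult_mat_dim GL_cancel[OF p])
      moreover have "G * D \<in> carrier_mat n n" by (rule mult_carrier_mat[OF Hm_D(4)[OF GH] dD(4)])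
      ultimately show "?P G D \<longleftrightarrow> mtype (adj p * D * p) ?l"
        using mtype_conj[OF p, of "G * D" ?l] by simp
    qed
    then show ?thesis by (simp add: nilp_def l)
  qed
  \<comment> \<open>Now \<open>D\<close> is brought to normal form. Its congruence is compensated by
    one of \<open>G\<close>, so that the product is only conjugated.\<close>
  have byD: "card {G \<in> ?N. ?P G D} = card {G \<in> ?N. ?P G (nf r k)}" if D: "D \<in> corank_set n k" for D
  proof -
    obtain g where g: "g \<in> GL n" "adj g * D * g = nf r k" using corank_set_normal_form[OF D] nr by auto
    have DH: "D \<in> Hm n" using D by (simp add: corank_set_def)
    define p where "p = adj (minv g)"
    have p: "p \<in> GL n" unfolding p_def using minv_GL[OF g(1)] by simp
    have ap: "adj p = minv g" by (simp add: p_def)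
    note d = GL_D[OF g(1)] Hm_D[OF DH] GL_D[OF p] minv_dim[OF g(1)]
    have pg: "p * adj g = 1\<^sub>m n" unfolding p_def using minv_right[OF g(1)] d by (simp flip: adj_mult)
    have "card {G \<in> Hm n. G \<in> GL n \<and> ?P G D} = card {G \<in> Hm n. G \<in> GL n \<and> ?P G (nf r k)}"
    proof (rule congruence_bij_restrict[OF p])
      fix G assume G: "G \<in> Hm n"
      note dG = Hm_D[OF G]
      have "adj p * G * p \<in> GL n \<longleftrightarrow> G \<in> GL n"
        using p d dG by (auto simp: GL_def det_mult[of _ n] det_adj[of _ n])
      moreover have "(adj p * G * p) * nf r k = minv g * (G * D) * g"
      proof -
        have "(adj p * G * p) * nf r k = adj p * (G * (p * adj g * (D * g)))"
          unfolding g(2)[symmetric] by (simp add: d dG assoc_mult_mat_dim)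
        then show ?thesis unfolding pg ap by (simp add: d dG assoc_mult_mat_dim left_mult_one_mat_dim)
      qed
      ultimately show "(G \<in> GL n \<and> ?P G D) \<longleftrightarrow> (adj p * G * p \<in> GL n \<and> ?P (adj p * G * p) (nf r k))"
        using mtype_conj[OF g(1) mult_carrier_mat[OF dG(4) Hm_D(4)[OF DH]], of ?l] by simp
    qed
    then show ?thesis unfolding N by (simp add: conj_assoc)
  qed
  \<comment> \<open>The type prescribes the kernel size of \<open>G * D\<close>, which is that of
    \<open>D\<close>; so only \<open>D\<close> of corank \<open>k\<close> occur.\<close>
  have corank: "D \<in> corank_set n k" if "G \<in> ?N" "D \<in> Hm n" "?P G D" for G D
  proof -
    have G: "G \<in> Hm n" "G \<in> GL n" using that N by auto
    have c: "G * D \<in> carrier_mat n n" using Hm_D[OF G(1)] Hm_D[OF that(2)] by auto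
    have "card (mker (G * D)) = (q\<^sup>2) ^ k" using mtype_card_mker[OF that(3) l(1) c] l(2) by (simp add: card_UNIV)
    moreover have "card (mker (G * D * 1\<^sub>m n)) = card (mker D)"
      by (rule card_mker_mult[OF G(2) one_GL]) (use Hm_D[OF that(2)] in simp)
    moreover have "G * D * 1\<^sub>m n = G * D" by (rule right_mult_one_mat[OF c])
    ultimately show ?thesis using that(2) by (simp add: corank_set_def)
  qed
  have "card ?N * card (nilp ?l) = (\<Sum>G\<in>?N. card {D \<in> Hm n. ?P G D})" by (simp add: byG)
  also have "\<dots> = (\<Sum>G\<in>?N. card {D \<in> corank_set n k. ?P G D})"
    by (rule sum.cong[OF refl], rule arg_cong[of _ _ card]) (use corank in \<open>auto simp: corank_set_def\<close>)
  also have "\<dots> = (\<Sum>D\<in>corank_set n k. card {G \<in> ?N. ?P G D})"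
    by (rule sum_multicount_gen) (auto simp: corank_set_def)
  also have "\<dots> = card (corank_set n k) * card {G \<in> ?N. ?P G (nf r k)}" by (simp add: byD)
  also have "card {G \<in> ?N. ?P G (nf r k)} = card {G \<in> Hm n. G \<in> GL n \<and> mtype (lead r G) m}"
  proof (rule arg_cong[of _ _ card])
    show "{G \<in> ?N. ?P G (nf r k)} = {G \<in> Hm n. G \<in> GL n \<and> mtype (lead r G) m}"
      unfolding N using mtype_mult_nf[of _ r k m] m nr by auto
  qed
  \<comment> \<open>The pairs are sorted by the leading block, which runs through the nilpotent
    Hermitian matrices of type \<open>m\<close>; all of them have corank
    \<open>size m\<close>.\<close>
  also have "\<dots> = (\<Sum>E\<in>nilp m. card {G \<in> {G \<in> Hm n. G \<in> GL n \<and> mtype (lead r G) m}. lead r G = E})"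
  proof -
    have "(\<Sum>E\<in>nilp m. \<Sum>G\<in>{G \<in> {G \<in> Hm n. G \<in> GL n \<and> mtype (lead r G) m}. lead r G = E}. 1::nat) =
      (\<Sum>G\<in>{G \<in> Hm n. G \<in> GL n \<and> mtype (lead r G) m}. 1)"
    proof (rule sum.group)
      show "finite (nilp m)" by (simp add: nilp_def)
      show "lead r ` {G \<in> Hm n. G \<in> GL n \<and> mtype (lead r G) m} \<subseteq> nilp m"
      proof (rule image_subsetI)
        fix G assume G: "G \<in> {G \<in> Hm n. G \<in> GL n \<and> mtype (lead r G) m}"
        then have "G \<in> Hm (r + k)" using nr by simp
        from Hm_split[OF this] obtain X Y Z where "X \<in> Hm r" "G = four_block_mat X Y (adj Y) Z" by metis
        then have "lead r G \<in> Hm r" using lead_four_block[OF Hm_D(4)] by simp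
        then show "lead r G \<in> nilp m" using G by (simp add: nilp_def r_def)
      qed
    qed simp
    then show ?thesis by (simp only: card_eq_sum)
  qed
  also have "\<dots> = (\<Sum>E\<in>nilp m. ext_count k r (size m))"
  proof (rule sum.cong[OF refl])
    fix E assume "E \<in> nilp m"
    then have E: "E \<in> Hm r" "mtype E m" by (auto simp: nilp_def r_def)
    then have "E \<in> corank_set r (size m)"
      using mtype_card_mker[OF E(2) m(1) Hm_D(4)[OF E(1)]] by (simp add: corank_set_def card_UNIV)
    from card_extensions[OF this, of k]
    have "card {H \<in> Hm n. H \<in> GL n \<and> lead r H = E} = ext_count k r (size m)" unfolding nr .
    moreover have "{G \<in> {G \<in> Hm n. G \<in> GL n \<and> mtype (lead r G) m}. lead r G = E} = {H \<in> Hm n. H \<in> GL n \<and> lead r H = E}"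
      using E by auto
    ultimately show "card {G \<in> {G \<in> Hm n. G \<in> GL n \<and> mtype (lead r G) m}. lead r G = E} = ext_count k r (size m)" by simp
  qed
  finally show ?thesis by simp
qed

lemma q_series: "q_series q"
  by unfold_locales (rule q_ge_2)

text \<open>The factor \<open>Q ^ ((r - c) * k)\<close> accounts for free border entries along the
  nondegenerate part of the given block; the remaining factor depends only on \<open>k\<close> and
  \<open>c\<close>, and its recursion is \<open>ext_count_identity\<close>.\<close>

lemma ext_count_closed_form:
  fixes Q :: real and x :: real
  defines "Q \<equiv> (real q)\<^sup>2" and "x \<equiv> - 1 / real q"
  assumes "c \<le> r"
  shows "real (ext_count k r c) = Q ^ ((r - c) * k) * (real q ^ (k\<^sup>2) * (\<Prod>i<c. Q ^ k - Q ^ i) * (\<Prod>i=1..k-c. 1 + x ^ i))"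
  using assms(3)
proof (induction k arbitrary: r c)
  case 0
  show ?case
  proof (cases c)
    case (Suc b)
    have "(\<Prod>i<c. Q ^ 0 - Q ^ i) = 0" by (rule prod_zero) (use Suc in \<open>auto intro!: bexI[of _ 0]\<close>)
    then show ?thesis using Suc by simp
  qed simp
next
  case (Suc k)
  let ?P = "\<lambda>c k. \<Prod>i<c. Q ^ k - Q ^ i" and ?S = "\<lambda>m. \<Prod>i=1..m. 1 + x ^ i"
  let ?q = "real q ^ (k\<^sup>2)"
  define d where "d = r - c"
  have Q1: "1 \<le> Q ^ c" using q_ge_2 by (simp add: Q_def)
  have e1: "real (ext_count k (Suc r) (Suc c)) = Q ^ (d * k) * (?q * (?P (c + 1) k * ?S (k - (c + 1))))"
    using Suc.IH[of "Suc c" "Suc r"] Suc.prems by (simp add: d_def mult.assoc del: prod.lessThan_Suc)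
  have e2: "real (ext_count k (Suc r) c) = Q ^ (d * k) * (?q * (Q ^ k * ?P c k * ?S (k - c)))"
    using Suc.IH[of c "Suc r"] Suc.prems by (simp add: d_def Suc_diff_le power_add mult_ac)
  \<comment> \<open>The factor \<open>Q ^ c - 1\<close> stays attached because it makes the equation
    true at \<open>c = 0\<close>, where \<open>c - 1\<close> is truncated.\<close>
  have e3: "(Q ^ c - 1) * real (ext_count k (Suc r) (c - 1)) = Q ^ (d * k) * (?q * ((Q ^ c - 1) * Q ^ (2 * k) * ?P (c - 1) k * ?S (k - (c - 1))))"
  proof (cases c)
    case (Suc b)
    then have "Suc r - b = Suc (Suc d)" using Suc.prems \<open>c \<le> r\<close> by (simp add: d_def)
    moreover have q2: "Q ^ (2 * k) = Q ^ k * Q ^ k" by (simp add: mult_2 power_add)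
    ultimately show ?thesis unfolding q2 using Suc.IH[of b "Suc r"] \<open>c \<le> r\<close> Suc by (simp add: power_add mult_ac)
  qed simp
  have pred: "real ((q\<^sup>2) ^ c - 1) = Q ^ c - 1" "real (q - 1) = real q - 1"
    using q_ge_2 by (simp_all add: Q_def of_nat_diff)
  have "real (ext_count (Suc k) r c) = Q ^ d * (real (ext_count k (Suc r) (Suc c)) + (real q - 1) * real (ext_count k (Suc r) c) +
      real q * ((Q ^ c - 1) * real (ext_count k (Suc r) (c - 1))))"
    unfolding ext_count.simps of_nat_mult of_nat_add pred by (simp add: Q_def d_def mult_ac)
  also have "\<dots> = Q ^ d * Q ^ (d * k) * (?q * (?P (c + 1) k * ?S (k - (c + 1)) + (real q - 1) * Q ^ k * ?P c k * ?S (k - c)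
      + (Q ^ c - 1) * real q * Q ^ (2 * k) * ?P (c - 1) k * ?S (k - (c - 1))))"
    unfolding e1 e2 e3 by (simp add: distrib_left mult_ac del: prod.lessThan_Suc)
  also have "Q ^ d * Q ^ (d * k) = Q ^ (d * Suc k)" by (simp add: power_add)
  also have "?q * (?P (c + 1) k * ?S (k - (c + 1)) + (real q - 1) * Q ^ k * ?P c k * ?S (k - c)
      + (Q ^ c - 1) * real q * Q ^ (2 * k) * ?P (c - 1) k * ?S (k - (c - 1))) =
      real q ^ ((k + 1)\<^sup>2) * ?P c (k + 1) * ?S (k + 1 - c)"
    unfolding Q_def x_def by (rule ext_count_identity[OF q_ge_2, symmetric])
  finally show ?case by (simp add: d_def del: prod.lessThan_Suc)
qed

lemma card_GL_eq: "real (card (GL k :: 'a mat set)) = (\<Prod>i<k. ((real q)\<^sup>2) ^ k - ((real q)\<^sup>2) ^ i)"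
proof (induction k)
  case 0
  have "GL 0 = {1\<^sub>m 0 :: 'a mat}" using one_GL[of 0] GL_D by (auto intro!: eq_matI)
  then show ?case by simp
next
  case (Suc k)
  let ?Q = "(real q)\<^sup>2"
  have "(\<Prod>i<Suc k. ?Q ^ Suc k - ?Q ^ i) = (?Q ^ Suc k - 1) * (\<Prod>i<k. ?Q * (?Q ^ k - ?Q ^ i))"
    by (subst prod.lessThan_Suc_shift) (simp add: algebra_simps)
  also have "\<dots> = (?Q ^ Suc k - 1) * (?Q ^ k * (\<Prod>i<k. ?Q ^ k - ?Q ^ i))" by (simp add: prod.distrib)
  also have "\<dots> = real (card (GL (Suc k) :: 'a mat set))"
  proof -
    have "real ((q\<^sup>2) ^ Suc k - 1) = ?Q ^ Suc k - 1" using q_ge_2 by (simp add: of_nat_diff del: power_Suc)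
    then show ?thesis unfolding card_GL_Suc card_UNIV of_nat_mult Suc[symmetric] by simp
  qed
  finally show ?case by simp
qed

lemma card_GL_pos: "0 < card (GL n :: 'a mat set)"
  using one_GL[of n] by (auto simp: card_gt_0_iff)

lemma card_UG_pos: "0 < card (UG n)"
proof -
  have "1\<^sub>m n \<in> UG n" by (simp add: UG_def left_mult_one_mat_dim)
  then show ?thesis by (auto simp: card_gt_0_iff)
qed

text \<open>Wall's formula for centralizers in the unitary group, in its form for nilpotent Hermitian matrices.\<close>

lemma card_nilp:
  assumes "l \<in> partitions"
  shows "real (card (nilp l)) = real (card (UG (\<Sum>\<^sub># l))) / Aut_U q l"
  using assms
proof (induction "\<Sum>\<^sub># l" arbitrary: l rule: less_induct)
  case less
  interpret q_series q by (rule q_series)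
  show ?case
  proof (cases "l = {#}")
    case True
    have "nilp {#} = {1\<^sub>m 0}"
    proof (intro equalityI subsetI)
      fix E assume "E \<in> nilp {#}"
      then show "E \<in> {1\<^sub>m 0}" by (auto simp: nilp_def dest: Hm_D intro!: eq_matI)
    next
      fix E :: "'a mat" assume E: "E \<in> {1\<^sub>m 0}"
      have "mker ((1\<^sub>m 0 :: 'a mat) ^\<^sub>m i) = {0\<^sub>v 0}" for i by (auto simp: mker_def intro!: eq_vecI)
      then show "E \<in> nilp {#}" using E by (auto simp: nilp_def Hm_def mtype_def conj_part_def)
    qed
    moreover have "UG 0 = {1\<^sub>m 0}" by (auto simp: UG_def intro!: eq_matI)
    ultimately show ?thesis unfolding True by (simp add: Aut_U_empty)
  next
    case False
    define m where "m = del_col l"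
    define k where "k = size l"
    define j where "j = size m"
    define r where "r = \<Sum>\<^sub># m"
    have m: "m \<in> partitions" "size m \<le> k" "add_col k m = l"
      using size_del_col[OF less.prems] add_col_del_col[OF less.prems] unfolding m_def k_def by (auto simp: del_col_partitions)
    have n: "\<Sum>\<^sub># l = r + k" using sum_add_col[OF m(2)] m(3) by (simp add: r_def)
    have k: "k \<noteq> 0" using False by (simp add: k_def)
    have jr: "j \<le> r" unfolding j_def r_def by (rule size_le_sum_partition[OF m(1)])
    have jk: "j \<le> k" using m by (simp add: j_def)
    have IH: "real (card (nilp m)) = real (card (UG r)) / Aut_U q m"
      using less.hyps[of m] m n k by (simp add: r_def)
    let ?GL = "\<lambda>n. real (card (GL n :: 'a mat set))" and ?U = "\<lambda>n. real (card (UG n))"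
    let ?Q = "(real q)\<^sup>2" and ?ext = "real (ext_count k r j)"
    have pos: "?GL n > 0" "?U n > 0" for n using card_GL_pos card_UG_pos by simp_all
    have Q0: "?Q > 0" using q_ge_2 by simp
    \<comment> \<open>The case of corank 0: there are \<open>|GL| / |U|\<close> invertible Hermitian
      matrices. In this way the order of the unitary group enters the count without being
      computed.\<close>
    have c0: "?GL (r + k) = real (card (corank_set (r + k) 0)) * ?U (r + k)"
    proof -
      have "card (GL 0 :: 'a mat set) = 1" using card_GL_eq[of 0] by simp
      then have "card (GL (r + k) :: 'a mat set) = card (corank_set (r + k) 0) * card (UG (r + k))"
        using card_corank_set[of "r + k" 0] by simp
      then show ?thesis by (simp only: of_nat_mult)
    qed
    have ck: "?GL (r + k) = real (card (corank_set (r + k) k)) * (?U r * ?Q ^ (k * r) * ?GL k)"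
      unfolding card_corank_set[of r k] by simp
    have rec: "real (card (corank_set (r + k) 0)) * real (card (nilp l)) = real (card (corank_set (r + k) k)) * (real (card (nilp m)) * ?ext)"
      using card_nilp_recursion[OF m(1,2)] unfolding m(3) r_def[symmetric] j_def[symmetric] by (simp only: flip: of_nat_mult)
    have "?GL (r + k) * real (card (nilp l)) = ?U (r + k) * (real (card (corank_set (r + k) 0)) * real (card (nilp l)))"
      unfolding c0 by simp
    also have "\<dots> = ?U (r + k) * (real (card (corank_set (r + k) k)) * (?U r / Aut_U q m * ?ext))"
      unfolding rec IH ..
    also have "\<dots> = ?GL (r + k) * (?U (r + k) / Aut_U q m * (?ext / (?Q ^ (k * r) * ?GL k)))"
    proof -
      have gen: "u * (c * (a / A * e)) = (c * (a * p * g)) * (u / A * (e / (p * g)))" if "0 < p" "0 < g" for u c a A e p g :: real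
        using that by simp
      have "0 < ?Q ^ (k * r)" using Q0 by (rule zero_less_power)
      then show ?thesis unfolding ck by (rule gen[OF _ pos(1)])
    qed
    finally have main: "real (card (nilp l)) = ?U (r + k) / Aut_U q m * (?ext / (?Q ^ (k * r) * ?GL k))"
      by (rule mult_left_cancel[THEN iffD1, OF less_imp_neq[OF pos(1), symmetric]])
    define x where "x = - 1 / real q"
    have xx: "x = xq" by (simp add: x_def xq_def yq_def)
    let ?P = "\<lambda>c. \<Prod>i<c. ?Q ^ k - ?Q ^ i" and ?S = "\<lambda>m. \<Prod>i=1..m. 1 + x ^ i"
    \<comment> \<open>The last \<open>t\<close> factors of the order of \<open>GL k\<close>: by
      \<open>Q * x\<^sup>2 = 1\<close> they are \<open>Q ^ k * (1 + x ^ i) * (1 - x ^ i)\<close> for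
      \<open>i = 1, ..., t\<close>. With \<open>t = k - j\<close> this lets the closed form of
      \<open>ext_count\<close> cancel against that order.\<close>
    have PS: "?P k = ?P (k - t) * ?Q ^ (k * t) * (?S t * qp x t)" if "t \<le> k" for t
      using that
    proof (induction t)
      case (Suc t)
      define s where "s = k - Suc t"
      have s: "k - t = Suc s" "k = s + Suc t" using Suc.prems by (auto simp: s_def)
      have "?Q * (x * x) = 1" using q_ge_2 by (simp add: x_def power2_eq_square)
      then have "?Q ^ Suc t * (x ^ Suc t * x ^ Suc t) = 1" by (metis power_mult_distrib power_one)
      then have "?Q ^ s = ?Q ^ k * (x ^ Suc t * x ^ Suc t)" unfolding s(2) power_add by (metis mult.assoc mult.right_neutral)
      then have "?Q ^ k - ?Q ^ s = ?Q ^ k * ((1 + x ^ Suc t) * (1 - x ^ Suc t))" by (simp add: algebra_simps)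
      then have "?P (Suc s) = ?P s * (?Q ^ k * ((1 + x ^ Suc t) * (1 - x ^ Suc t)))" by simp
      moreover have "?P k = ?P (Suc s) * ?Q ^ (k * t) * (?S t * qp x t)" using Suc s(1) by simp
      moreover have "?S (Suc t) = ?S t * (1 + x ^ Suc t)" "qp x (Suc t) = qp x t * (1 - x ^ Suc t)" by (simp_all add: qp_Suc)
      moreover have "?Q ^ (k * Suc t) = ?Q ^ k * ?Q ^ (k * t)" by (simp add: power_add)
      ultimately show ?case unfolding s_def[symmetric] by (simp only: mult_ac)
    qed simp
    \<comment> \<open>The result is the reciprocal of the factor in
      \<open>Aut_U_add_col\<close>.\<close>
    have "?ext / (?Q ^ (k * r) * ?GL k) = 1 / (real q ^ (k\<^sup>2) * qp x (k - j))"
    proof -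
      have "?ext * (real q ^ (k\<^sup>2) * qp x (k - j)) = ?Q ^ ((r - j) * k) * ((real q ^ (k\<^sup>2) * real q ^ (k\<^sup>2)) * (?P j * (?S (k - j) * qp x (k - j))))"
        unfolding ext_count_closed_form[OF jr] x_def by (simp only: mult_ac)
      also have "real q ^ (k\<^sup>2) * real q ^ (k\<^sup>2) = ?Q ^ (k * j) * ?Q ^ (k * (k - j))"
      proof -
        have "?Q ^ (k * j) * ?Q ^ (k * (k - j)) = ?Q ^ (k * k)" using jk by (simp flip: power_add distrib_left)
        then show ?thesis by (simp add: power2_eq_square power_mult_distrib)
      qed
      also have "?Q ^ ((r - j) * k) * ((?Q ^ (k * j) * ?Q ^ (k * (k - j))) * (?P j * (?S (k - j) * qp x (k - j)))) =
        (?Q ^ ((r - j) * k) * ?Q ^ (k * j)) * (?P j * ?Q ^ (k * (k - j)) * (?S (k - j) * qp x (k - j)))" by (simp only: mult_ac)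
      also have "?Q ^ ((r - j) * k) * ?Q ^ (k * j) = ?Q ^ (k * r)"
        using jr by (simp add: mult.commute[of _ k] flip: power_add distrib_left)
      also have "?P j * ?Q ^ (k * (k - j)) * (?S (k - j) * qp x (k - j)) = ?GL k"
        using PS[of "k - j"] jk unfolding card_GL_eq by simp
      finally have "?ext * (real q ^ (k\<^sup>2) * qp x (k - j)) = ?Q ^ (k * r) * ?GL k" .
      moreover have "real q ^ (k\<^sup>2) * qp x (k - j) > 0" using q_ge_2 qp_ge_1[of "k - j"] unfolding xx by (intro mult_pos_pos) auto
      moreover have "?Q ^ (k * r) * ?GL k > 0" using pos[of k] Q0 by simp
      moreover have "e / g = 1 / d" if "e * d = g" "0 < d" "0 < g" for e d g :: real using that by (simp add: field_simps)
      ultimately show ?thesis by blast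
    qed
    then show ?thesis unfolding main using Aut_U_add_col[OF m(1,2), of q] m(3) n by (simp add: x_def j_def)
  qed
qed

end

subsection \<open>Modules over the polynomial ring\<close>

context
  fixes n :: nat and g :: "'a::field mat"
  assumes g: "g \<in> carrier_mat n n"
begin

lemma poly_act_carrier [simp]: "poly_act n g p v \<in> carrier_vec n"
  by (simp add: poly_act_def)

lemma poly_act_dim [simp]: "dim_vec (poly_act n g p v) = n"
  by (simp add: poly_act_def)

lemma pow_vec_carrier: "v \<in> carrier_vec n \<Longrightarrow> g ^\<^sub>m i *\<^sub>v v \<in> carrier_vec n"
  by (rule mult_mat_vec_carrier[OF pow_carrier_mat[OF g]])

text \<open>The sum in \<open>poly_act\<close> runs to the degree, which changes under addition and
  scaling; a common bound makes the sums comparable.\<close>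

lemma poly_act_bound:
  assumes "Polynomial.degree p \<le> N"
  shows "poly_act n g p v = vec n (\<lambda>j. \<Sum>i\<le>N. Polynomial.coeff p i * ((g ^\<^sub>m i *\<^sub>v v) $ j))"
  unfolding poly_act_def
  by (rule eq_vecI) (auto intro!: sum.mono_neutral_left dest: Polynomial.le_degree simp: assms)

lemma poly_act_0 [simp]: "poly_act n g 0 v = 0\<^sub>v n"
  by (rule eq_vecI) (auto simp: poly_act_def)

lemma poly_act_add: "poly_act n g (p + r) v = poly_act n g p v + poly_act n g r v"
proof -
  define N where "N = max (Polynomial.degree p) (Polynomial.degree r)"
  have "Polynomial.degree (p + r) \<le> N" "Polynomial.degree p \<le> N" "Polynomial.degree r \<le> N"
    by (auto simp: N_def intro: degree_add_le)
  note b = this[THEN poly_act_bound, of v]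
  show ?thesis unfolding b by (rule eq_vecI) (auto simp: algebra_simps sum.distrib)
qed

lemma poly_act_smult: "poly_act n g (Polynomial.smult c p) v = c \<cdot>\<^sub>v poly_act n g p v"
  unfolding poly_act_bound[OF degree_smult_le]
  by (rule eq_vecI) (auto simp: poly_act_def sum_distrib_left mult.assoc)

lemma poly_act_add_vec:
  assumes "v \<in> carrier_vec n" "w \<in> carrier_vec n"
  shows "poly_act n g p (v + w) = poly_act n g p v + poly_act n g p w"
proof (rule eq_vecI)
  fix j assume "j < dim_vec (poly_act n g p v + poly_act n g p w)"
  then have j: "j < n" by simp
  have "g ^\<^sub>m i *\<^sub>v (v + w) = g ^\<^sub>m i *\<^sub>v v + g ^\<^sub>m i *\<^sub>v w" for i
    by (rule mult_add_distrib_mat_vec[OF pow_carrier_mat[OF g] assms])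
  then have "(g ^\<^sub>m i *\<^sub>v (v + w)) $ j = (g ^\<^sub>m i *\<^sub>v v) $ j + (g ^\<^sub>m i *\<^sub>v w) $ j" for i
    using j carrier_vecD[OF pow_vec_carrier[OF assms(2)]] by simp
  then show "poly_act n g p (v + w) $ j = (poly_act n g p v + poly_act n g p w) $ j"
    using j by (simp add: poly_act_def algebra_simps sum.distrib)
qed simp

lemma poly_act_pCons:
  assumes v: "v \<in> carrier_vec n"
  shows "poly_act n g (pCons c p) v = c \<cdot>\<^sub>v v + poly_act n g p (g *\<^sub>v v)"
proof -
  have gv: "g *\<^sub>v v \<in> carrier_vec n" using g v by simp
  have pw: "g ^\<^sub>m Suc i *\<^sub>v v = g ^\<^sub>m i *\<^sub>v (g *\<^sub>v v)" for i
    using g v by (simp add: assoc_mult_mat_vec[OF pow_carrier_mat[OF g] g v])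
  have deg: "Polynomial.degree (pCons c p) \<le> Suc (Polynomial.degree p)" by (rule degree_pCons_le)
  show ?thesis
  proof (rule eq_vecI)
    fix j assume "j < dim_vec (c \<cdot>\<^sub>v v + poly_act n g p (g *\<^sub>v v))"
    then have j: "j < n" using v by simp
    have "poly_act n g (pCons c p) v $ j = (\<Sum>i\<le>Suc (Polynomial.degree p). Polynomial.coeff (pCons c p) i * ((g ^\<^sub>m i *\<^sub>v v) $ j))"
      unfolding poly_act_bound[OF deg] using j by simp
    also have "\<dots> = c * v $ j + (\<Sum>i\<le>Polynomial.degree p. Polynomial.coeff p i * ((g ^\<^sub>m i *\<^sub>v (g *\<^sub>v v)) $ j))"
      unfolding sum.atMost_Suc_shift pw using g v by simp
    finally show "poly_act n g (pCons c p) v $ j = (c \<cdot>\<^sub>v v + poly_act n g p (g *\<^sub>v v)) $ j"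
      using j v by (simp add: poly_act_def)
  qed (use v in simp)
qed

lemma poly_act_commute_g:
  "v \<in> carrier_vec n \<Longrightarrow> poly_act n g p (g *\<^sub>v v) = g *\<^sub>v poly_act n g p v"
proof (induction p arbitrary: v)
  case 0
  then show ?case using g by simp
next
  case (pCons c p)
  have gv: "g *\<^sub>v v \<in> carrier_vec n" using g pCons.prems by simp
  have "g *\<^sub>v (c \<cdot>\<^sub>v v + poly_act n g p (g *\<^sub>v v)) = g *\<^sub>v (c \<cdot>\<^sub>v v) + g *\<^sub>v poly_act n g p (g *\<^sub>v v)"
    by (rule mult_add_distrib_mat_vec[OF g]) (use pCons.prems in simp_all)
  also have "g *\<^sub>v (c \<cdot>\<^sub>v v) = c \<cdot>\<^sub>v (g *\<^sub>v v)" by (rule mult_mat_vec[OF g pCons.prems])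
  finally show ?case unfolding poly_act_pCons[OF gv] poly_act_pCons[OF pCons.prems] pCons.IH[OF gv] by simp
qed

lemma poly_act_mult:
  "v \<in> carrier_vec n \<Longrightarrow> poly_act n g (p * r) v = poly_act n g p (poly_act n g r v)"
proof (induction p arbitrary: v)
  case 0
  then show ?case by simp
next
  case (pCons c p)
  have gv: "g *\<^sub>v v \<in> carrier_vec n" using g pCons.prems by simp
  have "poly_act n g (pCons c p * r) v = poly_act n g (Polynomial.smult c r) v + poly_act n g (pCons 0 (p * r)) v"
    by (simp add: mult_pCons_left poly_act_add)
  also have "poly_act n g (pCons 0 (p * r)) v = poly_act n g (p * r) (g *\<^sub>v v)"
    unfolding poly_act_pCons[OF pCons.prems] using pCons.prems by (auto intro!: eq_vecI)
  also have "\<dots> = poly_act n g p (poly_act n g r (g *\<^sub>v v))" by (rule pCons.IH[OF gv])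
  also have "poly_act n g r (g *\<^sub>v v) = g *\<^sub>v poly_act n g r v" by (rule poly_act_commute_g[OF pCons.prems])
  finally show ?case by (simp add: poly_act_smult poly_act_pCons)
qed

lemma poly_act_1: "v \<in> carrier_vec n \<Longrightarrow> poly_act n g 1 v = v"
  using poly_act_pCons[of v 1 0] g unfolding one_pCons by (auto intro!: eq_vecI)

lemma poly_act_zero_vec [simp]: "poly_act n g p (0\<^sub>v n) = 0\<^sub>v n"
proof -
  have "poly_act n g p (0\<^sub>v n) = poly_act n g p (poly_act n g 0 (0\<^sub>v n))" by simp
  also have "\<dots> = poly_act n g (p * 0) (0\<^sub>v n)" by (rule poly_act_mult[symmetric]) simp
  finally show ?thesis by simp
qed

lemma poly_act_minus: "poly_act n g (p - r) v = poly_act n g p v - poly_act n g r v"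
proof -
  have "p - r = p + Polynomial.smult (-1) r" by simp
  then show ?thesis by (auto simp only: poly_act_add poly_act_smult intro!: eq_vecI) simp_all
qed

lemma poly_act_mod:
  assumes v: "v \<in> carrier_vec n" "poly_act n g m v = 0\<^sub>v n"
  shows "poly_act n g (p mod m) v = poly_act n g p v"
proof -
  have "poly_act n g p v = poly_act n g (p div m * m) v + poly_act n g (p mod m) v"
    by (simp flip: poly_act_add)
  also have "poly_act n g (p div m * m) v = 0\<^sub>v n" using v by (simp add: poly_act_mult)
  finally show ?thesis by (auto intro!: eq_vecI)
qed

lemma poly_act_linear_power:
  assumes v: "v \<in> carrier_vec n"
  shows "poly_act n g ([:-1, 1:] ^ i) v = (g - 1\<^sub>m n) ^\<^sub>m i *\<^sub>v v"
  using v
proof (induction i arbitrary: v)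
  case 0
  then show ?case by (simp add: poly_act_1)
next
  case (Suc i)
  have T: "g - 1\<^sub>m n \<in> carrier_mat n n" by (rule minus_carrier_mat) simp
  have gv: "g *\<^sub>v v \<in> carrier_vec n" using g Suc.prems by simp
  have 1: "poly_act n g [:-1, 1:] v = (g - 1\<^sub>m n) *\<^sub>v v"
    unfolding poly_act_pCons[OF Suc.prems] poly_act_pCons[OF gv]
    using g Suc.prems by (auto intro!: eq_vecI simp: minus_mult_distrib_mat_vec[OF g one_carrier_mat Suc.prems])
  have "poly_act n g ([:-1, 1:] ^ Suc i) v = poly_act n g ([:-1, 1:] ^ i) (poly_act n g [:-1, 1:] v)"
    unfolding power_Suc2 by (rule poly_act_mult[OF Suc.prems])
  also have "\<dots> = (g - 1\<^sub>m n) ^\<^sub>m i *\<^sub>v ((g - 1\<^sub>m n) *\<^sub>v v)" unfolding 1 by (rule Suc.IH) (use T Suc.prems in simp)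
  also have "\<dots> = (g - 1\<^sub>m n) ^\<^sub>m Suc i *\<^sub>v v"
    using assoc_mult_mat_vec[OF pow_carrier_mat[OF T, of i] T Suc.prems] by simp
  finally show ?case .
qed

text \<open>Coordinatewise, because the zero vector, and with it the empty sum, depends on the
  dimension \<open>n\<close>.\<close>

definition vsum :: "nat set \<Rightarrow> (nat \<Rightarrow> 'a vec) \<Rightarrow> 'a vec" where
  "vsum I w = vec n (\<lambda>j. \<Sum>i\<in>I. w i $ j)"

lemma vsum_carrier [simp]: "vsum I w \<in> carrier_vec n"
  by (simp add: vsum_def)

lemma vsum_cong: "(\<And>i. i \<in> I \<Longrightarrow> w i = w' i) \<Longrightarrow> vsum I w = vsum I w'"
  by (simp add: vsum_def)

lemma vsum_insert: "finite I \<Longrightarrow> i \<notin> I \<Longrightarrow> w i \<in> carrier_vec n \<Longrightarrow> vsum (insert i I) w = w i + vsum I w"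
  by (rule eq_vecI) (auto simp: vsum_def)

lemma vsum_empty [simp]: "vsum {} w = 0\<^sub>v n"
  by (rule eq_vecI) (auto simp: vsum_def)

lemma vsum_zero: "(\<And>i. i \<in> I \<Longrightarrow> w i = 0\<^sub>v n) \<Longrightarrow> vsum I w = 0\<^sub>v n"
  by (rule eq_vecI) (auto simp: vsum_def)

lemma vsum_add: "(\<And>i. i \<in> I \<Longrightarrow> w i \<in> carrier_vec n) \<Longrightarrow> (\<And>i. i \<in> I \<Longrightarrow> w' i \<in> carrier_vec n) \<Longrightarrow>
  vsum I (\<lambda>i. w i + w' i) = vsum I w + vsum I w'"
proof -
  assume w: "\<And>i. i \<in> I \<Longrightarrow> w i \<in> carrier_vec n" "\<And>i. i \<in> I \<Longrightarrow> w' i \<in> carrier_vec n"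
  have "(w i + w' i) $ j = w i $ j + w' i $ j" if "i \<in> I" "j < n" for i j
    using carrier_vecD[OF w(2)[OF that(1)]] that by simp
  then show ?thesis by (intro eq_vecI) (simp_all add: vsum_def sum.distrib)
qed

lemma poly_act_vsum:
  "finite I \<Longrightarrow> (\<And>i. i \<in> I \<Longrightarrow> w i \<in> carrier_vec n) \<Longrightarrow>
    poly_act n g p (vsum I w) = vsum I (\<lambda>i. poly_act n g p (w i))"
proof (induction I rule: finite_induct)
  case empty
  then show ?case by (simp add: vsum_zero)
next
  case (insert x F)
  then show ?case by (simp add: vsum_insert poly_act_add_vec)
qed

end

section \<open>Polynomials modulo powers of z - 1, and partitions read by rows and columns\<close>

lemma bezout_linear_power:
  fixes h :: "'a::field poly"
  assumes h: "poly h 1 \<noteq> 0"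
  shows "\<exists>s t. s * h + t * [:-1, 1:] ^ l = 1"
proof (induction l)
  case 0
  have "0 * h + 1 * [:-1, 1:] ^ 0 = 1" by simp
  then show ?case by blast
next
  case (Suc l)
  define P where "P = ([:-1, 1:] :: 'a poly)"
  obtain s t where st: "s * h + t * P ^ l = 1" using Suc unfolding P_def by blast
  have "P dvd t - [:poly t 1:]" "P dvd h - [:poly h 1:]"
    unfolding P_def by (simp_all flip: poly_eq_0_iff_dvd)
  then obtain t' h' where t': "t - [:poly t 1:] = P * t'" and h': "h - [:poly h 1:] = P * h'" by (auto elim!: dvdE)
  \<comment> \<open>Modulo \<open>P\<close> the coefficient \<open>t\<close> equals
    \<open>c * h\<close>. Substituting this turns part of \<open>t * P ^ l\<close> into a multiple
    of \<open>h\<close> and gains a power of \<open>P\<close> in the rest.\<close>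
  define c where "c = [:poly t 1 / poly h 1:]"
  have c: "c * [:poly h 1:] = [:poly t 1:]" using h by (simp add: c_def)
  have "P * t' + c * (h - P * h') = P * t' + c * [:poly h 1:]" unfolding h'[symmetric] by simp
  also have "\<dots> = t" unfolding c t'[symmetric] by simp
  finally have t: "P * t' + c * (h - P * h') = t" .
  have "(s + c * P ^ l) * h + (t' - c * h') * P ^ Suc l = s * h + (P * t' + c * (h - P * h')) * P ^ l"
    by (simp add: algebra_simps)
  also have "\<dots> = 1" unfolding t by (rule st)
  finally have "(s + c * P ^ l) * h + (t' - c * h') * [:-1, 1:] ^ Suc l = 1" unfolding P_def .
  then show ?case by blast
qed

lemma mset_parts [simp]: "mset (parts l) = l"
  by (simp add: parts_def)

lemma parts_map_key:
  "parts (mset (map k xs)) = map k (rev (sort_key k xs))"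
proof -
  have "map k (sort_key k xs) = sort (map k xs)"
    by (rule properties_for_sort[symmetric]) simp_all
  then show ?thesis unfolding parts_def sorted_list_of_multiset_mset rev_map[symmetric] by (rule arg_cong[OF sym])
qed

lemma sum_nth_parts: "(\<Sum>j<length (parts l). f (parts l ! j)) = (\<Sum>x\<in>#l. f x)"
proof -
  have "(\<Sum>j<length (parts l). f (parts l ! j)) = sum_list (map f (parts l))"
    by (simp add: sum_list_sum_nth lessThan_atLeast0)
  also have "\<dots> = (\<Sum>x\<in>#mset (parts l). f x)" by (metis mset_map sum_mset_sum_list)
  finally show ?thesis by simp
qed

text \<open>Both sides count the boxes in the first \<open>i\<close> columns of the Young diagram,
  by rows and by columns.\<close>

lemma sum_min_eq_sum_conj_part: "(\<Sum>x\<in>#l. min i x) = (\<Sum>t=1..i. conj_part l t)"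
proof (induction l)
  case empty
  then show ?case by (simp add: conj_part_eq_size)
next
  case (add x l)
  have c: "conj_part (add_mset x l) t = (if t \<le> x then 1 else 0) + conj_part l t" for t
    by (simp add: conj_part_eq_size)
  have "(\<Sum>t=1..i. if t \<le> x then 1 else 0 :: nat) = min i x"
    by (induction i) (auto simp: min_def le_Suc_eq)
  then show ?case using add by (simp add: c sum.distrib)
qed

text \<open>Consecutive differences of the sums are the conjugate parts, and differences of these
  are the multiplicities.\<close>

lemma partitions_eqI:
  assumes "l \<in> partitions" "l' \<in> partitions" and eq: "\<And>i. (\<Sum>t=1..i. conj_part l t) = (\<Sum>t=1..i. conj_part l' t)"
  shows "l = l'"
proof (rule multiset_eqI)
  fix i
  have cp: "conj_part l (Suc i) = conj_part l' (Suc i)" for i using eq[of "Suc i"] eq[of i] by simp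
  have cnt: "conj_part m i = conj_part m (Suc i) + count m i" for m i
  proof -
    have "{#j \<in># m. i \<le> j#} = {#j \<in># m. Suc i \<le> j#} + {#j \<in># m. j = i#}"
      by (rule multiset_eqI) auto
    then show ?thesis by (simp add: conj_part_eq_size filter_eq_replicate_mset)
  qed
  show "count l i = count l' i"
  proof (cases i)
    case 0
    then show ?thesis using assms by (simp add: partitions_def not_in_iff)
  next
    case (Suc k)
    then show ?thesis using cnt[of l i] cnt[of l' i] cp[of k] cp[of i] by simp
  qed
qed

lemma card_poly_degree_less: "card {f :: 'a::{field,finite} poly. f = 0 \<or> Polynomial.degree f < k} = CARD('a) ^ k"
proof -
  let ?S = "\<lambda>k. {f :: 'a poly. f = 0 \<or> Polynomial.degree f < k}"
  have "card (?S k) = CARD('a) ^ k \<and> finite (?S k)"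
  proof (induction k)
    case (Suc k)
    let ?f = "\<lambda>(a, f). pCons a f :: 'a poly"
    have "?S (Suc k) = ?f ` (UNIV \<times> ?S k)"
    proof (intro equalityI subsetI)
      fix f assume f: "f \<in> ?S (Suc k)"
      obtain a r where r: "f = pCons a r" by (rule pCons_cases)
      then show "f \<in> ?f ` (UNIV \<times> ?S k)" using f by (auto split: if_splits intro!: image_eqI[of _ _ "(a, r)"])
    qed (auto split: if_splits)
    moreover have "inj_on ?f (UNIV \<times> ?S k)" by (auto simp: inj_on_def)
    ultimately show ?case using Suc by (simp add: card_image card_cartesian_product)
  qed auto
  then show ?thesis by simp
qed

lemma degree_linear_power': "Polynomial.degree ([:-1, 1:] ^ k :: 'a::field poly) = k"
  by (simp add: degree_power_eq)

lemma mod_linear_power_iff: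
  "f mod [:-1, 1:] ^ k = f \<longleftrightarrow> f = 0 \<or> Polynomial.degree f < k" for f :: "'a::field poly"
proof
  assume "f mod [:-1, 1:] ^ k = f"
  then show "f = 0 \<or> Polynomial.degree f < k"
    using degree_mod_less[of "[:-1, 1:] ^ k" f] by (auto simp: degree_linear_power')
qed (auto intro: mod_poly_less simp: degree_linear_power')

text \<open>For \<open>i < k\<close> the elements annihilated by power \<open>i\<close> of
  \<open>z - 1\<close> are the multiples of power \<open>k - i\<close>, with a cofactor of degree
  below \<open>i\<close>.\<close>

lemma card_power_torsion:
  "card {f :: 'a::{field,finite} poly. f mod [:-1, 1:] ^ k = f \<and> ([:-1, 1:] ^ i * f) mod [:-1, 1:] ^ k = 0} = CARD('a) ^ min i k"
proof (cases "k \<le> i")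
  case True
  have "([:-1, 1:] ^ i * f) mod [:-1, 1:] ^ k = 0" for f :: "'a poly"
    using le_imp_power_dvd[OF True, of "[:-1, 1:] :: 'a poly"] by (simp add: mod_eq_0_iff_dvd)
  then show ?thesis using True card_poly_degree_less[of k, where 'a = 'a] by (simp add: mod_linear_power_iff min_def)
next
  case False
  define P where "P = ([:-1, 1:] :: 'a poly)"
  define d where "d = k - i"
  have k: "k = i + d" using False by (simp add: d_def)
  have P0: "P \<noteq> 0" by (simp add: P_def)
  have degP: "Polynomial.degree (P ^ d * h) = d + Polynomial.degree h" if "h \<noteq> 0" for h
    using that P0 degree_linear_power'[of d, where 'a = 'a] by (simp add: degree_mult_eq P_def)
  have "bij_betw (\<lambda>h. P ^ d * h) {f. f = 0 \<or> Polynomial.degree f < i} {f. f mod P ^ k = f \<and> (P ^ i * f) mod P ^ k = 0}"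
  proof (rule bij_betwI')
    fix x y :: "'a poly" show "(P ^ d * x = P ^ d * y) = (x = y)" using P0 by simp
  next
    fix h :: "'a poly" assume h: "h \<in> {f. f = 0 \<or> Polynomial.degree f < i}"
    have "P ^ k dvd P ^ i * (P ^ d * h)" unfolding k power_add mult.assoc[symmetric] by simp
    then show "P ^ d * h \<in> {f. f mod P ^ k = f \<and> (P ^ i * f) mod P ^ k = 0}"
      using h degP[of h] k unfolding P_def by (cases "h = 0") (auto simp: mod_linear_power_iff mod_eq_0_iff_dvd)
  next
    fix f :: "'a poly" assume f: "f \<in> {f. f mod P ^ k = f \<and> (P ^ i * f) mod P ^ k = 0}"
    then have "P ^ i * P ^ d dvd P ^ i * f" by (simp add: mod_eq_0_iff_dvd k power_add)
    then have "P ^ d dvd f" using P0 by (simp add: dvd_mult_cancel_left)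
    then obtain h where h: "f = P ^ d * h" by (auto elim!: dvdE)
    have "f = 0 \<or> Polynomial.degree f < k" using f unfolding P_def by (simp add: mod_linear_power_iff)
    then have "h = 0 \<or> Polynomial.degree h < i" using degP[of h] k P0 h by (cases "h = 0") auto
    then show "\<exists>x\<in>{f. f = 0 \<or> Polynomial.degree f < i}. f = P ^ d * x" using h by blast
  qed
  from bij_betw_same_card[OF this] show ?thesis using False by (simp add: card_poly_degree_less P_def min_def)
qed

section \<open>Decomposition of the primary component into cyclic modules\<close>

context
  fixes n :: nat and g :: "'a::{field,finite} mat"
  assumes g: "g \<in> carrier_mat n n"
begin

abbreviation (input) "PP \<equiv> [:-1, 1:] :: 'a poly"
abbreviation (input) "W \<equiv> primary_component n PP g"
abbreviation (input) "act \<equiv> poly_act n g"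
abbreviation (input) "vs \<equiv> vsum n"

lemma W_carrier: "v \<in> W \<Longrightarrow> v \<in> carrier_vec n"
  by (simp add: primary_component_def)

lemma finite_W: "finite W"
  by (rule finite_subset[OF _ finite_carrier_vec[of n]]) (auto simp: primary_component_def)

lemma W_act: "v \<in> W \<Longrightarrow> act r v \<in> W"
proof -
  assume "v \<in> W"
  then obtain k where v: "v \<in> carrier_vec n" "act (PP ^ k) v = 0\<^sub>v n" by (auto simp: primary_component_def)
  have "act (PP ^ k) (act r v) = act (r * PP ^ k) v" unfolding mult.commute[of r] by (rule poly_act_mult[OF g v(1), symmetric])
  also have "\<dots> = 0\<^sub>v n" unfolding poly_act_mult[OF g v(1)] v(2) by (rule poly_act_zero_vec[OF g])
  finally show ?thesis using poly_act_carrier[OF g] by (auto simp: primary_component_def)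
qed

lemma act_power_mono: "v \<in> carrier_vec n \<Longrightarrow> act (PP ^ k) v = 0\<^sub>v n \<Longrightarrow> k \<le> m \<Longrightarrow> act (PP ^ m) v = 0\<^sub>v n"
  using poly_act_mult[OF g, of v "PP ^ (m - k)" "PP ^ k"] poly_act_zero_vec[OF g] by (simp flip: power_add)

lemma W_add: "v \<in> W \<Longrightarrow> w \<in> W \<Longrightarrow> v + w \<in> W"
proof -
  assume "v \<in> W" "w \<in> W"
  then obtain k l where v: "v \<in> carrier_vec n" "act (PP ^ k) v = 0\<^sub>v n" and w: "w \<in> carrier_vec n" "act (PP ^ l) w = 0\<^sub>v n"
    by (auto simp: primary_component_def)
  have "act (PP ^ (k + l)) (v + w) = 0\<^sub>v n"
    unfolding poly_act_add_vec[OF g v(1) w(1)] using act_power_mono[OF v, of "k + l"] act_power_mono[OF w, of "k + l"] by simp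
  then show ?thesis using v w by (auto simp: primary_component_def)
qed

lemma W_zero: "0\<^sub>v n \<in> W"
  using poly_act_zero_vec[OF g] by (auto simp: primary_component_def)

lemma W_vsum: "finite I \<Longrightarrow> (\<And>i. i \<in> I \<Longrightarrow> w i \<in> W) \<Longrightarrow> vs I w \<in> W"
proof (induction I rule: finite_induct)
  case empty
  then show ?case using W_zero by (simp add: vsum_empty[OF g])
next
  case (insert x F)
  then show ?case by (simp add: vsum_insert[OF g] W_carrier W_add)
qed

lemma W_bounded: "\<exists>N. \<forall>v\<in>W. act (PP ^ N) v = 0\<^sub>v n"
proof -
  have "\<forall>v\<in>W. \<exists>k. act (PP ^ k) v = 0\<^sub>v n" by (auto simp: primary_component_def)
  then obtain k where k: "\<And>v. v \<in> W \<Longrightarrow> act (PP ^ k v) v = 0\<^sub>v n" by metis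
  have "act (PP ^ Max (k ` W)) v = 0\<^sub>v n" if "v \<in> W" for v
    by (rule act_power_mono[OF W_carrier[OF that] k[OF that]]) (use that finite_W in auto)
  then show ?thesis by blast
qed

text \<open>The exponents need not be exact, and generators may be redundant or zero. The exchange
  argument can therefore keep their number \<open>M\<close> fixed and lower only the
  exponents.\<close>

definition gens :: "nat \<Rightarrow> (nat \<Rightarrow> 'a vec) \<Rightarrow> (nat \<Rightarrow> nat) \<Rightarrow> bool" where
  "gens M v lam \<longleftrightarrow> (\<forall>i<M. v i \<in> W \<and> act (PP ^ lam i) (v i) = 0\<^sub>v n) \<and>
     (\<forall>w\<in>W. \<exists>f. w = vs {..<M} (\<lambda>i. act (f i) (v i)))"

definition indep :: "nat \<Rightarrow> (nat \<Rightarrow> 'a vec) \<Rightarrow> (nat \<Rightarrow> nat) \<Rightarrow> bool" where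
  "indep M v lam \<longleftrightarrow> (\<forall>f. vs {..<M} (\<lambda>i. act (f i) (v i)) = 0\<^sub>v n \<longrightarrow> (\<forall>i<M. PP ^ lam i dvd f i))"

text \<open>Finiteness allows all elements of the component to be taken as generators, with one
  common exponent.\<close>

lemma ex_gens: "\<exists>M v lam. gens M v lam"
proof -
  obtain N where N: "\<And>v. v \<in> W \<Longrightarrow> act (PP ^ N) v = 0\<^sub>v n" using W_bounded by blast
  obtain v where v: "bij_betw v {..<card W} W" using ex_bij_betw_nat_finite[OF finite_W] by (auto simp: lessThan_atLeast0)
  have vW: "v i \<in> W" if "i < card W" for i using v that by (auto simp: bij_betw_def)
  have "\<exists>f. w = vs {..<card W} (\<lambda>i. act (f i) (v i))" if w: "w \<in> W" for w
  proof -
    obtain k where k: "k < card W" "v k = w"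
    proof -
      have "w \<in> v ` {..<card W}" using v w by (simp add: bij_betw_def)
      then show ?thesis using that by auto
    qed
    let ?f = "\<lambda>i. if i = k then 1 else 0 :: 'a poly"
    have "vs {..<card W} (\<lambda>i. act (?f i) (v i)) = vs (insert k ({..<card W} - {k})) (\<lambda>i. act (?f i) (v i))"
      using k by (simp add: insert_absorb)
    also have "\<dots> = act (?f k) (v k) + vs ({..<card W} - {k}) (\<lambda>i. act (?f i) (v i))"
      by (rule vsum_insert[OF g]) (use poly_act_carrier[OF g] in auto)
    also have "vs ({..<card W} - {k}) (\<lambda>i. act (?f i) (v i)) = 0\<^sub>v n"
      by (rule vsum_zero[OF g]) (simp add: poly_act_0[OF g])
    finally have "vs {..<card W} (\<lambda>i. act (?f i) (v i)) = w"
      using k W_carrier[OF w] by (simp add: poly_act_1[OF g])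
    then show ?thesis by metis
  qed
  then have "gens (card W) v (\<lambda>_. N)" unfolding gens_def using vW N by blast
  then show ?thesis by blast
qed

text \<open>In a relation \<open>\<Sum> f\<^sub>i v\<^sub>i = 0\<close> one can divide by the lowest power of \<open>z - 1\<close> and exchange the generator with
  a unit coefficient for the resulting combination, which is annihilated by a smaller power. Hence generators
  whose total order is minimal are independent.\<close>

lemma gens_exchange:
  assumes G: "gens M v lam" and f: "vs {..<M} (\<lambda>i. act (f i) (v i)) = 0\<^sub>v n" and bad: "i1 < M" "\<not> PP ^ lam i1 dvd f i1"
  shows "\<exists>v' lam'. gens M v' lam' \<and> sum lam' {..<M} < sum lam {..<M}"
proof -
  have vW: "v i \<in> W" and vl: "act (PP ^ lam i) (v i) = 0\<^sub>v n" if "i < M" for i using G that by (auto simp: gens_def)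
  have vc: "v i \<in> carrier_vec n" if "i < M" for i using W_carrier[OF vW[OF that]] .
  \<comment> \<open>The terms of the relation that are not killed by the annihilating power of their
    generator; for them the order \<open>a i\<close> of vanishing at 1 is below
    \<open>lam i\<close>.\<close>
  define J where "J = {i. i < M \<and> \<not> PP ^ lam i dvd f i}"
  define a where "a i = Polynomial.order 1 (f i)" for i
  have J: "finite J" "i1 \<in> J" using bad by (auto simp: J_def)
  have dec: "\<exists>h. f i = PP ^ a i * h \<and> poly h 1 \<noteq> 0" "a i < lam i" if "i \<in> J" for i
  proof -
    have nd: "\<not> PP ^ lam i dvd f i" using that by (simp add: J_def)
    then have "f i \<noteq> 0" by auto
    from order_decomp[OF this, of 1] show "\<exists>h. f i = PP ^ a i * h \<and> poly h 1 \<noteq> 0"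
      by (auto simp: a_def poly_eq_0_iff_dvd)
    show "a i < lam i"
    proof (rule ccontr)
      assume "\<not> a i < lam i"
      then have "PP ^ lam i dvd PP ^ a i" by (intro le_imp_power_dvd) simp
      also have "PP ^ a i dvd f i" unfolding a_def by (rule order_1)
      finally show False using nd by simp
    qed
  qed
  from dec(1) obtain h where h: "\<And>i. i \<in> J \<Longrightarrow> f i = PP ^ a i * h i" "\<And>i. i \<in> J \<Longrightarrow> poly (h i) 1 \<noteq> 0" by metis
  obtain k where k: "k \<in> J" "\<And>i. i \<in> J \<Longrightarrow> a k \<le> a i" using ex_min_if_finite[of "a ` J"] J
    by (metis (no_types, lifting) arg_min_if_finite(1) arg_min_least empty_iff)
  have kM: "k < M" using k by (simp add: J_def)
  \<comment> \<open>The relation divided by \<open>PP ^ a k\<close>, the lowest power that occurs;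
    indices outside \<open>J\<close> are dropped, since their terms are zero.\<close>
  define c where "c i = (if i \<in> J then PP ^ (a i - a k) * h i else 0)" for i
  have ck: "c k = h k" using k by (simp add: c_def)
  define w where "w = vs {..<M} (\<lambda>i. act (c i) (v i))"
  have wW: "w \<in> W" unfolding w_def by (rule W_vsum) (auto intro: W_act vW)
  have wk: "act (PP ^ a k) w = 0\<^sub>v n"
  proof -
    have "act (PP ^ a k) w = vs {..<M} (\<lambda>i. act (PP ^ a k) (act (c i) (v i)))"
      unfolding w_def by (rule poly_act_vsum[OF g]) (simp_all add: poly_act_carrier[OF g])
    also have "\<dots> = vs {..<M} (\<lambda>i. act (f i) (v i))"
    proof (rule vsum_cong[OF g])
      fix i assume "i \<in> {..<M}"
      then have i: "i < M" by simp
      have "act (PP ^ a k) (act (c i) (v i)) = act (PP ^ a k * c i) (v i)" by (rule poly_act_mult[OF g vc[OF i], symmetric])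
      also have "\<dots> = act (f i) (v i)"
      proof (cases "i \<in> J")
        case True
        have "PP ^ a k * c i = f i" using True k(2)[OF True] h(1)[OF True] by (simp add: c_def mult.assoc[symmetric] flip: power_add)
        then show ?thesis by simp
      next
        case False
        then have "PP ^ lam i dvd f i" using i by (simp add: J_def)
        then obtain r where "f i = r * PP ^ lam i" by (metis dvdE mult.commute)
        then have "act (f i) (v i) = 0\<^sub>v n" using vl[OF i] poly_act_zero_vec[OF g] by (simp add: poly_act_mult[OF g vc[OF i]])
        then show ?thesis using False by (simp add: c_def poly_act_0[OF g])
      qed
      finally show "act (PP ^ a k) (act (c i) (v i)) = act (f i) (v i)" .
    qed
    finally show ?thesis using f by simp
  qed
  \<comment> \<open>\<open>h k\<close> is invertible modulo \<open>PP ^ lam k\<close>, so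
    \<open>v k\<close> can be recovered from \<open>w\<close> and the other generators.\<close>
  obtain s t where st: "s * h k + t * PP ^ lam k = 1" using bezout_linear_power[OF h(2)[OF k(1)]] by blast
  define v' where "v' = v(k := w)"
  define lam' where "lam' = lam(k := a k)"
  have split: "vs {..<M} u = u k + vs ({..<M} - {k}) u" if "\<And>i. i < M \<Longrightarrow> u i \<in> carrier_vec n" for u :: "nat \<Rightarrow> 'a vec"
    using vsum_insert[OF g, of "{..<M} - {k}" k u] that[OF kM] kM by (simp add: insert_absorb)
  have vk: "v k = act s w - vs ({..<M} - {k}) (\<lambda>i. act (s * c i) (v i))"
  proof -
    have "v k = act (s * h k + t * PP ^ lam k) (v k)" unfolding st by (rule poly_act_1[OF g vc[OF kM], symmetric])
    also have "\<dots> = act (s * h k) (v k) + act t (act (PP ^ lam k) (v k))"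
      by (simp add: poly_act_add[OF g] poly_act_mult[OF g vc[OF kM]])
    also have "\<dots> = act (s * h k) (v k)" using vl[OF kM] poly_act_zero_vec[OF g] poly_act_carrier[OF g] by simp
    finally have 1: "v k = act (s * c k) (v k)" unfolding ck .
    have "act s w = vs {..<M} (\<lambda>i. act s (act (c i) (v i)))"
      unfolding w_def by (rule poly_act_vsum[OF g]) (simp_all add: poly_act_carrier[OF g])
    also have "\<dots> = vs {..<M} (\<lambda>i. act (s * c i) (v i))"
      by (rule vsum_cong[OF g]) (simp add: poly_act_mult[OF g vc])
    also have "\<dots> = act (s * c k) (v k) + vs ({..<M} - {k}) (\<lambda>i. act (s * c i) (v i))"
      by (rule split) (simp add: poly_act_carrier[OF g])
    finally have "act s w = v k + vs ({..<M} - {k}) (\<lambda>i. act (s * c i) (v i))" using 1 by simp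
    then show ?thesis using carrier_vecD[OF vc[OF kM]] carrier_vecD[OF vsum_carrier[OF g]] by (auto intro!: eq_vecI)
  qed
  have "gens M v' lam'" unfolding gens_def
  proof (intro conjI allI impI ballI)
    fix i assume "i < M"
    then show "v' i \<in> W" "act (PP ^ lam' i) (v' i) = 0\<^sub>v n" using vW vl wW wk by (auto simp: v'_def lam'_def)
  next
    fix x assume "x \<in> W"
    then obtain r where r: "x = vs {..<M} (\<lambda>i. act (r i) (v i))" using G by (auto simp: gens_def)
    let ?r = "\<lambda>i. if i = k then r k * s else r i - r k * (s * c i)"
    have "x = act (r k) (v k) + vs ({..<M} - {k}) (\<lambda>i. act (r i) (v i))"
      unfolding r by (rule split) (simp add: poly_act_carrier[OF g])
    also have "act (r k) (v k) = act (r k * s) w - vs ({..<M} - {k}) (\<lambda>i. act (r k * (s * c i)) (v i))"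
    proof -
      let ?u = "vs ({..<M} - {k}) (\<lambda>i. act (s * c i) (v i))"
      have "act (r k) (v k + ?u) = act (r k) (v k) + act (r k) ?u"
        by (rule poly_act_add_vec[OF g vc[OF kM] vsum_carrier[OF g]])
      moreover have "v k + ?u = act s w" unfolding vk
        using carrier_vecD[OF vsum_carrier[OF g]] carrier_vecD[OF poly_act_carrier[OF g]] by (intro eq_vecI) simp_all
      moreover have "act (r k) (act s w) = act (r k * s) w" by (rule poly_act_mult[OF g W_carrier[OF wW], symmetric])
      moreover have "act (r k) ?u = vs ({..<M} - {k}) (\<lambda>i. act (r k) (act (s * c i) (v i)))"
        by (rule poly_act_vsum[OF g]) (simp_all add: poly_act_carrier[OF g])
      moreover have "\<dots> = vs ({..<M} - {k}) (\<lambda>i. act (r k * (s * c i)) (v i))"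
        by (rule vsum_cong[OF g]) (simp add: poly_act_mult[OF g vc])
      ultimately have "act (r k * s) w = act (r k) (v k) + vs ({..<M} - {k}) (\<lambda>i. act (r k * (s * c i)) (v i))" by simp
      then show ?thesis using carrier_vecD[OF vsum_carrier[OF g]] carrier_vecD[OF poly_act_carrier[OF g]]
        by (intro eq_vecI) simp_all
    qed
    also have "act (r k * s) w - vs ({..<M} - {k}) (\<lambda>i. act (r k * (s * c i)) (v i)) + vs ({..<M} - {k}) (\<lambda>i. act (r i) (v i)) =
      act (r k * s) w + vs ({..<M} - {k}) (\<lambda>i. act (r i - r k * (s * c i)) (v i))"
      using carrier_vecD[OF poly_act_carrier[OF g]]
      by (intro eq_vecI) (simp_all add: vsum_def[OF g] poly_act_minus[OF g] sum_subtractf)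
    also have "\<dots> = act (?r k) (v' k) + vs ({..<M} - {k}) (\<lambda>i. act (?r i) (v' i))"
      by (intro arg_cong2[of _ _ _ _ "(+)"] vsum_cong[OF g]) (auto simp: v'_def)
    also have "\<dots> = vs {..<M} (\<lambda>i. act (?r i) (v' i))"
      by (rule split[symmetric]) (simp add: poly_act_carrier[OF g])
    finally show "\<exists>f. x = vs {..<M} (\<lambda>i. act (f i) (v' i))" by (intro exI[of _ ?r])
  qed
  moreover have "sum lam' {..<M} < sum lam {..<M}"
  proof -
    have "sum lam {..<M} = lam k + sum lam ({..<M} - {k})" "sum lam' {..<M} = lam' k + sum lam' ({..<M} - {k})"
      using kM by (simp_all add: sum.remove)
    moreover have "sum lam' ({..<M} - {k}) = sum lam ({..<M} - {k})" by (rule sum.cong) (auto simp: lam'_def)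
    ultimately show ?thesis using dec(2)[OF k(1)] by (simp add: lam'_def)
  qed
  ultimately show ?thesis by blast
qed

lemma ex_independent_gens: "\<exists>M v lam. gens M v lam \<and> indep M v lam"
proof -
  obtain M v0 lam0 where "gens M v0 lam0" using ex_gens by blast
  define T where "T s \<longleftrightarrow> (\<exists>v lam. gens M v lam \<and> sum lam {..<M} = s)" for s
  have "T (sum lam0 {..<M})" unfolding T_def using \<open>gens M v0 lam0\<close> by blast
  then have "T (LEAST s. T s)" by (rule LeastI)
  then obtain v lam where G: "gens M v lam" "sum lam {..<M} = (LEAST s. T s)" unfolding T_def by blast
  have "indep M v lam" unfolding indep_def
  proof (intro allI impI, rule ccontr)
    fix f i assume "vs {..<M} (\<lambda>i. act (f i) (v i)) = 0\<^sub>v n" "i < M" "\<not> PP ^ lam i dvd f i"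
    from gens_exchange[OF G(1) this] obtain v' lam' where "gens M v' lam'" "sum lam' {..<M} < (LEAST s. T s)"
      unfolding G(2) by blast
    then show False using not_less_Least[of "sum lam' {..<M}" T] unfolding T_def by blast
  qed
  then show ?thesis using G by blast
qed

text \<open>Generators with exponent 0 are zero vectors and are dropped, which leaves a partition;
  the others are listed by decreasing exponent to match \<open>parts\<close>.\<close>

lemma ex_sorted_independent_gens:
  "\<exists>l\<in>partitions. \<exists>u. (\<forall>j<length (parts l). u j \<in> W \<and> act (PP ^ (parts l ! j)) (u j) = 0\<^sub>v n) \<and>
    (\<forall>w\<in>W. \<exists>f. w = vs {..<length (parts l)} (\<lambda>j. act (f j) (u j))) \<and>
    (\<forall>f. vs {..<length (parts l)} (\<lambda>j. act (f j) (u j)) = 0\<^sub>v n \<longrightarrow> (\<forall>j<length (parts l). PP ^ (parts l ! j) dvd f j))"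
proof -
  obtain M v lam where G: "gens M v lam" and I: "indep M v lam" using ex_independent_gens by blast
  have vW: "v i \<in> W" and vl: "act (PP ^ lam i) (v i) = 0\<^sub>v n" if "i < M" for i using G that by (auto simp: gens_def)
  have vc: "v i \<in> carrier_vec n" if "i < M" for i using W_carrier[OF vW[OF that]] .
  define idx0 where "idx0 = filter (\<lambda>i. lam i > 0) [0..<M]"
  define idx where "idx = rev (sort_key lam idx0)"
  define l where "l = mset (map lam idx0)"
  have pl: "parts l = map lam idx" unfolding l_def idx_def by (rule parts_map_key)
  have dist: "distinct idx" by (simp add: idx_def idx0_def)
  have sidx: "set idx = {i. i < M \<and> lam i > 0}" by (auto simp: idx_def idx0_def)
  let ?L = "length (parts l)"
  have L: "?L = length idx" by (simp add: pl)
  have bij: "bij_betw ((!) idx) {..<?L} (set idx)" by (rule bij_betw_nth[OF dist]) (simp_all add: L)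
  have nthM: "idx ! j < M" if "j < ?L" for j using nth_mem[of j idx] sidx that L by auto
  define u where "u j = v (idx ! j)" for j
  have red: "vs {..<M} (\<lambda>i. act (f i) (v i)) = vs {..<?L} (\<lambda>j. act (f (idx ! j)) (u j))" for f
  proof (rule eq_vecI)
    fix c assume "c < dim_vec (vs {..<?L} (\<lambda>j. act (f (idx ! j)) (u j)))"
    then have c: "c < n" by (simp add: vsum_def[OF g])
    have z: "act (f i) (v i) $ c = 0" if "i < M" "i \<notin> set idx" for i
    proof -
      have "lam i = 0" using that sidx by auto
      then have "v i = 0\<^sub>v n" using vl[OF that(1)] poly_act_1[OF g vc[OF that(1)]] by simp
      then show ?thesis using poly_act_zero_vec[OF g] c by simp
    qed
    have "(\<Sum>i<M. act (f i) (v i) $ c) = (\<Sum>i\<in>set idx. act (f i) (v i) $ c)"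
      by (rule sum.mono_neutral_right) (use sidx z in auto)
    also have "\<dots> = (\<Sum>j<?L. act (f (idx ! j)) (v (idx ! j)) $ c)"
      by (rule sum.reindex_bij_betw[OF bij, symmetric])
    finally show "vs {..<M} (\<lambda>i. act (f i) (v i)) $ c = vs {..<?L} (\<lambda>j. act (f (idx ! j)) (u j)) $ c"
      using c by (simp add: vsum_def[OF g] u_def)
  qed (simp add: vsum_def[OF g])
  have "l \<in> partitions" by (auto simp: l_def partitions_def idx0_def)
  moreover have "u j \<in> W \<and> act (PP ^ (parts l ! j)) (u j) = 0\<^sub>v n" if "j < ?L" for j
    using vW[OF nthM[OF that]] vl[OF nthM[OF that]] that by (simp add: u_def pl)
  moreover have "\<exists>f. w = vs {..<?L} (\<lambda>j. act (f j) (u j))" if w: "w \<in> W" for w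
  proof -
    obtain f where "w = vs {..<M} (\<lambda>i. act (f i) (v i))" using G w by (auto simp: gens_def)
    then show ?thesis unfolding red by (rule exI[of _ "\<lambda>j. f (idx ! j)"])
  qed
  moreover have "PP ^ (parts l ! j) dvd f j" if f: "vs {..<?L} (\<lambda>j. act (f j) (u j)) = 0\<^sub>v n" and j: "j < ?L" for f j
  proof -
    \<comment> \<open>The coefficients are carried back to the original indices. What they are at
      dropped generators is immaterial, as those generators are zero.\<close>
    define fi where "fi i = f (inv_into {..<?L} ((!) idx) i)" for i
    have fi: "fi (idx ! j) = f j" if "j < ?L" for j
      using inv_into_f_f[OF bij_betw_imp_inj_on[OF bij], of j] that by (simp add: fi_def)
    have "vs {..<?L} (\<lambda>j. act (fi (idx ! j)) (u j)) = vs {..<?L} (\<lambda>j. act (f j) (u j))"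
      by (rule vsum_cong[OF g]) (simp add: fi)
    then have "vs {..<M} (\<lambda>i. act (fi i) (v i)) = 0\<^sub>v n" unfolding red f .
    then have "PP ^ lam (idx ! j) dvd fi (idx ! j)" using I nthM[OF j] unfolding indep_def by blast
    then show ?thesis using j by (simp add: fi pl)
  qed
  ultimately show ?thesis by blast
qed

text \<open>The isomorphism is built in the direction from the cyclic sum to the component, as
  \<open>f \<mapsto> \<Sum> f\<^sub>j u\<^sub>j\<close>, and then inverted: the annihilating powers
  make it compatible with remainders, independence makes it injective and generation makes it
  surjective.\<close>

lemma ex_primary_type: "\<exists>l\<in>partitions. has_primary_type n PP g l"
proof -
  obtain l u where l: "l \<in> partitions" and uW: "\<And>j. j < length (parts l) \<Longrightarrow> u j \<in> W"
    and ul: "\<And>j. j < length (parts l) \<Longrightarrow> act (PP ^ (parts l ! j)) (u j) = 0\<^sub>v n"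
    and span: "\<And>w. w \<in> W \<Longrightarrow> \<exists>f. w = vs {..<length (parts l)} (\<lambda>j. act (f j) (u j))"
    and ind: "\<And>f j. vs {..<length (parts l)} (\<lambda>j. act (f j) (u j)) = 0\<^sub>v n \<Longrightarrow> j < length (parts l) \<Longrightarrow> PP ^ (parts l ! j) dvd f j"
    using ex_sorted_independent_gens by blast
  have uc: "u j \<in> carrier_vec n" if "j < length (parts l)" for j using W_carrier[OF uW[OF that]] .
  define S where "S = cyclic_sum ([:-1, 1:] :: 'a poly) l"
  define \<Psi> where "\<Psi> f = vs {..<length (parts l)} (\<lambda>j. act (f j) (u j))" for f
  have \<Psi>_add: "\<Psi> (\<lambda>i. f i + f' i) = \<Psi> f + \<Psi> f'" for f f'
    unfolding \<Psi>_def by (simp add: poly_act_add[OF g] vsum_add[OF g] poly_act_carrier[OF g])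
  have \<Psi>_mod: "\<Psi> (\<lambda>j. if j < length (parts l) then f j mod PP ^ (parts l ! j) else 0) = \<Psi> f" for f
    unfolding \<Psi>_def by (rule vsum_cong[OF g]) (simp add: poly_act_mod[OF g uc ul])
  have \<Psi>_act: "\<Psi> (cyclic_sum_act PP l r f) = act r (\<Psi> f)" for r f
  proof -
    have "\<Psi> (cyclic_sum_act PP l r f) = \<Psi> (\<lambda>j. r * f j)"
      unfolding cyclic_sum_act_def by (rule \<Psi>_mod)
    also have "\<dots> = vs {..<length (parts l)} (\<lambda>j. act r (act (f j) (u j)))"
      unfolding \<Psi>_def by (rule vsum_cong[OF g]) (simp add: poly_act_mult[OF g uc])
    also have "\<dots> = act r (\<Psi> f)" unfolding \<Psi>_def
      by (rule poly_act_vsum[OF g, symmetric]) (simp_all add: poly_act_carrier[OF g])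
    finally show ?thesis .
  qed
  have S_mod: "(\<lambda>j. if j < length (parts l) then f j mod PP ^ (parts l ! j) else 0) \<in> S" for f
    by (simp add: S_def cyclic_sum_def)
  have S_add: "(\<lambda>i. f i + f' i) \<in> S" if "f \<in> S" "f' \<in> S" for f f'
    using that by (auto simp: S_def cyclic_sum_def poly_mod_add_left)
  have S_act: "cyclic_sum_act PP l r f \<in> S" for r f
    unfolding cyclic_sum_act_def by (rule S_mod)
  have inj: "inj_on \<Psi> S"
  proof (rule inj_onI)
    fix f f' assume f: "f \<in> S" "f' \<in> S" "\<Psi> f = \<Psi> f'"
    have "vs {..<length (parts l)} (\<lambda>j. act (f j - f' j) (u j)) = \<Psi> f - \<Psi> f'"
      unfolding \<Psi>_def
    proof (rule eq_vecI)
      fix c assume "c < dim_vec (vs {..<length (parts l)} (\<lambda>j. act (f j) (u j)) - vs {..<length (parts l)} (\<lambda>j. act (f' j) (u j)))"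
      then have c: "c < n" by (simp add: vsum_def[OF g])
      have "act (f j - f' j) (u j) $ c = act (f j) (u j) $ c - act (f' j) (u j) $ c" for j
        unfolding poly_act_minus[OF g] using c poly_act_dim[OF g] by (subst index_minus_vec) simp_all
      then show "vs {..<length (parts l)} (\<lambda>j. act (f j - f' j) (u j)) $ c =
          (vs {..<length (parts l)} (\<lambda>j. act (f j) (u j)) - vs {..<length (parts l)} (\<lambda>j. act (f' j) (u j))) $ c"
        using c by (simp add: vsum_def[OF g] sum_subtractf)
    qed (simp add: vsum_def[OF g])
    also have "\<dots> = 0\<^sub>v n" unfolding f(3) by (rule eq_vecI) (simp_all add: \<Psi>_def vsum_def[OF g])
    finally have d: "PP ^ (parts l ! j) dvd f j - f' j" if "j < length (parts l)" for j using ind[of "\<lambda>j. f j - f' j"] that by blast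
    show "f = f'"
    proof
      fix j show "f j = f' j"
      proof (cases "j < length (parts l)")
        case True
        have "f j mod PP ^ (parts l ! j) = f' j mod PP ^ (parts l ! j)" using d[OF True] by (simp add: mod_eq_dvd_iff)
        then show ?thesis using f True by (auto simp: S_def cyclic_sum_def)
      next
        case False
        then show ?thesis using f by (auto simp: S_def cyclic_sum_def)
      qed
    qed
  qed
  have im: "\<Psi> ` S = W"
  proof (intro equalityI subsetI)
    fix w assume "w \<in> \<Psi> ` S"
    then show "w \<in> W" unfolding \<Psi>_def by (auto intro!: W_vsum W_act uW)
  next
    fix w assume "w \<in> W"
    then obtain f where "w = \<Psi> f" using span unfolding \<Psi>_def by blast
    then have w: "w = \<Psi> (\<lambda>j. if j < length (parts l) then f j mod PP ^ (parts l ! j) else 0)" unfolding \<Psi>_mod .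
    show "w \<in> \<Psi> ` S" unfolding w by (rule imageI[OF S_mod])
  qed
  define \<phi> where "\<phi> = inv_into S \<Psi>"
  have \<phi>S: "\<phi> w \<in> S" and \<Psi>\<phi>: "\<Psi> (\<phi> w) = w" if "w \<in> W" for w
    using inv_into_into[of w \<Psi> S] f_inv_into_f[of w \<Psi> S] that unfolding \<phi>_def im by blast+
  have \<phi>\<Psi>: "\<phi> (\<Psi> f) = f" if "f \<in> S" for f unfolding \<phi>_def by (rule inv_into_f_f[OF inj that])
  have "bij_betw \<phi> W (cyclic_sum PP l)"
    unfolding \<phi>_def S_def[symmetric] by (rule bij_betw_inv_into) (simp add: bij_betw_def inj im)
  moreover have "\<phi> (v + w) = (\<lambda>i. \<phi> v i + \<phi> w i)" if "v \<in> W" "w \<in> W" for v w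
    using \<phi>\<Psi>[OF S_add[OF \<phi>S[OF that(1)] \<phi>S[OF that(2)]]] unfolding \<Psi>_add \<Psi>\<phi>[OF that(1)] \<Psi>\<phi>[OF that(2)] .
  moreover have "\<phi> (act r v) = cyclic_sum_act PP l r (\<phi> v)" if "v \<in> W" for r v
    using \<phi>\<Psi>[OF S_act[of r "\<phi> v"]] unfolding \<Psi>_act \<Psi>\<phi>[OF that] .
  ultimately have "has_primary_type n PP g l" unfolding has_primary_type_def by blast
  then show ?thesis using l by blast
qed

text \<open>The torsion is counted in each cyclic summand, and the exponents
  \<open>min i (parts l ! j)\<close> add up to the first \<open>i\<close> conjugate parts.\<close>

lemma card_cyclic_sum_torsion:
  "card {f \<in> cyclic_sum PP l. cyclic_sum_act PP l (PP ^ i) f = (\<lambda>_. 0)} = CARD('a) ^ (\<Sum>t=1..i. conj_part l t)"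
proof -
  let ?L = "length (parts l)"
  let ?A = "\<lambda>j. {f :: 'a poly. f mod PP ^ (parts l ! j) = f \<and> (PP ^ i * f) mod PP ^ (parts l ! j) = 0}"
  let ?K = "{f \<in> cyclic_sum PP l. cyclic_sum_act PP l (PP ^ i) f = (\<lambda>_. 0)}"
  have "bij_betw (\<lambda>f. restrict f {..<?L}) ?K (PiE {..<?L} ?A)"
  proof (rule bij_betw_byWitness[where f' = "\<lambda>f j. if j < ?L then f j else 0"])
    show "\<forall>f\<in>?K. (\<lambda>j. if j < ?L then restrict f {..<?L} j else 0) = f"
      by (auto simp: cyclic_sum_def fun_eq_iff)
    show "\<forall>f\<in>PiE {..<?L} ?A. restrict (\<lambda>j. if j < ?L then f j else 0) {..<?L} = f"
      by (intro ballI extensionalityI[where A = "{..<?L}"]) (auto simp: PiE_def)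
    show "(\<lambda>f. restrict f {..<?L}) ` ?K \<subseteq> PiE {..<?L} ?A"
      by (rule image_subsetI, rule restrict_PiE[THEN iffD2]) (auto simp: cyclic_sum_def cyclic_sum_act_def fun_eq_iff split: if_splits)
    show "(\<lambda>f j. if j < ?L then f j else 0) ` PiE {..<?L} ?A \<subseteq> ?K"
      by (rule image_subsetI) (auto simp: cyclic_sum_def cyclic_sum_act_def fun_eq_iff PiE_def Pi_def)
  qed
  from bij_betw_same_card[OF this] have "card ?K = (\<Prod>j<?L. card (?A j))" by (simp add: card_PiE)
  also have "\<dots> = (\<Prod>j<?L. CARD('a) ^ min i (parts l ! j))" by (simp only: card_power_torsion)
  also have "\<dots> = CARD('a) ^ (\<Sum>j<?L. min i (parts l ! j))" by (rule power_sum[symmetric])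
  also have "(\<Sum>j<?L. min i (parts l ! j)) = (\<Sum>t=1..i. conj_part l t)"
    unfolding sum_nth_parts by (rule sum_min_eq_sum_conj_part)
  finally show ?thesis .
qed

text \<open>An isomorphism preserves the elements annihilated by a power of \<open>z - 1\<close>,
  and on the side of \<open>g\<close> these form the kernel of that power of \<open>g - 1\<close>.
  Together with \<open>mtype_unique\<close> this shows that the description in
  \<open>primary_partition\<close> has only one solution.\<close>

lemma primary_type_imp_mtype:
  assumes "has_primary_type n PP g l"
  shows "mtype (g - 1\<^sub>m n) l"
proof -
  obtain \<phi> where bij: "bij_betw \<phi> W (cyclic_sum PP l)"
    and add: "\<And>v w. v \<in> W \<Longrightarrow> w \<in> W \<Longrightarrow> \<phi> (v + w) = (\<lambda>i. \<phi> v i + \<phi> w i)"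
    and act: "\<And>r v. v \<in> W \<Longrightarrow> \<phi> (act r v) = cyclic_sum_act PP l r (\<phi> v)"
    using assms unfolding has_primary_type_def by blast
  have T: "g - 1\<^sub>m n \<in> carrier_mat n n" by (rule minus_carrier_mat) simp
  have z: "0\<^sub>v n \<in> W" by (rule W_zero)
  have "\<phi> (0\<^sub>v n + 0\<^sub>v n) = (\<lambda>i. \<phi> (0\<^sub>v n) i + \<phi> (0\<^sub>v n) i)" by (rule add[OF z z])
  then have "\<phi> (0\<^sub>v n) i = \<phi> (0\<^sub>v n) i + \<phi> (0\<^sub>v n) i" for i by (simp only: right_zero_vec[OF zero_carrier_vec] fun_eq_iff)
  then have \<phi>0: "\<phi> (0\<^sub>v n) = (\<lambda>_. 0)" unfolding add_cancel_right_right by (rule ext)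
  have \<phi>_zero: "\<phi> w = (\<lambda>_. 0) \<longleftrightarrow> w = 0\<^sub>v n" if "w \<in> W" for w
    using bij_betw_imp_inj_on[OF bij] that z unfolding \<phi>0[symmetric] by (auto dest: inj_onD)
  have "card (mker ((g - 1\<^sub>m n) ^\<^sub>m i)) = CARD('a) ^ (\<Sum>t=1..i. conj_part l t)" for i
  proof -
    have "mker ((g - 1\<^sub>m n) ^\<^sub>m i) = {v \<in> W. act (PP ^ i) v = 0\<^sub>v n}"
    proof (intro equalityI subsetI)
      fix v assume "v \<in> mker ((g - 1\<^sub>m n) ^\<^sub>m i)"
      then have v: "v \<in> carrier_vec n" "(g - 1\<^sub>m n) ^\<^sub>m i *\<^sub>v v = 0\<^sub>v n"
        using pow_carrier_mat[OF T, of i] by (auto simp only: mker_def mem_Collect_eq dest: carrier_matD)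
      then show "v \<in> {v \<in> W. act (PP ^ i) v = 0\<^sub>v n}"
        unfolding primary_component_def poly_act_linear_power[OF g v(1), of i, symmetric] by blast
    next
      fix v assume "v \<in> {v \<in> W. act (PP ^ i) v = 0\<^sub>v n}"
      then have v: "v \<in> carrier_vec n" "act (PP ^ i) v = 0\<^sub>v n" by (auto simp: primary_component_def)
      then have "(g - 1\<^sub>m n) ^\<^sub>m i *\<^sub>v v = 0\<^sub>v n" unfolding poly_act_linear_power[OF g v(1), of i] by blast
      then show "v \<in> mker ((g - 1\<^sub>m n) ^\<^sub>m i)"
        using v(1) unfolding mker_def carrier_matD[OF pow_carrier_mat[OF T, of i]] by blast
    qed
    also have "card \<dots> = card {f \<in> cyclic_sum PP l. cyclic_sum_act PP l (PP ^ i) f = (\<lambda>_. 0)}"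
    proof (rule bij_betw_same_card, rule bij_betw_subset[OF bij])
      show "\<phi> ` {v \<in> W. act (PP ^ i) v = 0\<^sub>v n} = {f \<in> cyclic_sum PP l. cyclic_sum_act PP l (PP ^ i) f = (\<lambda>_. 0)}"
      proof (intro equalityI subsetI)
        fix f assume "f \<in> \<phi> ` {v \<in> W. act (PP ^ i) v = 0\<^sub>v n}"
        then obtain v where v: "v \<in> W" "act (PP ^ i) v = 0\<^sub>v n" "f = \<phi> v" by auto
        have "f \<in> cyclic_sum PP l" using bij v by (auto simp: bij_betw_def)
        moreover have "cyclic_sum_act PP l (PP ^ i) f = (\<lambda>_. 0)" using act[OF v(1), of "PP ^ i"] v \<phi>0 by simp
        ultimately show "f \<in> {f \<in> cyclic_sum PP l. cyclic_sum_act PP l (PP ^ i) f = (\<lambda>_. 0)}" by blast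
      next
        fix f assume "f \<in> {f \<in> cyclic_sum PP l. cyclic_sum_act PP l (PP ^ i) f = (\<lambda>_. 0)}"
        then have f: "f \<in> cyclic_sum PP l" "cyclic_sum_act PP l (PP ^ i) f = (\<lambda>_. 0)" by auto
        then obtain v where v: "v \<in> W" "f = \<phi> v" using bij by (auto simp: bij_betw_def)
        have "\<phi> (act (PP ^ i) v) = (\<lambda>_. 0)" using act[OF v(1), of "PP ^ i"] f v by simp
        then have "act (PP ^ i) v = 0\<^sub>v n" using \<phi>_zero[OF W_act[OF v(1)]] by blast
        then show "f \<in> \<phi> ` {v \<in> W. act (PP ^ i) v = 0\<^sub>v n}" using v by blast
      qed
    qed auto
    finally show ?thesis unfolding card_cyclic_sum_torsion .
  qed
  then show ?thesis unfolding mtype_def by blast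
qed

lemma CARD_field_gt_1: "1 < CARD('a)"
proof -
  have "card {0, 1 :: 'a} \<le> CARD('a)" by (rule card_mono) auto
  then show ?thesis by simp
qed

lemma mtype_unique:
  fixes T :: "'a mat"
  assumes "mtype T l" "mtype T l'" "l \<in> partitions" "l' \<in> partitions" shows "l = l'"
proof (rule partitions_eqI[OF assms(3,4)])
  fix i
  have "CARD('a) ^ (\<Sum>t=1..i. conj_part l t) = CARD('a) ^ (\<Sum>t=1..i. conj_part l' t)"
    using assms(1,2) unfolding mtype_def by metis
  then show "(\<Sum>t=1..i. conj_part l t) = (\<Sum>t=1..i. conj_part l' t)"
    by (rule power_inject_exp[OF CARD_field_gt_1, THEN iffD1])
qed

lemma primary_partition_partitions: "primary_partition n PP g \<in> partitions"
  and mtype_primary_partition: "mtype (g - 1\<^sub>m n) (primary_partition n PP g)"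
proof -
  obtain l where l: "l \<in> partitions" "has_primary_type n PP g l" using ex_primary_type by blast
  have "primary_partition n PP g = l" unfolding primary_partition_def
    by (rule the_equality) (use l mtype_unique primary_type_imp_mtype in blast)+
  then show "primary_partition n PP g \<in> partitions" "mtype (g - 1\<^sub>m n) (primary_partition n PP g)"
    using l primary_type_imp_mtype by auto
qed

lemma primary_partition_eq_iff:
  "l \<in> partitions \<Longrightarrow> primary_partition n PP g = l \<longleftrightarrow> mtype (g - 1\<^sub>m n) l"
  using primary_partition_partitions mtype_primary_partition mtype_unique by blast

end

subsection \<open>The Cayley transform\<close>

lemma mult_distrib_dim:
  fixes A :: "'a::comm_ring mat"
  shows mult_add_dim: "dim_col A = dim_row B \<Longrightarrow> dim_row C = dim_row B \<Longrightarrow> dim_col C = dim_col B \<Longrightarrow> A * (B + C) = A * B + A * C"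
    and add_mult_dim: "dim_row B = dim_row A \<Longrightarrow> dim_col B = dim_col A \<Longrightarrow> dim_row C = dim_col A \<Longrightarrow> (A + B) * C = A * C + B * C"
    and mult_minus_dim: "dim_col A = dim_row B \<Longrightarrow> dim_row C = dim_row B \<Longrightarrow> dim_col C = dim_col B \<Longrightarrow> A * (B - C) = A * B - A * C"
    and minus_mult_dim: "dim_row B = dim_row A \<Longrightarrow> dim_col B = dim_col A \<Longrightarrow> dim_row C = dim_col A \<Longrightarrow> (A - B) * C = A * C - B * C"
    and mult_smult_dim: "dim_col A = dim_row B \<Longrightarrow> A * (c \<cdot>\<^sub>m B) = c \<cdot>\<^sub>m (A * B)"
    and smult_mult_dim: "dim_col A = dim_row B \<Longrightarrow> (c \<cdot>\<^sub>m A) * B = c \<cdot>\<^sub>m (A * B)"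
  by (auto intro!: eq_matI simp: scalar_prod_def algebra_simps sum.distrib sum_subtractf sum_distrib_left)

lemma pow_mat_mult_vec_Suc: "T \<in> carrier_mat n n \<Longrightarrow> v \<in> carrier_vec n \<Longrightarrow> T ^\<^sub>m Suc i *\<^sub>v v = T *\<^sub>v (T ^\<^sub>m i *\<^sub>v v)"
  for T :: "'a::semiring_1 mat"
  unfolding pow_mat_Suc_left by (rule assoc_mult_mat_vec[OF _ pow_carrier_mat]) auto

lemma smult_mat_mult_vec: "(c \<cdot>\<^sub>m A) *\<^sub>v v = c \<cdot>\<^sub>v (A *\<^sub>v v)" if "dim_col A = dim_vec v" for A :: "'a::semiring_0 mat"
  by (rule eq_vecI) (use that in \<open>auto simp: scalar_prod_def sum_distrib_left mult.assoc\<close>)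

lemma zero_mat_mult_vec: "v \<in> carrier_vec n \<Longrightarrow> 0\<^sub>m m n *\<^sub>v v = 0\<^sub>v m" for v :: "'a::semiring_0 vec"
  by (rule eq_vecI) (auto simp: scalar_prod_def)

lemma mat_eq_zero_iff:
  fixes A :: "'a::semiring_1 mat"
  assumes "A \<in> carrier_mat m n"
  shows "A = 0\<^sub>m m n \<longleftrightarrow> (\<forall>v\<in>carrier_vec n. A *\<^sub>v v = 0\<^sub>v m)"
proof
  assume z: "\<forall>v\<in>carrier_vec n. A *\<^sub>v v = 0\<^sub>v m"
  show "A = 0\<^sub>m m n"
  proof (rule eq_matI)
    fix i j assume "i < dim_row (0\<^sub>m m n :: 'a mat)" "j < dim_col (0\<^sub>m m n :: 'a mat)"
    then have ij: "i < m" "j < n" by auto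
    have "A $$ (i, j) = (A *\<^sub>v unit_vec n j) $ i" using ij carrier_matD[OF assms] by simp
    also have "A *\<^sub>v unit_vec n j = 0\<^sub>v m" using z by (rule bspec) simp
    finally show "A $$ (i, j) = 0\<^sub>m m n $$ (i, j)" using ij by simp
  qed (use assms in auto)
qed (simp add: zero_mat_mult_vec)

lemma pow_mat_zero_add: "T \<in> carrier_mat n n \<Longrightarrow> T ^\<^sub>m e = 0\<^sub>m n n \<Longrightarrow> T ^\<^sub>m (e + i) = 0\<^sub>m n n" for T :: "'a::semiring_1 mat"
  by (induction i) simp_all

text \<open>A kernel vector satisfies \<open>v = k * T v\<close> with \<open>k = - c / b\<close>,
  hence \<open>v = k ^ e * T ^ e v = 0\<close>.\<close>

lemma linear_nilpotent_GL:
  fixes T :: "'a::field mat"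
  assumes T: "T \<in> carrier_mat n n" "T ^\<^sub>m e = 0\<^sub>m n n" and b: "b \<noteq> 0"
  shows "b \<cdot>\<^sub>m 1\<^sub>m n + c \<cdot>\<^sub>m T \<in> GL n"
proof -
  have C: "b \<cdot>\<^sub>m 1\<^sub>m n + c \<cdot>\<^sub>m T \<in> carrier_mat n n" using T by simp
  show ?thesis unfolding GL_iff_kernel[OF C]
  proof (intro ballI impI)
    fix v assume v: "v \<in> carrier_vec n" "(b \<cdot>\<^sub>m 1\<^sub>m n + c \<cdot>\<^sub>m T) *\<^sub>v v = 0\<^sub>v n"
    define k where "k = - c / b"
    have Tv: "T *\<^sub>v v \<in> carrier_vec n" using T v by simp
    have "(b \<cdot>\<^sub>m 1\<^sub>m n + c \<cdot>\<^sub>m T) *\<^sub>v v = (b \<cdot>\<^sub>m 1\<^sub>m n) *\<^sub>v v + (c \<cdot>\<^sub>m T) *\<^sub>v v"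
      by (rule add_mult_distrib_mat_vec[of _ n n]) (use T v in simp_all)
    also have "\<dots> = b \<cdot>\<^sub>v v + c \<cdot>\<^sub>v (T *\<^sub>v v)"
      using T v by (simp add: smult_mat_mult_vec)
    finally have z: "b \<cdot>\<^sub>v v + c \<cdot>\<^sub>v (T *\<^sub>v v) = 0\<^sub>v n" using v by simp
    have vk: "v = k \<cdot>\<^sub>v (T *\<^sub>v v)"
    proof (rule eq_vecI)
      fix i assume "i < dim_vec (k \<cdot>\<^sub>v (T *\<^sub>v v))"
      then have i: "i < n" using T by simp
      have "(b \<cdot>\<^sub>v v + c \<cdot>\<^sub>v (T *\<^sub>v v)) $ i = 0" unfolding z using i by simp
      then have "b * v $ i + c * (T *\<^sub>v v) $ i = 0" using i v T by simp
      then have "b * v $ i = - (c * (T *\<^sub>v v) $ i)" by (simp add: eq_neg_iff_add_eq_0)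
      then show "v $ i = (k \<cdot>\<^sub>v (T *\<^sub>v v)) $ i" using i T b by (simp add: k_def field_simps)
    qed (use T v in simp)
    have "v = k ^ i \<cdot>\<^sub>v (T ^\<^sub>m i *\<^sub>v v)" for i
    proof (induction i)
      case 0
      then show ?case using v T by simp
    next
      case (Suc i)
      have P: "T ^\<^sub>m i *\<^sub>v v \<in> carrier_vec n" by (rule mult_mat_vec_carrier[OF pow_carrier_mat[OF T(1)] v(1)])
      have "v = k \<cdot>\<^sub>v (T *\<^sub>v (k ^ i \<cdot>\<^sub>v (T ^\<^sub>m i *\<^sub>v v)))" using vk unfolding Suc[symmetric] .
      also have "\<dots> = k \<cdot>\<^sub>v (k ^ i \<cdot>\<^sub>v (T *\<^sub>v (T ^\<^sub>m i *\<^sub>v v)))" by (subst mult_mat_vec[OF T(1) P]) (rule refl)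
      also have "\<dots> = k ^ Suc i \<cdot>\<^sub>v (T ^\<^sub>m Suc i *\<^sub>v v)"
        unfolding pow_mat_mult_vec_Suc[OF T(1) v(1)] by (simp add: smult_smult_assoc)
      finally show ?case .
    qed
    from this[of e] show "v = 0\<^sub>v n" unfolding T(2) zero_mat_mult_vec[OF v(1)] by (auto intro!: eq_vecI)
  qed
qed

lemma mult_pow_commute:
  fixes A X :: "'a::semiring_1 mat"
  assumes A: "A \<in> carrier_mat n n" "X \<in> carrier_mat n n" and c: "A * X = X * A"
  shows "(A * X) ^\<^sub>m i = A ^\<^sub>m i * X ^\<^sub>m i"
proof (induction i)
  case 0
  then show ?case using A by (simp add: left_mult_one_mat_dim)
next
  case (Suc i)
  have cp: "X ^\<^sub>m i * A = A * X ^\<^sub>m i"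
  proof (induction i)
    case 0
    then show ?case using A by (simp add: left_mult_one_mat_dim right_mult_one_mat_dim)
  next
    case (Suc i)
    have "X ^\<^sub>m Suc i * A = X ^\<^sub>m i * (A * X)" unfolding c using A by (simp add: assoc_mult_mat_dim)
    also have "\<dots> = X ^\<^sub>m i * A * X" by (rule assoc_mult_mat_dim[symmetric]) (use A in auto)
    also have "\<dots> = A * X ^\<^sub>m Suc i" unfolding Suc using A by (simp add: assoc_mult_mat_dim)
    finally show ?case .
  qed
  have "(A * X) ^\<^sub>m Suc i = A ^\<^sub>m i * (X ^\<^sub>m i * A) * X"
    using Suc A by (simp add: assoc_mult_mat_dim)
  also have "\<dots> = A ^\<^sub>m Suc i * X ^\<^sub>m Suc i" unfolding cp using A by (simp add: assoc_mult_mat_dim)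
  finally show ?case .
qed

lemma GL_pow: "X \<in> GL n \<Longrightarrow> X ^\<^sub>m i \<in> GL n"
  by (induction i) (auto simp: GL_D one_GL GL_mult)

text \<open>With a commuting invertible factor the powers are \<open>A ^ i * X ^ i\<close>, whose
  kernels are as large as those of \<open>A ^ i\<close>. This is how the type survives the Cayley
  transform.\<close>

lemma mtype_mult_commute:
  assumes "A \<in> carrier_mat n n" "X \<in> GL n" "A * X = X * A"
  shows "mtype (A * X) l \<longleftrightarrow> mtype A l"
proof -
  have "card (mker ((A * X) ^\<^sub>m i)) = card (mker (A ^\<^sub>m i))" for i
  proof -
    have "(A * X) ^\<^sub>m i = 1\<^sub>m n * A ^\<^sub>m i * X ^\<^sub>m i"
      unfolding mult_pow_commute[OF assms(1) GL_D(1)[OF assms(2)] assms(3)] using assms(1) by (simp add: left_mult_one_mat_dim)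
    then show ?thesis using card_mker_mult[OF one_GL GL_pow[OF assms(2)] pow_carrier_mat[OF assms(1)]] by metis
  qed
  then show ?thesis by (simp add: mtype_def)
qed

lemma sum_conj_part_size: "\<Sum>\<^sub># l \<le> i \<Longrightarrow> (\<Sum>t=1..i. conj_part l t) = \<Sum>\<^sub># l"
proof -
  assume i: "\<Sum>\<^sub># l \<le> i"
  have "min i x = x" if "x \<in># l" for x
  proof -
    have "x \<le> \<Sum>\<^sub># l" using that by (auto dest!: multi_member_split)
    then show ?thesis using i by simp
  qed
  then have "(\<Sum>x\<in>#l. min i x) = (\<Sum>x\<in>#l. x)" by (intro arg_cong[of _ _ sum_mset] image_mset_cong)
  then show ?thesis unfolding sum_min_eq_sum_conj_part by simp
qed

lemma CARD_power_inject: "CARD('a::{field,finite}) ^ a = CARD('a) ^ b \<longleftrightarrow> a = b"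
  by (rule power_inject_exp[OF CARD_field_gt_1[OF zero_carrier_mat]])

lemma card_mker_le: "A \<in> carrier_mat m n \<Longrightarrow> card (mker A) \<le> CARD('a) ^ n" for A :: "'a::{field,finite} mat"
  unfolding card_carrier_vec[symmetric] by (rule card_mono) (auto simp: mker_def)

lemma card_mker_zero: "card (mker (0\<^sub>m m n :: 'a::{field,finite} mat)) = CARD('a) ^ n"
proof -
  have "mker (0\<^sub>m m n :: 'a mat) = carrier_vec n" by (auto simp: mker_def)
  then show ?thesis by (simp add: card_carrier_vec)
qed

text \<open>Conjugate parts beyond the size of \<open>l\<close> are zero, so at that exponent the
  kernel has already reached the size of the whole space.\<close>

lemma mtype_nilpotent:
  fixes T :: "'a::{field,finite} mat"
  assumes "mtype T l" "T \<in> carrier_mat (\<Sum>\<^sub># l) (\<Sum>\<^sub># l)"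
  shows "T ^\<^sub>m (\<Sum>\<^sub># l) = 0\<^sub>m (\<Sum>\<^sub># l) (\<Sum>\<^sub># l)"
proof -
  let ?n = "\<Sum>\<^sub># l"
  have C: "T ^\<^sub>m ?n \<in> carrier_mat ?n ?n" using assms(2) by (rule pow_carrier_mat)
  have "card (mker (T ^\<^sub>m ?n)) = card (carrier_vec ?n :: 'a vec set)"
    using assms(1) sum_conj_part_size[OF order_refl, of l] unfolding mtype_def card_carrier_vec by metis
  moreover have "mker (T ^\<^sub>m ?n) \<subseteq> carrier_vec ?n" using carrier_matD[OF C] by (auto simp: mker_def)
  ultimately have "mker (T ^\<^sub>m ?n) = carrier_vec ?n" by (intro card_subset_eq) simp_all
  then show ?thesis unfolding mat_eq_zero_iff[OF C] using carrier_matD[OF C] by (auto simp only: mker_def)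
qed

lemma mtype_size_le:
  fixes T :: "'a::{field,finite} mat"
  assumes "mtype T l" "T \<in> carrier_mat n n" shows "\<Sum>\<^sub># l \<le> n"
proof -
  have "CARD('a) ^ (\<Sum>\<^sub># l) \<le> CARD('a) ^ n"
    using card_mker_le[OF pow_carrier_mat[OF assms(2)], of "\<Sum>\<^sub># l"] assms(1) sum_conj_part_size[OF order_refl, of l]
    unfolding mtype_def by metis
  then show ?thesis by (rule power_le_imp_le_exp[OF CARD_field_gt_1[OF zero_carrier_mat]])
qed

lemma mtype_nilpotent_size:
  fixes T :: "'a::{field,finite} mat"
  assumes "mtype T l" "T \<in> carrier_mat n n" "T ^\<^sub>m e = 0\<^sub>m n n" shows "\<Sum>\<^sub># l = n"
proof -
  let ?i = "e + \<Sum>\<^sub># l"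
  have "T ^\<^sub>m ?i = 0\<^sub>m n n" by (rule pow_mat_zero_add[OF assms(2,3)])
  then have "CARD('a) ^ (\<Sum>\<^sub># l) = CARD('a) ^ n"
    using card_mker_zero[of n n, where 'a = 'a] assms(1) sum_conj_part_size[of l ?i] unfolding mtype_def by (metis le_add2)
  then show ?thesis by (simp add: CARD_power_inject)
qed

lemma minv_intertwine:
  assumes "A \<in> GL m" "B \<in> GL n" "X \<in> carrier_mat m n" "A * X = X * B"
  shows "minv A * X = X * minv B"
proof -
  note d = GL_D[OF assms(1)] GL_D[OF assms(2)] minv_dim[OF assms(1)] minv_dim[OF assms(2)] carrier_matD[OF assms(3)]
  have "minv A * (X * B) * minv B = X * minv B"
    unfolding assms(4)[symmetric] using d by (simp add: GL_cancel(2)[OF assms(1)])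
  moreover have "minv A * (X * B) * minv B = minv A * X"
    using d minv_right[OF assms(2)] by (simp add: assoc_mult_mat_dim right_mult_one_mat_dim)
  ultimately show ?thesis by simp
qed

context hermitian_field
begin

text \<open>The Cayley transform: \<open>E\<close> and \<open>g\<close> are related by \<open>g (1 + cj a E) = 1 + a E\<close>.\<close>

lemma cayley_unitary:
  assumes E: "E \<in> Hm n" "E ^\<^sub>m e = 0\<^sub>m n n" and a: "cj a \<noteq> a"
  shows "\<exists>g\<in>UG n. g * (1\<^sub>m n + cj a \<cdot>\<^sub>m E) = 1\<^sub>m n + a \<cdot>\<^sub>m E \<and> (\<forall>l. mtype (g - 1\<^sub>m n) l \<longleftrightarrow> mtype E l)"
proof -
  note dE = Hm_D[OF E(1)]
  define P where "P = 1\<^sub>m n + a \<cdot>\<^sub>m E"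
  define R where "R = 1\<^sub>m n + cj a \<cdot>\<^sub>m E"
  have one: "1 \<cdot>\<^sub>m 1\<^sub>m n = (1\<^sub>m n :: 'a mat)" by (rule eq_matI) auto
  have GL: "P \<in> GL n" "R \<in> GL n"
    using linear_nilpotent_GL[OF dE(4) E(2), of 1 a] linear_nilpotent_GL[OF dE(4) E(2), of 1 "cj a"] by (simp_all add: one P_def R_def)
  note d = dE GL_D[OF GL(1)] GL_D[OF GL(2)] minv_dim[OF GL(1)] minv_dim[OF GL(2)]
  have ER: "E * R = R * E"
    unfolding R_def using dE(4) by (simp add: mult_distrib_dim left_mult_one_mat_dim right_mult_one_mat_dim)
  have PR: "P * R = R * P"
    unfolding R_def P_def using dE(4)
    by (simp add: mult_distrib_dim left_mult_one_mat_dim right_mult_one_mat_dim, intro eq_matI, auto simp: algebra_simps)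
  have aP: "adj P = R" unfolding P_def R_def using dE by (simp add: adj_add adj_smult)
  have aR: "adj R = P" using aP by auto
  define X where "X = minv R"
  have X: "X \<in> GL n" unfolding X_def by (rule minv_GL[OF GL(2)])
  have XP: "X * P = P * X" unfolding X_def by (rule minv_intertwine[OF GL(2,2)]) (use d PR in auto)
  have XE: "X * E = E * X" unfolding X_def by (rule minv_intertwine[OF GL(2,2)]) (use d ER in auto)
  define g where "g = P * X"
  have gR: "g * R = P" unfolding g_def X_def using d minv_left[OF GL(2)] by (simp add: assoc_mult_mat_dim right_mult_one_mat_dim)
  have "adj g * g = 1\<^sub>m n"
  proof -
    have "adj g = minv P * R" unfolding g_def X_def using d minv_adj[OF GL(2)] by (simp add: adj_mult aP aR)
    then have "adj g * g = minv P * (R * (P * X))" using d by (simp add: g_def X_def assoc_mult_mat_dim)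
    also have "R * (P * X) = P" unfolding XP[symmetric] unfolding X_def using GL_cancel(1)[OF GL(2)] d by simp
    finally show ?thesis using minv_left[OF GL(1)] by simp
  qed
  then have gU: "g \<in> UG n" using GL_mult[OF GL(1) X] by (simp add: UG_def g_def GL_D)
  \<comment> \<open>\<open>g - 1 = (P - R) * X\<close> and \<open>P - R = (a - cj a) * E\<close>, so
    \<open>g - 1 = E * Y\<close>; the factor \<open>Y\<close> commutes with \<open>E\<close> and is
    invertible because \<open>cj a \<noteq> a\<close>.\<close>
  define Y where "Y = (a - cj a) \<cdot>\<^sub>m X"
  have Y: "Y \<in> GL n" unfolding Y_def using X a by (simp add: GL_def det_smult)
  have EY: "E * Y = Y * E" unfolding Y_def using XE d GL_D[OF X] dE(4)
    by (simp add: mult_distrib_dim left_mult_one_mat_dim right_mult_one_mat_dim)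
  have "g - 1\<^sub>m n = (P - R) * X"
    unfolding g_def X_def using d minv_right[OF GL(2)] minv_carrier[OF GL(2)] by (simp add: mult_distrib_dim)
  also have "P - R = (a - cj a) \<cdot>\<^sub>m E"
    unfolding P_def R_def by (rule eq_matI) (use dE in \<open>auto simp: algebra_simps\<close>)
  also have "(a - cj a) \<cdot>\<^sub>m E * X = E * Y"
    unfolding Y_def using dE(4) GL_D[OF X] by (simp add: mult_distrib_dim left_mult_one_mat_dim right_mult_one_mat_dim)
  finally have "mtype (g - 1\<^sub>m n) l \<longleftrightarrow> mtype E l" for l
    using mtype_mult_commute[OF dE(4) Y EY] by simp
  then show ?thesis using gU gR unfolding P_def R_def by blast
qed

text \<open>Solved for \<open>E\<close>, the Cayley relation reads
  \<open>(a - cj a * g) * E = g - 1\<close>, and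
  \<open>a - cj a * g = (a - cj a) - cj a * (g - 1)\<close> is invertible as a nonzero scalar plus a
  nilpotent matrix.\<close>

lemma cayley_hermitian:
  assumes g: "g \<in> UG n" "(g - 1\<^sub>m n) ^\<^sub>m e = 0\<^sub>m n n" and a: "cj a \<noteq> a"
  shows "\<exists>E\<in>Hm n. g * (1\<^sub>m n + cj a \<cdot>\<^sub>m E) = 1\<^sub>m n + a \<cdot>\<^sub>m E \<and> (\<forall>l. mtype (g - 1\<^sub>m n) l \<longleftrightarrow> mtype E l)"
proof -
  define T where "T = g - 1\<^sub>m n"
  have gc: "g \<in> carrier_mat n n" and ag: "adj g * g = 1\<^sub>m n" "g * adj g = 1\<^sub>m n"
    using g(1) UG_GL[OF g(1)] minv_UG[OF g(1)] minv_right[OF UG_GL[OF g(1)]] by (auto simp: UG_def)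
  have Tc: "T \<in> carrier_mat n n" unfolding T_def by (rule minus_carrier_mat) simp
  define S where "S = a \<cdot>\<^sub>m 1\<^sub>m n - cj a \<cdot>\<^sub>m g"
  have S': "S = (a - cj a) \<cdot>\<^sub>m 1\<^sub>m n + (- cj a) \<cdot>\<^sub>m T"
    unfolding S_def T_def by (rule eq_matI) (use gc in \<open>auto simp: algebra_simps\<close>)
  have S: "S \<in> GL n" unfolding S' by (rule linear_nilpotent_GL[OF Tc]) (use g a in \<open>auto simp: T_def\<close>)
  note d = carrier_matD[OF gc] carrier_matD[OF Tc] GL_D[OF S] minv_dim[OF S]
  define E where "E = minv S * T"
  have SE: "S * E = T" unfolding E_def using GL_cancel(1)[OF S] d by simp
  have Ec: "E \<in> carrier_mat n n" unfolding E_def by (rule mult_carrier_mat[OF minv_carrier[OF S] Tc])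
  have ST: "S * T = T * S" unfolding S' using Tc
    by (simp add: mult_distrib_dim left_mult_one_mat_dim right_mult_one_mat_dim)
  have MT: "minv S * T = T * minv S" by (rule minv_intertwine[OF S S Tc ST])
  have mt: "mtype (g - 1\<^sub>m n) l \<longleftrightarrow> mtype E l" for l
    using mtype_mult_commute[OF Tc minv_GL[OF S] MT[symmetric]] unfolding E_def MT by (simp add: T_def)
  have "g + cj a \<cdot>\<^sub>m (g * E) = 1\<^sub>m n + a \<cdot>\<^sub>m E"
  proof -
    have "a \<cdot>\<^sub>m E - cj a \<cdot>\<^sub>m (g * E) = g - 1\<^sub>m n"
      using SE gc Ec unfolding S_def T_def by (simp add: mult_distrib_dim left_mult_one_mat_dim right_mult_one_mat_dim)
    then have "(a \<cdot>\<^sub>m E - cj a \<cdot>\<^sub>m (g * E)) $$ ij = (g - 1\<^sub>m n) $$ ij" for ij by simp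
    then have *: "a * E $$ (i,j) - cj a * (g * E) $$ (i,j) = g $$ (i,j) - 1\<^sub>m n $$ (i,j)" if "i < n" "j < n" for i j
    proof -
      have "(a \<cdot>\<^sub>m E - cj a \<cdot>\<^sub>m (g * E)) $$ (i,j) = a * E $$ (i,j) - cj a * (g * E) $$ (i,j)"
        using that carrier_matD[OF Ec] carrier_matD[OF gc] by (simp del: index_mult_mat(1))
      moreover have "(g - 1\<^sub>m n) $$ (i,j) = g $$ (i,j) - 1\<^sub>m n $$ (i,j)" by (rule index_minus_mat) (use that in simp_all)
      ultimately show ?thesis using \<open>\<And>ij. (a \<cdot>\<^sub>m E - cj a \<cdot>\<^sub>m (g * E)) $$ ij = (g - 1\<^sub>m n) $$ ij\<close> by metis
    qed
    show ?thesis
    proof (rule eq_matI)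
      fix i j assume "i < dim_row (1\<^sub>m n + a \<cdot>\<^sub>m E)" "j < dim_col (1\<^sub>m n + a \<cdot>\<^sub>m E)"
      then have ij: "i < n" "j < n" using carrier_matD[OF Ec] by auto
      have "(g + cj a \<cdot>\<^sub>m (g * E)) $$ (i, j) = g $$ (i,j) + cj a * (g * E) $$ (i,j)"
        using ij carrier_matD[OF Ec] carrier_matD[OF gc] by (simp del: index_mult_mat(1))
      also have "\<dots> = 1\<^sub>m n $$ (i,j) + a * E $$ (i,j)" using *[OF ij] by (simp add: algebra_simps)
      also have "\<dots> = (1\<^sub>m n + a \<cdot>\<^sub>m E) $$ (i, j)" using ij carrier_matD[OF Ec] by simp
      finally show "(g + cj a \<cdot>\<^sub>m (g * E)) $$ (i, j) = (1\<^sub>m n + a \<cdot>\<^sub>m E) $$ (i, j)" .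
    qed (use Ec gc in auto)
  qed
  then have rel: "g * (1\<^sub>m n + cj a \<cdot>\<^sub>m E) = 1\<^sub>m n + a \<cdot>\<^sub>m E"
    using carrier_matD[OF gc] carrier_matD[OF Ec] by (simp add: mult_distrib_dim left_mult_one_mat_dim right_mult_one_mat_dim)
  have "adj E = E"
  proof -
    have aT: "adj T = adj g - 1\<^sub>m n" unfolding T_def using gc by (simp add: adj_minus)
    have aS: "adj S = cj a \<cdot>\<^sub>m 1\<^sub>m n - a \<cdot>\<^sub>m adj g" unfolding S_def using gc by (simp add: adj_minus adj_smult)
    have agc: "adj g \<in> carrier_mat n n" using gc by simp
    have 1: "adj S * adj E = adj T"
    proof -
      have "E * S = T" unfolding E_def MT using d minv_left[OF S] by (simp add: assoc_mult_mat_dim right_mult_one_mat_dim)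
      then have "adj (E * S) = adj T" by simp
      then show ?thesis using adj_mult[of E S] carrier_matD[OF Ec] d by simp
    qed
    \<comment> \<open>Here unitarity enters through \<open>g * adj g = 1\<close>: it makes
      \<open>adj E\<close> a second solution of \<open>S * E = T\<close>.\<close>
    have "S * adj T = T * adj S"
    proof -
      have "S * adj T = (a \<cdot>\<^sub>m adj g - cj a \<cdot>\<^sub>m 1\<^sub>m n) - (a \<cdot>\<^sub>m 1\<^sub>m n - cj a \<cdot>\<^sub>m g)"
        unfolding aT S_def using carrier_matD[OF gc] ag by (simp add: mult_distrib_dim left_mult_one_mat_dim right_mult_one_mat_dim)
      moreover have "T * adj S = cj a \<cdot>\<^sub>m (g - 1\<^sub>m n) - a \<cdot>\<^sub>m (1\<^sub>m n - adj g)"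
        unfolding aS T_def using carrier_matD[OF gc] ag by (simp add: mult_distrib_dim left_mult_one_mat_dim right_mult_one_mat_dim)
      moreover have "(a \<cdot>\<^sub>m adj g - cj a \<cdot>\<^sub>m 1\<^sub>m n) - (a \<cdot>\<^sub>m 1\<^sub>m n - cj a \<cdot>\<^sub>m g) = cj a \<cdot>\<^sub>m (g - 1\<^sub>m n) - a \<cdot>\<^sub>m (1\<^sub>m n - adj g)"
        by (rule eq_matI) (use carrier_matD[OF gc] in \<open>auto simp: algebra_simps\<close>)
      ultimately show ?thesis by simp
    qed
    have aSG: "adj S \<in> GL n" using S by simp
    note dd = GL_D[OF aSG] minv_dim[OF aSG]
    have SaE: "S * adj E = T"
    proof -
      have "adj S * adj T = adj T * adj S" using arg_cong[OF ST, of adj] adj_mult[of S T] adj_mult[of T S] d by simp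
      then have m2: "minv (adj S) * adj T = adj T * minv (adj S)" by (intro minv_intertwine[OF aSG aSG]) (use Tc in auto)
      have "adj E = adj T * minv (adj S)" unfolding 1[symmetric] m2[symmetric, unfolded 1[symmetric]]
        using GL_cancel(2)[OF aSG] carrier_matD[OF Ec] by simp
      then have "S * adj E = S * adj T * minv (adj S)" using d dd by (simp add: assoc_mult_mat_dim)
      also have "\<dots> = T * (adj S * minv (adj S))" unfolding \<open>S * adj T = T * adj S\<close> using d dd by (simp add: assoc_mult_mat_dim)
      also have "\<dots> = T" unfolding minv_right[OF aSG] using d by (simp add: right_mult_one_mat_dim)
      finally show ?thesis .
    qed
    have "minv S * (S * adj E) = minv S * (S * E)" unfolding SaE SE ..
    then show ?thesis using GL_cancel(2)[OF S] carrier_matD[OF Ec] by simp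
  qed
  then have "E \<in> Hm n" using Ec by (simp add: Hm_def)
  then show ?thesis using rel mt by blast
qed

lemma cayley_unique:
  assumes a: "cj a \<noteq> a" and g: "g \<in> carrier_mat n n" "(g - 1\<^sub>m n) ^\<^sub>m e = 0\<^sub>m n n"
    and E: "E \<in> carrier_mat n n" "g * (1\<^sub>m n + cj a \<cdot>\<^sub>m E) = 1\<^sub>m n + a \<cdot>\<^sub>m E"
    and E': "E' \<in> carrier_mat n n" "g * (1\<^sub>m n + cj a \<cdot>\<^sub>m E') = 1\<^sub>m n + a \<cdot>\<^sub>m E'"
  shows "E = E'"
proof -
  define S where "S = a \<cdot>\<^sub>m 1\<^sub>m n - cj a \<cdot>\<^sub>m g"
  have Tc: "g - 1\<^sub>m n \<in> carrier_mat n n" by (rule minus_carrier_mat) simp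
  have S': "S = (a - cj a) \<cdot>\<^sub>m 1\<^sub>m n + (- cj a) \<cdot>\<^sub>m (g - 1\<^sub>m n)"
    unfolding S_def by (rule eq_matI) (use g in \<open>auto simp: algebra_simps\<close>)
  have S: "S \<in> GL n" unfolding S' by (rule linear_nilpotent_GL[OF Tc g(2)]) (use a in auto)
  have SF: "S * F = g - 1\<^sub>m n" if F: "F \<in> carrier_mat n n" "g * (1\<^sub>m n + cj a \<cdot>\<^sub>m F) = 1\<^sub>m n + a \<cdot>\<^sub>m F" for F
  proof -
    have r: "g + cj a \<cdot>\<^sub>m (g * F) = 1\<^sub>m n + a \<cdot>\<^sub>m F"
      using F(2) carrier_matD[OF g(1)] carrier_matD[OF F(1)] by (simp add: mult_distrib_dim left_mult_one_mat_dim right_mult_one_mat_dim)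
    have e: "S * F = a \<cdot>\<^sub>m F - cj a \<cdot>\<^sub>m (g * F)"
      unfolding S_def using F(2) carrier_matD[OF g(1)] carrier_matD[OF F(1)] by (simp add: mult_distrib_dim left_mult_one_mat_dim right_mult_one_mat_dim)
    show ?thesis
    proof (rule eq_matI)
      fix i j assume "i < dim_row (g - 1\<^sub>m n)" "j < dim_col (g - 1\<^sub>m n)"
      then have ij: "i < n" "j < n" by auto
      have "(g + cj a \<cdot>\<^sub>m (g * F)) $$ (i, j) = (1\<^sub>m n + a \<cdot>\<^sub>m F) $$ (i, j)" unfolding r ..
      then have "g $$ (i, j) + cj a * (g * F) $$ (i, j) = 1\<^sub>m n $$ (i, j) + a * F $$ (i, j)"
        using ij carrier_matD[OF F(1)] carrier_matD[OF g(1)] by simp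
      then have "a * F $$ (i, j) - cj a * (g * F) $$ (i, j) = g $$ (i, j) - 1\<^sub>m n $$ (i, j)" by (simp add: algebra_simps)
      then show "(S * F) $$ (i, j) = (g - 1\<^sub>m n) $$ (i, j)" unfolding e
        using ij carrier_matD[OF F(1)] carrier_matD[OF g(1)] by simp
    qed (use F S GL_D[OF S] in auto)
  qed
  have "minv S * (S * E) = minv S * (S * E')" unfolding SF[OF E] SF[OF E'] ..
  then show ?thesis using GL_cancel(2)[OF S] carrier_matD[OF E(1)] carrier_matD[OF E'(1)] by simp
qed

text \<open>The Cayley relation is a bijection between the two sets: partners exist by
  \<open>cayley_unitary\<close> and \<open>cayley_hermitian\<close>, and they are unique because
  \<open>1 + cj a * E\<close> and \<open>a - cj a * g\<close> are invertible.\<close>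

lemma card_unipotent:
  shows "card {g \<in> UG (\<Sum>\<^sub># l). mtype (g - 1\<^sub>m (\<Sum>\<^sub># l)) l} = card (nilp l)"
proof -
  let ?n = "\<Sum>\<^sub># l"
  obtain a where a: "cj a \<noteq> a" using ex_cj_neq by blast
  define rel where "rel g E \<longleftrightarrow> g * (1\<^sub>m ?n + cj a \<cdot>\<^sub>m E) = 1\<^sub>m ?n + a \<cdot>\<^sub>m E" for g E
  let ?A = "{g \<in> UG ?n. mtype (g - 1\<^sub>m ?n) l}"
  have nA: "g \<in> carrier_mat ?n ?n" "(g - 1\<^sub>m ?n) ^\<^sub>m ?n = 0\<^sub>m ?n ?n" if "g \<in> ?A" for g
    using that mtype_nilpotent[of "g - 1\<^sub>m ?n" l] minus_carrier_mat[OF one_carrier_mat, of g ?n] by (auto simp: UG_def)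
  have nE: "E \<in> carrier_mat ?n ?n" "E ^\<^sub>m ?n = 0\<^sub>m ?n ?n" if "E \<in> nilp l" for E
    using that mtype_nilpotent[of E l] by (auto simp: nilp_def Hm_D)
  have ex1: "\<exists>g\<in>?A. rel g E" if "E \<in> nilp l" for E
  proof -
    have "E \<in> Hm ?n" using that by (simp add: nilp_def)
    from cayley_unitary[OF this nE(2)[OF that] a] that show ?thesis by (auto simp: rel_def nilp_def)
  qed
  have ex2: "\<exists>E\<in>nilp l. rel g E" if "g \<in> ?A" for g
  proof -
    have "g \<in> UG ?n" using that by simp
    from cayley_hermitian[OF this nA(2)[OF that] a] that show ?thesis by (auto simp: rel_def nilp_def)
  qed
  have u1: "g = g'" if "g \<in> ?A" "g' \<in> ?A" "E \<in> nilp l" "rel g E" "rel g' E" for g g' E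
  proof -
    have one: "1 \<cdot>\<^sub>m 1\<^sub>m ?n = (1\<^sub>m ?n :: 'a mat)" by (rule eq_matI) auto
    define R where "R = 1\<^sub>m ?n + cj a \<cdot>\<^sub>m E"
    have R: "R \<in> GL ?n" using linear_nilpotent_GL[OF nE[OF that(3)], of 1 "cj a"] by (simp add: one R_def)
    note d = GL_D[OF R] minv_dim[OF R] carrier_matD[OF nA(1)[OF that(1)]] carrier_matD[OF nA(1)[OF that(2)]]
    have "g * R = g' * R" using that(4,5) by (simp add: rel_def R_def)
    then have "g * R * minv R = g' * R * minv R" by simp
    then show ?thesis using d minv_right[OF R] by (simp add: assoc_mult_mat_dim right_mult_one_mat_dim)
  qed
  have u2: "E = E'" if "g \<in> ?A" "E \<in> nilp l" "E' \<in> nilp l" "rel g E" "rel g E'" for g E E'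
    by (rule cayley_unique[OF a nA[OF that(1)] nE(1)[OF that(2)] _ nE(1)[OF that(3)]]) (use that in \<open>simp_all add: rel_def\<close>)
  obtain f where f: "\<And>g. g \<in> ?A \<Longrightarrow> f g \<in> nilp l \<and> rel g (f g)" using ex2 by metis
  have "bij_betw f ?A (nilp l)" unfolding bij_betw_def
  proof (intro conjI inj_onI equalityI subsetI)
    fix g g' assume "g \<in> ?A" "g' \<in> ?A" "f g = f g'"
    then show "g = g'" using f[of g] f[of g'] u1[of g g' "f g"] by simp
  next
    fix E assume "E \<in> nilp l"
    then obtain g where "g \<in> ?A" "rel g E" using ex1 by blast
    then show "E \<in> f ` ?A" using u2[of g E "f g"] f[of g] \<open>E \<in> nilp l\<close> by blast
  qed (use f in blast)
  then show ?thesis by (rule bij_betw_same_card)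
qed

end

subsection \<open>The Fitting decomposition\<close>

lemma intertwine_pow:
  fixes A :: "'a::field mat"
  assumes A: "A \<in> carrier_mat m m" "B \<in> carrier_mat k k" "X \<in> carrier_mat m k" and c: "A * X = X * B"
  shows "A ^\<^sub>m i * X = X * B ^\<^sub>m i"
proof (induction i)
  case 0
  then show ?case using A by (simp add: left_mult_one_mat_dim right_mult_one_mat_dim)
next
  case (Suc i)
  have "A ^\<^sub>m Suc i * X = A ^\<^sub>m i * (X * B)" unfolding c[symmetric] using A by (simp add: assoc_mult_mat_dim)
  also have "\<dots> = (A ^\<^sub>m i * X) * B" by (rule assoc_mult_mat_dim[symmetric]) (use A in auto)
  also have "\<dots> = X * B ^\<^sub>m Suc i" unfolding Suc using A by (simp add: assoc_mult_mat_dim)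
  finally show ?case .
qed

lemma mult_GL_eq_zero:
  fixes M :: "'a::field mat"
  assumes "M \<in> GL k"
  shows "X \<in> carrier_mat m k \<Longrightarrow> X * M = 0\<^sub>m m k \<Longrightarrow> X = 0\<^sub>m m k"
    and "Y \<in> carrier_mat k m \<Longrightarrow> M * Y = 0\<^sub>m k m \<Longrightarrow> Y = 0\<^sub>m k m"
proof -
  assume X: "X \<in> carrier_mat m k" "X * M = 0\<^sub>m m k"
  have "X = X * (M * minv M)" using X minv_right[OF assms] by (simp add: right_mult_one_mat_dim)
  also have "\<dots> = (X * M) * minv M" by (rule assoc_mult_mat_dim[symmetric]) (use X GL_D[OF assms] minv_dim[OF assms] in simp_all)
  finally show "X = 0\<^sub>m m k" unfolding X(2) using minv_dim[OF assms] by (simp add: zero_mult_mat_dim)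
next
  assume Y: "Y \<in> carrier_mat k m" "M * Y = 0\<^sub>m k m"
  have "Y = minv M * (M * Y)" using GL_cancel(2)[OF assms, of Y] Y by simp
  then show "Y = 0\<^sub>m k m" unfolding Y(2) using minv_dim[OF assms] by (simp add: mult_zero_mat_dim)
qed

text \<open>From \<open>N * X = X * M\<close> follows \<open>X * M ^ e = N ^ e * X = 0\<close>, and
  \<open>M ^ e\<close> is invertible. This gives both the orthogonality of the Fitting decomposition
  and the block shape of the matrices that respect it.\<close>

lemma intertwine_zero:
  fixes M :: "'a::field mat"
  assumes N: "N \<in> carrier_mat m m" "N ^\<^sub>m e = 0\<^sub>m m m" and M: "M \<in> GL k"
  shows "X \<in> carrier_mat m k \<Longrightarrow> N * X = X * M \<Longrightarrow> X = 0\<^sub>m m k"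
    and "Y \<in> carrier_mat k m \<Longrightarrow> M * Y = Y * N \<Longrightarrow> Y = 0\<^sub>m k m"
proof -
  assume X: "X \<in> carrier_mat m k" "N * X = X * M"
  have "X * M ^\<^sub>m e = 0\<^sub>m m k"
    using intertwine_pow[OF N(1) GL_D(1)[OF M] X, of e] X unfolding N(2) by (simp add: zero_mult_mat_dim)
  then show "X = 0\<^sub>m m k" by (rule mult_GL_eq_zero(1)[OF GL_pow[OF M] X(1)])
next
  assume Y: "Y \<in> carrier_mat k m" "M * Y = Y * N"
  have "M ^\<^sub>m e * Y = 0\<^sub>m k m"
    using intertwine_pow[OF GL_D(1)[OF M] N(1) Y, of e] Y unfolding N(2) by (simp add: mult_zero_mat_dim)
  then show "Y = 0\<^sub>m k m" by (rule mult_GL_eq_zero(2)[OF GL_pow[OF M] Y(1)])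
qed

definition dsum :: "'a::zero mat \<Rightarrow> 'a mat \<Rightarrow> 'a mat" where
  "dsum A D = four_block_mat A (0\<^sub>m (dim_row A) (dim_col D)) (0\<^sub>m (dim_row D) (dim_col A)) D"

lemma dsum_dim [simp]: "dim_row (dsum A D) = dim_row A + dim_row D" "dim_col (dsum A D) = dim_col A + dim_col D"
  by (simp_all add: dsum_def)

lemma dsum_carrier: "A \<in> carrier_mat m m \<Longrightarrow> D \<in> carrier_mat k k \<Longrightarrow> dsum A D \<in> carrier_mat (m + k) (m + k)"
  by (rule carrier_matI) auto

lemma dsum_mult:
  fixes A :: "'a::semiring_0 mat"
  assumes "dim_col A = dim_row A'" "dim_col D = dim_row D'"
  shows "dsum A D * dsum A' D' = dsum (A * A') (D * D')"
  unfolding dsum_def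
  by (subst mult_four_block_dim) (simp_all add: assms zero_mat_dim)

lemma dsum_add: "dim_row A' = dim_row A \<Longrightarrow> dim_col A' = dim_col A \<Longrightarrow> dim_row D' = dim_row D \<Longrightarrow> dim_col D' = dim_col D \<Longrightarrow>
    dsum A D + dsum A' D' = dsum (A + A') (D + D')" for A :: "'a::monoid_add mat"
  by (rule eq_matI) (auto simp: dsum_def)

lemma dsum_minus: "dim_row A' = dim_row A \<Longrightarrow> dim_col A' = dim_col A \<Longrightarrow> dim_row D' = dim_row D \<Longrightarrow> dim_col D' = dim_col D \<Longrightarrow>
    dsum A D - dsum A' D' = dsum (A - A') (D - D')" for A :: "'a::group_add mat"
  by (rule eq_matI) (auto simp: dsum_def)

lemma dsum_one: "dsum (1\<^sub>m m) (1\<^sub>m k) = 1\<^sub>m (m + k)"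
  by (rule eq_matI) (auto simp: dsum_def)

lemma dsum_eq_iff:
  assumes "A \<in> carrier_mat m m" "A' \<in> carrier_mat m m" "D \<in> carrier_mat k k" "D' \<in> carrier_mat k k"
  shows "dsum A D = dsum A' D' \<longleftrightarrow> A = A' \<and> D = D'"
  unfolding dsum_def by (subst four_block_eq_iff[of _ m m _ k _ k]) (use assms in auto)

lemma dsum_GL:
  assumes "A \<in> carrier_mat m m" "D \<in> carrier_mat k k"
  shows "dsum A D \<in> GL (m + k) \<longleftrightarrow> A \<in> GL m \<and> D \<in> GL k"
  unfolding dsum_def using assms four_block_GL_upper[OF assms, of "0\<^sub>m m k"] by simp

lemma dsum_pow:
  fixes A :: "'a::semiring_1 mat"
  assumes "A \<in> carrier_mat m m" "D \<in> carrier_mat k k"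
  shows "dsum A D ^\<^sub>m i = dsum (A ^\<^sub>m i) (D ^\<^sub>m i)"
  by (induction i) (use assms in \<open>auto simp: dsum_mult dsum_one\<close>)

lemma card_mker_dsum:
  fixes A :: "'a::{field,finite} mat"
  assumes A: "A \<in> carrier_mat m m" and D: "D \<in> GL k"
  shows "card (mker (dsum A D)) = card (mker A)"
proof -
  note d = carrier_matD[OF A] GL_D[OF D]
  have mv: "dsum A D *\<^sub>v (a @\<^sub>v b) = (A *\<^sub>v a) @\<^sub>v (D *\<^sub>v b)" if "a \<in> carrier_vec m" "b \<in> carrier_vec k" for a b
  proof -
    have z: "0\<^sub>m m k *\<^sub>v b = 0\<^sub>v m" "0\<^sub>m k m *\<^sub>v a = 0\<^sub>v k" using that by (simp_all add: zero_mat_mult_vec)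
    have "dsum A D *\<^sub>v (a @\<^sub>v b) = (A *\<^sub>v a + 0\<^sub>m m k *\<^sub>v b) @\<^sub>v (0\<^sub>m k m *\<^sub>v a + D *\<^sub>v b)"
      unfolding dsum_def by (subst four_block_mult_vec_dim) (use d that in auto)
    moreover have "A *\<^sub>v a + 0\<^sub>v m = A *\<^sub>v a" "0\<^sub>v k + D *\<^sub>v b = D *\<^sub>v b"
      by (rule right_zero_vec[of _ m] left_zero_vec[of _ k], rule mult_mat_vec_carrier[OF A that(1)] mult_mat_vec_carrier[OF GL_D(1)[OF D] that(2)])+
    ultimately show ?thesis unfolding z by simp
  qed
  have mem: "a @\<^sub>v b \<in> mker (dsum A D) \<longleftrightarrow> a \<in> mker A \<and> b = 0\<^sub>v k" if "a \<in> carrier_vec m" "b \<in> carrier_vec k" for a b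
  proof -
    have ab: "a @\<^sub>v b \<in> carrier_vec (m + k)" using that by simp
    have z: "0\<^sub>v (m + k) = (0\<^sub>v m @\<^sub>v 0\<^sub>v k :: 'a vec)" by (rule eq_vecI) auto
    have "a @\<^sub>v b \<in> mker (dsum A D) \<longleftrightarrow> (A *\<^sub>v a) @\<^sub>v (D *\<^sub>v b) = 0\<^sub>v m @\<^sub>v 0\<^sub>v k"
      unfolding mker_def mem_Collect_eq mv[OF that] z[symmetric] using ab d by simp
    also have "\<dots> \<longleftrightarrow> A *\<^sub>v a = 0\<^sub>v m \<and> D *\<^sub>v b = 0\<^sub>v k"
      by (rule append_vec_eq[of _ m]) (use that A in auto)
    also have "\<dots> \<longleftrightarrow> a \<in> mker A \<and> b = 0\<^sub>v k"
      using GL_mult_vec_zero_iff[OF D, of b] that d by (simp add: mker_def)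
    finally show ?thesis .
  qed
  have "mker (dsum A D) = (\<lambda>a. a @\<^sub>v 0\<^sub>v k) ` mker A"
  proof (intro equalityI subsetI)
    fix v assume v: "v \<in> mker (dsum A D)"
    then have vc: "v \<in> carrier_vec (m + k)" using d by (simp add: mker_def)
    have e: "v = vec_first v m @\<^sub>v vec_last v k" using vc by simp
    have "vec_first v m \<in> mker A \<and> vec_last v k = 0\<^sub>v k"
      using v mem[of "vec_first v m" "vec_last v k"] unfolding e[symmetric] by simp
    then show "v \<in> (\<lambda>a. a @\<^sub>v 0\<^sub>v k) ` mker A" using e by (auto intro!: image_eqI[of _ _ "vec_first v m"])
  next
    fix v assume "v \<in> (\<lambda>a. a @\<^sub>v 0\<^sub>v k) ` mker A"
    then obtain a where "a \<in> mker A" "v = a @\<^sub>v 0\<^sub>v k" by auto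
    moreover have "a \<in> carrier_vec m" using \<open>a \<in> mker A\<close> d by (simp add: mker_def)
    ultimately show "v \<in> mker (dsum A D)" using mem[of a "0\<^sub>v k"] by simp
  qed
  moreover have "inj_on (\<lambda>a. a @\<^sub>v 0\<^sub>v k) (mker A)"
  proof (rule inj_onI)
    fix a b assume "a \<in> mker A" "b \<in> mker A" "a @\<^sub>v 0\<^sub>v k = b @\<^sub>v 0\<^sub>v k"
    then show "a = b" using append_vec_eq[of a m b] d by (auto simp: mker_def)
  qed
  ultimately show ?thesis by (simp add: card_image)
qed

lemma mtype_dsum:
  fixes A :: "'a::{field,finite} mat"
  assumes "A \<in> carrier_mat m m" "D \<in> GL k"
  shows "mtype (dsum A D) l \<longleftrightarrow> mtype A l"
  unfolding mtype_def dsum_pow[OF assms(1) GL_D(1)[OF assms(2)]]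
  using card_mker_dsum[OF pow_carrier_mat[OF assms(1)] GL_pow[OF assms(2)]] by simp

text \<open>Fitting decomposition. In the induction step a kernel vector is split off; the entries \<open>a2\<close> coupling it to
  the invertible part are removed by conjugating with \<open>1 + a2 M\<^sup>-\<^sup>1\<close>.\<close>

lemma border_nilpotent:
  fixes N :: "'a::field mat"
  assumes N: "N \<in> carrier_mat m m" "N ^\<^sub>m e = 0\<^sub>m m m" and a: "a \<in> carrier_mat 1 m"
  shows "four_block_mat (0\<^sub>m 1 1) a (0\<^sub>m m 1) N ^\<^sub>m Suc e = 0\<^sub>m (1 + m) (1 + m)"
proof -
  have "four_block_mat (0\<^sub>m 1 1) a (0\<^sub>m m 1) N ^\<^sub>m Suc i = four_block_mat (0\<^sub>m 1 1) (a * N ^\<^sub>m i) (0\<^sub>m m 1) (N ^\<^sub>m Suc i)" for i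
  proof (induction i)
    case 0
    then show ?case using N a by (simp add: left_mult_one_mat_dim right_mult_one_mat_dim)
  next
    case (Suc i)
    have "four_block_mat (0\<^sub>m 1 1) a (0\<^sub>m m 1) N ^\<^sub>m Suc (Suc i) = four_block_mat (0\<^sub>m 1 1) (a * N ^\<^sub>m i) (0\<^sub>m m 1) (N ^\<^sub>m Suc i) * four_block_mat (0\<^sub>m 1 1) a (0\<^sub>m m 1) N"
      using Suc by simp
    also have "\<dots> = four_block_mat (0\<^sub>m 1 1) (a * N ^\<^sub>m Suc i) (0\<^sub>m m 1) (N ^\<^sub>m Suc (Suc i))"
      by (subst mult_four_block_dim) (use N a in \<open>auto simp: zero_mat_dim assoc_mult_mat_dim\<close>)
    finally show ?case .
  qed
  moreover have "N ^\<^sub>m Suc e = 0\<^sub>m m m" using pow_mat_zero_add[OF N, of 1] by simp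
  moreover have "four_block_mat (0\<^sub>m 1 1) (0\<^sub>m 1 m) (0\<^sub>m m 1) (0\<^sub>m m m) = (0\<^sub>m (1 + m) (1 + m) :: 'a mat)"
    by (rule eq_matI) auto
  ultimately show ?thesis using N a by (simp add: mult_zero_mat_dim)
qed

lemma border_dsum_conj:
  fixes N :: "'a::field mat"
  assumes N: "N \<in> carrier_mat m m" and a: "a \<in> carrier_mat 1 (m + k)" and M: "M \<in> GL k"
  shows "\<exists>r\<in>GL (1 + m + k). \<exists>a1\<in>carrier_mat 1 m.
    four_block_mat (0\<^sub>m 1 1) a (0\<^sub>m (m + k) 1) (dsum N M) * r = r * dsum (four_block_mat (0\<^sub>m 1 1) a1 (0\<^sub>m m 1) N) M"
proof -
  note d = carrier_matD[OF N] carrier_matD[OF a] GL_D[OF M] minv_dim[OF M]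
  define a1 where "a1 = mat 1 m (\<lambda>(i, j). a $$ (i, j))"
  define b where "b = mat (1 + m) k (\<lambda>(i, j). if i = 0 then a $$ (0, m + j) else 0)"
  define N1 where "N1 = four_block_mat (0\<^sub>m 1 1) a1 (0\<^sub>m m 1) N"
  have a1: "a1 \<in> carrier_mat 1 m" by (simp add: a1_def)
  have b: "b \<in> carrier_mat (1 + m) k" by (simp add: b_def)
  have N1: "N1 \<in> carrier_mat (1 + m) (1 + m)" unfolding N1_def by (rule carrier_matI) (use d in simp_all)
  note d' = carrier_matD[OF a1] carrier_matD[OF b] carrier_matD[OF N1]
  have re: "four_block_mat (0\<^sub>m 1 1) a (0\<^sub>m (m + k) 1) (dsum N M) = four_block_mat N1 b (0\<^sub>m k (1 + m)) M"
  proof (rule eq_matI)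
    fix i j assume "i < dim_row (four_block_mat N1 b (0\<^sub>m k (1 + m)) M)" "j < dim_col (four_block_mat N1 b (0\<^sub>m k (1 + m)) M)"
    then have ij: "i < 1 + m + k" "j < 1 + m + k" using d d' by auto
    then show "four_block_mat (0\<^sub>m 1 1) a (0\<^sub>m (m + k) 1) (dsum N M) $$ (i, j) = four_block_mat N1 b (0\<^sub>m k (1 + m)) M $$ (i, j)"
      using d by (cases i; cases j) (simp_all add: dsum_def N1_def a1_def b_def)
  qed (use d d' in auto)
  \<comment> \<open>Only row 0 of \<open>b\<close> is nonzero, and it meets column 0 of
    \<open>N1\<close>, which is zero. Hence a single conjugation removes the coupling.\<close>
  have N1b: "N1 * b = 0\<^sub>m (1 + m) k"
  proof (rule eq_matI)
    fix i j assume "i < dim_row (0\<^sub>m (1 + m) k :: 'a mat)" "j < dim_col (0\<^sub>m (1 + m) k :: 'a mat)"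
    then have ij: "i < 1 + m" "j < k" by auto
    have "(N1 * b) $$ (i, j) = (\<Sum>l = 0..<1 + m. N1 $$ (i, l) * b $$ (l, j))"
      using ij d' by (simp add: scalar_prod_def)
    also have "\<dots> = 0" by (rule sum.neutral) (use ij d in \<open>auto simp: N1_def b_def a1_def\<close>)
    finally show "(N1 * b) $$ (i, j) = 0\<^sub>m (1 + m) k $$ (i, j)" using ij by simp
  qed (use d' in auto)
  define x where "x = b * minv M"
  have x: "x \<in> carrier_mat (1 + m) k" unfolding x_def by (rule mult_carrier_mat[OF b minv_carrier[OF M]])
  have N1x: "N1 * x = 0\<^sub>m (1 + m) k"
  proof -
    have "N1 * x = (N1 * b) * minv M" unfolding x_def by (rule assoc_mult_mat_dim[symmetric]) (use d d' in simp_all)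
    then show ?thesis unfolding N1b using d by (simp add: zero_mult_mat_dim)
  qed
  have xM: "x * M = b" unfolding x_def using minv_left[OF M] d d' by (simp add: assoc_mult_mat_dim right_mult_one_mat_dim)
  define r where "r = four_block_mat (1\<^sub>m (1 + m)) x (0\<^sub>m k (1 + m)) (1\<^sub>m k)"
  have r: "r \<in> GL (1 + m + k)" unfolding r_def by (subst four_block_GL_upper) (use x in \<open>auto simp: one_GL\<close>)
  have "four_block_mat N1 b (0\<^sub>m k (1 + m)) M * r = four_block_mat N1 b (0\<^sub>m k (1 + m)) M"
    unfolding r_def
    by (subst mult_four_block_dim) (use d d' x N1x in \<open>simp_all add: zero_mat_dim right_mult_one_mat_dim\<close>)
  also have "\<dots> = r * dsum N1 M"
    unfolding r_def dsum_def
    by (subst mult_four_block_dim) (use d d' x xM in \<open>simp_all add: zero_mat_dim left_mult_one_mat_dim\<close>)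
  finally show ?thesis unfolding re[symmetric] using r a1 by (auto simp: N1_def)
qed

lemma fitting:
  fixes T :: "'a::field mat"
  assumes "T \<in> carrier_mat n n"
  shows "\<exists>p\<in>GL n. \<exists>m k e. \<exists>N\<in>carrier_mat m m. \<exists>M\<in>GL k. m + k = n \<and> N ^\<^sub>m e = 0\<^sub>m m m \<and> T * p = p * dsum N M"
  using assms
proof (induction n arbitrary: T)
  case 0
  have "(1\<^sub>m 0 :: 'a mat) \<in> GL 0" "(0\<^sub>m 0 0 :: 'a mat) \<in> carrier_mat 0 0" "(0\<^sub>m 0 0 :: 'a mat) ^\<^sub>m 1 = 0\<^sub>m 0 0" by (auto simp: one_GL)
  moreover have "T * 1\<^sub>m 0 = 1\<^sub>m 0 * dsum (0\<^sub>m 0 0) (1\<^sub>m 0)" by (rule eq_matI) (use 0 in auto)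
  ultimately show ?case by (metis add_0)
next
  case (Suc n)
  show ?case
  proof (cases "T \<in> GL (Suc n)")
    case True
    have "dsum (0\<^sub>m 0 0) T = T" by (rule eq_matI) (auto simp: dsum_def)
    then have "T * 1\<^sub>m (Suc n) = 1\<^sub>m (Suc n) * dsum (0\<^sub>m 0 0) T" using Suc.prems by simp
    moreover have "(0\<^sub>m 0 0 :: 'a mat) \<in> carrier_mat 0 0" "(0\<^sub>m 0 0 :: 'a mat) ^\<^sub>m 1 = 0\<^sub>m 0 0" by auto
    ultimately show ?thesis using True one_GL by (metis add_0)
  next
    case False
    \<comment> \<open>With a kernel vector as first basis vector the first column becomes zero, and
      the induction hypothesis applies to the complementary block.\<close>
    then obtain v where v: "v \<in> carrier_vec (Suc n)" "v \<noteq> 0\<^sub>v (Suc n)" "T *\<^sub>v v = 0\<^sub>v (Suc n)"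
      using GL_iff_kernel[OF Suc.prems] by blast
    obtain p0 where p0: "p0 \<in> GL (Suc n)" "col p0 0 = v" using ex_GL_first_col[OF v(1,2)] by blast
    note d0 = GL_D[OF p0(1)] minv_dim[OF p0(1)] carrier_matD[OF Suc.prems]
    define A where "A = minv p0 * (T * p0)"
    have A: "A \<in> carrier_mat (1 + n) (1 + n)" by (rule carrier_matI) (use d0 in \<open>auto simp: A_def\<close>)
    have TA: "T * p0 = p0 * A" unfolding A_def using GL_cancel(1)[OF p0(1)] d0 by simp
    have A0: "A $$ (i, 0) = 0" if "i < 1 + n" for i
    proof -
      have "col (T * p0) 0 = T *\<^sub>v v" using d0 p0(2) by (subst col_mult2[OF Suc.prems GL_D(1)[OF p0(1)]]) auto
      then have "col A 0 = minv p0 *\<^sub>v 0\<^sub>v (Suc n)" unfolding A_def v(3)[symmetric]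
        using d0 by (subst col_mult2[OF minv_carrier[OF p0(1)], of "T * p0" "Suc n"]) (auto intro: carrier_matI)
      also have "\<dots> = 0\<^sub>v (Suc n)" using d0 by simp
      finally have "col A 0 $ i = 0" using that by simp
      then show ?thesis using that carrier_matD[OF A] by simp
    qed
    obtain A1 a A3 T' where bl: "A1 \<in> carrier_mat 1 1" "a \<in> carrier_mat 1 n" "A3 \<in> carrier_mat n 1" "T' \<in> carrier_mat n n"
      "A = four_block_mat A1 a A3 T'" by (rule four_block_split[OF A])
    have "A1 = 0\<^sub>m 1 1"
      by (rule eq_matI) (use A0[of 0] bl in auto)
    moreover have "A3 = 0\<^sub>m n 1"
    proof (rule eq_matI)
      fix i j assume "i < dim_row (0\<^sub>m n 1 :: 'a mat)" "j < dim_col (0\<^sub>m n 1 :: 'a mat)"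
      then show "A3 $$ (i, j) = 0\<^sub>m n 1 $$ (i, j)" using A0[of "Suc i"] bl by auto
    qed (use bl in auto)
    ultimately have A': "A = four_block_mat (0\<^sub>m 1 1) a (0\<^sub>m n 1) T'" using bl by simp
    obtain p' m k e N M where IH: "p' \<in> GL n" "N \<in> carrier_mat m m" "M \<in> GL k" "m + k = n" "N ^\<^sub>m e = 0\<^sub>m m m" "T' * p' = p' * dsum N M"
      using Suc.IH[OF bl(4)] by blast
    note dd = carrier_matD[OF bl(2)] carrier_matD[OF bl(4)] GL_D[OF IH(1)] carrier_matD[OF IH(2)] GL_D[OF IH(3)]
    define P where "P = dsum (1\<^sub>m 1) p'"
    have P: "P \<in> GL (Suc n)" unfolding P_def using dsum_GL[of "1\<^sub>m 1" 1 p' n] IH(1) one_GL dd by simp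
    define A2 where "A2 = four_block_mat (0\<^sub>m 1 1) (a * p') (0\<^sub>m (m + k) 1) (dsum N M)"
    have AP: "A * P = P * A2"
      unfolding A' P_def A2_def dsum_def[of "1\<^sub>m 1"]
      using dd IH(4,6) by (simp add: mult_four_block_dim zero_mat_dim left_mult_one_mat_dim)
    have ap: "a * p' \<in> carrier_mat 1 (m + k)" unfolding IH(4) by (rule mult_carrier_mat[OF bl(2) GL_D(1)[OF IH(1)]])
    obtain r a1 where r: "r \<in> GL (1 + m + k)" "a1 \<in> carrier_mat 1 m"
      "A2 * r = r * dsum (four_block_mat (0\<^sub>m 1 1) a1 (0\<^sub>m m 1) N) M"
      using border_dsum_conj[OF IH(2) ap IH(3)] unfolding A2_def by blast
    have r': "r \<in> GL (Suc n)" using r(1) IH(4) by simp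
    define N1 where "N1 = four_block_mat (0\<^sub>m 1 1) a1 (0\<^sub>m m 1) N"
    have N1: "N1 \<in> carrier_mat (1 + m) (1 + m)" "N1 ^\<^sub>m Suc e = 0\<^sub>m (1 + m) (1 + m)"
      unfolding N1_def using IH(2) border_nilpotent[OF IH(2,5) r(2)] by auto
    note d1 = GL_D[OF P] GL_D[OF r'] carrier_matD[OF A] carrier_matD[OF N1(1)]
    have dA2: "dim_row A2 = Suc n" "dim_col A2 = Suc n" using dd IH(4) by (auto simp: A2_def)
    have "T * (p0 * (P * r)) = (T * p0) * (P * r)" by (rule assoc_mult_mat_dim[symmetric]) (use d0 d1 in simp_all)
    also have "\<dots> = p0 * ((A * P) * r)" unfolding TA using d0 d1 by (simp add: assoc_mult_mat_dim)
    also have "\<dots> = p0 * (P * (A2 * r))" unfolding AP using d0 d1 dA2 by (simp add: assoc_mult_mat_dim)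
    also have "\<dots> = (p0 * (P * r)) * dsum N1 M" unfolding r(3) N1_def[symmetric] using d0 d1 dd IH(4) by (simp add: assoc_mult_mat_dim)
    finally have "T * (p0 * (P * r)) = (p0 * (P * r)) * dsum N1 M" .
    moreover have "p0 * (P * r) \<in> GL (Suc n)" by (intro GL_mult p0 P r')
    moreover have "(1 + m) + k = Suc n" using IH(4) by simp
    ultimately show ?thesis using N1 IH(3) by blast
  qed
qed

context hermitian_field
begin

lemma adj_dsum: "adj (dsum A D) = dsum (adj A) (adj D)"
  unfolding dsum_def by (subst adj_four_block) auto

lemma adj_pow: "N \<in> carrier_mat m m \<Longrightarrow> adj (N ^\<^sub>m i) = adj N ^\<^sub>m i"
proof (induction i)
  case (Suc i)
  have "adj (N ^\<^sub>m Suc i) = adj N * adj N ^\<^sub>m i" using Suc adj_mult[of "N ^\<^sub>m i" N] by simp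
  also have "\<dots> = adj N ^\<^sub>m Suc i" by (rule pow_mat_Suc_left[symmetric]) (use Suc.prems in simp)
  finally show ?case .
qed auto

lemma Hm_GL_normalize:
  assumes "E \<in> Hm n" "E \<in> GL n"
  shows "\<exists>r\<in>GL n. adj r * E * r = 1\<^sub>m n"
proof -
  have "E \<in> corank_set n 0" using assms by (simp add: corank_set_0)
  from corank_set_normal_form(2)[OF this] obtain r where r: "r \<in> GL n" "adj r * E * r = nf n 0" by auto
  moreover have "nf n 0 = 1\<^sub>m n" by (rule eq_matI) (auto simp: nf_def)
  ultimately show ?thesis by auto
qed

lemma UG_D: "g \<in> UG n \<Longrightarrow> g \<in> carrier_mat n n" "g \<in> UG n \<Longrightarrow> adj g * g = 1\<^sub>m n" "g \<in> UG n \<Longrightarrow> g * adj g = 1\<^sub>m n"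
  using minv_right[OF UG_GL, of g n] minv_UG[of g n] by (simp_all add: UG_def[of n])

lemma UG_mult: "g \<in> UG n \<Longrightarrow> h \<in> UG n \<Longrightarrow> g * h \<in> UG n"
proof -
  assume g: "g \<in> UG n" and h: "h \<in> UG n"
  note d = carrier_matD[OF UG_D(1)[OF g]] carrier_matD[OF UG_D(1)[OF h]]
  have "adj (g * h) * (g * h) = adj h * ((adj g * g) * h)" using d by (simp add: adj_mult assoc_mult_mat_dim)
  also have "\<dots> = 1\<^sub>m n" unfolding UG_D(2)[OF g] using UG_D(2)[OF h] d by (simp add: left_mult_one_mat_dim)
  finally show ?thesis using mult_carrier_mat[OF UG_D(1)[OF g] UG_D(1)[OF h]] by (simp add: UG_def)
qed

lemma UG_adj: "g \<in> UG n \<Longrightarrow> adj g \<in> UG n"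
proof -
  assume "g \<in> UG n"
  from UG_D[OF this] show ?thesis by (simp add: UG_def)
qed

lemma UG_cancel:
  assumes "u \<in> UG n"
  shows "dim_row B = n \<Longrightarrow> u * (adj u * B) = B" "dim_row B = n \<Longrightarrow> adj u * (u * B) = B"
  using GL_cancel(1,2)[OF UG_GL[OF assms], of B] minv_UG[OF assms] by auto

lemma dsum_UG:
  assumes "A \<in> carrier_mat m m" "D \<in> carrier_mat k k"
  shows "dsum A D \<in> UG (m + k) \<longleftrightarrow> A \<in> UG m \<and> D \<in> UG k"
proof -
  note d = carrier_matD[OF assms(1)] carrier_matD[OF assms(2)]
  have c: "adj A * A \<in> carrier_mat m m" "adj D * D \<in> carrier_mat k k" by (rule carrier_matI; simp add: d)+
  have "adj (dsum A D) * dsum A D = dsum (adj A * A) (adj D * D)"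
    unfolding adj_dsum by (rule dsum_mult) simp_all
  moreover have "dsum (adj A * A) (adj D * D) = 1\<^sub>m (m + k) \<longleftrightarrow> adj A * A = 1\<^sub>m m \<and> adj D * D = 1\<^sub>m k"
    unfolding dsum_one[symmetric] by (rule dsum_eq_iff) (use c in auto)
  ultimately show ?thesis using assms dsum_carrier[OF assms] by (simp add: UG_def)
qed

text \<open>The Gram matrix of a basis adapted to the Fitting decomposition of \<open>g - 1\<close> is block diagonal, since its
  off-diagonal block intertwines a nilpotent with an invertible matrix.\<close>

lemma unitary_fitting:
  assumes g: "g \<in> UG n"
  shows "\<exists>m k e. \<exists>u\<in>UG n. \<exists>g1\<in>UG m. \<exists>g2\<in>UG k. m + k = n \<and> (g1 - 1\<^sub>m m) ^\<^sub>m e = 0\<^sub>m m m \<and> g2 - 1\<^sub>m k \<in> GL k \<and> g * u = u * dsum g1 g2"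
proof -
  note gD = UG_D[OF g]
  have T: "g - 1\<^sub>m n \<in> carrier_mat n n" by (rule minus_carrier_mat) simp
  obtain p m k e N M where p: "p \<in> GL n" and N: "N \<in> carrier_mat m m" "N ^\<^sub>m e = 0\<^sub>m m m" and M: "M \<in> GL k"
    and mk: "m + k = n" and Tp: "(g - 1\<^sub>m n) * p = p * dsum N M"
    using fitting[OF T] by blast
  note d = carrier_matD[OF gD(1)] GL_D[OF p] minv_dim[OF p] carrier_matD[OF N(1)] GL_D[OF M]
  define h1 where "h1 = 1\<^sub>m m + N"
  define h2 where "h2 = 1\<^sub>m k + M"
  have h: "h1 \<in> carrier_mat m m" "h2 \<in> carrier_mat k k" unfolding h1_def h2_def by (rule carrier_matI; simp add: d)+
  note dh = carrier_matD[OF h(1)] carrier_matD[OF h(2)]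
  have gp: "g * p = p * dsum h1 h2"
  proof -
    have "dsum h1 h2 = 1\<^sub>m n + dsum N M" unfolding h1_def h2_def mk[symmetric] dsum_one[symmetric] using d by (simp add: dsum_add)
    then have "p * dsum h1 h2 = p + (g - 1\<^sub>m n) * p" unfolding Tp using d mk by (simp add: mult_add_dim right_mult_one_mat_dim)
    also have "(g - 1\<^sub>m n) * p = g * p - p" using d by (simp add: minus_mult_dim left_mult_one_mat_dim)
    also have "p + (g * p - p) = g * p" by (rule eq_matI) (use d in auto)
    finally show ?thesis by simp
  qed
  \<comment> \<open>\<open>h2\<close> is invertible as a diagonal block of a conjugate of
    \<open>g\<close>.\<close>
  have h2GL: "h2 \<in> GL k"
  proof -
    have "dsum h1 h2 = minv p * (g * p)" unfolding gp using GL_cancel(2)[OF p] dh mk by simp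
    then have "dsum h1 h2 \<in> GL (m + k)" using GL_mult[OF minv_GL[OF p] GL_mult[OF UG_GL[OF g] p]] mk by simp
    then show ?thesis using dsum_GL[OF h] by simp
  qed
  define B where "B = adj p * p"
  have BH: "B \<in> Hm (m + k)" using Hm_congruence[of "1\<^sub>m n" n p n] GL_D(1)[OF p] d by (simp add: B_def mk Hm_def right_mult_one_mat_dim)
  have BGL: "B \<in> GL (m + k)" unfolding B_def mk by (rule GL_mult) (use p in simp_all)
  have Binv: "adj (dsum h1 h2) * B * dsum h1 h2 = B"
  proof -
    have "adj (dsum h1 h2) * B * dsum h1 h2 = adj (p * dsum h1 h2) * (p * dsum h1 h2)"
      unfolding B_def using d dh mk by (simp add: adj_mult assoc_mult_mat_dim)
    also have "\<dots> = adj p * ((adj g * g) * p)" unfolding gp[symmetric] using d by (simp add: adj_mult assoc_mult_mat_dim)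
    also have "\<dots> = B" unfolding gD(2) B_def using d by (simp add: left_mult_one_mat_dim)
    finally show ?thesis .
  qed
  obtain B1 b B2 where bl: "B1 \<in> Hm m" "b \<in> carrier_mat m k" "B2 \<in> Hm k" "B = four_block_mat B1 b (adj b) B2"
    by (rule Hm_split[OF BH])
  note db = Hm_D[OF bl(1)] Hm_D[OF bl(3)] carrier_matD[OF bl(2)]
  have "adj h1 * b * h2 = b"
  proof -
    have "four_block_mat (adj h1 * B1 * h1) (adj h1 * b * h2) (adj h2 * adj b * h1) (adj h2 * B2 * h2) = four_block_mat B1 b (adj b) B2"
      using Binv unfolding bl(4) adj_dsum unfolding dsum_def using dh db
      by (simp add: mult_four_block_dim zero_mat_dim)
    moreover have "adj h1 * B1 * h1 \<in> carrier_mat m m" "adj h1 * b * h2 \<in> carrier_mat m k"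
      "adj h2 * adj b * h1 \<in> carrier_mat k m" "adj h2 * B2 * h2 \<in> carrier_mat k k" "adj b \<in> carrier_mat k m"
      by (rule carrier_matI; use dh db in simp)+
    ultimately show ?thesis using four_block_eq_iff[of _ m m _ k _ k] Hm_D(4)[OF bl(1)] Hm_D(4)[OF bl(3)] bl(2) by blast
  qed
  moreover have "adj h1 = 1\<^sub>m m + adj N" unfolding h1_def using d by (simp add: adj_add)
  ultimately have e1: "(b + adj N * b) * h2 = b" using d db by (simp add: add_mult_dim left_mult_one_mat_dim)
  \<comment> \<open>From \<open>(1 + adj N) * b * h2 = b\<close> and \<open>h2 = 1 + M\<close> one
    gets \<open>adj N * b = - b * M * minv h2\<close>, the intertwining relation that forces
    \<open>b = 0\<close>.\<close>
  define X where "X = - (M * minv h2)"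
  have X: "X \<in> GL k"
  proof -
    have "M * minv h2 \<in> GL k" by (rule GL_mult[OF M minv_GL[OF h2GL]])
    moreover have "X = (- 1) \<cdot>\<^sub>m (M * minv h2)" unfolding X_def by (rule eq_matI) auto
    ultimately show ?thesis by (simp add: GL_def det_smult)
  qed
  note dx = minv_dim[OF h2GL]
  have "adj N * b = b * X"
  proof -
    have bh2: "b * h2 = b + b * M" unfolding h2_def using d db by (simp add: mult_add_dim right_mult_one_mat_dim)
    have "(b + adj N * b) * h2 = b + b * M + adj N * b * h2" using d db dh bh2 by (simp add: add_mult_dim)
    then have s: "b + b * M + adj N * b * h2 = b" using e1 by simp
    have "adj N * b * h2 = - (b * M)"
    proof (rule eq_matI)
      fix i j assume "i < dim_row (- (b * M))" "j < dim_col (- (b * M))"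
      then have ij: "i < m" "j < k" using db d by auto
      have "(b + b * M + adj N * b * h2) $$ (i, j) = b $$ (i, j)" using s by simp
      then have "b $$ (i, j) + (b * M) $$ (i, j) + (adj N * b * h2) $$ (i, j) = b $$ (i, j)"
        using ij db d dh by (simp del: index_mult_mat(1))
      then have "(adj N * b * h2) $$ (i, j) = - (b * M) $$ (i, j)" by (simp add: eq_neg_iff_add_eq_0 add.commute del: index_mult_mat(1))
      then show "(adj N * b * h2) $$ (i, j) = (- (b * M)) $$ (i, j)" using ij db d by (simp del: index_mult_mat(1))
    qed (use db d dh in auto)
    then have "adj N * b * h2 * minv h2 = - (b * M) * minv h2" by simp
    moreover have "adj N * b * h2 * minv h2 = adj N * b"
      using d db dh dx minv_right[OF h2GL] by (simp add: assoc_mult_mat_dim right_mult_one_mat_dim)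
    moreover have "- (b * M) * minv h2 = b * X" unfolding X_def using d db dx
      by (simp add: assoc_mult_mat_dim)
    ultimately show ?thesis by simp
  qed
  moreover have "adj N ^\<^sub>m e = 0\<^sub>m m m" using adj_pow[OF N(1), of e] N(2) by simp
  ultimately have b0: "b = 0\<^sub>m m k" using intertwine_zero(1)[OF _ _ X bl(2), of "adj N" e] N(1) by simp
  have Bd: "B = dsum B1 B2" unfolding bl(4) b0 dsum_def using db by simp
  then have "B1 \<in> GL m" "B2 \<in> GL k" using BGL dsum_GL[OF Hm_D(4)[OF bl(1)] Hm_D(4)[OF bl(3)]] by auto
  \<comment> \<open>Each diagonal block of the Gram matrix is congruent to 1; changing the basis
    within the blocks makes the base change unitary.\<close>
  then obtain r1 r2 where r: "r1 \<in> GL m" "adj r1 * B1 * r1 = 1\<^sub>m m" "r2 \<in> GL k" "adj r2 * B2 * r2 = 1\<^sub>m k"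
    using Hm_GL_normalize bl by meson
  note dr = GL_D[OF r(1)] GL_D[OF r(3)] minv_dim[OF r(1)] minv_dim[OF r(3)]
  define u where "u = p * dsum r1 r2"
  have rGL: "dsum r1 r2 \<in> GL n" unfolding mk[symmetric] using dsum_GL dr r by blast
  have uc: "u \<in> carrier_mat n n" unfolding u_def by (rule mult_carrier_mat[OF GL_D(1)[OF p] GL_D(1)[OF rGL]])
  have "adj u * u = 1\<^sub>m n"
  proof -
    have "adj u * u = adj (dsum r1 r2) * (B * dsum r1 r2)" unfolding u_def B_def using d dr mk by (simp add: adj_mult assoc_mult_mat_dim)
    also have "\<dots> = 1\<^sub>m n" unfolding Bd adj_dsum mk[symmetric] dsum_one[symmetric]
      using r dr db by (simp add: dsum_mult assoc_mult_mat_dim)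
    finally show ?thesis .
  qed
  then have u: "u \<in> UG n" using uc by (simp add: UG_def)
  define g1 where "g1 = minv r1 * h1 * r1"
  define g2 where "g2 = minv r2 * h2 * r2"
  have g12: "g1 \<in> carrier_mat m m" "g2 \<in> carrier_mat k k" unfolding g1_def g2_def by (rule carrier_matI; simp add: dr)+
  note dg = carrier_matD[OF g12(1)] carrier_matD[OF g12(2)]
  have gu: "g * u = u * dsum g1 g2"
  proof -
    have "g * u = (g * p) * dsum r1 r2" unfolding u_def using d dr mk by (simp add: assoc_mult_mat_dim)
    also have "\<dots> = p * dsum (h1 * r1) (h2 * r2)" unfolding gp using d dh dr mk by (simp add: assoc_mult_mat_dim dsum_mult)
    also have "dsum (h1 * r1) (h2 * r2) = dsum r1 r2 * dsum g1 g2"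
      unfolding g1_def g2_def using dr dh GL_cancel(1)[OF r(1)] GL_cancel(1)[OF r(3)] by (simp add: dsum_mult assoc_mult_mat_dim)
    also have "p * (dsum r1 r2 * dsum g1 g2) = u * dsum g1 g2" unfolding u_def using d dr dg mk by (simp add: assoc_mult_mat_dim)
    finally show ?thesis .
  qed
  have "dsum g1 g2 = adj u * (g * u)" unfolding gu using UG_cancel(2)[OF u] dg mk by simp
  then have "dsum g1 g2 \<in> UG (m + k)" using UG_mult[OF UG_adj[OF u] UG_mult[OF g u]] mk by simp
  then have U: "g1 \<in> UG m" "g2 \<in> UG k" using dsum_UG[OF g12] by auto
  have "g1 - 1\<^sub>m m = minv r1 * N * r1"
  proof -
    have "g1 = 1\<^sub>m m + minv r1 * N * r1" unfolding g1_def h1_def using dr d minv_left[OF r(1)]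
      by (simp add: mult_distrib_dim right_mult_one_mat_dim)
    then show ?thesis by (simp only:) (rule eq_matI, use dr d in auto)
  qed
  moreover have "minv r1 * 0\<^sub>m m m * r1 = 0\<^sub>m m m" using dr by (simp add: mult_zero_mat_dim zero_mult_mat_dim)
  ultimately have nil: "(g1 - 1\<^sub>m m) ^\<^sub>m e = 0\<^sub>m m m" using pow_mat_conj[OF r(1) N(1), of e] N(2) by simp
  have "g2 - 1\<^sub>m k = minv r2 * M * r2"
  proof -
    have "g2 = 1\<^sub>m k + minv r2 * M * r2" unfolding g2_def h2_def using dr d minv_left[OF r(3)]
      by (simp add: mult_distrib_dim right_mult_one_mat_dim)
    then show ?thesis by (simp only:) (rule eq_matI, use dr d in auto)
  qed
  then have "g2 - 1\<^sub>m k \<in> GL k" using GL_mult[OF GL_mult[OF minv_GL[OF r(3)] M] r(3)] by simp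
  then show ?thesis using mk u U nil gu by blast
qed

text \<open>The elements without eigenvalue 1; their proportion is the \<open>e\<^sub>k\<close> of
  the overview.\<close>

definition unit_free :: "nat \<Rightarrow> 'a mat set" where
  "unit_free k = {g \<in> UG k. g - 1\<^sub>m k \<in> GL k}"

lemma minus_one_conj:
  assumes "u \<in> UG n" "A \<in> carrier_mat n n"
  shows "u * A * adj u - 1\<^sub>m n = u * (A - 1\<^sub>m n) * adj u"
  using UG_D[OF assms(1)] carrier_matD[OF assms(2)] by (simp add: mult_distrib_dim right_mult_one_mat_dim)

lemma mtype_unitary_conj:
  assumes "u \<in> UG n" "A \<in> carrier_mat n n"
  shows "mtype (u * A * adj u - 1\<^sub>m n) l \<longleftrightarrow> mtype (A - 1\<^sub>m n) l"
proof -
  have "minv (adj u) = u" using minv_UG[OF UG_adj[OF assms(1)]] by simp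
  then show ?thesis unfolding minus_one_conj[OF assms]
    using mtype_conj[OF UG_GL[OF UG_adj[OF assms(1)]] minus_carrier_mat[OF one_carrier_mat, of A n]] by simp
qed

lemma mtype_dsum_minus_one:
  assumes "g1 \<in> UG m" "g2 \<in> unit_free k"
  shows "mtype (dsum g1 g2 - 1\<^sub>m (m + k)) l \<longleftrightarrow> mtype (g1 - 1\<^sub>m m) l"
proof -
  have c: "g1 \<in> carrier_mat m m" "g2 \<in> carrier_mat k k" "g2 - 1\<^sub>m k \<in> GL k" using assms UG_D by (auto simp: unit_free_def)
  have "dsum g1 g2 - 1\<^sub>m (m + k) = dsum (g1 - 1\<^sub>m m) (g2 - 1\<^sub>m k)"
    unfolding dsum_one[symmetric] by (rule dsum_minus) (use c in auto)
  then show ?thesis using mtype_dsum[OF minus_carrier_mat[OF one_carrier_mat, of g1 m] c(3)] by simp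
qed

text \<open>The block diagonal elements centralize the decomposition: a matrix conjugating one decomposed element
  into another preserves both blocks.\<close>

lemma intertwine_dsum:
  assumes g: "g1 \<in> carrier_mat m m" "(g1 - 1\<^sub>m m) ^\<^sub>m e = 0\<^sub>m m m" "g2 \<in> carrier_mat k k" "g2 - 1\<^sub>m k \<in> GL k"
    and h: "h1 \<in> carrier_mat m m" "(h1 - 1\<^sub>m m) ^\<^sub>m e' = 0\<^sub>m m m" "h2 \<in> carrier_mat k k" "h2 - 1\<^sub>m k \<in> GL k"
    and D: "D \<in> carrier_mat (m + k) (m + k)" "dsum g1 g2 * D = D * dsum h1 h2"
  shows "\<exists>d1\<in>carrier_mat m m. \<exists>d2\<in>carrier_mat k k. D = dsum d1 d2"
proof -
  obtain d1 x y d2 where bl: "d1 \<in> carrier_mat m m" "x \<in> carrier_mat m k" "y \<in> carrier_mat k m" "d2 \<in> carrier_mat k k"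
    "D = four_block_mat d1 x y d2" by (rule four_block_split[OF D(1)])
  note d = bl(1-4)[THEN carrier_matD(1)] bl(1-4)[THEN carrier_matD(2)] g(1,3)[THEN carrier_matD(1)] g(1,3)[THEN carrier_matD(2)]
    h(1,3)[THEN carrier_matD(1)] h(1,3)[THEN carrier_matD(2)]
  have "four_block_mat (g1 * d1) (g1 * x) (g2 * y) (g2 * d2) = four_block_mat (d1 * h1) (x * h2) (y * h1) (d2 * h2)"
    using D(2) unfolding bl(5) dsum_def using d
    by (simp add: mult_four_block_dim zero_mat_dim)
  then have "g1 * x = x * h2" "g2 * y = y * h1"
    by (subst (asm) four_block_eq_iff[of _ m m _ k _ k], use g h bl(1-4) in \<open>auto intro: mult_carrier_mat\<close>)+
  then have "(g1 - 1\<^sub>m m) * x = x * (h2 - 1\<^sub>m k)" "(g2 - 1\<^sub>m k) * y = y * (h1 - 1\<^sub>m m)"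
    using d by (simp_all add: mult_distrib_dim left_mult_one_mat_dim right_mult_one_mat_dim)
  then have "x = 0\<^sub>m m k" "y = 0\<^sub>m k m"
    using intertwine_zero(1)[OF minus_carrier_mat[OF one_carrier_mat] g(2) h(4) bl(2)]
      intertwine_zero(2)[OF minus_carrier_mat[OF one_carrier_mat] h(2) g(4) bl(3)] by auto
  then have "D = dsum d1 d2" unfolding bl(5) dsum_def using d by simp
  then show ?thesis using bl by blast
qed

text \<open>Every element of type \<open>l\<close> is \<open>u * dsum g1 g2 * adj u\<close> with
  \<open>g1\<close> unipotent of type \<open>l\<close> and \<open>g2\<close> without eigenvalue 1.
  The triples \<open>(u, g1, g2)\<close> over a given element are permuted simply transitively by
  \<open>UG m \<times> UG k\<close>, since by \<open>intertwine_dsum\<close> two of them differ by a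
  block diagonal unitary matrix.\<close>

lemma card_mtype_class:
  fixes l :: "nat multiset" and k :: nat
  defines "m \<equiv> \<Sum>\<^sub># l"
  shows "card {g \<in> UG (m + k). mtype (g - 1\<^sub>m (m + k)) l} * (card (UG m) * card (UG k)) =
    card (UG (m + k)) * (card {g \<in> UG m. mtype (g - 1\<^sub>m m) l} * card (unit_free k))"
proof -
  let ?n = "m + k"
  define A where "A = {g \<in> UG m. mtype (g - 1\<^sub>m m) l}"
  define C where "C = {g \<in> UG ?n. mtype (g - 1\<^sub>m ?n) l}"
  define f where "f = (\<lambda>(u, g1, g2). u * dsum g1 g2 * adj u)"
  have AD: "g \<in> UG m" "g \<in> carrier_mat m m" "(g - 1\<^sub>m m) ^\<^sub>m m = 0\<^sub>m m m" if "g \<in> A" for g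
    using that mtype_nilpotent[of "g - 1\<^sub>m m" l] minus_carrier_mat[OF one_carrier_mat, of g m] UG_D(1) by (auto simp: A_def m_def)
  have FD: "g \<in> UG k" "g \<in> carrier_mat k k" "g - 1\<^sub>m k \<in> GL k" if "g \<in> unit_free k" for g
    using that UG_D(1) by (auto simp: unit_free_def)
  have dc: "dsum g1 g2 \<in> carrier_mat ?n ?n" "dsum g1 g2 \<in> UG ?n" if "g1 \<in> A" "g2 \<in> unit_free k" for g1 g2
    using dsum_carrier[OF AD(2)[OF that(1)] FD(2)[OF that(2)]] dsum_UG[OF AD(2)[OF that(1)] FD(2)[OF that(2)]] AD(1)[OF that(1)] FD(1)[OF that(2)] by auto
  have fC: "f x \<in> C" if xx: "x \<in> UG ?n \<times> A \<times> unit_free k" for x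
  proof -
    obtain u g1 g2 where x: "x = (u, g1, g2)" "u \<in> UG ?n" "g1 \<in> A" "g2 \<in> unit_free k" using xx by (cases x) auto
    have "f x \<in> UG ?n" unfolding f_def x(1) prod.case by (intro UG_mult x UG_adj dc)
    moreover have "mtype (f x - 1\<^sub>m ?n) l"
      unfolding f_def x(1) prod.case mtype_unitary_conj[OF x(2) dc(1)[OF x(3,4)]] mtype_dsum_minus_one[OF AD(1)[OF x(3)] x(4)]
      using x(3) by (simp add: A_def)
    ultimately show ?thesis by (simp add: C_def)
  qed
  have surj: "\<exists>x\<in>UG ?n \<times> A \<times> unit_free k. f x = g" if "g \<in> C" for g
  proof -
    have g: "g \<in> UG ?n" "mtype (g - 1\<^sub>m ?n) l" using that by (auto simp: C_def)
    obtain m' k' e u g1 g2 where F: "u \<in> UG ?n" "g1 \<in> UG m'" "g2 \<in> UG k'" "m' + k' = ?n" "(g1 - 1\<^sub>m m') ^\<^sub>m e = 0\<^sub>m m' m'"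
      "g2 - 1\<^sub>m k' \<in> GL k'" "g * u = u * dsum g1 g2" using unitary_fitting[OF g(1)] by blast
    have g2: "g2 \<in> unit_free k'" using F by (simp add: unit_free_def)
    have dd: "dsum g1 g2 \<in> carrier_mat ?n ?n" using dsum_carrier[OF UG_D(1)[OF F(2)] UG_D(1)[OF F(3)]] F(4) by simp
    note du = carrier_matD[OF UG_D(1)[OF F(1)]] carrier_matD[OF UG_D(1)[OF g(1)]]
    have ge: "g = u * dsum g1 g2 * adj u" unfolding F(7)[symmetric] using du UG_D(3)[OF F(1)] by (simp add: assoc_mult_mat_dim right_mult_one_mat_dim)
    have "mtype (dsum g1 g2 - 1\<^sub>m ?n) l" using g(2) unfolding ge mtype_unitary_conj[OF F(1) dd] .
    then have t: "mtype (g1 - 1\<^sub>m m') l" using mtype_dsum_minus_one[OF F(2) g2] F(4) by simp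
    \<comment> \<open>The size of the unipotent block is forced by the type.\<close>
    have "\<Sum>\<^sub># l = m'" by (rule mtype_nilpotent_size[OF t minus_carrier_mat[OF one_carrier_mat] F(5)])
    then have "m' = m" "k' = k" using F(4) by (simp_all add: m_def)
    then have "(u, g1, g2) \<in> UG ?n \<times> A \<times> unit_free k" using F g2 t by (simp add: A_def)
    moreover have "f (u, g1, g2) = g" unfolding f_def prod.case by (rule ge[symmetric])
    ultimately show ?thesis by (rule bexI[rotated])
  qed
  have fib: "card {x \<in> UG ?n \<times> A \<times> unit_free k. f x = b} = card (UG m) * card (UG k)" if b: "b \<in> C" for b
  proof -
    obtain u0 g1 g2 where x0: "u0 \<in> UG ?n" "g1 \<in> A" "g2 \<in> unit_free k" "f (u0, g1, g2) = b" using surj[OF b] by auto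
    note d0 = carrier_matD[OF UG_D(1)[OF x0(1)]] carrier_matD[OF AD(2)[OF x0(2)]] carrier_matD[OF FD(2)[OF x0(3)]]
    define J where "J = (\<lambda>(d1, d2). (u0 * dsum d1 d2, adj d1 * g1 * d1, adj d2 * g2 * d2))"
    have "bij_betw J (UG m \<times> UG k) {x \<in> UG ?n \<times> A \<times> unit_free k. f x = b}"
      unfolding bij_betw_def
    proof (intro conjI equalityI)
      show "inj_on J (UG m \<times> UG k)"
      proof (rule inj_onI)
        fix x y assume x: "x \<in> UG m \<times> UG k" and y: "y \<in> UG m \<times> UG k" and e: "J x = J y"
        obtain d1 d2 e1 e2 where xy: "x = (d1, d2)" "y = (e1, e2)" by (cases x, cases y)
        have c: "d1 \<in> carrier_mat m m" "d2 \<in> carrier_mat k k" "e1 \<in> carrier_mat m m" "e2 \<in> carrier_mat k k"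
          using x y xy UG_D(1) by auto
        have "u0 * dsum d1 d2 = u0 * dsum e1 e2" using e by (simp add: J_def xy)
        then have "adj u0 * (u0 * dsum d1 d2) = adj u0 * (u0 * dsum e1 e2)" by simp
        then have "dsum d1 d2 = dsum e1 e2" using UG_cancel(2)[OF x0(1)] c by simp
        then show "x = y" using dsum_eq_iff[OF c(1,3,2,4)] xy by simp
      qed
      show "J ` (UG m \<times> UG k) \<subseteq> {x \<in> UG ?n \<times> A \<times> unit_free k. f x = b}"
      proof (rule image_subsetI)
        fix x assume x: "x \<in> UG m \<times> UG k"
        obtain d1 d2 where xy: "x = (d1, d2)" by (cases x)
        have U: "d1 \<in> UG m" "d2 \<in> UG k" using x xy by auto
        note dd = carrier_matD[OF UG_D(1)[OF U(1)]] carrier_matD[OF UG_D(1)[OF U(2)]]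
        have D: "dsum d1 d2 \<in> UG ?n" using dsum_UG[OF UG_D(1)[OF U(1)] UG_D(1)[OF U(2)]] U by simp
        have 1: "u0 * dsum d1 d2 \<in> UG ?n" by (rule UG_mult[OF x0(1) D])
        have 2: "adj d1 * g1 * d1 \<in> A"
        proof -
          have "adj d1 * g1 * d1 \<in> UG m" by (intro UG_mult UG_adj U AD(1)[OF x0(2)])
          moreover have "mtype (adj d1 * g1 * d1 - 1\<^sub>m m) l"
            using mtype_unitary_conj[OF UG_adj[OF U(1)] AD(2)[OF x0(2)], of l] x0(2) by (simp add: A_def)
          ultimately show ?thesis by (simp add: A_def)
        qed
        have 3: "adj d2 * g2 * d2 \<in> unit_free k"
        proof -
          have "adj d2 * g2 * d2 \<in> UG k" by (intro UG_mult UG_adj U FD(1)[OF x0(3)])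
          moreover have "adj d2 * g2 * d2 - 1\<^sub>m k = adj d2 * (g2 - 1\<^sub>m k) * d2"
            using minus_one_conj[OF UG_adj[OF U(2)] FD(2)[OF x0(3)]] by simp
          moreover have "adj d2 * (g2 - 1\<^sub>m k) * d2 \<in> GL k"
            by (intro GL_mult FD(3)[OF x0(3)] UG_GL U UG_adj)
          ultimately show ?thesis by (simp add: unit_free_def)
        qed
        have "f (J x) = u0 * (dsum d1 d2 * dsum (adj d1 * g1 * d1) (adj d2 * g2 * d2) * adj (dsum d1 d2)) * adj u0"
          unfolding f_def J_def xy prod.case using d0 dd by (simp add: adj_mult assoc_mult_mat_dim)
        also have "dsum d1 d2 * dsum (adj d1 * g1 * d1) (adj d2 * g2 * d2) * adj (dsum d1 d2) = dsum g1 g2"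
          using d0 dd UG_cancel(1)[OF U(1)] UG_cancel(1)[OF U(2)] UG_D(3)[OF U(1)] UG_D(3)[OF U(2)]
          by (simp add: adj_dsum dsum_mult assoc_mult_mat_dim right_mult_one_mat_dim)
        also have "u0 * dsum g1 g2 * adj u0 = b" using x0(4) by (simp add: f_def)
        finally show "J x \<in> {x \<in> UG ?n \<times> A \<times> unit_free k. f x = b}" using 1 2 3 by (simp add: J_def xy)
      qed
      show "{x \<in> UG ?n \<times> A \<times> unit_free k. f x = b} \<subseteq> J ` (UG m \<times> UG k)"
      proof
        fix x assume "x \<in> {x \<in> UG ?n \<times> A \<times> unit_free k. f x = b}"
        then obtain u h1 h2 where x: "x = (u, h1, h2)" "u \<in> UG ?n" "h1 \<in> A" "h2 \<in> unit_free k" "f (u, h1, h2) = b" by (cases x) auto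
        note du = carrier_matD[OF UG_D(1)[OF x(2)]] carrier_matD[OF AD(2)[OF x(3)]] carrier_matD[OF FD(2)[OF x(4)]]
        define D where "D = adj u0 * u"
        have DU: "D \<in> UG ?n" unfolding D_def by (rule UG_mult[OF UG_adj[OF x0(1)] x(2)])
        have "u0 * dsum g1 g2 * adj u0 = u * dsum h1 h2 * adj u" using x0(4) x(5) by (simp add: f_def)
        then have "adj u0 * (u0 * dsum g1 g2 * adj u0) * u = adj u0 * (u * dsum h1 h2 * adj u) * u" by simp
        moreover have "adj u0 * (u0 * dsum g1 g2 * adj u0) * u = dsum g1 g2 * D"
          unfolding D_def using d0 du UG_cancel(2)[OF x0(1)] by (simp add: assoc_mult_mat_dim)
        moreover have "adj u0 * (u * dsum h1 h2 * adj u) * u = D * dsum h1 h2"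
          unfolding D_def using d0 du UG_D(2)[OF x(2)] by (simp add: assoc_mult_mat_dim right_mult_one_mat_dim)
        ultimately have gD: "dsum g1 g2 * D = D * dsum h1 h2" by simp
        obtain d1 d2 where dd: "d1 \<in> carrier_mat m m" "d2 \<in> carrier_mat k k" "D = dsum d1 d2"
          using intertwine_dsum[OF AD(2,3)[OF x0(2)] FD(2,3)[OF x0(3)] AD(2,3)[OF x(3)] FD(2,3)[OF x(4)] UG_D(1)[OF DU] gD] by blast
        have U: "d1 \<in> UG m" "d2 \<in> UG k" using dsum_UG[OF dd(1,2)] DU unfolding dd(3) by auto
        note ddd = carrier_matD[OF dd(1)] carrier_matD[OF dd(2)]
        have "u0 * dsum d1 d2 = u" unfolding dd(3)[symmetric] D_def using UG_cancel(1)[OF x0(1)] du by simp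
        moreover have "dsum (g1 * d1) (g2 * d2) = dsum (d1 * h1) (d2 * h2)"
          using gD unfolding dd(3) using d0 du ddd by (simp add: dsum_mult)
        then have gd: "g1 * d1 = d1 * h1" "g2 * d2 = d2 * h2"
          by (subst (asm) dsum_eq_iff[of _ m _ _ k], use AD(2)[OF x0(2)] AD(2)[OF x(3)] FD(2)[OF x0(3)] FD(2)[OF x(4)] dd in \<open>auto intro: mult_carrier_mat\<close>)+
        moreover have "adj d1 * g1 * d1 = h1"
          using UG_cancel(2)[OF U(1), of h1] gd(1) d0 du ddd by (simp add: assoc_mult_mat_dim)
        moreover have "adj d2 * g2 * d2 = h2"
          using UG_cancel(2)[OF U(2), of h2] gd(2) d0 du ddd by (simp add: assoc_mult_mat_dim)
        ultimately have "x = J (d1, d2)" by (simp add: J_def x(1))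
        then show "x \<in> J ` (UG m \<times> UG k)" using U by blast
      qed
    qed
    from bij_betw_same_card[OF this] show ?thesis by (simp add: card_cartesian_product)
  qed
  have fin: "finite A" "finite C" "finite (unit_free k)" by (auto simp: A_def C_def unit_free_def)
  have "card (UG ?n \<times> A \<times> unit_free k) = card C * (card (UG m) * card (UG k))"
    by (rule card_fibres[where f = f]) (use fin fC fib in auto)
  then show ?thesis by (simp add: card_cartesian_product A_def C_def)
qed

end

subsection \<open>Transport to the given Hermitian form\<close>

context hermitian_field
begin

text \<open>Combines \<open>card_mtype_class\<close>, the Cayley correspondence and
  \<open>card_nilp\<close>; the order of \<open>UG (\<Sum>\<^sub># l)\<close> cancels.\<close>

lemma card_mtype_class_div:
  assumes "l \<in> partitions"
  shows "real (card {g \<in> UG n. mtype (g - 1\<^sub>m n) l}) / real (card (UG n)) =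
    (if \<Sum>\<^sub># l \<le> n then real (card (unit_free (n - \<Sum>\<^sub># l))) / real (card (UG (n - \<Sum>\<^sub># l))) / Aut_U q l else 0)"
proof (cases "\<Sum>\<^sub># l \<le> n")
  case False
  then have "{g \<in> UG n. mtype (g - 1\<^sub>m n) l} = {}"
    using mtype_size_le[OF _ minus_carrier_mat[OF one_carrier_mat]] by blast
  then show ?thesis using False by (simp only: card.empty if_False)
next
  case True
  define k where "k = n - \<Sum>\<^sub># l"
  have n: "n = \<Sum>\<^sub># l + k" using True by (simp add: k_def)
  define c where "c = real (card {g \<in> UG n. mtype (g - 1\<^sub>m n) l})"
  define um where "um = real (card (UG (\<Sum>\<^sub># l)))"
  define uk where "uk = real (card (UG k))"
  define un where "un = real (card (UG n))"
  define f where "f = real (card (unit_free k))"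
  have pos: "um > 0" "uk > 0" "un > 0" unfolding um_def uk_def un_def of_nat_0_less_iff by (rule card_UG_pos)+
  have "card {g \<in> UG n. mtype (g - 1\<^sub>m n) l} * (card (UG (\<Sum>\<^sub># l)) * card (UG k)) = card (UG n) * (card (nilp l) * card (unit_free k))"
    using card_mtype_class[of l k] unfolding card_unipotent n[symmetric] .
  then have "real (card {g \<in> UG n. mtype (g - 1\<^sub>m n) l} * (card (UG (\<Sum>\<^sub># l)) * card (UG k))) = real (card (UG n) * (card (nilp l) * card (unit_free k)))"
    by (rule arg_cong)
  then have "c * (um * uk) = un * (um / Aut_U q l * f)"
    unfolding of_nat_mult card_nilp[OF assms] c_def um_def uk_def un_def f_def .
  moreover have "Aut_U q l > 0" by (rule Aut_U_pos[OF q_ge_2])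
  ultimately have "c / un = f / uk / Aut_U q l" using pos by (simp add: field_simps)
  then show ?thesis using True unfolding c_def un_def uk_def f_def k_def by (simp only: if_True)
qed

text \<open>Each element of \<open>UG k\<close> has exactly one type, so the proportions of the
  types add up to 1; they are then grouped by the size of the partition.\<close>

lemma unit_free_convolution:
  "(\<Sum>m\<le>k. q_series.uu q m * (real (card (unit_free (k - m))) / real (card (UG (k - m))))) = 1"
proof -
  interpret q_series q by (rule q_series)
  define P where "P g = primary_partition k ([:-1, 1:] :: 'a poly) g" for g
  define S where "S = (\<Union>m\<le>k. partitions_of m)"
  define c where "c l = real (card {g \<in> UG k. mtype (g - 1\<^sub>m k) l})" for l
  have fin: "finite S" unfolding S_def by (intro finite_UN_I) (auto intro: finite_partitions_of)
  have PS: "P g \<in> S" if g: "g \<in> UG k" for g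
    using primary_partition_partitions[OF UG_D(1)[OF g]] mtype_size_le[OF mtype_primary_partition[OF UG_D(1)[OF g]] minus_carrier_mat[OF one_carrier_mat]]
    by (auto simp: S_def P_def partitions_of_def)
  have "real (card (UG k)) = (\<Sum>l\<in>S. c l)"
  proof -
    have "(\<Sum>l\<in>S. \<Sum>g\<in>{g \<in> UG k. P g = l}. 1 :: real) = (\<Sum>g\<in>UG k. 1)"
      by (rule sum.group) (use fin PS in auto)
    moreover have "(\<Sum>g\<in>{g \<in> UG k. P g = l}. 1) = c l" if "l \<in> S" for l
    proof -
      have "l \<in> partitions" using that by (auto simp: S_def partitions_of_def)
      then have "{g \<in> UG k. P g = l} = {g \<in> UG k. mtype (g - 1\<^sub>m k) l}"
        using primary_partition_eq_iff[OF UG_D(1)] unfolding P_def by blast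
      then show ?thesis by (simp add: c_def)
    qed
    ultimately show ?thesis by simp
  qed
  also have "\<dots> = (\<Sum>m\<le>k. \<Sum>l\<in>partitions_of m. c l)"
    unfolding S_def
  proof (rule sum.UNION_disjoint)
    show "\<forall>m\<in>{..k}. finite (partitions_of m)" by (simp add: finite_partitions_of)
    show "\<forall>i\<in>{..k}. \<forall>j\<in>{..k}. i \<noteq> j \<longrightarrow> partitions_of i \<inter> partitions_of j = {}" by (auto simp: partitions_of_def)
  qed simp
  finally have "1 = (\<Sum>m\<le>k. \<Sum>l\<in>partitions_of m. c l) / real (card (UG k))" using card_UG_pos[of k] by simp
  also have "\<dots> = (\<Sum>m\<le>k. \<Sum>l\<in>partitions_of m. c l / real (card (UG k)))" by (simp only: sum_divide_distrib)
  also have "\<dots> = (\<Sum>m\<le>k. \<Sum>l\<in>partitions_of m. 1 / Aut_U q l * (real (card (unit_free (k - m))) / real (card (UG (k - m)))))"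
    unfolding c_def by (intro sum.cong refl) (auto simp: card_mtype_class_div partitions_of_def)
  also have "\<dots> = (\<Sum>m\<le>k. uu m * (real (card (unit_free (k - m))) / real (card (UG (k - m)))))"
    unfolding sum_distrib_right[symmetric] sum_Aut_U_uu ..
  finally show ?thesis by simp
qed

text \<open>The indices are exchanged because the form is linear in its first argument: in this
  convention \<open>B x y\<close> is \<open>adj y * gram n B * x\<close>, and pulling back along
  \<open>g\<close> gives \<open>adj g * gram n B * g\<close>.\<close>

definition gram :: "nat \<Rightarrow> ('a vec \<Rightarrow> 'a vec \<Rightarrow> 'a) \<Rightarrow> 'a mat" where
  "gram n B = mat n n (\<lambda>(j, i). B (unit_vec n i) (unit_vec n j))"

lemma gram_dim [simp]: "dim_row (gram n B) = n" "dim_col (gram n B) = n" "gram n B \<in> carrier_mat n n"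
  by (auto simp: gram_def)

lemma hermitian_formD:
  assumes "hermitian_form q n B"
  shows "x \<in> carrier_vec n \<Longrightarrow> y \<in> carrier_vec n \<Longrightarrow> z \<in> carrier_vec n \<Longrightarrow> B (x + y) z = B x z + B y z"
    and "x \<in> carrier_vec n \<Longrightarrow> y \<in> carrier_vec n \<Longrightarrow> B (a \<cdot>\<^sub>v x) y = a * B x y"
    and "x \<in> carrier_vec n \<Longrightarrow> y \<in> carrier_vec n \<Longrightarrow> B y x = cj (B x y)"
  using assms unfolding hermitian_form_def cj_def by blast+

text \<open>Additivity is given for two vectors at a time, so \<open>x\<close> is built up from its
  truncations \<open>X k\<close>.\<close>

lemma form_linear:
  fixes B :: "'a vec \<Rightarrow> 'a vec \<Rightarrow> 'a"
  assumes B: "hermitian_form q n B" and x: "x \<in> carrier_vec n" and y: "y \<in> carrier_vec n"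
  shows "B x y = (\<Sum>i<n. x $ i * B (unit_vec n i) y)"
proof -
  note add = hermitian_formD(1)[OF B _ _ y] and smult = hermitian_formD(2)[OF B _ y]
  define X where "X k = vec n (\<lambda>i. if i < k then x $ i else 0)" for k
  have "B (X k) y = (\<Sum>i<k. x $ i * B (unit_vec n i) y)" if "k \<le> n" for k
    using that
  proof (induction k)
    case 0
    \<comment> \<open>Homogeneity with the scalar 0 supplies the value at the zero vector.\<close>
    have "X 0 = 0 \<cdot>\<^sub>v X 0" by (rule eq_vecI) (auto simp: X_def)
    then have "B (X 0) y = 0 * B (X 0) y" using smult[of "X 0" 0] by (simp add: X_def)
    then show ?case by simp
  next
    case (Suc k)
    have "X (Suc k) = X k + x $ k \<cdot>\<^sub>v unit_vec n k" by (rule eq_vecI) (use Suc.prems in \<open>auto simp: X_def less_Suc_eq\<close>)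
    then have "B (X (Suc k)) y = B (X k) y + x $ k * B (unit_vec n k) y" by (simp add: add smult X_def)
    then show ?case using Suc by simp
  qed
  moreover have "X n = x" by (rule eq_vecI) (use x in \<open>auto simp: X_def\<close>)
  ultimately show ?thesis by (metis order_refl)
qed

lemma form_gram:
  assumes B: "hermitian_form q n B" and x: "x \<in> carrier_vec n" and y: "y \<in> carrier_vec n"
  shows "B x y = (\<Sum>j<n. cj (y $ j) * (\<Sum>i<n. gram n B $$ (j, i) * x $ i))"
proof -
  note sym = hermitian_formD(3)[OF B]
  have "B x y = (\<Sum>i<n. x $ i * B (unit_vec n i) y)" by (rule form_linear[OF B x y])
  also have "\<dots> = (\<Sum>i<n. x $ i * (\<Sum>j<n. cj (y $ j) * gram n B $$ (j, i)))"
  proof (rule sum.cong[OF refl])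
    fix i assume "i \<in> {..<n}"
    then have i: "i < n" by simp
    have "B (unit_vec n i) y = cj (B y (unit_vec n i))" by (rule sym) (use y in auto)
    also have "B y (unit_vec n i) = (\<Sum>j<n. y $ j * B (unit_vec n j) (unit_vec n i))"
      by (rule form_linear[OF B y]) simp
    also have "cj \<dots> = (\<Sum>j<n. cj (y $ j) * cj (B (unit_vec n j) (unit_vec n i)))" by (simp add: cj.hom_sum)
    also have "\<dots> = (\<Sum>j<n. cj (y $ j) * gram n B $$ (j, i))"
      by (rule sum.cong) (use i in \<open>simp_all add: gram_def sym[of "unit_vec n j" "unit_vec n i" for j]\<close>)
    finally show "x $ i * B (unit_vec n i) y = x $ i * (\<Sum>j<n. cj (y $ j) * gram n B $$ (j, i))" by simp
  qed
  also have "\<dots> = (\<Sum>j<n. cj (y $ j) * (\<Sum>i<n. gram n B $$ (j, i) * x $ i))"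
    unfolding sum_distrib_left by (subst sum.swap) (simp only: mult.commute mult.left_commute)
  finally show ?thesis .
qed

lemma gram_Hm: "hermitian_form q n B \<Longrightarrow> gram n B \<in> Hm n"
proof -
  assume B: "hermitian_form q n B"
  have "adj (gram n B) = gram n B"
  proof (rule eq_matI)
    fix i j assume "i < dim_row (gram n B)" "j < dim_col (gram n B)"
    then have ij: "i < n" "j < n" by auto
    then show "adj (gram n B) $$ (i, j) = gram n B $$ (i, j)"
      using hermitian_formD(3)[OF B, of "unit_vec n i" "unit_vec n j"] by (simp add: gram_def)
  qed auto
  then show ?thesis by (simp add: Hm_def)
qed

lemma gram_eq_iff:
  assumes "hermitian_form q n B" "hermitian_form q n C"
  shows "gram n B = gram n C \<longleftrightarrow> (\<forall>x\<in>carrier_vec n. \<forall>y\<in>carrier_vec n. B x y = C x y)"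
proof
  assume "gram n B = gram n C"
  then show "\<forall>x\<in>carrier_vec n. \<forall>y\<in>carrier_vec n. B x y = C x y"
    using form_gram[OF assms(1)] form_gram[OF assms(2)] by simp
qed (auto simp: gram_def intro!: eq_matI)

lemma form_pullback:
  assumes B: "hermitian_form q n B" and g: "g \<in> carrier_mat n n"
  shows "hermitian_form q n (\<lambda>x y. B (g *\<^sub>v x) (g *\<^sub>v y))"
    and "gram n (\<lambda>x y. B (g *\<^sub>v x) (g *\<^sub>v y)) = adj g * gram n B * g"
proof -
  show "hermitian_form q n (\<lambda>x y. B (g *\<^sub>v x) (g *\<^sub>v y))"
    unfolding hermitian_form_def
  proof (intro conjI ballI allI)
    fix x y z :: "'a vec" assume c: "x \<in> carrier_vec n" "y \<in> carrier_vec n" "z \<in> carrier_vec n"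
    have "g *\<^sub>v (x + y) = g *\<^sub>v x + g *\<^sub>v y" by (rule mult_add_distrib_mat_vec[OF g c(1,2)])
    then show "B (g *\<^sub>v (x + y)) (g *\<^sub>v z) = B (g *\<^sub>v x) (g *\<^sub>v z) + B (g *\<^sub>v y) (g *\<^sub>v z)"
      using hermitian_formD(1)[OF B] g c by simp
  next
    fix a and x y :: "'a vec" assume c: "x \<in> carrier_vec n" "y \<in> carrier_vec n"
    have "g *\<^sub>v (a \<cdot>\<^sub>v x) = a \<cdot>\<^sub>v (g *\<^sub>v x)" by (rule mult_mat_vec[OF g c(1)])
    then show "B (g *\<^sub>v (a \<cdot>\<^sub>v x)) (g *\<^sub>v y) = a * B (g *\<^sub>v x) (g *\<^sub>v y)"
      using hermitian_formD(2)[OF B] g c by simp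
  next
    fix x y :: "'a vec" assume "x \<in> carrier_vec n" "y \<in> carrier_vec n"
    then show "B (g *\<^sub>v y) (g *\<^sub>v x) = B (g *\<^sub>v x) (g *\<^sub>v y) ^ q"
      using hermitian_formD(3)[OF B, of "g *\<^sub>v x" "g *\<^sub>v y"] g by (simp add: cj_def)
  qed
  show "gram n (\<lambda>x y. B (g *\<^sub>v x) (g *\<^sub>v y)) = adj g * gram n B * g"
  proof (rule eq_matI)
    note d = carrier_matD[OF g]
    fix j i assume "j < dim_row (adj g * gram n B * g)" "i < dim_col (adj g * gram n B * g)"
    then have ij: "i < n" "j < n" using d by auto
    have "gram n (\<lambda>x y. B (g *\<^sub>v x) (g *\<^sub>v y)) $$ (j, i) = B (g *\<^sub>v unit_vec n i) (g *\<^sub>v unit_vec n j)"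
      using ij by (simp add: gram_def)
    also have "\<dots> = (\<Sum>b<n. cj ((g *\<^sub>v unit_vec n j) $ b) * (\<Sum>a<n. gram n B $$ (b, a) * (g *\<^sub>v unit_vec n i) $ a))"
      by (rule form_gram[OF B]) (use g in auto)
    also have "\<dots> = (\<Sum>b<n. cj (g $$ (b, j)) * (\<Sum>a<n. gram n B $$ (b, a) * g $$ (a, i)))"
      by (rule sum.cong, rule refl) (use ij d in simp)
    also have "\<dots> = (adj g * (gram n B * g)) $$ (j, i)"
      using ij d by (simp add: scalar_prod_def lessThan_atLeast0)
    finally show "gram n (\<lambda>x y. B (g *\<^sub>v x) (g *\<^sub>v y)) $$ (j, i) = (adj g * gram n B * g) $$ (j, i)"
      using d by (simp add: assoc_mult_mat_dim)
  qed (use g in auto)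
qed

lemma gram_GL:
  assumes B: "hermitian_form q n B" and nd: "nondegenerate n B"
  shows "gram n B \<in> GL n"
  unfolding GL_iff_kernel[OF gram_dim(3)]
proof (intro ballI impI)
  fix x assume x: "x \<in> carrier_vec n" "gram n B *\<^sub>v x = 0\<^sub>v n"
  have z: "(\<Sum>i<n. gram n B $$ (j, i) * x $ i) = 0" if "j < n" for j
  proof -
    have "(gram n B *\<^sub>v x) $ j = (\<Sum>i<n. gram n B $$ (j, i) * x $ i)"
      using that x(1) by (simp add: scalar_prod_def lessThan_atLeast0)
    then show ?thesis using that x(2) by simp
  qed
  have "B x y = 0" if "y \<in> carrier_vec n" for y
    unfolding form_gram[OF B x(1) that] by (rule sum.neutral) (simp add: z)
  then show "x = 0\<^sub>v n" using nd x(1) by (auto simp: nondegenerate_def)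
qed

lemma unitary_group_eq:
  assumes "hermitian_form q n B"
  shows "unitary_group n B = {g \<in> GL n. adj g * gram n B * g = gram n B}"
proof (intro equalityI subsetI)
  fix g assume g: "g \<in> unitary_group n B"
  then have gc: "g \<in> carrier_mat n n" "g \<in> GL n" using invertible_mat_iff_GL by (auto simp: unitary_group_def)
  have "adj g * gram n B * g = gram n B"
    using g gram_eq_iff[OF form_pullback(1)[OF assms gc(1)] assms] form_pullback(2)[OF assms gc(1)] by (simp add: unitary_group_def)
  then show "g \<in> {g \<in> GL n. adj g * gram n B * g = gram n B}" using gc by simp
next
  fix g assume g: "g \<in> {g \<in> GL n. adj g * gram n B * g = gram n B}"
  then have gc: "g \<in> carrier_mat n n" "invertible_mat g" using invertible_mat_iff_GL GL_D(1) by auto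
  show "g \<in> unitary_group n B"
    using g gc gram_eq_iff[OF form_pullback(1)[OF assms gc(1)] assms] form_pullback(2)[OF assms gc(1)] by (simp add: unitary_group_def)
qed

text \<open>Nondegeneracy makes the Gram matrix invertible, so some \<open>h\<close> brings it to 1
  by congruence, and conjugation by \<open>h\<close> identifies the two isometry groups.\<close>

lemma unitary_group_bij:
  assumes B: "hermitian_form q n B" "nondegenerate n B"
  shows "\<exists>h\<in>GL n. bij_betw (\<lambda>g. minv h * g * h) (unitary_group n B) (UG n)"
proof -
  define G where "G = gram n B"
  have GH: "G \<in> Hm n" "G \<in> GL n" unfolding G_def using gram_Hm gram_GL B by auto
  obtain h where h: "h \<in> GL n" "adj h * G * h = 1\<^sub>m n" using Hm_GL_normalize[OF GH] by blast
  note d = GL_D[OF h(1)] minv_dim[OF h(1)] GL_D[OF GH(2)]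
  have G: "adj (minv h) * minv h = G"
  proof -
    have a: "adj (minv h) * adj h = 1\<^sub>m n" using adj_mult[of h "minv h"] minv_right[OF h(1)] d by simp
    have "adj (minv h) * (adj h * G * h) * minv h = adj (minv h) * adj h * (G * (h * minv h))" using d by (simp add: assoc_mult_mat_dim)
    also have "\<dots> = G" unfolding a minv_right[OF h(1)] using d by (simp add: left_mult_one_mat_dim right_mult_one_mat_dim)
    finally show ?thesis unfolding h(2) using d by (simp add: right_mult_one_mat_dim)
  qed
  have "bij_betw (\<lambda>g. minv h * g * h) {g \<in> GL n. adj g * G * g = G} (UG n)"
  proof (rule bij_betw_byWitness[where f' = "\<lambda>A. h * A * minv h"])
    show "\<forall>g\<in>{g \<in> GL n. adj g * G * g = G}. h * (minv h * g * h) * minv h = g"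
    proof
      fix g assume g: "g \<in> {g \<in> GL n. adj g * G * g = G}"
      then have "dim_row g = n" "dim_col g = n" using GL_D by auto
      then show "h * (minv h * g * h) * minv h = g"
        using d GL_cancel(1)[OF h(1)] minv_right[OF h(1)] by (simp add: assoc_mult_mat_dim right_mult_one_mat_dim)
    qed
    show "\<forall>A\<in>UG n. minv h * (h * A * minv h) * h = A"
    proof
      fix A assume A: "A \<in> UG n"
      note dA = carrier_matD[OF UG_D(1)[OF A]]
      show "minv h * (h * A * minv h) * h = A"
        using d dA GL_cancel(2)[OF h(1)] minv_left[OF h(1)] by (simp add: assoc_mult_mat_dim right_mult_one_mat_dim)
    qed
    show "(\<lambda>g. minv h * g * h) ` {g \<in> GL n. adj g * G * g = G} \<subseteq> UG n"
    proof (rule image_subsetI)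
      fix g assume g: "g \<in> {g \<in> GL n. adj g * G * g = G}"
      then have dg: "dim_row g = n" "dim_col g = n" "adj g * G * g = G" using GL_D by auto
      have "adj (minv h * g * h) * (minv h * g * h) = adj h * (adj g * (adj (minv h) * minv h) * g) * h"
        using d dg(1,2) by (simp add: adj_mult assoc_mult_mat_dim)
      also have "\<dots> = 1\<^sub>m n" unfolding G dg(3) h(2) ..
      finally show "minv h * g * h \<in> UG n" unfolding UG_def using d dg by (auto intro: carrier_matI)
    qed
    show "(\<lambda>A. h * A * minv h) ` UG n \<subseteq> {g \<in> GL n. adj g * G * g = G}"
    proof (rule image_subsetI)
      fix A assume A: "A \<in> UG n"
      note dA = carrier_matD[OF UG_D(1)[OF A]]
      have "adj (h * A * minv h) * G * (h * A * minv h) = adj (minv h) * (adj A * ((adj h * G * h) * A)) * minv h"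
        using d dA by (simp add: adj_mult assoc_mult_mat_dim)
      also have "\<dots> = G" unfolding h(2) using UG_D(2)[OF A] G d dA by (simp add: left_mult_one_mat_dim right_mult_one_mat_dim)
      finally show "h * A * minv h \<in> {g \<in> GL n. adj g * G * g = G}"
        using GL_mult[OF GL_mult[OF h(1) UG_GL[OF A]] minv_GL[OF h(1)]] by simp
    qed
  qed
  then show ?thesis using h(1) unfolding unitary_group_eq[OF B(1)] G_def by blast
qed

text \<open>The conjugation that identifies the groups does not change the type of
  \<open>g - 1\<close>, so the distribution is the same for all nondegenerate forms.\<close>

lemma pmf_Lambda_U:
  fixes B :: "'a vec \<Rightarrow> 'a vec \<Rightarrow> 'a"
  assumes B: "hermitian_form q n B" "nondegenerate n B" and l: "l \<in> partitions"
  shows "pmf (Lambda_U n B) l = real (card {g \<in> UG n. mtype (g - 1\<^sub>m n) l}) / real (card (UG n))"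
proof -
  define \<U> where "\<U> = unitary_group n B"
  obtain h where h: "h \<in> GL n" and bij: "bij_betw (\<lambda>g. minv h * g * h) \<U> (UG n)"
    using unitary_group_bij[OF B] unfolding \<U>_def by blast
  note d = GL_D[OF h] minv_dim[OF h]
  have fin: "finite \<U>" using bij_betw_finite[OF bij] by simp
  have cd: "card \<U> = card (UG n)" by (rule bij_betw_same_card[OF bij])
  then have ne: "\<U> \<noteq> {}" using card_UG_pos[of n] by auto
  have gc: "g \<in> carrier_mat n n" if "g \<in> \<U>" for g using that by (simp add: \<U>_def unitary_group_def)
  have mt: "mtype (minv h * g * h - 1\<^sub>m n) l \<longleftrightarrow> mtype (g - 1\<^sub>m n) l" if "g \<in> \<U>" for g
  proof -
    note dg = carrier_matD[OF gc[OF that]]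
    have "minv h * g * h - 1\<^sub>m n = minv h * (g - 1\<^sub>m n) * h"
      using d dg minv_left[OF h] by (simp add: mult_distrib_dim right_mult_one_mat_dim)
    then show ?thesis using mtype_conj[OF h minus_carrier_mat[OF one_carrier_mat, of g n]] by simp
  qed
  have "bij_betw (\<lambda>g. minv h * g * h) {g \<in> \<U>. mtype (g - 1\<^sub>m n) l} {g \<in> UG n. mtype (g - 1\<^sub>m n) l}"
  proof (rule bij_betw_subset[OF bij])
    show "(\<lambda>g. minv h * g * h) ` {g \<in> \<U>. mtype (g - 1\<^sub>m n) l} = {g \<in> UG n. mtype (g - 1\<^sub>m n) l}"
    proof (intro equalityI subsetI)
      fix x assume x: "x \<in> {g \<in> UG n. mtype (g - 1\<^sub>m n) l}"
      then have "x \<in> (\<lambda>g. minv h * g * h) ` \<U>" using bij unfolding bij_betw_def by simp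
      then obtain g where "g \<in> \<U>" "x = minv h * g * h" by auto
      then show "x \<in> (\<lambda>g. minv h * g * h) ` {g \<in> \<U>. mtype (g - 1\<^sub>m n) l}" using mt x by auto
    qed (use bij mt in \<open>auto simp: bij_betw_def\<close>)
  qed auto
  from bij_betw_same_card[OF this]
  have c: "card {g \<in> \<U>. mtype (g - 1\<^sub>m n) l} = card {g \<in> UG n. mtype (g - 1\<^sub>m n) l}" .
  have "\<U> \<inter> primary_partition n [:-1, 1:] -` {l} = {g \<in> \<U>. mtype (g - 1\<^sub>m n) l}"
    using primary_partition_eq_iff[OF gc l] by auto
  then show ?thesis unfolding Lambda_U_def pmf_map \<U>_def[symmetric] measure_pmf_of_set[OF ne fin] cd[symmetric] c[symmetric] by simp
qed

end

theorem theorem3p4: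
  fixes q n :: nat
    and B :: "'a::{field, finite} vec \<Rightarrow> 'a vec \<Rightarrow> 'a"
  assumes "primepow q"
    and "CARD('a) = q\<^sup>2"
    and "n \<ge> 1"
    and "hermitian_form q n B"
    and "nondegenerate n B"
  shows "1 / (6 * real q ^ (n + 1)) \<le> tv_dist partitions (P_U q) (pmf (Lambda_U n B)) \<and>
         tv_dist partitions (P_U q) (pmf (Lambda_U n B)) \<le> 3 / real q ^ (n + 1)"
proof -
  interpret hermitian_field q "TYPE('a)" by unfold_locales (rule assms(1,2))+
  interpret q_series q by (rule q_series)
  show ?thesis
  proof (rule tv_dist_bounds[where e = "\<lambda>k. real (card (unit_free k)) / real (card (UG k))"])
    fix l assume "l \<in> partitions"
    then show "pmf (Lambda_U n B) l = (if \<Sum>\<^sub># l \<le> n then real (card (unit_free (n - \<Sum>\<^sub># l))) / real (card (UG (n - \<Sum>\<^sub># l))) / Aut_U q l else 0)"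
      using pmf_Lambda_U[OF assms(4,5)] card_mtype_class_div by simp
  qed (rule unit_free_convolution)
qed

end
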